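(* If $f\colon V\rightarrow\mathbb{N}$ is any function such that $f(m)\in\phi^{-1}(m)$ for every $m\in V$, then $f(V)$ contains arbitrarily long arithmetic progressions.
   Context: $\phi$ is Euler's totient function, $V=\{\phi(n)\colon n\in\mathbb{N}\}$, and $\phi^{-1}(m)=\{x\in\mathbb{N}\colon\phi(x)=m\}$. *)

theory Defs
  imports "HOL-Number_Theory.Number_Theory"
begin

(* The natural numbers of the source start at 1, and totient 0 = 0 in the library,
   so the argument 0 is excluded from both V and the fibres. *)

definition totient_values :: "nat set" where
  "totient_values = {totient n | n. n > 0}"

definition totient_fibre :: "nat \<Rightarrow> nat set" where
  "totient_fibre m = {x. x > 0 \<and> totient x = m}"

definition has_arbitrarily_long_APs :: "nat set \<Rightarrow> bool" where
  "has_arbitrarily_long_APs A \<longleftrightarrow> (\<forall>k. \<exists>a d. d > 0 \<and> (\<forall>i<k. a + i * d \<in> A))"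

end

theory Submission imports "HOL-Analysis.Analysis" "HOL-Real_Asymp.Real_Asymp" Defs begin

text \<open>If \<open>p \<equiv> 3 (mod 4)\<close> is prime, then a preimage of \<open>p - 1\<close> under the totient function is
\<open>q^a\<close> or \<open>2 q^a\<close> for a prime \<open>q\<close>; since proper prime powers are rare, \<open>f (p - 1)\<close> is \<open>p\<close> or \<open>2 p\<close>
for all but a negligible set of these primes. One of the two cases therefore has positive relative
density in the primes on infinitely many dyadic scales, and the Green--Tao theorem for such a set
gives progressions \<open>a + j d\<close>, respectively \<open>2 a + 2 j d\<close>, of values of \<open>f\<close>. The Green--Tao theorem is
obtained by transference: density Hales--Jewett yields Szemeredi's theorem with many progressions,
a truncated Selberg sieve majorises the primes and satisfies the linear forms condition, and the
relative Szemeredi theorem of Conlon, Fox and Zhao combines the two.\<close>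

section \<open>Density Hales--Jewett and Szemeredi with many progressions\<close>

text \<open>If p is 3 modulo 4, then 4 does not divide p - 1; two odd prime factors of a preimage
  would each contribute a factor 2 to its totient, so there is only one. Whether \<open>f\<close>
  selects p or 2p is arbitrary, hence progressions are needed in an uncontrolled subset of the
  primes of positive relative density, and a pigeonhole over two colours provides such a subset only
  on infinitely many dyadic scales; \<open>dense_primes_AP\<close> has exactly this hypothesis. On
  the sieve side the majorant is divided by the exact value of Selberg's quadratic form, so that
  this form has to be known only up to constant factors, and the linear forms condition becomes a
  comparison relative to that value. The cutoff couples all primes and prevents an honest Euler
  product; the factor of a prime is therefore an operator on functions of logarithmic shifts, and
  the Euler product is a composition of commuting operators. The sieve level R is a small power of
  N, so the moduli that arise stay negligible against N.\<close>

definition words :: "nat => nat => nat list set" where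
 "words K n = {w. set w \<subseteq> {..<K} & length w = n}"

lemma finite_words [simp]: "finite (words K n)"
 unfolding words_def by (rule finite_lists_length_eq) simp

lemma card_words [simp]: "card (words K n) = K ^ n"
 unfolding words_def by (simp add: card_lists_length_eq)

lemma words_0 [simp]: "words K 0 = {[]}"
 by (auto simp: words_def)

lemma append_in_words: "x \<in> words K a ==> y \<in> words K b ==> x @ y \<in> words K (a + b)"
 by (simp add: words_def)

lemma sum_words_append:
 "(SUM w:words K (a + b). f w) = (SUM x:words K a. SUM y:words K b. f (x @ y))"
proof -
 have "bij_betw (%(x, y). x @ y) (words K a \<times> words K b) (words K (a + b))"
 proof (rule bij_betwI[where g = "%w. (take a w, drop a w)"])
  show "(%w. (take a w, drop a w)) \<in> words K (a + b) \<rightarrow> words K a \<times> words K b"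
   by (auto simp: words_def dest: in_set_takeD in_set_dropD)
 qed (auto simp: words_def)
 hence "(SUM w:words K (a + b). f w) = (SUM z:words K a \<times> words K b. f (case z of (x, y) => x @ y))"
  by (rule sum.reindex_bij_betw[symmetric])
 also have "... = (SUM x:words K a. SUM y:words K b. f (x @ y))"
  by (simp add: sum.cartesian_product case_prod_unfold)
 finally show ?thesis .
qed

lemma sum_words_1: "(SUM w:words K 1. f w) = (\<Sum>a<K. f [a])"
proof -
 have "words K 1 = (%a. [a]) ` {..<K}"
  by (auto simp: words_def length_Suc_conv)
 thus ?thesis by (simp add: sum.reindex inj_on_def)
qed

lemma sum_words_Suc:
 "(SUM w:words K (Suc n). f w) = (\<Sum>a<K. SUM w:words K n. f (a # w))"
 using sum_words_append[of f K 1 n] sum_words_1[of "%x. SUM y:words K n. f (x @ y)" K] by simp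

text \<open>A word over \<open>{..<K + m}\<close> is read as a template: the symbols below \<open>K\<close> are letters and
 \<open>K + j\<close> is the \<open>j\<close>-th variable. Words, lines and subspaces thus share one substitution operation.\<close>

definition sub :: "nat => nat list => nat => nat" where
 "sub K t s = (if s < K then s else t ! (s - K))"

definition app :: "nat => nat list => nat list => nat list" where
 "app K ta t = map (sub K t) ta"

text \<open>Requiring every variable to occur makes \<open>app K ta\<close> injective, so a template
  is a genuine m-dimensional combinatorial subspace; \<open>m = 1\<close> gives combinatorial
  lines.\<close>

definition tmpl :: "nat => nat => nat => nat list set" where
 "tmpl K m n = {ta \<in> words (K + m) n. {K..<K + m} \<subseteq> set ta}"

lemma sub_less: "s < K + m ==> t \<in> words K m ==> sub K t s < K"
 by (simp add: sub_def words_def subset_iff)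

lemma app_in_words: "ta \<in> words (K + m) n ==> t \<in> words K m ==> app K ta t \<in> words K n"
 using sub_less[of _ K m t] by (force simp: app_def words_def)

lemma app_word: "w \<in> words K n ==> app K w t = w"
 by (auto simp: app_def words_def sub_def intro!: map_idI)

lemma app_append: "app K (si @ ta) t = app K si t @ app K ta t"
 by (simp add: app_def)

text \<open>Associativity of substitution: a subspace of a subspace is a subspace of the ambient
  cube.\<close>

lemma app_app:
 assumes "ta \<in> words (K + m) n" "length si = m"
 shows "app K (app K ta si) t = app K ta (app K si t)"
 using assms by (auto simp: app_def words_def sub_def)

lemma tmpl_words: "ta \<in> tmpl K m n ==> ta \<in> words (K + m) n"
 by (simp add: tmpl_def)

lemma finite_tmpl [simp]: "finite (tmpl K m n)"
 by (rule finite_subset[of _ "words (K + m) n"]) (auto simp: tmpl_def)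

lemma card_tmpl_le: "card (tmpl K m n) <= (K + m) ^ n"
 using card_mono[of "words (K + m) n" "tmpl K m n"] by (simp add: tmpl_def)

lemma words_mono: "K <= L ==> words K n \<subseteq> words L n"
 by (auto simp: words_def)

lemma app_in_tmpl:
 assumes t: "ta \<in> tmpl K m n" and s: "si \<in> tmpl K l m"
 shows "app K ta si \<in> tmpl K l n"
proof -
 have 1: "sub K si s < K + l" if "s < K + m" for s
  using that s by (simp add: sub_def tmpl_def words_def subset_iff)
 have 2: "v \<in> set (app K ta si)" if v: "v \<in> {K..<K + l}" for v
 proof -
  have "v \<in> set si" using s v by (auto simp: tmpl_def)
  then obtain j where j: "j < length si" "si ! j = v" by (meson in_set_conv_nth)
  hence "K + j \<in> set ta" using s t by (auto simp: tmpl_def words_def)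
  moreover have "sub K si (K + j) = v" using j by (simp add: sub_def)
  ultimately show ?thesis unfolding app_def by force
 qed
 show ?thesis
  using 1 2 t by (auto simp: tmpl_def words_def app_def)
qed

lemma inj_on_app:
 assumes "ta \<in> tmpl K m n"
 shows "inj_on (app K ta) (words K m)"
proof (rule inj_onI)
 fix t u assume t: "t \<in> words K m" and u: "u \<in> words K m" and e: "app K ta t = app K ta u"
 show "t = u"
 proof (rule nth_equalityI)
  show "length t = length u" using t u by (simp add: words_def)
  fix j assume "j < length t"
  hence "K + j \<in> set ta" using t assms by (auto simp: words_def tmpl_def)
  with e have "sub K t (K + j) = sub K u (K + j)" by (simp add: app_def)
  thus "t ! j = u ! j" by (simp add: sub_def)
 qed
qed

lemma prefix_in_tmpl: "x \<in> words K a ==> ta \<in> tmpl K m n ==> x @ ta \<in> tmpl K m (a + n)"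
 by (auto simp: tmpl_def words_def)

lemma suffix_in_tmpl: "x \<in> words K a ==> ta \<in> tmpl K m n ==> ta @ x \<in> tmpl K m (n + a)"
 by (auto simp: tmpl_def words_def)

section \<open>From combinatorial lines to combinatorial subspaces\<close>

definition DHJ :: "nat => nat => bool" where
 "DHJ K m \<longleftrightarrow> (\<forall>de>0. EX n0. \<forall>n\<ge>n0. ALL A. A \<subseteq> words K n --> de * real (K ^ n) <= real (card A) -->
   (EX ta:tmpl K m n. ALL t:words K m. app K ta t \<in> A))"

lemma DHJE:
 assumes "DHJ K m" "de > 0"
 obtains n0 where "!!n A. n >= n0 ==> A \<subseteq> words K n ==> de * real (K ^ n) <= real (card A) ==>
   EX ta:tmpl K m n. ALL t:words K m. app K ta t \<in> A"
proof -
 from assms(1)[unfolded DHJ_def, THEN spec, THEN mp, OF assms(2)]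
 obtain n0 where "\<forall>n\<ge>n0. ALL A. A \<subseteq> words K n --> de * real (K ^ n) <= real (card A) -->
   (EX ta:tmpl K m n. ALL t:words K m. app K ta t \<in> A)" ..
 thus ?thesis by (intro that[of n0]) simp
qed

text \<open>The variable of the line takes the first slot, so \<open>sh\<close> moves the variables
  of the second factor up by one and leaves letters alone.\<close>

lemma tmpl_product:
 assumes l: "l \<in> tmpl K 1 n" and s: "si \<in> tmpl K m n'"
 defines "sh \<equiv> (%s. if s < K then s else Suc s)"
 shows "l @ map sh si \<in> tmpl K (Suc m) (n + n')"
  and "app K (l @ map sh si) (a # t) = app K l [a] @ app K si t"
proof -
 have "v \<in> set l \<union> sh ` set si" if v: "v \<in> {K..<K + Suc m}" for v
 proof (cases "v = K")
  case True thus ?thesis using l by (simp add: tmpl_def)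
 next
  case False
  hence "v - 1 \<in> {K..<K+m}" "sh (v - 1) = v" using v by (auto simp: sh_def)
  thus ?thesis using s unfolding tmpl_def by (smt (verit) UnCI image_iff mem_Collect_eq subset_iff)
 qed
 hence "{K..<K + Suc m} \<subseteq> set (l @ map sh si)" by (metis set_append set_map subsetI)
 moreover have "set l \<subseteq> {..<K + Suc m}" using l by (auto simp: tmpl_def words_def)
 moreover have "sh x < K + Suc m" if "x \<in> set si" for x
  using s that by (auto simp: tmpl_def words_def sh_def)
 moreover have "length (l @ map sh si) = n + n'" using l s by (simp add: tmpl_def words_def)
 ultimately show "l @ map sh si \<in> tmpl K (Suc m) (n + n')"
  by (auto simp: tmpl_def words_def)
 show "app K (l @ map sh si) (a # t) = app K l [a] @ app K si t" using l by (simp add: tmpl_def words_def sub_def subset_iff less_Suc_eq_le app_def sh_def)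
qed

lemma sum_indicator_card: "finite A ==> (SUM x:A. of_bool (P x)) = real (card {x\<in>A. P x})"
 by (simp add: Int_def)

lemma pigeonhole_card:
 fixes c :: real
 assumes "finite A" "finite T" "!!x. x \<in> A ==> EX t:T. P t x" "c <= card A" "A ~= {} \<or> T ~= {}"
  "real (card T) <= M"
 shows "EX t:T. c / M <= card {x\<in>A. P t x}"
proof (rule ccontr)
 assume "\<not> ?thesis"
 hence less: "card {x\<in>A. P t x} < c / M" if "t \<in> T" for t using that by force
 have ne: "T ~= {}" using assms(3,5) by auto
 hence cT: "card T > 0" using assms(2) by auto
 have "card A <= card (\<Union>t\<in>T. {x\<in>A. P t x})" using assms(3) assms(1,2) by (intro card_mono) auto
 also have "... <= (SUM t:T. card {x\<in>A. P t x})" by (rule card_UN_le) fact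
 finally have "card A <= (SUM t:T. card {x\<in>A. P t x})" .
 hence "(card A) <= (SUM t:T. real (card {x\<in>A. P t x}))"
  by (metis of_nat_le_iff of_nat_sum)
 also have "... < (SUM t:T. c / M)" using less ne assms(2) by (intro sum_strict_mono)
 also have "... = card T * (c / M)" by simp
 also have "... <= c"
 proof -
  have "0 < c / M" using ne less by auto
  moreover have "M > 0" using cT assms(6) by simp
  ultimately show ?thesis using assms(6) by (simp add: field_simps)
 qed
 finally show False using assms(4) by simp
qed

text \<open>Cut the word into a block of fixed length \<open>n1\<close> and a suffix. A positive
  proportion of the suffixes have a dense section and hence a line over them. The number of lines in
  the block does not depend on the suffix length, so one line serves a dense set of suffixes, and in
  that set the induction hypothesis finds the remaining dimensions.\<close>

lemma DHJ_multidim: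
 assumes D: "DHJ K 1" and K: "K > 0"
 shows "DHJ K m"
proof (induction m)
 case 0
 show ?case unfolding DHJ_def
 proof (intro allI impI exI[of _ 0], goal_cases)
  case (1 de n A)
  hence "0 < real (card A)" using K by (intro less_le_trans[OF _ 1(4)]) auto
  then obtain w where "w \<in> A" by (metis card.empty ex_in_conv less_irrefl of_nat_0)
  hence "w \<in> tmpl K 0 n" "app K w [] \<in> A" using 1(3) app_word by (auto simp: tmpl_def)
  thus ?case by auto
 qed
next
 case (Suc m)
 show ?case unfolding DHJ_def
 proof (intro allI impI)
  fix de :: real assume d: "de > 0"
  then obtain n1 where n1: "!!n A. n >= n1 ==> A \<subseteq> words K n ==> de/2 * real (K ^ n) <= real (card A) ==>
   (EX ta:tmpl K 1 n. ALL t:words K 1. app K ta t \<in> A)" by (meson DHJE[OF D] half_gt_zero)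
  define T where "T = real (K + 1) ^ n1"
  have T: "T > 0" by (simp add: T_def)
  hence "de/2/T > 0" using d by simp
  then obtain n2 where n2: "!!n A. n >= n2 ==> A \<subseteq> words K n ==> de/2/T * real (K ^ n) <= real (card A) ==>
   (EX ta:tmpl K m n. ALL t:words K m. app K ta t \<in> A)" by (rule DHJE[OF Suc]) blast
  show "EX n0. \<forall>n\<ge>n0. ALL A. A \<subseteq> words K n --> de * real (K ^ n) <= real (card A) -->
   (EX ta:tmpl K (Suc m) n. ALL t:words K (Suc m). app K ta t \<in> A)"
  proof (intro exI[of _ "n1 + n2"] allI impI)
   fix n A assume n: "n1 + n2 <= n" and A: "A \<subseteq> words K n" and cA: "de * (K ^ n) <= (card A)"
   define n' where "n' = n - n1"
   have nn: "n = n1 + n'" "n' >= n2" using n by (auto simp: n'_def)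
   define S where "S y = {x \<in> words K n1. x @ y \<in> A}" for y
   define Y where "Y = {y \<in> words K n'. de/2 * (K ^ n1) <= card (S y)}"
   have S1: "card (S y) <= real (K ^ n1)" for y
   proof -
    have "card (S y) <= card (words K n1)" by (intro card_mono) (auto simp: S_def)
    thus ?thesis by simp
   qed
   have "real (card A) = (SUM w:words K n. of_bool (w \<in> A))"
   proof -
    have "{x \<in> words K n. x \<in> A} = A" using A by auto
    thus ?thesis by (simp only: sum_indicator_card[OF finite_words])
   qed
   also have "... = (SUM y:words K n'. SUM x:words K n1. of_bool (x @ y \<in> A))"
    unfolding nn(1) sum_words_append by (rule sum.swap)
   also have "... = (SUM y:words K n'. real (card (S y)))"
    by (simp add: S_def Int_def)
   also have "... <= (SUM y:words K n'. de/2 * (K ^ n1) + real (K ^ n1) * of_bool (y \<in> Y))"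
    using S1 d by (intro sum_mono) (auto simp: Y_def of_bool_def not_le intro: add_increasing less_imp_le)
   also have "... = de/2 * (K ^ n) + real (K ^ n1) * (card Y)"
   proof -
    have "words K n' \<inter> Y = Y" by (auto simp: Y_def)
    thus ?thesis
     by (simp add: sum.distrib nn(1) power_add)
   qed
   finally have "de/2 * (K ^ n1) * (K ^ n') <= real (K ^ n1) * (card Y)"
    using cA by (simp add: nn(1) power_add)
   hence cY: "de/2 * (K ^ n') <= card Y" using K by simp
   have "EX ta:tmpl K 1 n1. ALL t:words K 1. app K ta t @ y \<in> A" if "y \<in> Y" for y
    using n1[of n1 "S y"] that by (auto simp: S_def Y_def)
   hence "EX ta:tmpl K 1 n1. de/2 * (K ^ n') / T <= card {y\<in>Y. ALL t:words K 1. app K ta t @ y \<in> A}"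
   proof (intro pigeonhole_card[OF _ _ _ cY])
    show "finite Y" by (simp add: Y_def)
    have "0 < de/2 * (K ^ n')" using d K by simp
    thus "Y ~= {} \<or> tmpl K 1 n1 ~= {}" using cY by auto
    show "(card (tmpl K 1 n1)) <= T" unfolding T_def using card_tmpl_le[of K 1 n1]
     by (metis of_nat_le_iff of_nat_power)
   qed auto
   then obtain l where l: "l \<in> tmpl K 1 n1"
    "de/2/T * (K ^ n') <= card {y\<in>Y. ALL t:words K 1. app K l t @ y \<in> A}" by auto
   obtain si where s: "si \<in> tmpl K m n'" "!!t. t \<in> words K m ==> app K si t \<in> {y\<in>Y. ALL t:words K 1. app K l t @ y \<in> A}"
    using n2[OF nn(2) _ l(2)] by (auto simp: Y_def)
   define sh where "sh = (%s. if s < K then s else Suc s)"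
   note tp = tmpl_product[OF l(1) s(1), folded sh_def]
   show "EX ta:tmpl K (Suc m) n. ALL t:words K (Suc m). app K ta t \<in> A"
   proof (intro bexI ballI)
    show "l @ map sh si \<in> tmpl K (Suc m) n" using tp(1) nn by simp
    fix t assume "t \<in> words K (Suc m)"
    then obtain a t' where t: "t = a # t'" "a < K" "t' \<in> words K m"
     by (auto simp: words_def length_Suc_conv)
    thus "app K (l @ map sh si) t \<in> A" using s(2)[OF t(3)] by (simp add: words_def tp(2))
   qed
  qed
 qed
qed

section \<open>Product weights on words\<close>

definition Exw :: "(nat => real) => nat => nat => (nat list => real) => real" where
 "Exw p M n F = (SUM w:words M n. prod_list (map p w) * F w)"

lemma Exw_0 [simp]: "Exw p M 0 F = F []"
 by (simp add: Exw_def)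

lemma Exw_Suc: "Exw p M (Suc n) F = (\<Sum>a<M. p a * Exw p M n (%w. F (a # w)))"
 by (simp add: Exw_def sum_words_Suc sum_distrib_left mult_ac)

lemma Exw_one: "Exw p M n (%_. 1) = (\<Sum>a<M. p a) ^ n"
 by (induction n) (simp_all add: Exw_Suc sum_distrib_right)

lemma Exw_cmult: "Exw p M n (%w. c * F w) = c * Exw p M n F"
 by (simp add: Exw_def sum_distrib_left mult_ac)

lemma Exw_const: "(\<Sum>a<M. p a) = 1 ==> Exw p M n (%_. c) = c"
 using Exw_cmult[of p M n c "%_. 1"] by (simp add: Exw_one)

lemma Exw_diff: "Exw p M n (%w. F w - G w) = Exw p M n F - Exw p M n G"
 by (simp add: Exw_def sum_subtractf algebra_simps)

lemma Exw_add: "Exw p M n (%w. F w + G w) = Exw p M n F + Exw p M n G"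
 by (simp add: Exw_def sum.distrib algebra_simps)

lemma Exw_sum: "Exw p M n (%w. SUM i:I. F i w) = (SUM i:I. Exw p M n (F i))"
 unfolding Exw_def by (subst sum.swap) (simp add: sum_distrib_left)

lemma weight_nonneg:
 assumes "!!a. a < M ==> (0::real) <= p a" "w \<in> words M n" shows "0 <= prod_list (map p w)"
 using assms by (intro prod_list_nonneg) (auto simp: words_def)

lemma Exw_mono:
 assumes "!!a. a < M ==> 0 <= p a" "!!w. w \<in> words M n ==> F w <= G w"
 shows "Exw p M n F <= Exw p M n G"
 unfolding Exw_def using assms weight_nonneg[of M p] by (intro sum_mono mult_left_mono) auto

lemma Exw_cong: "(!!w. w \<in> words M n ==> F w = G w) ==> Exw p M n F = Exw p M n G"
 unfolding Exw_def by simp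

lemma Exw_exists:
 assumes p: "!!a. a < M ==> 0 <= p a" "(\<Sum>a<M. p a) = 1" and c: "c <= Exw p M n F"
 shows "EX w:words M n. c <= F w"
proof (rule ccontr)
 assume "\<not> ?thesis"
 hence less: "!!w. w \<in> words M n ==> F w < c" by force
 have one: "(SUM w:words M n. prod_list (map p w)) = 1"
  using Exw_one[of p M n] p(2) by (simp add: Exw_def)
 hence "EX w:words M n. prod_list (map p w) ~= 0" by (metis sum.neutral zero_neq_one)
 then obtain w0 where w0: "w0 \<in> words M n" "prod_list (map p w0) > 0"
  using weight_nonneg[of M p _ n] p(1) by (metis less_eq_real_def)
 have "Exw p M n F < Exw p M n (%_. c)" unfolding Exw_def
 proof (rule sum_strict_mono_ex1)
  show "ALL w:words M n. prod_list (map p w) * F w <= prod_list (map p w) * c"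
   using less weight_nonneg[of M p _ n] p(1) by (intro ballI mult_left_mono) (auto simp: less_imp_le)
  show "EX w:words M n. prod_list (map p w) * F w < prod_list (map p w) * c"
   using w0 less by (intro bexI[of _ w0]) auto
 qed simp
 thus False using c Exw_const[OF p(2), of n c] by simp
qed

text \<open>A letterwise map sends a product weight to a product weight; only the letter weights
  have to be pushed forward.\<close>

lemma Exw_push:
 assumes "!!s. s < M ==> g s < M'"
 shows "Exw p M n (%w. F (map g w)) = Exw (%a. \<Sum>s<M. if g s = a then p s else 0) M' n F"
proof (induction n arbitrary: F)
 case (Suc n)
 define p' where "p' = (%a. \<Sum>s<M. if g s = a then p s else 0)"
 have "Exw p M (Suc n) (%w. F (map g w)) = (\<Sum>s<M. p s * Exw p' M' n (%w. F (g s # w)))"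
  by (simp add: Exw_Suc Suc.IH[of "%w. F (_ # w)"] p'_def)
 also have "... = (\<Sum>s<M. \<Sum>a<M'. (if g s = a then p s else 0) * Exw p' M' n (%w. F (a # w)))"
 proof (rule sum.cong)
  fix s assume "s \<in> {..<M}"
  hence "g s < M'" using assms by auto
  let ?A = "\<Sum>a<M'. (if g s = a then p s else 0) * Exw p' M' n (%w. F (a # w))"
  have "?A =
    (\<Sum>a<M'. if a = g s then p s * Exw p' M' n (%w. F (a # w)) else 0)"
   by (intro sum.cong) auto
  also have "... = p s * Exw p' M' n (%w. F (g s # w))" using \<open>g s < M'\<close> by simp
  finally show "p s * Exw p' M' n (%w. F (g s # w)) = ?A" ..
 qed simp
 also have "... = Exw p' M' (Suc n) F" by (subst sum.swap) (simp only: Exw_Suc p'_def sum_distrib_right)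
 finally show ?case by (simp add: p'_def)
qed simp

lemma weighted_CS:
 fixes w a b :: "'i => real"
 assumes "!!i. i \<in> I ==> 0 <= w i"
 shows "(SUM i:I. w i * a i * b i)\<^sup>2 <= (SUM i:I. w i * (a i)\<^sup>2) * (SUM i:I. w i * (b i)\<^sup>2)"
proof -
 have "(SUM i:I. w i * a i * b i) = (SUM i:I. (sqrt (w i) * a i) * (sqrt (w i) * b i))"
 proof (rule sum.cong)
  fix i assume "i \<in> I"
  thus "w i * a i * b i = (sqrt (w i) * a i) * (sqrt (w i) * b i)" using assms by simp
 qed simp
 also have "...\<^sup>2 <= (SUM i:I. (sqrt (w i) * a i)\<^sup>2) * (SUM i:I. (sqrt (w i) * b i)\<^sup>2)"
  by (rule Cauchy_Schwarz_ineq_sum)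
 also have "... = (SUM i:I. w i * (a i)\<^sup>2) * (SUM i:I. w i * (b i)\<^sup>2)"
  using assms by (intro arg_cong2[of _ _ _ _ "(*)"] sum.cong) (auto simp: power_mult_distrib)
 finally show ?thesis .
qed

lemma prod_list_sq_div: "(prod_list (map q w))\<^sup>2 / prod_list (map p w) = prod_list (map (%a. (q a)\<^sup>2 / p a) w)"
 for p q :: "nat => real"
proof (induction w)
 case (Cons a w)
 have "(prod_list (map q (a # w)))\<^sup>2 / prod_list (map p (a # w))
   = ((q a)\<^sup>2 / p a) * ((prod_list (map q w))\<^sup>2 / prod_list (map p w))"
  by (simp add: power_mult_distrib)
 thus ?case by (simp only: Cons.IH list.map prod_list.Cons)
qed simp

lemma weight_pos:
 assumes "!!a. a < M ==> (0::real) < p a" "w \<in> words M n" shows "0 < prod_list (map p w)"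
proof -
 have "set w \<subseteq> {..<M}" using assms(2) by (simp add: words_def)
 thus ?thesis by (induction w) (use assms(1) in auto)
qed

text \<open>Cauchy-Schwarz against the weight \<open>P\<close> bounds the difference by the square
  root of the chi-square divergence of \<open>Q\<close> from \<open>P\<close>. Unlike total
  variation, one plus this divergence is multiplicative over positions, so letter weights that
  differ by O(1/n) give a total divergence of only O(1/n).\<close>

lemma Exw_chi_square:
 assumes p: "!!a. a < M ==> 0 < p a" "(\<Sum>a<M. p a) = 1" and q: "(\<Sum>a<M. q a) = 1"
  and e: "!!a. a < M ==> (q a - p a)\<^sup>2 <= e * p a" and F: "!!w. w \<in> words M n ==> \<bar>F w\<bar> <= 1"
 shows "\<bar>Exw q M n F - Exw p M n F\<bar> <= sqrt ((1 + M * e) ^ n - 1)"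
proof -
 define P where "P w = prod_list (map p w)" for w
 define Q where "Q w = prod_list (map q w)" for w
 have P: "P w > 0" if "w \<in> words M n" for w
  unfolding P_def by (rule weight_pos[OF p(1) that])
 have P1: "(SUM w:words M n. P w) = 1" using Exw_one[of p M n] p(2) by (simp add: Exw_def P_def)
 have Q1: "(SUM w:words M n. Q w) = 1" using Exw_one[of q M n] q by (simp add: Exw_def Q_def)
 let ?B = "SUM w:words M n. P w * (Q w / P w - 1) * F w"
 have "Exw q M n F - Exw p M n F = ?B"
  unfolding Exw_def sum_subtractf[symmetric] P_def[symmetric] Q_def[symmetric]
  by (intro sum.cong) (use P in \<open>force simp: field_simps\<close>)+
 also have "\<bar>\<dots>\<bar> <= sqrt ((1 + M * e) ^ n - 1)"
 proof (rule real_le_rsqrt, unfold power2_abs)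
  let ?A = "SUM w:words M n. P w * (Q w / P w - 1)\<^sup>2"
  let ?C = "SUM w:words M n. P w * (F w)\<^sup>2"
  let ?D = "\<Sum>a<M. (q a - p a)\<^sup>2 / p a"
  let ?E = "SUM w:words M n. (Q w)\<^sup>2 / P w"
  have "?B\<^sup>2
   <= ?A * ?C"
   by (rule weighted_CS) (use P in \<open>force simp: less_imp_le\<close>)
  also have "... <= ?A * 1"
  proof (rule mult_left_mono)
   have "?C <= (SUM w:words M n. P w * 1)"
   proof (intro sum_mono mult_left_mono)
    fix w assume w: "w \<in> words M n"
    show "(F w)\<^sup>2 <= 1" using F[OF w] by (simp add: abs_square_le_1)
    show "0 <= P w" using P[OF w] by simp
   qed
   thus "?C <= 1" using P1 by simp
   show "0 <= ?A"
    by (intro sum_nonneg mult_nonneg_nonneg) (use P in \<open>auto simp: less_imp_le\<close>)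
  qed
  also have "?A = (SUM w:words M n. (Q w)\<^sup>2 / P w - 2 * Q w + P w)"
  proof (rule sum.cong)
   fix w assume "w \<in> words M n"
   hence "P w ~= 0" using P by force
   thus "P w * (Q w / P w - 1)\<^sup>2 = (Q w)\<^sup>2 / P w - 2 * Q w + P w"
    by (simp add: power2_eq_square field_simps)
  qed simp
  also have "... = ?E - 1"
   by (simp add: sum.distrib sum_subtractf sum_distrib_left[symmetric] P1 Q1)
  also have "?E = (\<Sum>a<M. (q a)\<^sup>2 / p a) ^ n"
   unfolding P_def Q_def prod_list_sq_div using Exw_one[of "%a. (q a)\<^sup>2 / p a" M n] by (simp add: Exw_def)
  also have "(\<Sum>a<M. (q a)\<^sup>2 / p a) = (\<Sum>a<M. 2 * q a - p a + (q a - p a)\<^sup>2 / p a)"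
  proof (rule sum.cong)
   fix a assume "a \<in> {..<M}"
   hence "p a ~= 0" using p(1) by force
   thus "(q a)\<^sup>2 / p a = 2 * q a - p a + (q a - p a)\<^sup>2 / p a"
    by (simp add: power2_eq_square field_simps)
  qed simp
  also have "... = 1 + ?D"
   by (simp add: sum.distrib sum_subtractf sum_distrib_left[symmetric] p(2) q)
  also have "(1 + ?D) ^ n <= (1 + (\<Sum>a<M. e)) ^ n"
  proof (intro power_mono add_left_mono sum_mono)
   show "(q a - p a)\<^sup>2 / p a <= e" if "a \<in> {..<M}" for a
    using that p(1)[of a] e[of a] by (simp add: divide_le_eq)
   show "0 <= 1 + ?D"
    using p(1) by (intro add_nonneg_nonneg sum_nonneg) (auto simp: less_imp_le)
  qed
  finally show "?B\<^sup>2 <= (1 + M * e) ^ n - 1"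
   by simp
 qed
 finally show ?thesis .
qed

section \<open>Random templates\<close>

lemma Exw_avoid: "Exw p M n (%w. of_bool (v \<notin> set w)) = ((\<Sum>a<M. p a) - (if v < M then p v else 0)) ^ n"
proof (induction n)
 case (Suc n)
 let ?A = "%w. of_bool (v \<notin> set w)"
 have "Exw p M (Suc n) ?A = (\<Sum>a<M. (p a - (if a = v then p v else 0)) * Exw p M n ?A)"
  unfolding Exw_Suc
 proof (rule sum.cong)
  fix a show "p a * Exw p M n (%w. of_bool (v \<notin> set (a # w))) = (p a - (if a = v then p v else 0)) * Exw p M n ?A"
   using Exw_cmult[of p M n 0] by simp
 qed simp
 also have "... = ((\<Sum>a<M. p a) - (if v < M then p v else 0)) ^ Suc n"
  by (simp add: Suc.IH sum_distrib_right[symmetric] sum_subtractf)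
 finally show ?case .
qed simp

text \<open>The law of one position of a random template: each variable has probability
  \<open>ta\<close>, and the rest is shared equally by the letters. With \<open>ta\<close> of order
  lam/n a variable is expected about lam times, which makes degenerate templates rare, while letter
  frequencies move only by O(1/n).\<close>

definition tw :: "nat => nat => real => nat => real" where
 "tw K m ta s = (if s < K then (1 - m * ta) / K else ta)"

lemma sum_tw: "K > 0 ==> (\<Sum>s<K + m. tw K m ta s) = 1"
proof -
 assume K: "K > 0"
 have "(\<Sum>s<K + l. h s) = (\<Sum>s<K. h s) + (\<Sum>j<l. h (K + j))" for h :: "nat => real" and l
  by (induction l) auto
 note this[of "tw K m ta" m]
 thus ?thesis using K by (simp add: tw_def)
qed

lemma Exw_degenerate:
 assumes "K > 0" "0 <= ta" "m * ta <= 1"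
 shows "Exw (tw K m ta) (K + m) n (%V. of_bool (V \<notin> tmpl K m n)) <= m * exp (- (n * ta))"
proof -
 have nn: "0 <= tw K m ta a" for a using assms by (simp add: tw_def)
 have "Exw (tw K m ta) (K + m) n (%V. of_bool (V \<notin> tmpl K m n))
   <= Exw (tw K m ta) (K + m) n (%V. \<Sum>j<m. of_bool (K + j \<notin> set V))"
 proof (rule Exw_mono[OF nn])
  fix V assume V: "V \<in> words (K + m) n"
  let ?A = "\<Sum>j<m. of_bool (K + j \<notin> set V) :: real"
  show "of_bool (V \<notin> tmpl K m n) <= ?A"
  proof (cases "V \<in> tmpl K m n")
   case False
   then obtain v where "v \<in> {K..<K+m}" "v \<notin> set V" using V unfolding tmpl_def by blast
   hence j: "v - K < m" "K + (v - K) \<notin> set V" by auto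
   have "(1::real) = of_bool (K + (v - K) \<notin> set V)" using j(2) by simp
   also have "... <= ?A"
    by (rule member_le_sum) (use j in auto)
   finally show ?thesis by simp
  qed (simp add: sum_nonneg)
 qed
 also have "... = (\<Sum>j<m. (1 - ta) ^ n)"
  unfolding Exw_sum Exw_avoid sum_tw[OF assms(1)] by (simp add: tw_def)
 also have "... <= m * exp (- (n * ta))"
 proof (cases "m = 0")
  case False
  hence "ta <= 1" using assms(2) mult_right_mono[of 1 "real m" ta] assms(3) by simp
  hence "(1 - ta) ^ n <= exp (- ta) ^ n" using exp_ge_add_one_self[of "-ta"] by (intro power_mono) auto
  also have "... = exp (- (n * ta))" by (simp add: exp_of_nat_mult[symmetric])
  finally show ?thesis by (simp add: mult_left_mono)
 qed simp
 finally show ?thesis .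
qed

text \<open>The squared perturbation of a letter weight is O(1/n^2), and n factors 1 + O(1/n^2)
  multiply to 1 + O(1/n). This is why variables get rates of order 1/n.\<close>

lemma chi_error_tendsto: "eventually (%n. sqrt ((1 + M * (C / real n ^ 2)) ^ n - 1) <= et) sequentially"
 if "et > 0" "M >= 0" "C >= 0" for C M :: real
proof -
 have "((%n::nat. sqrt (exp (M * C / n) - 1)) \<longlongrightarrow> sqrt (exp 0 - 1)) sequentially"
  by (intro tendsto_intros lim_const_over_n)
 hence "eventually (%n::nat. sqrt (exp (M * C / n) - 1) < et) sequentially"
  using that by (intro order_tendstoD) auto
 thus ?thesis
  using eventually_gt_at_top[of 0]
 proof eventually_elim
  case (elim n)
  have "(1 + M * (C / real n ^ 2)) ^ n <= exp (M * (C / real n ^ 2)) ^ n"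
   using that by (intro power_mono) auto
  also have "... = exp (M * C / n)"
   by (simp add: exp_of_nat_mult[symmetric] power2_eq_square)
  finally show ?case using elim(1) by (smt (verit) real_sqrt_le_mono)
 qed
qed

definition cnt :: "nat list => nat => nat" where
 "cnt l a = card {j. j < length l & l ! j = a}"

lemma cnt_le: "cnt l a <= length l"
 unfolding cnt_def by (rule order.trans[OF card_mono[of "{..<length l}"]]) auto

lemma cnt_pos: "a \<in> set l ==> cnt l a > 0"
 by (simp add: cnt_def card_gt_0_iff in_set_conv_nth)

lemma sum_lessThan_add: "(\<Sum>s<K + l. h s) = (\<Sum>s<K. h s) + (\<Sum>j<l. h (K + j))"
 for h :: "nat => 'a :: comm_monoid_add"
 by (induction l) (auto simp: add_ac)

lemma push_tw:
 fixes ta :: real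
 assumes "length l = m"
 shows "(\<Sum>s<K + m. if sub K l s = a then tw K m ta s else 0)
    = (if a < K then (1 - m * ta) / K else 0) + ta * cnt l a"
proof -
 have "(\<Sum>s<K. if sub K l s = a then tw K m ta s else 0) = (\<Sum>s<K. if s = a then (1 - m * ta) / K else 0)"
  by (intro sum.cong) (auto simp: sub_def tw_def)
 moreover have "(\<Sum>j<m. if sub K l (K + j) = a then tw K m ta (K + j) else 0) = ta * cnt l a"
  using assms by (simp add: sub_def tw_def sum.If_cases cnt_def Int_def)
 ultimately show ?thesis by (simp add: sum_lessThan_add)
qed

text \<open>Substituting a fixed \<open>l\<close> into a random template gives a random word
  (\<open>d = 0\<close>) or a random line (\<open>d = 1\<close>). By \<open>push_tw\<close> the
  variable rate of the result is exactly \<open>ta * cnt l K\<close>, so only the letter weights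
  differ from the intended law, by at most 2 m ta, and the chi-square bound applies.\<close>

lemma tmpl_close:
 fixes ta :: real
 assumes K: "K > 0" and l: "d <= 1" "l \<in> words (K + d) m" "d = 1 ==> K \<in> set l"
  and t: "ta > 0" "m * ta <= 1/2" and F: "!!w. w \<in> words (K + d) n ==> \<bar>F w\<bar> <= 1"
 shows "\<bar>Exw (tw K m ta) (K + m) n (%V. F (app K V l)) - Exw (tw K d (ta * cnt l K)) (K + d) n F\<bar>
   <= sqrt ((1 + real (K + d) * (8 * real K * (m * ta)\<^sup>2)) ^ n - 1)"
proof -
 have lm: "length l = m" using l by (simp add: words_def)
 define q where "q = (%a. \<Sum>s<K + m. if sub K l s = a then tw K m ta s else 0)"
 have q: "q a = (if a < K then (1 - m * ta) / K else 0) + ta * cnt l a" for a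
  unfolding q_def by (rule push_tw[OF lm])
 have less: "sub K l s < K + d" if "s < K + m" for s
  using that l by (simp add: sub_def words_def subset_iff)
 have push: "Exw (tw K m ta) (K + m) i (%V. G (map (sub K l) V)) = Exw q (K + d) i G" for i G
  unfolding q_def by (rule Exw_push[OF less])
 have q1: "(\<Sum>a<K + d. q a) = 1"
  using push[of 1 "%_. 1"] by (simp add: Exw_Suc sum_tw[OF K])
 have dc: "real d * cnt l K = cnt l K"
 proof (cases "d = 0")
  case True
  show ?thesis using l by (auto simp: cnt_def words_def in_set_conv_nth subset_iff)
 qed (use l in auto)
 have ct: "ta * cnt l K <= m * ta" "m * ta >= 0" using t cnt_le[of l] lm by auto
 define p where "p = tw K d (ta * cnt l K)"
 let ?A = "1 - ta * cnt l K"
 have pK: "p a = ?A / K" if "a < K" for a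
  using that dc by (simp add: p_def tw_def)
 have pK2: "p a >= 1 / (2 * K)" if "a < K" for a
 proof -
  have "1 / 2 <= 1 - ta * cnt l K" using ct t by linarith
  hence "1 / 2 / K <= ?A / K" by (rule divide_right_mono) simp
  thus ?thesis using pK[OF that] by simp
 qed
 have pd: "p a = q a & p a > 0" if "a < K + d" "\<not> a < K" for a
 proof -
  have "a = K" "d = 1" using that l(1) by auto
  thus ?thesis using cnt_pos[OF l(3)] t by (simp add: p_def tw_def q)
 qed
 show ?thesis
  unfolding app_def push p_def[symmetric]
 proof (rule Exw_chi_square)
  show "0 < p a" if "a < K + d" for a
   using pd[of a] pK2[of a] that by (cases "a < K") (auto intro: less_le_trans[rotated])
  show "(\<Sum>a<K + d. p a) = 1" unfolding p_def by (rule sum_tw[OF K])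
  \<comment> \<open>The square of 2 m ta is 8 K (m ta)^2 times 1 / (2 K), and 1 / (2 K) is the lower
    bound \<open>pK2\<close> for \<open>p a\<close>.\<close>
  show "(q a - p a)\<^sup>2 <= 8 * real K * (m * ta)\<^sup>2 * p a" if a: "a < K + d" for a
  proof (cases "a < K")
   case True
   have "\<bar>(1 - m * ta) / K - ?A / K\<bar> = (m * ta - ta * cnt l K) / K"
    using ct by (simp add: diff_divide_distrib[symmetric])
   also have "... <= (m * ta - ta * cnt l K) / 1" using K ct(1) by (intro divide_left_mono) auto
   also have "... <= m * ta" using t by simp
   finally have 1: "\<bar>(1 - m * ta) / K - ?A / K\<bar> <= m * ta" .
   have 2: "0 <= ta * cnt l a" "ta * cnt l a <= m * ta" using cnt_le[of l a] lm t by auto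
   have "\<bar>q a - p a\<bar> <= 2 * (m * ta)" proof -
    have "\<bar>x + z - y\<bar> <= 2 * M" if "\<bar>x - y\<bar> <= M" "0 <= z" "z <= M" for x y z M :: real
     using that by simp
    from this[OF 1 2] show ?thesis unfolding q pK[OF True] using True by simp
   qed
   hence "(q a - p a)\<^sup>2 <= (2 * (m * ta))\<^sup>2" using power2_le_iff_abs_le[of "2 * (m * ta)"] by simp
   also have "... = 8 * real K * (m * ta)\<^sup>2 * (1 / (2 * K))" using K by simp
   also have "... <= 8 * real K * (m * ta)\<^sup>2 * p a" using pK2[OF True] by (intro mult_left_mono) auto
   finally show ?thesis .
  qed (use pd[OF a] in auto)
 qed (use q1 F in auto)
qed

text \<open>One threshold for n serves all multiples s of the rate up to S, all l and all F at once;
  the multiple is chosen only after the set A is known.\<close>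

lemma tmpl_close_eventually:
 assumes K: "K > 0" and et: "et > 0" and lam: "lam > 0"
 shows "eventually (%n::nat. ALL s:{1..S::nat}. \<forall>d\<le>1. ALL l:words (K + d) m. ALL F. (d = 1 --> K \<in> set l) -->
   (ALL w:words (K + d) n. \<bar>F w\<bar> <= 1) --> m * (real s * lam / n) <= 1/2 & n > 0 &
   \<bar>Exw (tw K m (real s * lam / n)) (K + m) n (%V. F (app K V l)) - Exw (tw K d (real s * lam / n * cnt l K)) (K + d) n F\<bar> <= et) sequentially"
proof -
 have "eventually (%n::nat. 2 * real m * S * lam < n) sequentially"
  using filterlim_real_sequentially by (simp add: filterlim_at_top_dense)
 moreover have "eventually (%n. sqrt ((1 + (K + 1) * ((8 * real K * (m * S * lam)\<^sup>2) / real n ^ 2)) ^ n - 1) <= et) sequentially"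
  by (rule chi_error_tendsto) (use et in auto)
 ultimately show ?thesis using eventually_gt_at_top[of 0]
 proof eventually_elim
  case (elim n)
  show ?case
  proof (intro ballI allI impI)
   fix s d l F
   assume s: "s \<in> {1..S}" and d: "d <= (1::nat)" and l: "l \<in> words (K + d) m" and dl: "d = 1 --> K \<in> set l"
    and F: "ALL w:words (K + d) n. \<bar>F w\<bar> <= (1::real)"
   define ta where "ta = s * lam / n"
   have tS: "ta <= S * lam / n" unfolding ta_def using s lam by (intro divide_right_mono mult_right_mono) auto
   have mta: "m * ta <= m * (S * lam / n)" by (rule mult_left_mono[OF tS]) simp
   also have "... <= 1/2" using elim by simp
   finally have 1: "m * ta <= 1/2" .
   have ta: "ta > 0" unfolding ta_def using s lam elim by auto
   have "\<bar>Exw (tw K m ta) (K + m) n (%V. F (app K V l)) - Exw (tw K d (ta * cnt l K)) (K + d) n F\<bar>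
     <= sqrt ((1 + real (K + d) * (8 * real K * (m * ta)\<^sup>2)) ^ n - 1)"
    by (rule tmpl_close) (use K d l dl ta 1 F in auto)
   also have "... <= sqrt ((1 + (K + 1) * (8 * real K * (m * (S * lam / n))\<^sup>2)) ^ n - 1)"
   proof -
    have "(m * ta)\<^sup>2 <= (m * (S * lam / n))\<^sup>2" using mta ta by (intro power_mono) auto
    moreover have "real (K + d) <= (K + 1)" using d by simp
    ultimately show ?thesis using ta tS
     by (intro real_sqrt_le_mono diff_right_mono power_mono add_left_mono mult_mono) auto
   qed
   also have "... <= et" using elim(2) by (simp add: power_divide mult.assoc)
   finally show "m * (real s * lam / n) <= 1/2 & n > 0 &
    \<bar>Exw (tw K m (real s * lam / n)) (K + m) n (%V. F (app K V l)) - Exw (tw K d (real s * lam / n * cnt l K)) (K + d) n F\<bar> <= et"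
    using 1 elim(3) unfolding ta_def by simp
  qed
 qed
qed

lemma tw_nonneg: "0 <= (ta::real) ==> m * ta <= 1 ==> 0 <= tw K m ta a"
 by (simp add: tw_def)

lemma Exw_uniform:
 assumes "K > 0"
 shows "Exw (tw K 0 x) K n F = (SUM w:words K n. F w) / (K ^ n)"
proof -
 have "prod_list (map (tw K 0 x) w) = 1 / real (K ^ n)" if "w \<in> words K n" for w
 proof -
  have "prod_list (map (tw K 0 x) w) = 1 / real K ^ length w" if "set w \<subseteq> {..<K}"
   using that by (induction w) (auto simp: tw_def)
  thus ?thesis using that by (simp add: words_def)
 qed
 thus ?thesis unfolding Exw_def by (simp add: sum_divide_distrib)
qed

section \<open>Insensitive sets and their covering by subspaces\<close>

definition rep :: "nat => nat => nat => nat" where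
 "rep k i s = (if s = k then i else s)"

definition insens :: "nat => nat => nat => nat list set => bool" where
 "insens k i n D \<longleftrightarrow> (ALL w:words (Suc k) n. w \<in> D \<longleftrightarrow> map (rep k i) w \<in> D)"

text \<open>Each fixed point of a random subspace is nearly uniform in the cube, so some subspace of
  dimension \<open>m0\<close> carries D with density et/2 on its words over the smaller alphabet.
  \<open>DHJ k m\<close> gives a subspace there, and insensitivity extends it to the letter k at no
  cost.\<close>

lemma insens_subspace:
 assumes D: "DHJ k m" and k: "i < k" and et: "et > 0"
 shows "EX n0. \<forall>n\<ge>n0. ALL D. D \<subseteq> words (Suc k) n --> insens k i n D --> et * real (Suc k ^ n) <= card D -->
  (EX ta:tmpl (Suc k) m n. ALL t:words (Suc k) m. app (Suc k) ta t \<in> D)"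
proof -
 obtain m0 where m0: "!!A. A \<subseteq> words k m0 ==> et/2 * real (k ^ m0) <= real (card A) ==>
   EX ta:tmpl k m m0. ALL t:words k m. app k ta t \<in> A"
  using DHJE[OF D, of "et/2"] et by (metis half_gt_zero order_refl)
 define K where "K = Suc k"
 have K: "K > 0" by (simp add: K_def)
 obtain lam where lam: "lam > 0" "m0 * exp (- lam) <= et/4"
 proof -
  have "((%x. m0 * exp (- x)) \<longlongrightarrow> real m0 * 0) at_top"
   by (intro tendsto_intros filterlim_compose[OF exp_at_bot] filterlim_uminus_at_bot_at_top)
  hence "eventually (%x. m0 * exp (- x) < et/4) at_top" using et by (intro order_tendstoD) auto
  hence "eventually (%x. x > 0 & m0 * exp (- x) < et/4) at_top"
   using eventually_gt_at_top[of 0] by eventually_elim auto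
  from eventually_happens'[OF trivial_limit_at_top_linorder this] show ?thesis using that by force
 qed
 have "et/4 > 0" using et by simp
 from tmpl_close_eventually[OF K this lam(1), of 1 m0]
 obtain n0 where N: "\<forall>n\<ge>n0. ALL s:{1..1}. \<forall>d\<le>1. ALL l:words (K + d) m0. ALL F. (d = 1 --> K \<in> set l) -->
   (ALL w:words (K + d) n. \<bar>F w\<bar> <= 1) --> m0 * (real s * lam / n) <= 1/2 & n > 0 &
   \<bar>Exw (tw K m0 (real s * lam / n)) (K + m0) n (%V. F (app K V l)) - Exw (tw K d (real s * lam / n * cnt l K)) (K + d) n F\<bar> <= et/4"
  unfolding eventually_sequentially by blast
 have n0: "m0 * (lam / n) <= 1/2 & n > 0 &
   \<bar>Exw (tw K m0 (lam / n)) (K + m0) n (%V. F (app K V l)) - Exw (tw K 0 (lam / n * cnt l K)) K n F\<bar> <= et/4"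
  if "n >= n0" "l \<in> words K m0" "!!w. w \<in> words K n ==> \<bar>F w\<bar> <= 1" for n l F
  using N[rule_format, of n 1 0 l F] that by simp
 show ?thesis
 proof (intro exI[of _ n0] allI impI)
  fix n D assume n: "n0 <= n" and Dw: "D \<subseteq> words (Suc k) n" and ins: "insens k i n D"
   and cD: "et * (Suc k ^ n) <= card D"
  define ta where "ta = lam / n"
  have "replicate m0 0 \<in> words K m0" by (auto simp: words_def K_def)
  from n0[OF n this, of "%_. 0"] have ta: "m0 * ta <= 1" "n > 0" "ta >= 0" using lam by (auto simp: ta_def)
  note nn = tw_nonneg[OF ta(3,1), of K]
  have prob: "Exw (tw K m0 ta) (K + m0) n (%V. of_bool (app K V t \<in> D)) >= et - et/4" if t: "t \<in> words k m0" for t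
  proof -
   have tK: "t \<in> words K m0" using t words_mono[of k K m0] by (auto simp: K_def)
   have "words K n \<inter> {x. x \<in> D} = D" using Dw by (auto simp: K_def)
   hence "Exw (tw K 0 (ta * cnt t K)) K n (%w. of_bool (w \<in> D)) >= et"
    unfolding Exw_uniform[OF K] using cD by (simp add: K_def field_simps)
   moreover have "\<bar>Exw (tw K m0 ta) (K + m0) n (%V. of_bool (app K V t \<in> D)) - Exw (tw K 0 (ta * cnt t K)) K n (%w. of_bool (w \<in> D))\<bar> <= et/4"
    using n0[OF n tK, of "%w. of_bool (w \<in> D)"] unfolding ta_def by simp
   ultimately show ?thesis by linarith
  qed
  \<comment> \<open>The penalty for a degenerate V is as large as the count can be, so a V with
    positive \<open>c V\<close> is automatically a genuine template.\<close>
  define c where "c V = (SUM t:words k m0. of_bool (app K V t \<in> D)) - real (k ^ m0) * of_bool (V \<notin> tmpl K m0 n)" for V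
  have "(k ^ m0) * (et / 2) <= (SUM t:words k m0. et - et/4) - (k ^ m0) * (et/4)"
   by simp
  also have "... <= (SUM t:words k m0. Exw (tw K m0 ta) (K + m0) n (%V. of_bool (app K V t \<in> D)))
    - real (k ^ m0) * Exw (tw K m0 ta) (K + m0) n (%V. of_bool (V \<notin> tmpl K m0 n))"
  proof (intro diff_mono sum_mono prob mult_left_mono)
   have "Exw (tw K m0 ta) (K + m0) n (%V. of_bool (V \<notin> tmpl K m0 n)) <= m0 * exp (- (n * ta))"
    by (rule Exw_degenerate) (use K ta in auto)
   also have "... <= et/4" using lam ta by (simp add: ta_def)
   finally show "Exw (tw K m0 ta) (K + m0) n (%V. of_bool (V \<notin> tmpl K m0 n)) <= et/4" .
  qed auto
  also have "... = Exw (tw K m0 ta) (K + m0) n c"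
   unfolding c_def Exw_diff Exw_sum Exw_cmult ..
  finally obtain V where V: "V \<in> words (K + m0) n" "(k ^ m0) * (et/2) <= c V"
   using Exw_exists[of "K + m0" "tw K m0 ta", OF nn sum_tw[OF K]] by blast
  have "(SUM t:words k m0. of_bool (app K V t \<in> D)) <= (SUM t:words k m0. (1::real))" by (intro sum_mono) auto
  also have "... = (k ^ m0)" by simp
  finally have le: "(SUM t:words k m0. of_bool (app K V t \<in> D)) <= real (k ^ m0)" .
  have "0 < (k ^ m0) * (et/2)" using et k by simp
  have Vt: "V \<in> tmpl K m0 n"
  proof (rule ccontr)
   assume "V \<notin> tmpl K m0 n"
   hence "c V = (SUM t:words k m0. of_bool (app K V t \<in> D)) - real (k ^ m0)" by (simp add: c_def)
   thus False using V(2) le \<open>0 < real (k ^ m0) * (et/2)\<close> by linarith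
  qed
  hence "et/2 * (k ^ m0) <= card {t \<in> words k m0. app K V t \<in> D}"
   using V(2) by (simp add: c_def mult.commute Int_def)
  from m0[OF _ this] obtain si where si: "si \<in> tmpl k m m0" "!!t. t \<in> words k m ==> app K V (app k si t) \<in> D"
   by auto
  define sh where "sh = (%s. if s < k then s else Suc s)"
  define si' where "si' = map sh si"
  have siw: "si' \<in> words (K + m) m0" using si(1) by (auto simp: tmpl_def words_def si'_def sh_def K_def)
  have si': "si' \<in> tmpl K m m0"
  proof -
   have "v \<in> sh ` set si" if "v \<in> {K..<K + m}" for v
   proof -
    have "v - 1 \<in> {k..<k + m}" "sh (v - 1) = v" using that by (auto simp: sh_def K_def)
    moreover from this have "v - 1 \<in> set si" using si(1) unfolding tmpl_def by blast
    ultimately show ?thesis by (metis imageI)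
   qed
   thus ?thesis using siw by (auto simp: tmpl_def si'_def)
  qed
  have eq: "app K si' t = app k si t" for t
   by (simp add: app_def si'_def sub_def sh_def K_def)
  \<comment> \<open>Replacing k by i in t gives a word over the smaller alphabet. Its image and the
    image of t agree after \<open>map (rep k i)\<close>, and insensitivity transfers
    membership.\<close>
  have "app K (app K V si') t \<in> D" if t: "t \<in> words K m" for t
  proof -
   have t': "map (rep k i) t \<in> words k m" using t k by (auto simp: words_def rep_def K_def)
   have l: "length si' = m0" using siw by (simp add: words_def)
   have D1: "app K (app K V si') (map (rep k i) t) \<in> D" using app_app[OF V(1) l] eq by (simp add: si(2)[OF t'])
   define ta' where "ta' = app K V si'"
   have ta'w: "ta' \<in> words (K + m) n" using app_in_tmpl[OF Vt si'] by (simp add: tmpl_def ta'_def)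
   have r: "map (rep k i) (app K ta' (map (rep k i) t)) = map (rep k i) (app K ta' t)"
    using ta'w t by (auto simp: app_def sub_def words_def rep_def)
   have "app K ta' t \<in> words (Suc k) n" using app_in_words[OF ta'w t] by (simp add: K_def)
   moreover have "app K ta' (map (rep k i) t) \<in> words (Suc k) n"
    using D1 Dw by (auto simp: ta'_def)
   ultimately show ?thesis using D1 ins r unfolding insens_def ta'_def[symmetric] by simp
  qed
  thus "EX ta:tmpl (Suc k) m n. ALL t:words (Suc k) m. app (Suc k) ta t \<in> D"
   using app_in_tmpl[OF Vt si'] by (auto simp: K_def)
 qed
qed

lemma dense_sections:
 fixes c :: real
 assumes A: "finite A" and B: "finite B" "B ~= {}" and S: "!!a. a \<in> A ==> S a \<subseteq> B" and c: "c >= 0"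
  and le: "c * card A * card B <= (SUM a:A. real (card (S a)))"
 shows "c/2 * card A <= card {a\<in>A. c/2 * card B <= card (S a)}"
proof -
 define Y where "Y = {a\<in>A. c/2 * card B <= card (S a)}"
 have "(SUM a:A. real (card (S a))) <= (SUM a:A. c/2 * card B + card B * of_bool (a \<in> Y))"
 proof (rule sum_mono)
  fix a assume a: "a \<in> A"
  have 1: "real (card (S a)) <= card B" using card_mono[OF B(1) S[OF a]] by simp
  have 2: "0 <= c/2 * card B" using c by simp
  show "(card (S a)) <= c/2 * card B + card B * of_bool (a \<in> Y)"
   using a 1 2 by (cases "a \<in> Y") (auto simp: Y_def)
 qed
 also have "... = c/2 * card B * card A + card B * card Y"
 proof -
  have "A \<inter> Y = Y" by (auto simp: Y_def)
  thus ?thesis using A by (simp add: sum.distrib)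
 qed
 finally have "(card B) * (c/2 * card A) <= real (card B) * (card Y)" using le by (simp add: algebra_simps)
 moreover have "real (card B) > 0" using B by auto
 ultimately have "c/2 * card A <= card Y" by simp
 thus ?thesis by (simp add: Y_def)
qed

lemma insens_same:
 assumes "insens k i n D" "x \<in> words (Suc k) n" "y \<in> words (Suc k) n" "map (rep k i) x = map (rep k i) y"
 shows "x \<in> D \<longleftrightarrow> y \<in> D"
 using assms unfolding insens_def by simp

lemma rep_idem: "i < k ==> rep k i (rep k i s) = rep k i s"
 by (simp add: rep_def)

lemma map_rep_words: "i < k ==> y \<in> words (Suc k) n ==> map (rep k i) y \<in> words (Suc k) n"
 by (auto simp: words_def rep_def)

lemma words_split:
 assumes "z \<in> words K (a + b)" obtains x y where "z = x @ y" "x \<in> words K a" "y \<in> words K b"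
proof
 show "z = take a z @ drop a z" by simp
qed (use assms in \<open>auto simp: words_def dest: in_set_takeD in_set_dropD\<close>)

text \<open>The fact behind this is that an insensitive set is, up to density et, a disjoint union
  of M-dimensional subspaces; it is recorded through its effect on a function h with nonpositive sum
  over every such subspace. Each round spends a fresh block of \<open>n1\<close> coordinates, and
  the set left over is insensitive only in the coordinates behind it. Hence the hypothesis speaks of
  sections over prefixes of length \<open>a\<close>. The proportion \<open>lam\<close> removed per
  round is the density et/2 of good prefix-suffix pairs, divided among the templates of the block,
  times the \<open>K ^ M\<close> points of a template out of \<open>K ^ n1\<close>.\<close>

lemma cover_greedy:
 fixes k M n1 i :: nat and et :: real
 defines "K \<equiv> Suc k"
 assumes i: "i < k" and et: "et > 0"
  and sub: "!!D. D \<subseteq> words K n1 ==> insens k i n1 D ==> et/2 * real (K ^ n1) <= card D ==>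
   EX ta:tmpl K M n1. ALL t:words K M. app K ta t \<in> D"
  and n: "n1 * r <= n" and D: "D \<subseteq> words K (a + n)"
  and ins: "!!x. x \<in> words K a ==> insens k i n {y. x @ y \<in> D}"
  and h: "!!w. w \<in> words K (a + n) ==> h w <= (1::real)"
  and tm: "!!ta. ta \<in> tmpl K M (a + n) ==> (SUM t:words K M. h (app K ta t)) <= 0"
 defines "lam \<equiv> et/2 / real ((K + M) ^ n1) * real (K ^ M) / real (K ^ n1)"
 shows "(SUM w:D. h w) <= max (et * real (K ^ (a + n))) (card D - lam * r * real (K ^ (a + n)))"
 using n D ins h tm
proof (induction r arbitrary: a n D)
 case 0
 have "(SUM w:D. h w) <= (SUM w:D. 1)" using 0 by (intro sum_mono) auto
 thus ?case by simp
next
 case (Suc r)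
 define n' where "n' = n - n1"
 have nn: "n = n1 + n'" "n1 * r <= n'" using Suc.prems(1) by (auto simp: n'_def)
 have fD: "finite D" using Suc.prems(2) finite_words finite_subset by blast
 have K0: "K > 0" by (simp add: K_def)
 show ?case
 proof (cases "card D <= et * real (K ^ (a + n))")
  case True
  have "(SUM w:D. h w) <= (SUM w:D. 1)" using Suc.prems by (intro sum_mono) auto
  thus ?thesis using True by simp
 next
  case False
  define X where "X = words K a \<times> words K n'"
  define S where "S = (%(x, y). {w \<in> words K n1. x @ w @ y \<in> D})"
  define Y where "Y = {p\<in>X. et/2 * card (words K n1) <= card (S p)}"
  have cX: "real (card X) = (K ^ (a + n'))" by (simp add: X_def power_add)
  let ?A = "SUM p:X. real (card (S p))"
  have "real (card D) = (SUM w:words K (a + (n1 + n')). of_bool (w \<in> D))"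
  proof -
   have "words K (a + (n1 + n')) \<inter> D = D" using Suc.prems(2) nn by auto
   thus ?thesis by simp
  qed
  also have "... = (SUM x:words K a. SUM w:words K n1. SUM y:words K n'. of_bool (x @ w @ y \<in> D))"
   by (simp only: sum_words_append)
  also have "... = (SUM x:words K a. SUM y:words K n'. SUM w:words K n1. of_bool (x @ w @ y \<in> D))"
   by (intro sum.cong refl sum.swap)
  also have "... = ?A"
   by (simp add: X_def S_def sum.cartesian_product Int_def case_prod_unfold)
  finally have cD: "(card D) = ?A" .
  have cY: "et/2 * card X <= card Y" unfolding Y_def
  proof (rule dense_sections)
   have "replicate n1 0 \<in> words K n1" by (auto simp: words_def K_def)
   thus "words K n1 ~= {}" by auto
   show "et * (card X) * (card (words K n1)) <= ?A"
    using False unfolding cX cD[symmetric] by (simp add: nn(1) power_add mult_ac)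
  qed (use et in \<open>auto simp: X_def S_def\<close>)
  have "EX ta:tmpl K M n1. et/2 * card X / ((K + M) ^ n1) <= card {p\<in>Y. ALL t:words K M. fst p @ app K ta t @ snd p \<in> D}"
  proof (rule pigeonhole_card[OF _ _ _ cY])
   show "finite Y" by (simp add: Y_def X_def)
   show "EX ta:tmpl K M n1. ALL t:words K M. fst p @ app K ta t @ snd p \<in> D" if p: "p \<in> Y" for p
   proof -
    have px: "fst p \<in> words K a" "snd p \<in> words K n'" using p by (auto simp: Y_def X_def)
    have "insens k i n1 (S p)" unfolding insens_def
    proof
     fix w assume w: "w \<in> words (Suc k) n1"
     note rw = map_rep_words[OF i w]
     have y: "w @ snd p \<in> words (Suc k) n" "map (rep k i) w @ snd p \<in> words (Suc k) n"
      using append_in_words[OF w, of "snd p" n'] append_in_words[OF rw, of "snd p" n'] px by (auto simp: nn K_def)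
     have "w @ snd p \<in> {y. fst p @ y \<in> D} \<longleftrightarrow> map (rep k i) w @ snd p \<in> {y. fst p @ y \<in> D}"
      by (rule insens_same[OF Suc.prems(3)[OF px(1)] y]) (simp add: rep_idem[OF i])
     thus "w \<in> S p \<longleftrightarrow> map (rep k i) w \<in> S p"
      using w rw by (auto simp: S_def K_def)
    qed
    from sub[OF _ this] show ?thesis using p by (auto simp: Y_def S_def case_prod_unfold)
   qed
   have "0 < et/2 * card X" unfolding cX using et K0 by simp
   thus "Y ~= {} \<or> tmpl K M n1 ~= {}" using cY by auto
   show "real (card (tmpl K M n1)) <= ((K + M) ^ n1)" by (simp only: of_nat_le_iff card_tmpl_le)
  qed simp
  then obtain ta where ta: "ta \<in> tmpl K M n1" and
   Z: "et/2 * card X / ((K + M) ^ n1) <= card {p\<in>Y. ALL t:words K M. fst p @ app K ta t @ snd p \<in> D}" by blast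
  define Z where "Z = {p\<in>X. ALL t:words K M. fst p @ app K ta t @ snd p \<in> D}"
  have fZ: "finite Z" by (simp add: Z_def X_def)
  have "card {p\<in>Y. ALL t:words K M. fst p @ app K ta t @ snd p \<in> D} <= card Z"
   by (rule card_mono[OF fZ]) (auto simp: Z_def Y_def)
  hence cZ: "et/2 * card X / ((K + M) ^ n1) <= card Z" using Z by simp
  define g where "g = (%(p, t). fst p @ app K ta t @ snd p)"
  \<comment> \<open>The removed set: parallel copies of a single template, one over every
    prefix-suffix pair that admits it.\<close>
  define R where "R = g ` (Z \<times> words K M)"
  have apw: "app K ta t \<in> words K n1" if "t \<in> words K M" for t
   using app_in_words[OF tmpl_words[OF ta] that] .
  have inj: "inj_on g (Z \<times> words K M)"
  proof (rule inj_onI)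
   fix u v assume u: "u \<in> Z \<times> words K M" and v: "v \<in> Z \<times> words K M" and e: "g u = g v"
   obtain p t where uu: "u = (p, t)" by (cases u)
   obtain q s where vv: "v = (q, s)" by (cases v)
   have "length (fst p) = length (fst q)" "length (app K ta t) = length (app K ta s)"
    using u v uu vv by (auto simp: Z_def X_def words_def app_def)
   hence "fst p = fst q" "app K ta t = app K ta s" "snd p = snd q"
    using e uu vv by (auto simp: g_def)
   moreover from this have "t = s" using inj_on_app[OF ta] u v uu vv by (auto dest: inj_onD)
   ultimately show "u = v" using uu vv by (simp add: prod_eq_iff)
  qed
  have RD: "R \<subseteq> D" by (auto simp: R_def g_def Z_def)
  have cR: "card R = card Z * K ^ M"
   unfolding R_def using card_image[OF inj] by (simp add: card_cartesian_product)
  have hR: "(SUM w:R. h w) <= 0"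
  proof -
   have "(SUM w:R. h w) = (SUM p:Z. SUM t:words K M. h (g (p, t)))"
    unfolding R_def by (subst sum.reindex[OF inj]) (simp add: sum.cartesian_product)
   also have "... <= (SUM p:Z. 0)"
   proof (rule sum_mono)
    fix p assume "p \<in> Z"
    hence p: "fst p \<in> words K a" "snd p \<in> words K n'" by (auto simp: Z_def X_def)
    have tp: "fst p @ ta @ snd p \<in> tmpl K M (a + n)"
     unfolding nn by (intro prefix_in_tmpl suffix_in_tmpl p ta)
    have "g (p, t) = app K (fst p @ ta @ snd p) t" for t
     by (simp add: g_def app_append app_word[OF p(1)] app_word[OF p(2)])
    thus "(SUM t:words K M. h (g (p, t))) <= 0" using Suc.prems(5)[OF tp] by simp
   qed
   finally show ?thesis by simp
  qed
  have an: "a + n1 + n' = a + n" using nn by simp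
  have IH: "(SUM w:D - R. h w) <= max (et * (K ^ (a + n1 + n'))) (card (D - R) - lam * r * (K ^ (a + n1 + n')))"
  proof (rule Suc.IH)
   show "D - R \<subseteq> words K (a + n1 + n')" unfolding an using Suc.prems(2) by blast
   fix z assume "z \<in> words K (a + n1)"
   then obtain x w where z: "z = x @ w" "x \<in> words K a" "w \<in> words K n1" by (rule words_split)
   show "insens k i n' {y. z @ y \<in> D - R}" unfolding insens_def
   proof
    fix y assume y: "y \<in> words (Suc k) n'"
    note ry = map_rep_words[OF i y]
    have same: "x @ v @ y \<in> D \<longleftrightarrow> x @ v @ map (rep k i) y \<in> D" if v: "v \<in> words K n1" for v
    proof -
     have "v @ y \<in> {u. x @ u \<in> D} \<longleftrightarrow> v @ map (rep k i) y \<in> {u. x @ u \<in> D}"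
      by (rule insens_same[OF Suc.prems(3)[OF z(2)]])
       (use append_in_words[of v _ n1 _ n'] v y ry in \<open>auto simp: nn K_def rep_idem[OF i]\<close>)
     thus ?thesis by simp
    qed
    have inR: "x @ w @ u \<in> R \<longleftrightarrow> w \<in> app K ta ` words K M & (ALL t:words K M. x @ app K ta t @ u \<in> D)"
     if u: "u \<in> words K n'" for u
    proof
     assume "x @ w @ u \<in> R"
     then obtain p t where p: "p \<in> Z" "t \<in> words K M" "x @ w @ u = fst p @ app K ta t @ snd p"
      by (auto simp: R_def g_def)
     have "length x = length (fst p)" "length w = length (app K ta t)"
      using p(1) apw[OF p(2)] z(2,3) by (auto simp: Z_def X_def words_def)
     hence "fst p = x" "app K ta t = w" "snd p = u" using p(3) by auto
     thus "w \<in> app K ta ` words K M & (ALL t:words K M. x @ app K ta t @ u \<in> D)"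
      using p by (auto simp: Z_def)
    next
     assume *: "w \<in> app K ta ` words K M & (ALL t:words K M. x @ app K ta t @ u \<in> D)"
     then obtain t where t: "t \<in> words K M" "w = app K ta t" by blast
     have "(x, u) \<in> Z" using * z u by (simp add: Z_def X_def)
     thus "x @ w @ u \<in> R" unfolding R_def using t
      by (intro image_eqI[of _ _ "((x, u), t)"]) (auto simp: g_def)
    qed
    show "y \<in> {y. z @ y \<in> D - R} \<longleftrightarrow> map (rep k i) y \<in> {y. z @ y \<in> D - R}"
     using same[OF z(3)] same[OF apw] inR y ry by (simp add: z K_def)
   qed
  qed (use Suc.prems nn an in auto)
  have "lam * (K ^ (a + n)) = et/2 * card X / ((K + M) ^ n1) * (K ^ M)"
   using K0 unfolding lam_def cX nn by (simp add: power_add)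
  also have "... <= card Z * real (K ^ M)" by (rule mult_right_mono[OF cZ]) simp
  also have "... = card R" by (simp add: cR)
  finally have lamR: "lam * (K ^ (a + n)) <= card R" .
  have cDR: "(card (D - R)) = real (card D) - (card R)"
   using card_Diff_subset[OF finite_subset[OF RD fD] RD] card_mono[OF fD RD] by simp
  have "(SUM w:D. h w) <= (SUM w:D - R. h w)" using hR by (simp add: sum.subset_diff[OF RD fD])
  also have "... <= max (et * (K ^ (a + n))) (card D - lam * Suc r * (K ^ (a + n)))"
  proof (rule order.trans[OF IH], unfold an cDR, rule max.mono)
   show "real (card D) - (card R) - lam * r * (K ^ (a + n)) <= (card D) - lam * Suc r * (K ^ (a + n))"
    using lamR by (simp add: algebra_simps)
  qed simp
  finally show ?thesis .
 qed
qed

lemma insens_cover: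
 fixes k M i :: nat and et :: real
 defines "K \<equiv> Suc k"
 assumes DHJ: "DHJ k 1" and i: "i < k" and et: "et > 0"
 shows "EX n0. \<forall>n\<ge>n0. ALL D h. D \<subseteq> words K n --> insens k i n D --> (ALL w:words K n. h w <= 1) -->
  (ALL ta:tmpl K M n. (SUM t:words K M. h (app K ta t)) <= 0) --> (SUM w:D. h w) <= et * real (K ^ n)"
proof -
 have "DHJ k M" using DHJ_multidim[OF DHJ] i by simp
 moreover have "et/2 > 0" using et by simp
 ultimately obtain n1 where n1: "\<forall>n\<ge>n1. ALL D. D \<subseteq> words K n --> insens k i n D --> et/2 * real (K ^ n) <= card D -->
  (EX ta:tmpl K M n. ALL t:words K M. app K ta t \<in> D)"
  using insens_subspace[OF _ i] unfolding K_def by blast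
 define lam where "lam = et/2 / ((K + M) ^ n1) * (K ^ M) / (K ^ n1)"
 have "lam > 0" using et by (simp add: lam_def K_def)
 \<comment> \<open>More than 1/lam rounds cannot all remove a proportion lam, so the process has to
   stop at density et.\<close>
 then obtain r :: nat where r: "1 < r * lam" using reals_Archimedean3 by blast
 show ?thesis
 proof (intro exI[of _ "n1 * r"] allI impI)
  fix n D and h :: "nat list => real"
  assume n: "n1 * r <= n" and D: "D \<subseteq> words K n" "insens k i n D" and h: "ALL w:words K n. h w <= 1"
   and t: "ALL ta:tmpl K M n. (SUM t:words K M. h (app K ta t)) <= 0"
  have "(SUM w:D. h w) <= max (et * (K ^ (0 + n))) (card D - lam * r * (K ^ (0 + n)))"
   unfolding lam_def K_def
   by (rule cover_greedy[where i = i and h = h and n = n and a = 0]) (use n1 i et n D h t in \<open>auto simp: K_def\<close>)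
  also have "... <= et * (K ^ n)"
  proof -
   have "real (card D) <= (K ^ n)" using card_mono[OF finite_words D(1)] by simp
   also have "... <= lam * r * (K ^ n)" using r mult_right_mono[of 1 "r * lam" "real (K ^ n)"] by (simp add: mult.commute)
   finally have "card D - lam * r * (K ^ n) <= 0" by simp
   also have "0 <= et * (K ^ n)" using et by simp
   finally show ?thesis by simp
  qed
  finally show "(SUM w:D. h w) <= et * (K ^ n)" .
 qed
qed

lemma insens_app:
 assumes "si \<in> words (Suc k + m) n" "insens k i n E" "i < k"
 shows "insens k i m {t. app (Suc k) si t \<in> E}"
 unfolding insens_def
proof
 fix t assume t: "t \<in> words (Suc k) m"
 have "app (Suc k) si t \<in> E \<longleftrightarrow> app (Suc k) si (map (rep k i) t) \<in> E"
 proof (rule insens_same[OF assms(2)])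
  show "map (rep k i) (app (Suc k) si t) = map (rep k i) (app (Suc k) si (map (rep k i) t))"
   using assms t by (auto simp: app_def sub_def words_def rep_def)
 qed (use app_in_words[OF assms(1)] t map_rep_words[OF assms(3) t] in auto)
 thus "t \<in> {t. app (Suc k) si t \<in> E} \<longleftrightarrow> map (rep k i) t \<in> {t. app (Suc k) si t \<in> E}" by simp
qed

text \<open>Induction on the number of sets. The last set is exhausted by subspaces of dimension
  \<open>m1\<close>; inside each of them the other sets are still insensitive, and \<open>m1\<close>
  was chosen so large that the induction hypothesis holds there.\<close>

lemma insens_inter_cover:
 fixes k M J :: nat and et :: real
 defines "K \<equiv> Suc k"
 assumes DHJ: "DHJ k 1" and k: "k > 0" and et: "et > 0"
 shows "EX n0. \<forall>n\<ge>n0. ALL E c h. (\<forall>j<J. c j < k & insens k (c j) n (E j)) --> (ALL w:words K n. h w <= 1) -->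
  (ALL ta:tmpl K M n. (SUM t:words K M. h (app K ta t)) <= 0) -->
  (\<Sum>w | w \<in> words K n & (\<forall>j<J. w \<in> E j). h w) <= et * real (K ^ n)"
 using et
proof (induction J arbitrary: et)
 case 0
 have "insens k 0 n (words (Suc k) n)" for n using k map_rep_words[of 0 k] by (simp add: insens_def)
 moreover obtain n0 where "\<forall>n\<ge>n0. ALL D h. D \<subseteq> words K n --> insens k 0 n D --> (ALL w:words K n. h w <= 1) -->
  (ALL ta:tmpl K M n. (SUM t:words K M. h (app K ta t)) <= 0) --> (SUM w:D. h w) <= et * real (K ^ n)"
  using insens_cover[OF DHJ k 0] unfolding K_def by blast
 ultimately show ?case by (intro exI[of _ n0]) (simp add: K_def)
next
 case (Suc J)
 have et2: "et/2 > 0" using Suc.prems by simp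
 obtain m1 where m1: "\<forall>n\<ge>m1. ALL E c h. (\<forall>j<J. c j < k & insens k (c j) n (E j)) --> (ALL w:words K n. h w <= 1) -->
  (ALL ta:tmpl K M n. (SUM t:words K M. h (app K ta t)) <= 0) -->
  (\<Sum>w | w \<in> words K n & (\<forall>j<J. w \<in> E j). h w) <= et/2 * real (K ^ n)" using Suc.IH[OF et2] by blast
 have "ALL i. EX n0. i < k --> (\<forall>n\<ge>n0. ALL D h. D \<subseteq> words K n --> insens k i n D --> (ALL w:words K n. h w <= 1) -->
  (ALL ta:tmpl K m1 n. (SUM t:words K m1. h (app K ta t)) <= 0) --> (SUM w:D. h w) <= et/2 * real (K ^ n))"
  using insens_cover[OF DHJ _ et2, of _ m1] unfolding K_def by simp
 from choice[OF this] obtain N where N: "ALL i. i < k --> (\<forall>n\<ge>N i. ALL D h. D \<subseteq> words K n --> insens k i n D --> (ALL w:words K n. h w <= 1) -->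
  (ALL ta:tmpl K m1 n. (SUM t:words K m1. h (app K ta t)) <= 0) --> (SUM w:D. h w) <= et/2 * real (K ^ n))" ..
 show ?case
 proof (intro exI[of _ "\<Sum>i<k. N i"] allI impI)
  fix n E c and h :: "nat list => real"
  assume n: "(\<Sum>i<k. N i) <= n" and E: "\<forall>j<Suc J. c j < k & insens k (c j) n (E j)"
   and h: "ALL w:words K n. h w <= 1" and tm: "ALL ta:tmpl K M n. (SUM t:words K M. h (app K ta t)) <= 0"
  define i where "i = c J"
  have i: "i < k" "insens k i n (E J)" using E by (auto simp: i_def)
  have "N i <= n" using n i member_le_sum[of i "{..<k}" N] by simp
  \<comment> \<open>Subtracting et/2 turns the induction bound on subspaces of dimension
    \<open>m1\<close> into the nonpositive sums that \<open>insens_cover\<close> requires.\<close>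
  define h' where "h' w = h w * of_bool (\<forall>j<J. w \<in> E j) - et/2" for w
  define D where "D = words K n \<inter> E J"
  have "insens k i n D" using i map_rep_words[OF i(1)] by (simp add: D_def insens_def K_def)
  have le: "(SUM w:D. h' w) <= et/2 * (K ^ n)"
  proof (rule N[THEN spec, THEN mp, THEN spec, THEN mp, THEN spec, THEN spec, THEN mp, THEN mp, THEN mp, THEN mp])
   show "ALL w:words K n. h' w <= 1"
   proof
    fix w assume "w \<in> words K n"
    hence "h w * of_bool b <= 1" for b using h by simp
    from this[of "\<forall>j<J. w \<in> E j"] et2 show "h' w <= 1" unfolding h'_def by simp
   qed
   show "ALL ta:tmpl K m1 n. (SUM t:words K m1. h' (app K ta t)) <= 0"
   proof
    fix si assume si: "si \<in> tmpl K m1 n"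
    note siw = tmpl_words[OF si]
    have ins: "\<forall>j<J. c j < k & insens k (c j) m1 {t. app K si t \<in> E j}"
     using E insens_app[of si k m1 n] siw by (simp add: K_def)
    have h1: "ALL t:words K m1. h (app K si t) <= 1" using h app_in_words[OF siw] by auto
    have tms: "ALL ta:tmpl K M m1. (SUM t:words K M. h (app K si (app K ta t))) <= 0"
    proof
     fix ta assume ta: "ta \<in> tmpl K M m1"
     hence "length ta = m1" by (simp add: tmpl_def words_def)
     from tm[THEN bspec, OF app_in_tmpl[OF si ta]]
     show "(SUM t:words K M. h (app K si (app K ta t))) <= 0"
      by (simp only: app_app[OF siw \<open>length ta = m1\<close>])
    qed
    let ?A = "\<Sum>t | t \<in> words K m1 & (\<forall>j<J. t \<in> {t. app K si t \<in> E j}). h (app K si t)"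
    let ?C = "SUM t:words K m1. h' (app K si t)"
    have "?A <= et/2 * (K ^ m1)"
     by (rule m1[THEN spec[of _ m1], THEN mp, OF order_refl, THEN spec[of _ "%j. {t. app K si t \<in> E j}"], THEN spec[of _ c], THEN spec[of _ "%t. h (app K si t)"], THEN mp, THEN mp, THEN mp, OF ins h1 tms])
    moreover have "?C =
      ?A - et/2 * real (K ^ m1)"
    proof -
     let ?B = "SUM t:words K m1. h (app K si t) * of_bool (\<forall>j<J. app K si t \<in> E j)"
     have "?C = ?B - et/2 * (K ^ m1)"
      by (simp add: h'_def sum_subtractf)
     also have "?B
       = (SUM t:words K m1. if \<forall>j<J. app K si t \<in> E j then h (app K si t) else 0)"
      by (intro sum.cong) auto
     finally show ?thesis by (simp add: sum.inter_filter)
    qed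
    ultimately show "?C <= 0" by simp
   qed
  qed (use i \<open>N i <= n\<close> \<open>insens k i n D\<close> in \<open>auto simp: D_def\<close>)
  have "et/2 * card D <= et/2 * (K ^ n)" using card_mono[of "words K n" D] et2 by (simp add: D_def flip: of_nat_power)
  moreover have "(\<Sum>w | w \<in> words K n & (\<forall>j<Suc J. w \<in> E j). h w) = (SUM w:D. h' w) + et/2 * card D"
  proof -
   have "(SUM w:D. h' w) + et/2 * card D = (SUM w:D. h w * of_bool (\<forall>j<J. w \<in> E j))"
    by (simp add: h'_def sum_subtractf)
   also have "... = (SUM w:D. if \<forall>j<J. w \<in> E j then h w else 0)" by (intro sum.cong) auto
   also have "... = (\<Sum>w | w \<in> D & (\<forall>j<J. w \<in> E j). h w)" by (rule sum.inter_filter[symmetric]) (simp add: D_def)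
   also have "{w. w \<in> D & (\<forall>j<J. w \<in> E j)} = {w. w \<in> words K n & (\<forall>j<Suc J. w \<in> E j)}"
    by (auto simp: D_def less_Suc_eq)
   finally show ?thesis by simp
  qed
  ultimately show "(\<Sum>w | w \<in> words K n & (\<forall>j<Suc J. w \<in> E j). h w) <= et * (K ^ n)"
   using le by simp
 qed
qed

section \<open>The density step for lines\<close>

definition lin :: "nat => nat list => nat list" where
 "lin k t = map (%a. if a = k then Suc k else a) t"

lemma lin_words: "t \<in> words (Suc k) m ==> lin k t \<in> words (Suc k + 1) m"
 by (auto simp: lin_def words_def)

lemma lin_tmpl: "t \<in> words (Suc k) m ==> k \<in> set t ==> lin k t \<in> tmpl (Suc k) 1 m"
 using lin_words[of t k m] by (simp add: tmpl_def lin_def)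

text \<open>The letter k is promoted to the variable, so t itself is the last point of its line, and
  membership of the i-th point in a set depends on t only through
  \<open>map (rep k i) t\<close>.\<close>

lemma app_lin: "t \<in> words (Suc k) m ==> app (Suc k) (lin k t) [i] = map (rep k i) t"
 by (auto simp: app_def lin_def sub_def rep_def words_def)

lemma cnt_lin: "t \<in> words (Suc k) m ==> cnt (lin k t) (Suc k) = cnt t k"
proof -
 assume t: "t \<in> words (Suc k) m"
 have "lin k t ! j = Suc k \<longleftrightarrow> t ! j = k" if "j < length t" for j
 proof -
  have "t ! j < Suc k" using nth_mem[OF that] t unfolding words_def by blast
  thus ?thesis using that by (simp add: lin_def)
 qed
 thus ?thesis unfolding cnt_def by (intro arg_cong[of _ _ card]) (auto simp: lin_def)
qed

text \<open>Only the first k of the k + 1 points are tested; these are the points within reach of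
  the induction hypothesis \<open>DHJ k 1\<close>.\<close>

definition ln_ev :: "nat => nat list set => nat list => real" where
 "ln_ev k A v = of_bool (\<forall>i<k. app (Suc k) v [i] \<in> A)"

definition qpr :: "nat => nat => nat list set => real => real" where
 "qpr k n A x = Exw (tw (Suc k) 1 x) (Suc k + 1) n (ln_ev k A)"

lemma close_lin:
 assumes "et > 0" "lam > 0"
 shows "eventually (%n::nat. ALL s:{1..S::nat}. ALL A. m * (real s * lam / n) <= 1/2 & n > 0 &
   (ALL t:words (Suc k) m. k \<in> set t -->
   \<bar>Exw (tw (Suc k) m (real s * lam / n)) (Suc k + m) n (%V. ln_ev k A (app (Suc k) V (lin k t))) - qpr k n A (real s * lam / n * cnt t k)\<bar> <= et) &
   (ALL t:words (Suc k) m. A \<subseteq> words (Suc k) n --> Exw (tw (Suc k) m (real s * lam / n)) (Suc k + m) n (%V. of_bool (app (Suc k) V t \<in> A)) >= card A / real (Suc k ^ n) - et)) sequentially"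
 using tmpl_close_eventually[OF _ assms, of "Suc k" S m, OF zero_less_Suc]
proof eventually_elim
 case (elim n)
 show ?case
 proof (intro ballI allI conjI impI)
  fix s A assume s: "s \<in> {1..S}"
  define K where "K = Suc k"
  note E = elim[rule_format, OF s, folded K_def]
  have "replicate m 0 \<in> words (K + 0) m" by (auto simp: words_def K_def)
  from E[of 0, OF _ this, of "%_. 0"] show "m * (s * lam / n) <= 1/2" "n > 0" by auto
  show "\<bar>Exw (tw (Suc k) m (real s * lam / n)) (Suc k + m) n (%V. ln_ev k A (app (Suc k) V (lin k t))) - qpr k n A (real s * lam / n * cnt t k)\<bar> <= et"
   if t: "t \<in> words (Suc k) m" and kt: "k \<in> set t" for t
  proof -
   show ?thesis using kt E[of 1 "lin k t" "ln_ev k A"] lin_words[OF t] cnt_lin[OF t] by (simp add: lin_def K_def ln_ev_def qpr_def)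
  qed
  show "Exw (tw (Suc k) m (real s * lam / n)) (Suc k + m) n (%V. of_bool (app (Suc k) V t \<in> A)) >= card A / real (Suc k ^ n) - et"
   if t: "t \<in> words (Suc k) m" and A: "A \<subseteq> words (Suc k) n" for t
  proof -
   have "words K n \<inter> {x. x \<in> A} = A" using A by (auto simp: K_def)
   hence "Exw (tw K 0 x) K n (%w. of_bool (w \<in> A)) = card A / real (K ^ n)" for x by (subst Exw_uniform) (simp_all add: K_def)
   hence "\<bar>Exw (tw K m (s * lam / n)) (K + m) n (%V. of_bool (app K V t \<in> A)) - card A / (K ^ n)\<bar> <= et"
    using E[of 0 t "%w. of_bool (w \<in> A)"] t by (simp add: K_def)
   thus ?thesis
    unfolding K_def by simp
  qed
 qed
qed

text \<open>The induction hypothesis inside a random subspace produces a line over the smaller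
  alphabet; a pigeonhole over the boundedly many lines \<open>l\<close> fixes one, and its number of
  variable positions is the multiplier c. This multiplier is bounded, but it may depend on A and on
  s.\<close>

lemma line_probability:
 assumes D: "DHJ k 1" and k: "k > 0" and de: "de > 0"
 shows "\<exists>m0>(0::nat). \<exists>vt>0. \<forall>lam>0. ALL S. eventually (%n. ALL A. A \<subseteq> words (Suc k) n --> de * real (Suc k ^ n) <= card A -->
   (ALL s:{1..S::nat}. EX c:{1..m0}. qpr k n A (real s * lam / n * c) >= vt)) sequentially"
proof -
 define K where "K = Suc k"
 obtain m0 where m0: "!!n A. n >= m0 ==> A \<subseteq> words k n ==> de/4 * real (k ^ n) <= real (card A) ==>
   EX ta:tmpl k 1 n. ALL t:words k 1. app k ta t \<in> A"
  using DHJE[OF D, of "de/4"] de by auto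
 define m where "m = Suc m0"
 \<comment> \<open>The probabilities of all lines add up to at least de/2 and there are at most
   \<open>K ^ m\<close> of them, so one has probability at least 2 vt. Half of that pays for the
   approximation error \<open>et\<close>.\<close>
 define vt where "vt = de/8 / (K ^ m)"
 have vt: "vt > 0" using de by (simp add: vt_def K_def)
 define et where "et = min (de/4) vt"
 have et: "et > 0" using de vt by (simp add: et_def)
 have main: "eventually (%n. ALL A. A \<subseteq> words K n --> de * real (K ^ n) <= card A -->
   (ALL s:{1..S::nat}. EX c:{1..m}. qpr k n A (real s * lam / n * c) >= vt)) sequentially"
  if lam: "lam > 0" for lam S
  using close_lin[OF et lam, of S m k]
 proof eventually_elim
  case (elim n)
  show ?case
  proof (intro allI impI ballI)
   fix A s assume A: "A \<subseteq> words K n" and cA: "de * (K ^ n) <= card A" and s: "s \<in> {1..S}"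
   define ta where "ta = s * lam / n"
   note E = elim[rule_format, OF s, of A, folded K_def, folded ta_def]
   have ta: "ta >= 0" "m * ta <= 1" using E lam by (auto simp: ta_def)
   note nn = tw_nonneg[OF ta, of K]
   have K0: "K > 0" by (simp add: K_def)
   have kK: "words k m \<subseteq> words K m" by (rule words_mono) (simp add: K_def)
   have cAK: "card A / (K ^ n) >= de" using cA K0 by (simp add: field_simps)
   let ?E = "Exw (tw K m ta) (K + m) n"
   define L where "L l V = (of_bool (\<forall>i<k. app K V (app k l [i]) \<in> A) :: real)" for l V :: "nat list"
   let ?A = "SUM l:tmpl k 1 m. ?E (L l)"
   have "(k ^ m) * (de - de/4) <= (SUM t:words k m. card A / (K ^ n) - et)"
   proof -
    have "et <= de/4" by (simp add: et_def)
    hence "de - de/4 <= card A / (K ^ n) - et" using cAK by linarith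
    hence "(k ^ m) * (de - de/4) <= (k ^ m) * (card A / (K ^ n) - et)" by (rule mult_left_mono) simp
    thus ?thesis by simp
   qed
   also have "... <= (SUM t:words k m. ?E (%V. of_bool (app K V t \<in> A)))"
    using E A kK by (intro sum_mono) auto
   also have "... = ?E (%V. SUM t:words k m. of_bool (app K V t \<in> A))" by (simp only: Exw_sum)
   also have "... <= ?E (%V. (k ^ m) * (de/4) + (k ^ m) * (SUM l:tmpl k 1 m. L l V))"
   proof (rule Exw_mono[OF nn])
    fix V
    define B where "B = {t\<in>words k m. app K V t \<in> A}"
    have cB: "(SUM t:words k m. of_bool (app K V t \<in> A)) = real (card B)" by (simp add: B_def Int_def)
    show "(SUM t:words k m. of_bool (app K V t \<in> A)) <= (k ^ m) * (de/4) + (k ^ m) * (SUM l:tmpl k 1 m. L l V)"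
    proof (cases "de/4 * real (k ^ m) <= card B")
     case True
     then obtain l where l: "l \<in> tmpl k 1 m" "ALL t:words k 1. app k l t \<in> B"
      using m0[of m B] by (auto simp: B_def m_def)
     have "app K V (app k l [i]) \<in> A" if "i < k" for i
     proof -
      show ?thesis using that l(2) by (simp add: words_def B_def)
     qed
     hence "L l V = 1" by (simp add: L_def)
     moreover have "L l V <= (SUM l:tmpl k 1 m. L l V)" by (rule member_le_sum) (use l in \<open>auto simp: L_def\<close>)
     ultimately have "real (k ^ m) * 1 <= (k ^ m) * (SUM l:tmpl k 1 m. L l V)" by (intro mult_left_mono) auto
     moreover have "real (card B) <= (k ^ m)"
      using card_mono[of "words k m" B] by (simp add: B_def flip: of_nat_power)
     moreover have "0 <= (k ^ m) * (de/4)" using de by simp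
     ultimately show ?thesis unfolding cB by linarith
    next
     case False
     moreover have "0 <= (k ^ m) * (SUM l:tmpl k 1 m. L l V)" by (simp add: L_def)
     ultimately show ?thesis using cB by (simp add: mult.commute)
    qed
   qed
   also have "... = (k ^ m) * (de/4) + (k ^ m) * ?A"
    by (simp only: Exw_add Exw_cmult Exw_sum Exw_const[OF sum_tw[OF K0]])
   finally have "(k ^ m) * (de/2) <= (k ^ m) * ?A" by (simp add: algebra_simps)
   hence sumE: "de/2 <= ?A" using k by simp
   have "EX l:tmpl k 1 m. ?E (L l) >= 2 * vt"
   proof (rule ccontr)
    assume "\<not> ?thesis"
    hence "?A <= (SUM l:tmpl k 1 m. 2 * vt)" by (intro sum_mono) auto
    also have "... = card (tmpl k 1 m) * (2 * vt)" by simp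
    also have "... <= (K ^ m) * (2 * vt)"
     using card_tmpl_le[of k 1 m] vt by (intro mult_right_mono) (auto simp: K_def simp flip: of_nat_power)
    also have "... = de/4" using K0 by (simp add: vt_def)
    finally show False using sumE de by simp
   qed
   then obtain l where l: "l \<in> tmpl k 1 m" "?E (L l) >= 2 * vt" by auto
   have lw: "l \<in> words (Suc k) m" "k \<in> set l" using l(1) by (simp_all add: tmpl_def)
   have "L l V = ln_ev k A (app K V (lin k l))" if V: "V \<in> words (K + m) n" for V
   proof -
    have "app K (app K V (lin k l)) [i] = app K V (app k l [i])" for i
    proof -
     have "app K (app K V (lin k l)) [i] = app K V (app K (lin k l) [i])" using lw app_app[OF V] by (simp add: lin_def words_def)
     also have "app K (lin k l) [i] = app k l [i]"
     proof -
      have "map (rep k i) l = map (sub k [i]) l"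
      proof (rule map_cong)
       fix x assume "x \<in> set l"
       thus "rep k i x = sub k [i] x" using lw(1) by (auto simp: words_def rep_def sub_def)
      qed simp
      thus ?thesis using app_lin[OF lw(1)] by (simp add: K_def app_def)
     qed
     finally show ?thesis .
    qed
    thus ?thesis by (simp add: L_def ln_ev_def K_def)
   qed
   hence "?E (%V. ln_ev k A (app K V (lin k l))) >= 2 * vt"
    using l(2) Exw_cong[of "K + m" n "L l"] by simp
   moreover have "\<bar>?E (%V. ln_ev k A (app K V (lin k l))) - qpr k n A (ta * cnt l k)\<bar> <= et"
    by (rule E[THEN conjunct2, THEN conjunct2, THEN conjunct1, THEN bspec, THEN mp]) (use lw in \<open>simp_all add: K_def\<close>)
   moreover have "et <= vt" by (simp add: et_def)
   ultimately have "qpr k n A (ta * cnt l k) >= vt" by simp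
   moreover have "cnt l k \<in> {1..m}" using cnt_pos[OF lw(2)] cnt_le[of l k] lw(1) by (simp add: words_def)
   ultimately show "EX c:{1..m}. qpr k n A (s * lam / n * c) >= vt" unfolding ta_def by blast
  qed
 qed
 show ?thesis
  by (rule exI[of _ m], rule conjI, simp add: m_def, rule exI[of _ vt]) (use vt main in \<open>auto simp: K_def\<close>)
qed

text \<open>The line statement at a single density, so that the density can be lowered in
  steps.\<close>

definition good :: "nat => real => bool" where
 "good K de \<longleftrightarrow> (EX n0. \<forall>n\<ge>n0. ALL A. A \<subseteq> words K n --> de * real (K ^ n) <= real (card A) -->
   (EX ta:tmpl K 1 n. ALL t:words K 1. app K ta t \<in> A))"

text \<open>Let C consist of the t whose line has its first k points in A. Since A contains no line,
  A meets C only in words without the letter k. The complement of C splits into intersections of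
  insensitive sets, which are almost unions of M-dimensional subspaces, and there A has density at
  most rh. So A loses the share rh of C altogether.\<close>

lemma subspace_density_bound:
 fixes k M m n :: nat and de ga et :: real
 defines "K \<equiv> Suc k"
 assumes k: "k > 0" and V: "V \<in> tmpl K m n" and et: "et >= 0"
  and cover: "!!J E c h. J <= k ==> (\<forall>j<J. c j < k & insens k (c j) m (E j)) ==> (ALL w:words K m. h w <= (1::real)) ==>
   (ALL ta:tmpl K M m. (SUM t:words K M. h (app K ta t)) <= 0) ==>
   (\<Sum>w | w \<in> words K m & (\<forall>j<J. w \<in> E j). h w) <= et * real (K ^ m)"
  and noline: "!!ta. ta \<in> tmpl K 1 n ==> EX t:words K 1. app K ta t \<notin> A"
  and dens: "!!ta. ta \<in> tmpl K M n ==> card {t\<in>words K M. app K ta t \<in> A} <= rh * real (K ^ M)"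
  and rh: "rh >= 0"
 shows "card {t\<in>words K m. app K V t \<in> A} + rh * (\<Sum>t | t \<in> words K m & k \<in> set t. ln_ev k A (app K V (lin k t)))
   <= rh * real (K ^ m) + k * et * real (K ^ m) + real (k ^ m)"
proof -
 define A' where "A' = {t\<in>words K m. app K V t \<in> A}"
 define B where "B i = {t. app K V (map (rep k i) t) \<in> A}" for i
 define C where "C = {t\<in>words K m. \<forall>i<k. t \<in> B i}"
 \<comment> \<open>Sorting the complement of C by the first failing index makes each piece an
   intersection of i + 1 insensitive sets, because complements of insensitive sets are
   insensitive.\<close>
 define D where "D i = {t\<in>words K m. (\<forall>j<i. t \<in> B j) & t \<notin> B i}" for i
 define h where "h t = of_bool (app K V t \<in> A) - rh" for t
 note Vw = tmpl_words[OF V]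
 have lnC: "ln_ev k A (app K V (lin k t)) = of_bool (t \<in> C)" if t: "t \<in> words K m" for t
 proof -
  have "length (lin k t) = m" using t by (simp add: lin_def words_def)
  hence "app K (app K V (lin k t)) [i] = app K V (map (rep k i) t)" for i
   using app_app[OF Vw] app_lin[of t k m] t by (metis K_def)
  thus ?thesis using t by (simp add: ln_ev_def C_def B_def K_def)
 qed
 have insB: "insens k i m (B i)" "insens k i m (- B i)" if "i < k" for i
  by (simp_all add: insens_def B_def o_def rep_idem[OF that])
 have sumD: "(SUM t:D i. h t) <= et * real (K ^ m)" if i: "i < k" for i
 proof -
  define E where "E j = (if j = i then - B i else B j)" for j
  have "(\<Sum>w | w \<in> words K m & (\<forall>j<Suc i. w \<in> E j). h w) <= et * (K ^ m)"
  proof (rule cover[where c = id])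
   show "\<forall>j<Suc i. id j < k & insens k (id j) m (E j)" using i insB by (simp add: E_def)
   show "ALL w:words K m. h w <= 1" using rh by (simp add: h_def)
   show "ALL ta:tmpl K M m. (SUM t:words K M. h (app K ta t)) <= 0"
   proof
    fix ta assume ta: "ta \<in> tmpl K M m"
    hence "app K V (app K ta t) = app K (app K V ta) t" for t using app_app[OF Vw] by (simp add: tmpl_def words_def)
    thus "(SUM t:words K M. h (app K ta t)) <= 0" using dens[OF app_in_tmpl[OF V ta]] by (simp add: h_def sum_subtractf Int_def field_simps)
   qed
  qed (use i in auto)
  moreover have "{w. w \<in> words K m & (\<forall>j<Suc i. w \<in> E j)} = D i"
   by (auto simp: D_def E_def less_Suc_eq)
  ultimately show ?thesis by simp
 qed
 have part: "words K m - C = (\<Union>i<k. D i)"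
 proof
  show "words K m - C \<subseteq> (\<Union>i<k. D i)"
  proof
   fix t assume t: "t \<in> words K m - C"
   hence ex: "EX i. i < k & t \<notin> B i" by (simp add: C_def)
   define i where "i = (LEAST i. i < k & t \<notin> B i)"
   have i: "i < k" "t \<notin> B i" using LeastI_ex[OF ex] by (auto simp: i_def)
   have "t \<in> B j" if "j < i" for j using not_less_Least[of j "%i. i < k & t \<notin> B i"] that i(1) by (simp add: i_def)
   thus "t \<in> (\<Union>i<k. D i)" using i t by (auto simp: D_def)
  qed
 qed (auto simp: C_def D_def)
 have disj: "D i \<inter> D j = {}" if ne: "i ~= j" for i j
 proof -
  consider "i < j" | "j < i" using ne by linarith
  thus ?thesis by cases (auto simp: D_def)
 qed
 have finD: "finite (D i)" for i by (simp add: D_def)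
 let ?B = "SUM t:words K m - C. h t"
 have "?B = (\<Sum>i<k. SUM t:D i. h t)"
  unfolding part by (rule sum.UNION_disjoint) (use finD disj in auto)
 also have "... <= (\<Sum>i<k. et * (K ^ m))" using sumD by (intro sum_mono) auto
 finally have 1: "?B <= k * et * (K ^ m)" by simp
 have Cw: "C \<subseteq> words K m" by (simp add: C_def)
 have 2: "?B = card (A' - C) - rh * (real (K ^ m) - card C)"
 proof -
  have "(words K m - C) \<inter> {t. app K V t \<in> A} = A' - C" by (auto simp: A'_def)
  moreover have "card (words K m - C) = K ^ m - card C" "card C <= K ^ m"
   using card_Diff_subset[OF finite_subset[OF Cw] Cw] card_mono[OF _ Cw] by auto
  ultimately show ?thesis by (simp add: h_def sum_subtractf of_nat_diff)
 qed
 \<comment> \<open>A word of \<open>A'\<close> in C that contains the letter k would complete a line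
   in A.\<close>
 have 3: "A' \<inter> C \<subseteq> words k m"
 proof
  fix t assume t: "t \<in> A' \<inter> C"
  hence tw: "t \<in> words K m" by (simp add: A'_def)
  have "k \<notin> set t"
  proof
   assume "k \<in> set t"
   hence l: "lin k t \<in> tmpl K 1 m" using lin_tmpl tw by (simp add: K_def)
   have "ALL u:words K 1. app K (app K V (lin k t)) u \<in> A"
   proof
    fix u assume "u \<in> words K 1"
    then obtain i where i: "u = [i]" "i < Suc k" by (auto simp: words_def length_Suc_conv K_def)
    have "length (lin k t) = m" using tw by (simp add: lin_def words_def)
    hence e: "app K (app K V (lin k t)) u = app K V (map (rep k i) t)"
     using app_app[OF Vw] app_lin[of t k m] tw i by (metis K_def)
    show "app K (app K V (lin k t)) u \<in> A"
    proof (cases "i = k")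
     case True
     thus ?thesis using t e by (simp add: rep_def map_idI A'_def)
    next
     case False
     thus ?thesis using t e i by (simp add: C_def B_def)
    qed
   qed
   thus False using noline[OF app_in_tmpl[OF V l]] by simp
  qed
  thus "t \<in> words k m" using tw by (auto simp: words_def K_def less_Suc_eq)
 qed
 have 4: "card A' <= card (A' - C) + real (k ^ m)"
 proof -
  have "card (A' \<inter> C) <= card (words k m)" by (rule card_mono[OF finite_words 3])
  moreover have "card A' = card (A' - C) + card (A' \<inter> C)"
  proof -
   have "finite A'" by (simp add: A'_def)
   moreover have "A' = (A' - C) \<union> (A' \<inter> C)" by auto
   moreover have "(A' - C) \<inter> (A' \<inter> C) = {}" by auto
   ultimately show ?thesis by (metis card_Un_disjoint finite_Diff finite_Int)
  qed
  ultimately show ?thesis by simp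
 qed
 let ?A = "\<Sum>t | t \<in> words K m & k \<in> set t. ln_ev k A (app K V (lin k t))"
 let ?C = "SUM t:words K m. of_bool (t \<in> C)"
 have "?A <= ?C"
 proof -
  have "?A = (\<Sum>t | t \<in> words K m & k \<in> set t. of_bool (t \<in> C))"
   using lnC by simp
  also have "... <= ?C" by (rule sum_mono2) auto
  finally show ?thesis .
 qed
 also have "... = card C"
 proof -
  have "words K m \<inter> C = C" using Cw by auto
  thus ?thesis by simp
 qed
 finally have "rh * ?A <= rh * card C"
  using rh by (rule mult_left_mono)
 thus ?thesis using 1 2 4 by (simp add: A'_def[symmetric] algebra_simps)
qed

text \<open>If A has no line although density de + ga forces one, every M-dimensional subspace
  carries A with density at most de + ga. Averaging \<open>subspace_density_bound\<close> over
  random subspaces then contradicts \<open>line_probability\<close>, which makes the expected size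
  of C a fixed proportion of the cube. The gain \<open>ga\<close> is uniform for de above de1, which
  is what allows iteration.\<close>

lemma good_step:
 assumes D: "DHJ k 1" and k: "k > 0" and de1: "de1 > 0"
 shows "\<exists>ga>0. \<forall>de\<ge>de1. good (Suc k) (de + ga) --> good (Suc k) de"
proof -
 define K where "K = Suc k"
 have K0: "K > 0" by (simp add: K_def)
 obtain m0 :: nat and vt where m0: "m0 > 0" and vt: "vt > 0" and LP: "\<forall>lam>0. ALL S. eventually (%n. ALL A. A \<subseteq> words K n --> de1 * real (K ^ n) <= card A -->
   (ALL s:{1..S::nat}. EX c:{1..m0}. qpr k n A (real s * lam / n * c) >= vt)) sequentially"
  using line_probability[OF D k de1] unfolding K_def[symmetric] by auto
 define vt1 where "vt1 = vt / (4 * m0)"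
 have vt1: "vt1 > 0" using vt m0 by (simp add: vt1_def)
 \<comment> \<open>The comparison at the end yields \<open>de * vt1 <= 6 * ga\<close>, which the
   divisor 8 contradicts.\<close>
 define ga where "ga = de1 * vt1 / 8"
 have ga: "ga > 0" using de1 vt1 by (simp add: ga_def)
 have main: "good K de" if de: "de >= de1" "de <= 1" and g: "good K (de + ga)" for de
 proof -
  obtain M where M: "!!n A. n >= M ==> A \<subseteq> words K n ==> (de + ga) * real (K ^ n) <= real (card A) ==>
   EX ta:tmpl K 1 n. ALL t:words K 1. app K ta t \<in> A" using g unfolding good_def by meson
  have gk: "ga / k > 0" using ga k by simp
  have "eventually (%m. ALL J:{..k}. ALL E c h. (\<forall>j<J. c j < k & insens k (c j) m (E j)) --> (ALL w:words K m. h w <= 1) -->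
   (ALL ta:tmpl K M m. (SUM t:words K M. h (app K ta t)) <= 0) -->
   (\<Sum>w | w \<in> words K m & (\<forall>j<J. w \<in> E j). h w) <= ga/k * real (K ^ m)) sequentially"
   by (rule eventually_ball_finite)
    (use insens_inter_cover[OF D k gk] in \<open>auto simp: eventually_sequentially K_def\<close>)
  moreover have "eventually (%m. real k ^ m / real K ^ m < min (1/2) ga) sequentially"
  proof -
   have "((%m. (k / K) ^ m) \<longlongrightarrow> 0) sequentially" by (rule LIMSEQ_realpow_zero) (auto simp: K_def)
   thus ?thesis using ga by (intro order_tendstoD) (auto simp: power_divide)
  qed
  ultimately have "eventually (%m. (ALL J:{..k}. ALL E c h. (\<forall>j<J. c j < k & insens k (c j) m (E j)) --> (ALL w:words K m. h w <= 1) -->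
   (ALL ta:tmpl K M m. (SUM t:words K M. h (app K ta t)) <= 0) -->
   (\<Sum>w | w \<in> words K m & (\<forall>j<J. w \<in> E j). h w) <= ga/k * real (K ^ m)) & real k ^ m / real K ^ m < min (1/2) ga) sequentially"
   by (rule eventually_conj)
  from eventually_happens'[OF sequentially_bot this]
  obtain m where cov: "ALL J:{..k}. ALL E c h. (\<forall>j<J. c j < k & insens k (c j) m (E j)) --> (ALL w:words K m. h w <= 1) -->
   (ALL ta:tmpl K M m. (SUM t:words K M. h (app K ta t)) <= 0) -->
   (\<Sum>w | w \<in> words K m & (\<forall>j<J. w \<in> E j). h w) <= ga/k * real (K ^ m)"
   and km: "real k ^ m / real K ^ m < min (1/2) ga" by auto
  have cover: "(\<Sum>w | w \<in> words K m & (\<forall>j<J. w \<in> E j). h w) <= ga/k * real (K ^ m)"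
   if "J <= k" "\<forall>j<J. c j < k & insens k (c j) m (E j)" "ALL w:words K m. h w <= 1"
    "ALL ta:tmpl K M m. (SUM t:words K M. h (app K ta t)) <= 0" for J E c h
   using cov[THEN bspec[of _ _ J], THEN spec[of _ E], THEN spec[of _ c], THEN spec[of _ h]] that by simp
  have Km: "real (K ^ m) > 0" using K0 by simp
  have km1: "(k ^ m) <= 1/2 * (K ^ m)" "(k ^ m) <= ga * (K ^ m)"
   using km Km by (simp_all add: divide_simps)
  obtain lam where lam: "lam > 0" "m * exp (- lam) <= ga"
  proof -
   have "((%x. m * exp (- x)) \<longlongrightarrow> real m * 0) at_top"
    by (intro tendsto_intros filterlim_compose[OF exp_at_bot] filterlim_uminus_at_bot_at_top)
   hence "eventually (%x. m * exp (- x) < ga) at_top" using ga by (intro order_tendstoD) auto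
   hence "eventually (%x. x > 0 & m * exp (- x) < ga) at_top"
    using eventually_gt_at_top[of 0] by eventually_elim auto
   from eventually_happens'[OF trivial_limit_at_top_linorder this] show ?thesis using that by force
  qed
  define et where "et = min ga (vt/2)"
  have et: "et > 0" using ga vt by (simp add: et_def)
  have "eventually (%n. ALL A. A \<subseteq> words K n --> de * real (K ^ n) <= real (card A) -->
    (EX ta:tmpl K 1 n. ALL t:words K 1. app K ta t \<in> A)) sequentially"
   using LP[THEN spec[of _ lam], THEN mp, OF lam(1), THEN spec[of _ m]] close_lin[OF et lam(1), of m0 m k]
  proof eventually_elim
   case (elim n)
   note LPn = elim(1) and CL = elim(2)[folded K_def]
   show ?case
   proof (intro allI impI, rule ccontr)
    fix A assume A: "A \<subseteq> words K n" and cA: "de * (K ^ n) <= card A"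
     and no: "\<not> (EX ta:tmpl K 1 n. ALL t:words K 1. app K ta t \<in> A)"
    have no1: "EX t:words K 1. app K ta t \<notin> A" if "ta \<in> tmpl K 1 n" for ta using no that by simp
    have dens: "card {t\<in>words K M. app K ta t \<in> A} <= (de + ga) * real (K ^ M)" if ta: "ta \<in> tmpl K M n" for ta
    proof (rule ccontr)
     assume "\<not> ?thesis"
     then obtain l where l: "l \<in> tmpl K 1 M" "ALL t:words K 1. app K l t \<in> {t\<in>words K M. app K ta t \<in> A}"
      using M[of M "{t\<in>words K M. app K ta t \<in> A}"] by auto
     have "ALL t:words K 1. app K (app K ta l) t \<in> A" using l app_app[OF tmpl_words[OF ta]] by (simp add: tmpl_def words_def)
     thus False using no1[OF app_in_tmpl[OF ta l(1)]] by simp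
    qed
    have ex: "ALL s:{1..m}. EX c:{1..m0}. qpr k n A (s * lam / n * c) >= vt" using cA de(1) mult_right_mono[of de1 de "real (K ^ n)"] LPn A by simp
    define T where "T = {t\<in>words K m. k \<in> set t}"
    have T: "finite T" "(card T) >= 1/2 * (K ^ m)"
    proof -
     have "words K m = T \<union> words k m" by (auto simp: T_def words_def K_def less_Suc_eq)
     hence "card (words K m) <= card T + card (words k m)" by (metis card_Un_le)
     thus "(card T) >= 1/2 * (K ^ m)" using km1(1) by (simp flip: of_nat_power of_nat_add)
     show "finite T" by (simp add: T_def)
    qed
    \<comment> \<open>The multiplier c of \<open>line_probability\<close> is used at the scale s
      given by the number of k in t. Reading the same product in the other order makes c lam/n a
      rate shared by many t, so the uncontrolled multiplier can be fixed by a pigeonhole over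
      t.\<close>
    have "EX c:{1..m0}. vt <= qpr k n A (real c * lam / n * cnt t k)" if "t \<in> T" for t
    proof -
     have "cnt t k \<in> {1..m}" using that cnt_pos[of k t] cnt_le[of t k] by (simp add: T_def words_def)
     then obtain c where "c \<in> {1..m0}" "vt <= qpr k n A ((cnt t k) * lam / n * c)" using ex by blast
     moreover have "(cnt t k) * lam / n * c = c * lam / n * cnt t k" by simp
     ultimately show ?thesis by metis
    qed
    hence "EX c:{1..m0}. 1/2 * (K ^ m) / m0 <= card {t\<in>T. vt <= qpr k n A (c * lam / n * cnt t k)}"
     by (intro pigeonhole_card[OF T(1) _ _ T(2)]) (use m0 in auto)
    then obtain c where c: "c \<in> {1..m0}" "1/2 * (K ^ m) / m0 <= card {t\<in>T. vt <= qpr k n A (c * lam / n * cnt t k)}" by auto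
    define ta where "ta = c * lam / n"
    note CLc = CL[THEN bspec[OF _ c(1)], THEN spec[of _ A], folded ta_def]
    have n0: "n > 0" and mta: "m * ta <= 1" using CLc by auto
    have ta0: "ta >= 0" using lam by (simp add: ta_def)
    note nn = tw_nonneg[OF ta0 mta, of K]
    let ?E = "Exw (tw K m ta) (K + m) n"
    define a where "a V = real (card {t\<in>words K m. app K V t \<in> A})" for V
    define b where "b V = (SUM t:T. ln_ev k A (app K V (lin k t)))" for V
    have aE: "?E a >= (de - ga) * (K ^ m)"
    proof -
     have "de <= card A / (K ^ n)" using cA K0 by (simp add: field_simps)
     moreover have "et <= ga" by (simp add: et_def)
     ultimately have "de - ga <= card A / (K ^ n) - et" by simp
     moreover have "card A / real (K ^ n) - et <= ?E (%V. of_bool (app K V t \<in> A))" if "t \<in> words K m" for t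
      using CLc that A by simp
     ultimately have "(SUM t:words K m. de - ga) <= (SUM t:words K m. ?E (%V. of_bool (app K V t \<in> A)))"
      by (intro sum_mono) (meson order_trans)
     also have "... = ?E a" unfolding Exw_sum[symmetric] a_def by (intro Exw_cong) (simp add: Int_def)
     finally show ?thesis by (simp add: mult.commute)
    qed
    have bE: "?E b >= vt1 * (K ^ m)"
    proof -
     define T' where "T' = {t\<in>T. vt <= qpr k n A (ta * cnt t k)}"
     have "vt1 * (K ^ m) = 1/2 * (K ^ m) / m0 * (vt/2)" by (simp add: vt1_def)
     also have "... <= card T' * (vt/2)" using c(2) vt unfolding T'_def ta_def by (intro mult_right_mono) auto
     also have "... = (SUM t:T'. vt/2)" by simp
     also have "... <= (SUM t:T'. ?E (%V. ln_ev k A (app K V (lin k t))))"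
     proof (rule sum_mono)
      fix t assume t: "t \<in> T'"
      hence "\<bar>?E (%V. ln_ev k A (app K V (lin k t))) - qpr k n A (ta * cnt t k)\<bar> <= et"
       using CLc by (simp add: T'_def T_def)
      moreover have "et <= vt/2" by (simp add: et_def)
      moreover have "vt <= qpr k n A (ta * cnt t k)" using t by (simp add: T'_def)
      ultimately show "vt/2 <= ?E (%V. ln_ev k A (app K V (lin k t)))" by simp
     qed
     also have "... <= (SUM t:T. ?E (%V. ln_ev k A (app K V (lin k t))))"
     proof (rule sum_mono2)
      fix t
      have "?E (%V. 0) <= ?E (%V. ln_ev k A (app K V (lin k t)))" by (rule Exw_mono[OF nn]) (simp add: ln_ev_def)
      thus "0 <= ?E (%V. ln_ev k A (app K V (lin k t)))" by (simp add: Exw_def)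
     qed (auto simp: T'_def T(1))
     also have "... = ?E b" by (simp only: b_def[abs_def] Exw_sum)
     finally show ?thesis .
    qed
    have DE: "?E (%V. of_bool (V \<notin> tmpl K m n)) <= ga"
    proof -
     have "?E (%V. of_bool (V \<notin> tmpl K m n)) <= m * exp (- (n * ta))"
      by (rule Exw_degenerate) (use K0 ta0 mta in auto)
     also have "n * ta = c * lam" using n0 by (simp add: ta_def)
     also have "m * exp (- (c * lam)) <= m * exp (- lam)"
      using c(1) lam(1) by (intro mult_left_mono) auto
     also have "... <= ga" by (rule lam(2))
     finally show ?thesis .
    qed
    \<comment> \<open>Of the three \<open>ga\<close>, one comes from rh = de + ga, one from k
      covering errors ga/k, and one from the words without the letter k. A degenerate V is charged
      the trivial bound 2.\<close>
    have pw: "a V + de * b V <= (de + 3 * ga) * real (K ^ m) + 2 * real (K ^ m) * of_bool (V \<notin> tmpl K m n)"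
     if V: "V \<in> words (K + m) n" for V
    proof (cases "V \<in> tmpl K m n")
     case True
     have b0: "b V >= 0" by (auto simp: b_def ln_ev_def intro!: sum_nonneg)
     have "a V + (de + ga) * b V <= (de + ga) * (K ^ m) + k * (ga/k) * (K ^ m) + (k ^ m)"
      unfolding a_def b_def T_def K_def
      by (rule subspace_density_bound[where M = M])
       (use k True gk cover no1 dens de de1 ga in \<open>auto simp: K_def[symmetric]\<close>)
     moreover have "k * (ga/k) = ga" using k by simp
     moreover have "de * b V <= (de + ga) * b V" using b0 ga by (intro mult_right_mono) auto
     moreover have z: "of_bool (V \<notin> tmpl K m n) = (0::real)" using True by simp
     ultimately show ?thesis using km1(2) unfolding z by (simp only: distrib_right mult_zero_right)
    next
     case False
     have "a V <= (K ^ m)" unfolding a_def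
      using card_mono[of "words K m" "{t\<in>words K m. app K V t \<in> A}"] by simp
     moreover have "b V <= (K ^ m)"
     proof -
      have "b V <= (SUM t:T. 1)" unfolding b_def by (intro sum_mono) (auto simp: ln_ev_def)
      also have "... <= (card (words K m))" using card_mono[of "words K m" T] by (simp add: T_def flip: of_nat_power)
      finally show ?thesis by simp
     qed
     moreover have "0 <= b V" by (auto simp: b_def ln_ev_def intro!: sum_nonneg)
     moreover have "de * b V <= 1 * b V" using de \<open>0 <= b V\<close> by (intro mult_right_mono)
     moreover have "0 <= (de + 3 * ga) * (K ^ m)" using de de1 ga by simp
     moreover have z: "of_bool (V \<notin> tmpl K m n) = (1::real)" using False by simp
     ultimately show ?thesis unfolding z by simp
    qed
    have "(de - ga) * (K ^ m) + de * (vt1 * (K ^ m)) <= ?E a + de * ?E b"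
     using aE bE de de1 by (intro add_mono mult_left_mono) auto
    also have "... = ?E (%V. a V + de * b V)" by (simp only: Exw_add Exw_cmult)
    also have "... <= ?E (%V. (de + 3 * ga) * (K ^ m) + 2 * real (K ^ m) * of_bool (V \<notin> tmpl K m n))"
     by (rule Exw_mono[OF nn pw])
    also have "... = (de + 3 * ga) * (K ^ m) + 2 * real (K ^ m) * ?E (%V. of_bool (V \<notin> tmpl K m n))"
     by (simp only: Exw_add Exw_cmult Exw_const[OF sum_tw[OF K0]])
    also have "... <= (de + 3 * ga) * (K ^ m) + 2 * real (K ^ m) * ga"
     using DE by (intro add_left_mono mult_left_mono) auto
    finally have "(de * vt1) * (K ^ m) <= (6 * ga) * (K ^ m)" by (simp add: algebra_simps)
    hence "de * vt1 <= 6 * ga" using Km by simp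
    moreover have "8 * ga <= de * vt1" using de(1) vt1 by (simp add: ga_def)
    ultimately show False using ga by simp
   qed
  qed
  thus ?thesis by (simp add: good_def eventually_sequentially)
 qed
 have "good K de" if "de > 1" for de
  unfolding good_def
 proof (intro exI[of _ 0] allI impI)
  fix n A assume A: "A \<subseteq> words K n" "de * (K ^ n) <= card A"
  have "real (card A) <= (K ^ n)" using card_mono[OF finite_words A(1)] by simp
  moreover have "1 * real (K ^ n) < de * (K ^ n)" using that K0 by simp
  ultimately show "EX ta:tmpl K 1 n. ALL t:words K 1. app K ta t \<in> A" using A(2) by simp
 qed
 hence "\<forall>de\<ge>de1. good K (de + ga) --> good K de" using main by (meson not_le_imp_less)
 thus ?thesis using ga unfolding K_def by blast
qed

text \<open>Densities above 1 are vacuously good, and finitely many steps of the uniform size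
  \<open>ga\<close> lead down to \<open>de1\<close>.\<close>

lemma DHJ_Suc:
 assumes D: "DHJ k 1" and k: "k > 0"
 shows "DHJ (Suc k) 1"
proof -
 have "good (Suc k) de1" if de1: "de1 > 0" for de1
 proof -
  obtain ga where ga: "ga > 0" and st: "\<forall>de\<ge>de1. good (Suc k) (de + ga) --> good (Suc k) de"
   using good_step[OF D k de1] by auto
  have all: "good (Suc k) de" if "de >= de1" "de > 1 - real j * ga" for j de
   using that
  proof (induction j arbitrary: de)
   case 0
   show ?case unfolding good_def
   proof (intro exI[of _ 0] allI impI)
    fix n A assume A: "A \<subseteq> words (Suc k) n" "de * (Suc k ^ n) <= card A"
    have "card A <= Suc k ^ n" using card_mono[OF finite_words A(1)] by simp
    hence "real (card A) <= (Suc k ^ n)" by linarith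
    moreover have "1 * real (Suc k ^ n) < de * (Suc k ^ n)" using 0 by simp
    ultimately show "EX ta:tmpl (Suc k) 1 n. ALL t:words (Suc k) 1. app (Suc k) ta t \<in> A" using A(2) by linarith
   qed
  next
   case (Suc j)
   show ?case by (rule st[rule_format, OF Suc.prems(1) Suc.IH]) (use Suc.prems ga in \<open>auto simp: algebra_simps\<close>)
  qed
  obtain j :: nat where "1 < real j * ga" using reals_Archimedean3[OF ga] by blast
  hence "de1 > 1 - j * ga" using de1 by simp
  from all[OF order_refl this] show ?thesis .
 qed
 thus ?thesis unfolding DHJ_def good_def by simp
qed

theorem density_Hales_Jewett: "k > 0 ==> DHJ k 1"
proof (induction k)
 case (Suc k)
 show ?case
 proof (cases "k = 0")
  case True
  have "DHJ 1 1" unfolding DHJ_def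
  proof (intro allI impI exI[of _ 1], goal_cases)
   case (1 de n A)
   have "0 < real (card A)" using 1(1) by (intro less_le_trans[OF _ 1(4)]) simp
   hence "A ~= {}" by auto
   moreover have "A \<subseteq> {replicate n 0}" using 1(3) by (simp add: words_def replicate_eqI subset_iff)
   ultimately have A: "replicate n 0 \<in> A" by blast
   have "replicate n 1 \<in> tmpl 1 1 n" using 1(2) by (simp add: tmpl_def words_def)
   moreover have "app 1 (replicate n 1) t = replicate n 0" if "t \<in> words 1 1" for t
    using that by (auto simp: app_def sub_def words_def length_Suc_conv)
   ultimately show ?case using A by (intro bexI[of _ "replicate n 1"] ballI) auto
  qed
  thus ?thesis using True by simp
 qed (use DHJ_Suc Suc in auto)
qed simp

section \<open>From lines to progressions modulo N\<close>

abbreviation zN :: "nat => int set" where "zN N \<equiv> {0..<int N}"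

lemma bij_shift_mod: "N > 0 ==> bij_betw (%y. (y + a) mod int N) (zN N) (zN N)"
proof -
 assume N: "N > 0"
 have id: "((y + a) mod int N + - a) mod int N = y" if "y \<in> zN N" for y a
  using that by (simp add: mod_simps)
 show ?thesis
 proof (rule bij_betwI[where g = "%y. (y + - a) mod int N"])
  show "((y + a) mod int N + - a) mod int N = y" if "y \<in> zN N" for y by (rule id[OF that])
  show "((y + - a) mod int N + a) mod int N = y" if "y \<in> zN N" for y using id[OF that, of "-a"] by simp
 qed (use N in auto)
qed

lemma bij_mult_mod:
 assumes N: "N > 0" and c: "coprime e (int N)"
 shows "bij_betw (%y. (e * y) mod int N) (zN N) (zN N)"
proof -
 have inj: "inj_on (%y. (e * y) mod int N) (zN N)"
 proof (rule inj_onI)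
  fix x y assume x: "x \<in> zN N" and y: "y \<in> zN N" and e: "(e * x) mod int N = (e * y) mod int N"
  have "[e * x = e * y] (mod int N)" using e unfolding cong_def .
  hence "[x = y] (mod int N)" by (simp only: cong_mult_lcancel[OF c])
  hence "x mod int N = y mod int N" unfolding cong_def .
  moreover have "x mod int N = x" "y mod int N = y" using x y by simp_all
  ultimately show "x = y" by (simp only:)
 qed
 moreover have "(%y. (e * y) mod int N) ` zN N \<subseteq> zN N" using N by (intro image_subsetI) simp
 ultimately show ?thesis by (simp add: bij_betw_def endo_inj_surj)
qed

lemma sum_shift_mod: "N > 0 ==> (SUM y:zN N. F ((y + a) mod int N)) = (SUM y:zN N. F y)"
 by (rule sum.reindex_bij_betw[OF bij_shift_mod])

lemma sum_mult_mod: "N > 0 ==> coprime e (int N) ==> (SUM y:zN N. F ((e * y) mod int N)) = (SUM y:zN N. F y)"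
 by (rule sum.reindex_bij_betw[OF bij_mult_mod])

lemma mod_lin: "((A mod N) + i * (B mod N)) mod N = (A + i * B) mod (N::int)"
proof -
 have "((A mod N) + i * (B mod N)) mod N = ((A mod N) mod N + (i * (B mod N)) mod N) mod N"
  by (simp only: mod_add_eq)
 also have "... = (A + i * B) mod N" by (simp only: mod_mod_trivial mod_mult_right_eq mod_add_eq)
 finally show ?thesis .
qed

text \<open>Along a line only the variable positions change, all by the same amount, so digit sums
  form a progression whose difference is the number e of variable positions.\<close>

lemma sum_list_line:
 assumes "l \<in> words (Suc k) n" "k \<in> set l"
 shows "EX s e. 1 <= e & e <= n & (ALL i. sum_list (app k l [i]) = s + i * e)"
proof -
 let ?A = "filter ((<=) k) l"
 have "sum_list (app k l [i]) = sum_list (map (%s. if s < k then s else 0) l) + i * length ?A"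
  if "set l \<subseteq> {..<Suc k}" for i
  using that by (induction l) (auto simp: app_def sub_def)
 moreover have "length ?A <= n" using assms(1) length_filter_le[of "(<=) k" l] by (simp add: words_def)
 moreover have "1 <= length ?A"
 proof -
  have "k \<in> set ?A" using assms(2) by simp
  thus ?thesis by (metis One_nat_def Suc_leI length_pos_if_in_set)
 qed
 ultimately show ?thesis using assms(1) by (auto simp: words_def)
qed

text \<open>For every pair (y, d) the map sending w to y + d * sum_list w pulls S back to a cube of
  fixed dimension n, and over random y each word lands in S with the density of S. Dense pullbacks
  contain a line, that is, a progression in S. For a fixed template the resulting start and
  difference are again uniform, because e \<le> n is invertible modulo N; this is the source of Q =
  n! and makes the count a positive proportion of all progressions.\<close>

theorem Szemeredi_Varnavides:
 assumes k: "k > 0" and de: "de > (0::real)"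
 shows "\<exists>c>0. \<exists>Q>0. ALL N S. N > 0 --> coprime N Q --> S \<subseteq> zN N --> de * real N <= card S -->
  c * real N ^ 2 <= (SUM y:zN N. SUM d:zN N. of_bool (\<forall>j<k. (y + int j * d) mod int N \<in> S))"
proof -
 obtain n where n: "!!n' A. n' >= n ==> A \<subseteq> words k n' ==> de/2 * real (k ^ n') <= real (card A) ==>
   EX ta:tmpl k 1 n'. ALL t:words k 1. app k ta t \<in> A"
  using DHJE[OF density_Hales_Jewett[OF k], of "de/2"] de by auto
 define c where "c = de/2 / (Suc k ^ n)"
 have c: "c > 0" using de by (simp add: c_def)
 have "c * real N ^ 2 <= (SUM y:zN N. SUM d:zN N. of_bool (\<forall>j<k. (y + int j * d) mod int N \<in> S))"
  if N: "N > 0" and co: "coprime N (fact n)" and S: "S \<subseteq> zN N" "de * real N <= card S" for N S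
 proof -
  define X where "X = (SUM d:zN N. SUM y:zN N. of_bool (\<forall>j<k. (y + int j * d) mod int N \<in> S) :: real)"
  define f where "f y d s = (of_bool ((y + d * int s) mod int N \<in> S) :: real)" for y d s
  have S1: "(SUM y:zN N. f y d s) = card S" for d s
  proof -
   have "(SUM y:zN N. f y d s) = (SUM y:zN N. of_bool (y \<in> S))"
    unfolding f_def by (rule sum_shift_mod[OF N, of "%y. of_bool (y \<in> S)"])
   moreover have "zN N \<inter> S = S" using S by auto
   ultimately show ?thesis by simp
  qed
  define L where "L l y d = (of_bool (\<forall>i<k. (y + d * int (sum_list (app k l [i]))) mod int N \<in> S) :: real)" for l y d
  have LX: "(SUM d:zN N. SUM y:zN N. L l y d) = X" if l: "l \<in> tmpl k 1 n" for l
  proof -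
   have "l \<in> words (Suc k) n" "k \<in> set l" using l by (simp_all add: tmpl_def)
   then obtain s e where e: "1 <= e" "e <= n" "!!i. sum_list (app k l [i]) = s + i * e" using sum_list_line by blast
   have "e dvd fact n" using e by (intro dvd_fact)
   hence "coprime e N" using co by (meson coprime_commute coprime_divisors dvd_refl)
   hence ce: "coprime (int e) (int N)" by simp
   have "(SUM y:zN N. L l y d) = (SUM y:zN N. of_bool (\<forall>i<k. (y + int i * ((int e * d) mod int N)) mod int N \<in> S))" for d
   proof -
    have "(y + d * int (sum_list (app k l [i]))) mod int N = ((y + d * int s) mod int N + int i * ((int e * d) mod int N)) mod int N" for i y
     by (simp add: e(3) mod_lin) (simp add: algebra_simps)
    hence "(SUM y:zN N. L l y d) = (SUM y:zN N. of_bool (\<forall>i<k. ((y + d * int s) mod int N + int i * ((int e * d) mod int N)) mod int N \<in> S))"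
     by (simp add: L_def)
    also have "... = (SUM y:zN N. of_bool (\<forall>i<k. (y + int i * ((int e * d) mod int N)) mod int N \<in> S))"
     by (rule sum_shift_mod[OF N, of "%y. of_bool (\<forall>i<k. (y + int i * ((int e * d) mod int N)) mod int N \<in> S)"])
    finally show ?thesis .
   qed
   thus ?thesis unfolding X_def
    using sum_mult_mod[OF N ce, of "%d. SUM y:zN N. of_bool (\<forall>i<k. (y + int i * d) mod int N \<in> S) :: real"] by simp
  qed
  have kn: "real (k ^ n) > 0" using k by simp
  let ?A = "SUM l:tmpl k 1 n. X"
  have "(k ^ n) * (N * (de * N)) <= (SUM w:words k n. SUM d:zN N. real (card S))"
   using S(2) by (simp add: mult_left_mono)
  also have "... = (SUM w:words k n. SUM d:zN N. SUM y:zN N. f y d (sum_list w))" by (simp only: S1)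
  also have "... = (SUM d:zN N. SUM y:zN N. SUM w:words k n. f y d (sum_list w))" by (subst sum.swap) (intro sum.cong refl sum.swap)
  also have "... <= (SUM d:zN N. SUM y:zN N. (k ^ n) * (de/2) + (k ^ n) * (SUM l:tmpl k 1 n. L l y d))"
  proof (intro sum_mono)
   fix d y
   define B where "B = {w\<in>words k n. (y + d * int (sum_list w)) mod int N \<in> S}"
   have B: "(SUM w:words k n. f y d (sum_list w)) = card B" by (simp add: f_def B_def Int_def)
   show "(SUM w:words k n. f y d (sum_list w)) <= (k ^ n) * (de/2) + (k ^ n) * (SUM l:tmpl k 1 n. L l y d)"
   proof (cases "de/2 * real (k ^ n) <= card B")
    case True
    then obtain l where l: "l \<in> tmpl k 1 n" "ALL t:words k 1. app k l t \<in> B" using n[of n B] by (auto simp: B_def)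
    have "(y + d * int (sum_list (app k l [i]))) mod int N \<in> S" if "i < k" for i
    proof -
     have "app k l [i] \<in> B" using that l(2) by (simp add: words_def)
     thus ?thesis by (simp add: B_def)
    qed
    hence "L l y d = 1" by (simp add: L_def)
    moreover have "L l y d <= (SUM l:tmpl k 1 n. L l y d)" by (rule member_le_sum) (use l in \<open>auto simp: L_def\<close>)
    ultimately have "real (k ^ n) * 1 <= (k ^ n) * (SUM l:tmpl k 1 n. L l y d)" by (intro mult_left_mono) auto
    moreover have "real (card B) <= (k ^ n)"
     using card_mono[of "words k n" B] by (simp add: B_def flip: of_nat_power)
    moreover have "0 <= (k ^ n) * (de/2)" using de by simp
    ultimately show ?thesis unfolding B by linarith
   next
    case False
    moreover have "0 <= (k ^ n) * (SUM l:tmpl k 1 n. L l y d)" by (intro mult_nonneg_nonneg sum_nonneg) (auto simp: L_def)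
    ultimately show ?thesis using B by (simp add: mult.commute)
   qed
  qed
  also have "... = (k ^ n) * (N * (N * (de/2))) + (k ^ n) * ?A"
  proof -
   have "(SUM d:zN N. SUM y:zN N. SUM l:tmpl k 1 n. L l y d) = (SUM d:zN N. SUM l:tmpl k 1 n. SUM y:zN N. L l y d)"
    by (intro sum.cong refl sum.swap)
   also have "... = ?A" using LX by (subst sum.swap) simp
   finally show ?thesis by (simp add: sum.distrib sum_distrib_left[symmetric])
  qed
  finally have "(k ^ n) * (de/2 * real N ^ 2) <= (k ^ n) * ?A"
   by (simp add: power2_eq_square algebra_simps)
  hence "de/2 * real N ^ 2 <= ?A" using kn by simp
  also have "... = card (tmpl k 1 n) * X" by simp
  also have "... <= (Suc k ^ n) * X"
  proof (rule mult_right_mono)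
   have "card (tmpl k 1 n) <= Suc k ^ n" using card_tmpl_le[of k 1 n] by simp
   thus "real (card (tmpl k 1 n)) <= (Suc k ^ n)" by linarith
   show "0 <= X" unfolding X_def by (intro sum_nonneg) auto
  qed
  finally have "c * real N ^ 2 <= X" unfolding c_def by (simp add: field_simps)
  also have "X = (SUM y:zN N. SUM d:zN N. of_bool (\<forall>j<k. (y + int j * d) mod int N \<in> S))"
   unfolding X_def by (rule sum.swap)
  finally show ?thesis .
 qed
 thus ?thesis using c by (intro exI[of _ c] conjI exI[of _ "fact n"]) auto
qed

section \<open>Relative Szemeredi theorem\<close>

definition avg :: "'a set => ('a => real) => real" where
 "avg S F = (SUM x:S. F x) / real (card S)"

lemma avg_cong: "(!!x. x \<in> S ==> F x = G x) ==> avg S F = avg S G"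
 by (simp add: avg_def)

lemma avg_add: "avg S (%x. F x + G x) = avg S F + avg S G"
 by (simp add: avg_def sum.distrib add_divide_distrib)

lemma avg_diff: "avg S (%x. F x - G x) = avg S F - avg S G"
 by (simp add: avg_def sum_subtractf diff_divide_distrib)

lemma avg_cmult: "avg S (%x. c * F x) = c * avg S F"
 by (simp add: avg_def sum_distrib_left[symmetric])

lemma avg_cmult_right: "avg S (%x. F x * c) = avg S F * c"
 by (simp add: avg_def sum_distrib_right[symmetric])

lemma avg_sum: "avg S (%x. SUM i:I. F i x) = (SUM i:I. avg S (F i))"
 unfolding avg_def by (subst sum.swap) (simp add: sum_divide_distrib)

lemma avg_const: "finite S ==> S ~= {} ==> avg S (%_. c) = c"
 by (simp add: avg_def)

lemma avg_mono: "(!!x. x \<in> S ==> F x <= G x) ==> avg S F <= avg S G"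
 unfolding avg_def by (intro divide_right_mono sum_mono) auto

lemma avg_nonneg: "(!!x. x \<in> S ==> 0 <= F x) ==> 0 <= avg S F"
 unfolding avg_def by (intro divide_nonneg_nonneg sum_nonneg) auto

lemma avg_abs: "\<bar>avg S F\<bar> <= avg S (%x. \<bar>F x\<bar>)"
 unfolding avg_def by (simp add: divide_right_mono)

lemma avg_le_const: "finite S ==> S ~= {} ==> (!!x. x \<in> S ==> F x <= c) ==> avg S F <= c"
 using avg_mono[of S F "%_. c"] avg_const[of S c] by simp

lemma avg_abs_le_const:
 assumes "finite S" "S ~= {}" "!!x. x \<in> S ==> \<bar>F x\<bar> <= c" shows "\<bar>avg S F\<bar> <= c"
 by (rule order_trans[OF avg_abs avg_le_const]) (use assms in auto)

lemma avg_swap: "avg S (%x. avg T (F x)) = avg T (%y. avg S (%x. F x y))"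
 unfolding avg_def sum_divide_distrib[symmetric] by (subst sum.swap) auto

lemma avg_Times: "avg (S \<times> T) F = avg S (%x. avg T (%y. F (x, y)))"
 unfolding avg_def sum_divide_distrib[symmetric]
 by (simp add: sum.cartesian_product card_cartesian_product)

lemma avg_reindex: "bij_betw f S T ==> avg S (%x. F (f x)) = avg T F"
 unfolding avg_def by (simp add: sum.reindex_bij_betw bij_betw_same_card)

lemma avg_CS:
 assumes "!!x. x \<in> S ==> 0 <= w x"
 shows "(avg S (%x. w x * a x * b x))\<^sup>2 <= avg S (%x. w x * (a x)\<^sup>2) * avg S (%x. w x * (b x)\<^sup>2)"
 using weighted_CS[of S w a b, OF assms] unfolding avg_def
 by (simp add: power_divide power2_eq_square[of "real (card S)"] divide_right_mono)

lemma avg_CS_dominated: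
 assumes w: "!!x. x \<in> S ==> \<bar>f x\<bar> <= w x"
 shows "(avg S (%x. f x * r x))\<^sup>2 <= avg S w * avg S (%x. w x * (r x)\<^sup>2)"
proof -
 have w0: "0 <= w x" if "x \<in> S" for x using w[OF that] by simp
 have "\<bar>avg S (%x. f x * r x)\<bar> <= avg S (%x. \<bar>f x * r x\<bar>)" by (rule avg_abs)
 also have "... <= avg S (%x. w x * 1 * \<bar>r x\<bar>)"
  using w by (intro avg_mono) (simp add: abs_mult mult_right_mono)
 finally have "(avg S (%x. f x * r x))\<^sup>2 <= (avg S (%x. w x * 1 * \<bar>r x\<bar>))\<^sup>2"
  by (metis abs_ge_zero power2_abs power_mono)
 also have "... <= avg S (%x. w x * 1\<^sup>2) * avg S (%x. w x * \<bar>r x\<bar>\<^sup>2)"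
  by (rule avg_CS[OF w0])
 finally show ?thesis by simp
qed

lemma upd_in_PiE: "x \<in> PiE I (%_. X) ==> j \<in> I ==> a \<in> X ==> x(j := a) \<in> PiE I (%_. X)"
 by auto

lemma finite_cube: "finite I ==> finite X ==> finite (PiE I (%_. X))"
 by (simp add: finite_PiE)

lemma cube_nonempty: "X ~= {} ==> PiE I (%_. X) ~= {}"
 by (simp add: PiE_eq_empty_iff)

text \<open>Exchanging the coordinate j with an independent fresh value is a bijection of the
  product space.\<close>

lemma avg_resample:
 assumes X: "finite X" "X ~= {}" and j: "j \<in> I"
 shows "avg (PiE I (%_. X)) (%x. avg X (%a. G (x(j := a)))) = avg (PiE I (%_. X)) G"
proof -
 let ?O = "PiE I (%_. X)"
 have "bij_betw (%(x, a). (x(j := a), x j)) (?O \<times> X) (?O \<times> X)"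
  by (rule bij_betwI[where g = "%(x, a). (x(j := a), x j)"])
   (use j in \<open>auto simp: PiE_iff extensional_def fun_eq_iff split: if_splits\<close>)
 from avg_reindex[OF this, of "%(x, a). G x"]
 have "avg (?O \<times> X) (%(x, a). G (x(j := a))) = avg (?O \<times> X) (%(x, a). G x)"
  by (simp add: case_prod_unfold)
 thus ?thesis using X by (simp add: avg_Times avg_const)
qed

section \<open>The weighted Gowers-Cauchy-Schwarz inequality\<close>

definition mix :: "'i set => ('i => 'a) => ('i => 'a) => 'i => 'a" where
 "mix om x y = (%i. if i \<in> om then y i else x i)"

lemma mix_empty [simp]: "mix {} x y = x"
 by (simp add: mix_def)

lemma mix_in: "x \<in> PiE I (%_. X) ==> y \<in> PiE I (%_. X) ==> om \<subseteq> I ==> mix om x y \<in> PiE I (%_. X)"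
 by (auto simp: mix_def)

lemma mix_upd1: "j \<notin> om ==> mix om (x(j := a)) y = (mix om x y)(j := a)"
 by (auto simp: mix_def)

lemma mix_upd2: "j \<notin> om ==> mix om x (y(j := a)) = mix om x y"
 by (auto simp: mix_def)

lemma mix_insert: "j \<notin> om ==> mix (insert j om) x y = mix om (x(j := y j)) y"
 by (auto simp: mix_def)

lemma prod_Pow_insert:
 assumes "finite D" "j \<notin> D"
 shows "(PROD om:Pow (insert j D). f om) = (PROD om:Pow D. f om) * (PROD om:Pow D. f (insert j om))"
proof -
 have "inj_on (insert j) (Pow D)" using assms(2) by (auto simp: inj_on_def)
 moreover have "Pow D \<inter> insert j ` Pow D = {}" using assms(2) by auto
 ultimately show ?thesis
  using assms(1) unfolding Pow_insert by (subst prod.union_disjoint) (auto simp: prod.reindex)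
qed

text \<open>The expectation obtained after the coordinates in \<open>D\<close> have been doubled by
 Cauchy-Schwarz: each \<open>F j\<close> with \<open>j \<in> D\<close> has been replaced by its majorant \<open>V j\<close>.\<close>

definition gcs_term ::
 "'i set => ('i => ('i => 'a) => real) => ('i => ('i => 'a) => real) => (('i => 'a) => real) => 'i set => ('i => 'a) => ('i => 'a) => real"
where
 "gcs_term J V F h D x y = (PROD om:Pow D. h (mix om x y) * (PROD j:J - D. F j (mix om x y)))
   * (PROD j:D. PROD om:Pow (D - {j}). V j (mix om x y))"

definition indep :: "'i set => 'a set => 'i => (('i => 'a) => real) => bool" where
 "indep I X j F \<longleftrightarrow> (ALL x:PiE I (%_. X). ALL a:X. F (x(j := a)) = F x)"

lemma indepD: "indep I X j F ==> x \<in> PiE I (%_. X) ==> a \<in> X ==> F (x(j := a)) = F x"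
 by (simp add: indep_def)

text \<open>Since \<open>F p j\<close> ignores coordinate j, the remaining factors may first be
  averaged over that coordinate. Cauchy-Schwarz with weight \<open>V p j\<close> then eliminates
  \<open>F p j\<close>, and the squared average over coordinate j opens into two independent copies,
  x j and y j.\<close>

lemma gcs_step:
 fixes I :: "'i set" and X :: "'a set" and P :: "'p set"
 assumes X: "finite X" "X ~= {}" and fin: "finite J" and JI: "J \<subseteq> I" and D: "D \<subseteq> J" "j \<in> J" "j \<notin> D"
  and F: "!!p. p \<in> P ==> indep I X j (F p j)" and V: "!!p. p \<in> P ==> indep I X j (V p j)"
  and FV: "!!p x. p \<in> P ==> x \<in> PiE I (%_. X) ==> \<bar>F p j x\<bar> <= V p j x"
 defines "Om \<equiv> PiE I (%_. X)"
 shows "(avg P (%p. avg Om (%x. avg Om (gcs_term J (V p) (F p) (h p) D x))))\<^sup>2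
  <= avg P (%p. avg Om (%x. avg Om (%y. PROD om:Pow D. V p j (mix om x y))))
   * avg P (%p. avg Om (%x. avg Om (gcs_term J (V p) (F p) (h p) (insert j D) x)))"
proof -
 have jI: "j \<in> I" and fD: "finite D" using D JI fin finite_subset by auto
 define Ph where "Ph p x y = (PROD om:Pow D. F p j (mix om x y))" for p x y
 define A where "A p x y = (PROD om:Pow D. V p j (mix om x y))" for p x y
 define R where "R p x y = (PROD om:Pow D. h p (mix om x y) * (PROD i:J - insert j D. F p i (mix om x y)))
   * (PROD i:D. PROD om:Pow (D - {i}). V p i (mix om x y))" for p x y
 define Rb where "Rb p x y = avg X (%a. R p (x(j := a)) y)" for p x y
 have gD: "gcs_term J (V p) (F p) (h p) D x y = Ph p x y * R p x y" for p x y
 proof -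
  have JD: "J - D = insert j (J - insert j D)" using D by auto
  have "(PROD i:J - D. F p i z) = F p j z * (PROD i:J - insert j D. F p i z)" for z
   unfolding JD using fin by simp
  thus ?thesis unfolding gcs_term_def Ph_def R_def
   by (simp add: prod.distrib)
 qed
 have mx: "mix om x y \<in> Om" if "x \<in> Om" "y \<in> Om" "om \<in> Pow D" for om x y
  using that mix_in[of x I X y om] D JI by (simp add: Om_def)
 have up: "x(j := a) \<in> Om" if "x \<in> Om" "a \<in> X" for x a
  unfolding Om_def by (rule upd_in_PiE) (use that jI in \<open>auto simp: Om_def\<close>)
 have nj: "j \<notin> om" if "om \<in> Pow D" for om using that D by auto
 have Aj: "A p (x(j := a)) y = A p x y" if "p \<in> P" "x \<in> Om" "y \<in> Om" "a \<in> X" for p x y a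
  unfolding A_def
 proof (rule prod.cong)
  fix om assume w: "om \<in> Pow D"
  show "V p j (mix om (x(j := a)) y) = V p j (mix om x y)"
   using indepD[OF V[OF that(1)] mx[OF that(2,3) w, unfolded Om_def] that(4)] by (simp add: mix_upd1[OF nj[OF w]])
 qed simp
 have Phj: "Ph p (x(j := a)) y = Ph p x y" if "p \<in> P" "x \<in> Om" "y \<in> Om" "a \<in> X" for p x y a
  unfolding Ph_def
 proof (rule prod.cong)
  fix om assume w: "om \<in> Pow D"
  show "F p j (mix om (x(j := a)) y) = F p j (mix om x y)"
   using indepD[OF F[OF that(1)] mx[OF that(2,3) w, unfolded Om_def] that(4)] by (simp add: mix_upd1[OF nj[OF w]])
 qed simp
 have Ay: "A p x (y(j := a)) = A p x y" for p x y a
  unfolding A_def by (intro prod.cong refl) (simp add: mix_upd2 nj)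
 have Ry: "R p x (y(j := a)) = R p x y" for p x y a
  unfolding R_def by (intro arg_cong2[of _ _ _ _ "(*)"] prod.cong refl) (auto simp: mix_upd2 nj subset_iff)
 have PhA: "\<bar>Ph p x y\<bar> <= A p x y" if "p \<in> P" "x \<in> Om" "y \<in> Om" for p x y
  unfolding Ph_def A_def abs_prod using that mx FV by (intro prod_mono) (auto simp: Om_def)
 define T where "T = P \<times> Om \<times> Om"
 have avgT: "avg T (%(p, x, y). G p x y) = avg P (%p. avg Om (%x. avg Om (G p x)))" for G
  by (simp add: T_def avg_Times)
 have avgT': "avg T (%(p, x, y). G p x y) = avg P (%p. avg Om (%y. avg Om (%x. G p x y)))" for G
  unfolding avgT by (intro avg_cong avg_swap)
 have res: "avg Om (%x. avg X (%a. G (x(j := a)))) = avg Om G" for G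
  unfolding Om_def by (rule avg_resample[OF X jI])
 let ?A = "%(p, x, y). Ph p x y * Rb p x y"
 have "avg P (%p. avg Om (%x. avg Om (gcs_term J (V p) (F p) (h p) D x))) = avg T (%(p, x, y). Ph p x y * R p x y)"
  unfolding avgT by (intro avg_cong) (simp add: gD)
 also have "... = avg T ?A"
  unfolding avgT'
 proof (rule avg_cong, rule avg_cong)
  fix p y assume py: "p \<in> P" "y \<in> Om"
  have "avg Om (%x. Ph p x y * R p x y) = avg Om (%x. avg X (%a. Ph p (x(j := a)) y * R p (x(j := a)) y))"
   by (rule res[symmetric])
  also have "... = avg Om (%x. Ph p x y * Rb p x y)"
   unfolding Rb_def avg_cmult[symmetric] using py by (intro avg_cong) (simp add: Phj)
  finally show "avg Om (%x. Ph p x y * R p x y) = avg Om (%x. Ph p x y * Rb p x y)" .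
 qed
 finally have 1: "avg P (%p. avg Om (%x. avg Om (gcs_term J (V p) (F p) (h p) D x))) = avg T ?A" .
 let ?C = "%(p, x, y). A p x y * (Rb p x y)\<^sup>2"
 have "(avg T ?A)\<^sup>2 <= avg T (%(p, x, y). A p x y) * avg T ?C"
  using avg_CS_dominated[of T "%(p, x, y). Ph p x y" "%(p, x, y). A p x y" "%(p, x, y). Rb p x y"] PhA
  by (auto simp: T_def case_prod_unfold)
 also have "avg T ?C = avg T (%(p, x, y). A p x y * R p x y * Rb p x y)"
  unfolding avgT'
 proof (rule avg_cong, rule avg_cong)
  fix p y assume py: "p \<in> P" "y \<in> Om"
  let ?D = "%x. A p x y * R p x y * Rb p x y"
  let ?E = "%x. A p x y * (Rb p x y)\<^sup>2"
  have "avg Om ?D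
    = avg Om (%x. avg X (%a. A p (x(j := a)) y * R p (x(j := a)) y * Rb p (x(j := a)) y))"
   by (rule res[symmetric])
  also have "... = avg Om (%x. avg X (%a. (A p x y * Rb p x y) * R p (x(j := a)) y))"
   using py by (intro avg_cong) (simp add: Aj, simp add: Rb_def)
  also have "... = avg Om ?E"
   unfolding avg_cmult by (simp add: Rb_def power2_eq_square mult.assoc)
  finally show "avg Om ?E = avg Om ?D" ..
 qed
 \<comment> \<open>No factor depends on y j up to this point, because j lies outside D; the bound
   averaging variable can therefore be stored there.\<close>
 also have "... = avg T (%(p, x, y). A p x y * R p x y * R p (x(j := y j)) y)"
  unfolding avgT
 proof (rule avg_cong, rule avg_cong)
  fix p x assume "p \<in> P" "x \<in> Om"
  let ?B = "%y. A p x y * R p x y * R p (x(j := y j)) y"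
  let ?F = "%y. A p x y * R p x y * Rb p x y"
  have "avg Om ?B
   = avg Om (%y. avg X (%a. A p x (y(j := a)) * R p x (y(j := a)) * R p (x(j := (y(j := a)) j)) (y(j := a))))"
   by (rule res[symmetric])
  also have "... = avg Om ?F"
   unfolding Rb_def avg_cmult[symmetric] by (simp add: Ay Ry)
  finally show "avg Om ?F = avg Om ?B" ..
 qed
 also have "... = avg P (%p. avg Om (%x. avg Om (gcs_term J (V p) (F p) (h p) (insert j D) x)))"
  unfolding avgT
 proof (intro avg_cong)
  fix p and x y :: "'i => 'a"
  have e1: "(PROD om:Pow E. g (mix (insert j om) x y)) = (PROD om:Pow E. g (mix om (x(j := y j)) y))"
   if "E \<subseteq> D" for E and g :: "_ => real"
  proof (rule prod.cong)
   fix om assume "om \<in> Pow E"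
   hence "j \<notin> om" using that D(3) by blast
   thus "g (mix (insert j om) x y) = g (mix om (x(j := y j)) y)" by (simp add: mix_insert)
  qed simp
  have ins: "insert j D - {i} = insert j (D - {i})" if "i \<in> D" for i using that D(3) by auto
  have "(PROD om:Pow (insert j D - {i}). V p i (mix om x y))
    = (PROD om:Pow (D - {i}). V p i (mix om x y)) * (PROD om:Pow (D - {i}). V p i (mix om (x(j := y j)) y))"
   if "i \<in> D" for i
  proof -
   have "(PROD om:Pow (insert j D - {i}). V p i (mix om x y))
    = (PROD om:Pow (D - {i}). V p i (mix om x y)) * (PROD om:Pow (D - {i}). V p i (mix (insert j om) x y))"
    unfolding ins[OF that] by (rule prod_Pow_insert) (use fD D(3) in auto)
   thus ?thesis using e1[of "D - {i}" "V p i"] by auto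
  qed
  moreover have "insert j D - {j} = D" using D(3) by auto
  ultimately have "(PROD i:insert j D. PROD om:Pow (insert j D - {i}). V p i (mix om x y))
   = A p x y * ((PROD i:D. PROD om:Pow (D - {i}). V p i (mix om x y)) * (PROD i:D. PROD om:Pow (D - {i}). V p i (mix om (x(j := y j)) y)))"
   using fD D(3) by (simp add: A_def prod.distrib[symmetric])
  moreover have "(PROD om:Pow (insert j D). h p (mix om x y) * (PROD i:J - insert j D. F p i (mix om x y)))
    = (PROD om:Pow D. h p (mix om x y) * (PROD i:J - insert j D. F p i (mix om x y)))
    * (PROD om:Pow D. h p (mix om (x(j := y j)) y) * (PROD i:J - insert j D. F p i (mix om (x(j := y j)) y)))"
   by (subst prod_Pow_insert[OF fD D(3)]) (simp only: e1[OF order_refl, of "%z. h p z * (PROD i:J - insert j D. F p i z)"])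
  ultimately show "A p x y * R p x y * R p (x(j := y j)) y = gcs_term J (V p) (F p) (h p) (insert j D) x y"
   unfolding gcs_term_def R_def by simp
 qed
 finally show ?thesis unfolding 1 avgT A_def[symmetric] .
qed

text \<open>Iterates \<open>gcs_step\<close> over J. The constant 2 reproduces itself, since 2 times
  2 ep^(2^(d+1)) is the square of 2 ep^(2^d), so the last bound descends to 2 ep. The parameter p
  leaves room for a further variable that is averaged but never doubled.\<close>

lemma gowers_cauchy_schwarz:
 fixes I :: "'i set" and X :: "'a set" and P :: "'p set"
 assumes X: "finite X" "X ~= {}" and fin: "finite I" and JI: "J \<subseteq> I"
  and F: "!!p j. p \<in> P ==> j \<in> J ==> indep I X j (F p j)" and V: "!!p j. p \<in> P ==> j \<in> J ==> indep I X j (V p j)"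
  and FV: "!!p j x. p \<in> P ==> j \<in> J ==> x \<in> PiE I (%_. X) ==> \<bar>F p j x\<bar> <= V p j x"
  and ep: "ep >= 0"
 defines "Om \<equiv> PiE I (%_. X)"
 assumes A: "!!D j. D \<subseteq> J ==> j \<in> J ==> j \<notin> D ==> avg P (%p. avg Om (%x. avg Om (%y. PROD om:Pow D. V p j (mix om x y)))) <= 2"
  and last: "\<bar>avg P (%p. avg Om (%x. avg Om (%y. (PROD om:Pow J. h p (mix om x y)) * (PROD j:J. PROD om:Pow (J - {j}). V p j (mix om x y)))))\<bar> <= 2 * ep ^ (2 ^ card J)"
 shows "\<bar>avg P (%p. avg Om (%x. h p x * (PROD j:J. F p j x)))\<bar> <= 2 * ep"
proof -
 define Q where "Q D = avg P (%p. avg Om (%x. avg Om (gcs_term J (V p) (F p) (h p) D x)))" for D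
 have fJ: "finite J" using fin JI finite_subset by blast
 have "\<bar>Q D\<bar> <= 2 * ep ^ (2 ^ card D)" if "D \<subseteq> J" for D
  using that
 proof (induction "card (J - D)" arbitrary: D)
  case 0
  hence "D = J" using fJ by auto
  thus ?case using last by (simp add: Q_def gcs_term_def[abs_def])
 next
  case (Suc n)
  hence "J - D ~= {}" by auto
  then obtain j where j: "j \<in> J" "j \<notin> D" by auto
  have fD: "finite D" using Suc.prems fJ finite_subset by blast
  have "J - D = insert j (J - insert j D)" using j by blast
  moreover have "card (insert j (J - insert j D)) = Suc (card (J - insert j D))" using fJ by simp
  ultimately have "card (J - D) = Suc (card (J - insert j D))" by argo
  hence IH: "\<bar>Q (insert j D)\<bar> <= 2 * ep ^ (2 ^ card (insert j D))"
   using Suc.hyps(2) Suc.prems j by (intro Suc.hyps(1)) auto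
  define Ad where "Ad = avg P (%p. avg Om (%x. avg Om (%y. PROD om:Pow D. V p j (mix om x y))))"
  have Ad0: "Ad >= 0" unfolding Ad_def
  proof (intro avg_nonneg prod_nonneg)
   fix p x y om assume p: "p \<in> P" and x: "x \<in> Om" "y \<in> Om" and w: "om \<in> Pow D"
   hence "mix om x y \<in> Om" using mix_in[of x I X y om] Suc.prems JI by (simp add: Om_def)
   thus "0 <= V p j (mix om x y)" using FV[OF p j(1)] by (force simp: Om_def)
  qed
  have "(Q D)\<^sup>2 <= Ad * Q (insert j D)"
   unfolding Q_def Ad_def Om_def by (rule gcs_step) (use X fJ JI Suc.prems j F V FV in auto)
  also have "... <= Ad * \<bar>Q (insert j D)\<bar>" using Ad0 by (intro mult_left_mono) auto
  also have "... <= 2 * (2 * ep ^ (2 ^ card (insert j D)))"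
   using A[OF Suc.prems j] IH by (intro mult_mono) (auto simp: Ad_def)
  also have "... = (2 * ep ^ (2 ^ card D))\<^sup>2"
   using j fD by (simp add: power_even_eq)
  finally have "(Q D)\<^sup>2 <= (2 * ep ^ (2 ^ card D))\<^sup>2" .
  moreover have "0 <= 2 * ep ^ (2 ^ card D)" using ep by simp
  ultimately show ?case by (simp only: power2_le_iff_abs_le)
 qed
 from this[of "{}"] have "\<bar>Q {}\<bar> <= 2 * ep" by simp
 moreover have "Q {} = avg P (%p. avg Om (%x. h p x * (PROD j:J. F p j x)))"
  unfolding Q_def gcs_term_def[abs_def] Om_def
  by (simp add: avg_const[OF finite_cube[OF fin X(1)] cube_nonempty[OF X(2)]])
 ultimately show ?thesis by simp
qed

section \<open>The linear forms condition for weighted hypergraphs\<close>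

abbreviation cube :: "nat => 'a set => (nat => 'a) set" where
 "cube k X \<equiv> PiE {..<k} (%_. X)"

text \<open>The predicate e selects an arbitrary subset of the factors, so every pattern of
  exponents 0 and 1 is covered with the same error.\<close>

definition lfc :: "'a set => nat => (nat => (nat => 'a) => real) => real => bool" where
 "lfc X k nu et \<longleftrightarrow> (ALL e. \<bar>avg (cube k X) (%x. avg (cube k X) (%y.
   \<Prod>j<k. PROD om:Pow ({..<k} - {j}). if e j om then nu j (mix om x y) else 1)) - 1\<bar> <= et)"

lemma lfc_Z:
 assumes "lfc X k nu et" "Z \<subseteq> Sigma {..<k} (%j. Pow ({..<k} - {j}))"
 shows "\<bar>avg (cube k X) (%x. avg (cube k X) (%y. PROD p:Z. nu (fst p) (mix (snd p) x y))) - 1\<bar> <= et"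
proof -
 let ?S = "Sigma {..<k} (%j. Pow ({..<k} - {j}))"
 have fin: "finite ?S" by auto
 have "(PROD p:Z. nu (fst p) (mix (snd p) x y)) = (\<Prod>j<k. PROD om:Pow ({..<k} - {j}). if (j, om) \<in> Z then nu j (mix om x y) else 1)" for x y
 proof -
  have "(PROD p:Z. nu (fst p) (mix (snd p) x y)) = (PROD p:?S \<inter> Z. nu (fst p) (mix (snd p) x y))"
   using assms(2) by (simp add: Int_absorb1)
  also have "... = (PROD p:?S. if p \<in> Z then nu (fst p) (mix (snd p) x y) else 1)"
   by (rule prod.inter_restrict[OF fin])
  also have "... = (\<Prod>j<k. PROD om:Pow ({..<k} - {j}). if (j, om) \<in> Z then nu j (mix om x y) else 1)"
   by (subst prod.Sigma) (auto simp: case_prod_unfold)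
  finally show ?thesis .
 qed
 thus ?thesis using assms(1) unfolding lfc_def by simp
qed

lemma avg_resample_product:
 assumes X: "finite X" "X ~= {}" and j: "j \<in> I" and ph: "indep I X j ph"
 shows "avg (PiE I (%_. X)) (%x. ph x * avg X (%a. P (x(j := a)))) = avg (PiE I (%_. X)) (%x. ph x * P x)"
proof -
 have "avg (PiE I (%_. X)) (%x. ph x * avg X (%a. P (x(j := a)))) = avg (PiE I (%_. X)) (%x. avg X (%a. ph (x(j := a)) * P (x(j := a))))"
  unfolding avg_cmult[symmetric] by (rule avg_cong, rule avg_cong) (simp add: indepD[OF ph])
 thus ?thesis by (simp only: avg_resample[OF X j, of "%x. ph x * P x"])
qed

lemma indep_avg: "indep I X j (%x. avg X (%a. P (x(j := a))))"
 by (simp add: indep_def)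

lemma indep_mult: "indep I X j F ==> indep I X j G ==> indep I X j (%x. F x * G x)"
 by (simp add: indep_def)

lemma avg_resample_product2:
 assumes X: "finite X" "X ~= {}" and j: "j \<in> I" and ph: "indep I X j ph"
 shows "avg (PiE I (%_. X)) (%x. ph x * avg X (%a. P (x(j := a))) * avg X (%a. Q (x(j := a))))
   = avg (PiE I (%_. X)) (%x. avg X (%b. ph x * (P x * Q (x(j := b)))))"
proof -
 let ?A = "PiE I (%_. X)"
 have "avg ?A (%x. ph x * avg X (%a. P (x(j := a))) * avg X (%a. Q (x(j := a))))
   = avg ?A (%x. (ph x * avg X (%a. Q (x(j := a)))) * avg X (%a. P (x(j := a))))"
  by (simp add: mult_ac)
 also have "... = avg ?A (%x. (ph x * avg X (%a. Q (x(j := a)))) * P x)"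
  by (rule avg_resample_product[OF X j]) (intro indep_mult ph indep_avg)
 also have "... = avg ?A (%x. avg X (%b. ph x * (P x * Q (x(j := b)))))"
  unfolding avg_cmult by (simp add: mult_ac)
 finally show ?thesis .
qed

text \<open>As G ignores y j, the parameter b can take its place. This turns an average with a
  parameter into one over two cubes, the only kind the linear forms condition speaks of.\<close>

lemma avg_param_coord:
 assumes X: "finite X" "X ~= {}" and j: "j \<in> I"
  and G: "!!b x y a. x \<in> PiE I (%_. X) ==> G b x (y(j := a)) = G b x y"
 shows "avg X (%b. avg (PiE I (%_. X)) (%x. avg (PiE I (%_. X)) (G b x)))
   = avg (PiE I (%_. X)) (%x. avg (PiE I (%_. X)) (%y. G (y j) x y))"
proof -
 let ?O = "PiE I (%_. X)"
 have "avg X (%b. avg ?O (%x. avg ?O (G b x))) = avg ?O (%x. avg ?O (%y. avg X (%b. G b x y)))" by (subst avg_swap) (intro avg_cong avg_swap)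
 also have "... = avg ?O (%x. avg ?O (%y. G (y j) x y))"
 proof (rule avg_cong)
  fix x assume x: "x \<in> ?O"
  have "avg ?O (%y. avg X (%b. G b x y)) = avg ?O (%y. avg X (%b. G ((y(j := b)) j) x (y(j := b))))"
   by (simp add: G[OF x])
  also have "... = avg ?O (%y. G (y j) x y)" by (rule avg_resample[OF X j, of "%y. G (y j) x y"])
  finally show "avg ?O (%y. avg X (%b. G b x y)) = avg ?O (%y. G (y j) x y)" .
 qed
 finally show ?thesis .
qed

lemma mix_upd_self: "j \<notin> om ==> (mix om x y)(j := y j) = mix (insert j om) x y"
 by (auto simp: mix_def)

lemma alternating_Pow_sum: "finite A ==> A ~= {} ==> (SUM S:Pow A. (-1) ^ card (A - S)) = (0::real)"
 using prod_add[of A "%_. 1" "%_. -1::real"] by (simp add: power_0_left)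

lemma prod_single_Times: "(PROD p:{j} \<times> E. g p) = (PROD w:E. g (j, w))"
proof -
 have "{j} \<times> E = Pair j ` E" by auto
 thus ?thesis by (simp add: prod.reindex inj_on_def)
qed

text \<open>The two products differ in coordinate j0, as happens when a conditional average over
  that coordinate is squared. Gowers-Cauchy-Schwarz in the other coordinates trades all F and F' for
  their majorants and leaves a product of nu - 1 over all mixes. Its alternating expansion has
  2^(2^(k-1)) terms; each average is 1 up to et, and the signs add up to 0. The sets U and U' say
  which factors are bounded by nu and which by 1.\<close>

lemma nu_minus_one_small:
 fixes X :: "'a set" and nu F F' :: "nat => (nat => 'a) => real"
 assumes X: "finite X" "X ~= {}" and j0: "j0 < k"
  and nu: "!!j. j < k ==> indep {..<k} X j (nu j)" "!!j x. j < k ==> x \<in> cube k X ==> 0 <= nu j x"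
  and lf: "lfc X k nu et" and et: "et <= 1" and ep: "ep >= 0" "2 ^ (2 ^ (k - 1)) * et <= 2 * ep ^ (2 ^ (k - 1))"
 defines "J \<equiv> {..<k} - {j0}"
 assumes F: "!!j. j \<in> J ==> indep {..<k} X j (F j)" "!!j x. j \<in> J ==> x \<in> cube k X ==> \<bar>F j x\<bar> <= (if j \<in> U then nu j x else 1)"
  and F': "!!j. j \<in> J ==> indep {..<k} X j (F' j)" "!!j x. j \<in> J ==> x \<in> cube k X ==> \<bar>F' j x\<bar> <= (if j \<in> U' then nu j x else 1)"
 shows "\<bar>avg (cube k X) (%x. avg X (%b. (nu j0 x - 1) * ((PROD j:J. F j x) * (PROD j:J. F' j (x(j0 := b))))))\<bar> <= 2 * ep"
proof -
 let ?I = "{..<k}"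
 define Om where "Om = cube k X"
 have JI: "J \<subseteq> ?I" "finite J" "j0 \<notin> J" by (auto simp: J_def)
 have cJ: "card J = k - 1" using j0 by (simp add: J_def)
 define G where "G b j x = F j x * F' j (x(j0 := b))" for b j x
 define u where "u j x = (if j \<in> U then nu j x else 1)" for j x
 define u' where "u' j x = (if j \<in> U' then nu j x else 1)" for j x
 define V where "V b j x = u j x * u' j (x(j0 := b))" for b j x
 have up: "x(j := a) \<in> Om" if "x \<in> Om" "a \<in> X" "j < k" for x a j
  unfolding Om_def by (rule upd_in_PiE) (use that in \<open>auto simp: Om_def\<close>)
 have ind: "indep ?I X j (%x. f j x * f' j (x(j0 := b)))" if "j \<in> J" "b \<in> X" "indep ?I X j (f j)" "indep ?I X j (f' j)" for f f' j b
  unfolding indep_def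
 proof (intro ballI)
  fix x a assume x: "x \<in> cube k X" and a: "a \<in> X"
  have "x(j := a, j0 := b) = x(j0 := b, j := a)" using that(1) by (auto simp: J_def)
  thus "f j (x(j := a)) * f' j (x(j := a, j0 := b)) = f j x * f' j (x(j0 := b))"
   using indepD[OF that(3) x a] indepD[OF that(4) up[unfolded Om_def, OF x that(2) j0] a] by simp
 qed
 have iu: "indep ?I X j (u j)" "indep ?I X j (u' j)" if "j \<in> J" for j
  using nu(1)[of j] that JI by (auto simp: u_def u'_def indep_def)
 have eqV: "(PROD om:Pow D. V (y j0) j (mix om x y)) = (PROD om:Pow D. u j (mix om x y)) * (PROD om:Pow D. u' j (mix (insert j0 om) x y))"
  if "D \<subseteq> J" for D j x y
 proof -
  have "V (y j0) j (mix om x y) = u j (mix om x y) * u' j (mix (insert j0 om) x y)" if w: "om \<in> Pow D" for om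
  proof -
   have "j0 \<notin> om" using w \<open>D \<subseteq> J\<close> JI by auto
   thus ?thesis by (simp add: V_def mix_upd_self)
  qed
  thus ?thesis by (simp add: prod.distrib)
 qed
 have noy: "(PROD om:Pow D. f om (mix om x (y(j0 := a)))) = (PROD om:Pow D. f om (mix om x y))" if "D \<subseteq> J"
  for D x y a and f :: "nat set => (nat => 'a) => real"
 proof (rule prod.cong)
  fix om assume "om \<in> Pow D"
  hence "j0 \<notin> om" using that JI(3) by blast
  thus "f om (mix om x (y(j0 := a))) = f om (mix om x y)" by (simp add: mix_upd2)
 qed simp
 have J': "J \<inter> - {j} = J - {j}" for j by auto
 have "\<bar>avg X (%b. avg Om (%x. (nu j0 x - 1) * (PROD j:J. G b j x)))\<bar> <= 2 * ep"
  unfolding Om_def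
 proof (rule gowers_cauchy_schwarz[where V = V])
  show "indep ?I X j (G p j)" if "p \<in> X" "j \<in> J" for p j
   unfolding G_def by (rule ind) (use that F(1) F'(1) in auto)
  show "indep ?I X j (V p j)" if "p \<in> X" "j \<in> J" for p j
   unfolding V_def by (rule ind) (use that iu in auto)
  show "\<bar>G p j x\<bar> <= V p j x" if "p \<in> X" "j \<in> J" "x \<in> cube k X" for p j x
   unfolding G_def V_def abs_mult u_def u'_def
   using F(2)[OF that(2,3)] F'(2)[OF that(2) up[unfolded Om_def, OF that(3,1) j0]] by (intro mult_mono) auto
  show "avg X (%p. avg (cube k X) (%x. avg (cube k X) (%y. PROD om:Pow D. V p j (mix om x y)))) <= 2"
   if D: "D \<subseteq> J" "j \<in> J" "j \<notin> D" for D j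
  proof -
   define Z where "Z = (if j \<in> U then {j} \<times> Pow D else {}) \<union> (if j \<in> U' then {j} \<times> insert j0 ` Pow D else {})"
   have injD: "inj_on (insert j0) (Pow D)" using D JI by (auto simp: inj_on_def)
   have fD: "finite D" using D JI finite_subset by auto
   have prZ: "(PROD om:Pow D. u j (mix om x y)) * (PROD om:Pow D. u' j (mix (insert j0 om) x y)) = (PROD p:Z. nu (fst p) (mix (snd p) x y))" for x y
   proof -
    have "Pow D \<inter> insert j0 ` Pow D = {}" using D JI by auto
    hence "(PROD p:Z. nu (fst p) (mix (snd p) x y)) = (PROD p:(if j \<in> U then {j} \<times> Pow D else {}). nu (fst p) (mix (snd p) x y))
      * (PROD p:(if j \<in> U' then {j} \<times> insert j0 ` Pow D else {}). nu (fst p) (mix (snd p) x y))"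
     unfolding Z_def using fD by (intro prod.union_disjoint) auto
    also have "(PROD p:(if j \<in> U then {j} \<times> Pow D else {}). nu (fst p) (mix (snd p) x y)) = (PROD om:Pow D. u j (mix om x y))"
     by (simp add: u_def prod_single_Times)
    also have "(PROD p:(if j \<in> U' then {j} \<times> insert j0 ` Pow D else {}). nu (fst p) (mix (snd p) x y)) = (PROD om:Pow D. u' j (mix (insert j0 om) x y))"
     using injD by (simp add: u'_def prod.reindex prod_single_Times)
    finally show ?thesis ..
   qed
   have "avg X (%p. avg (cube k X) (%x. avg (cube k X) (%y. PROD om:Pow D. V p j (mix om x y))))
     = avg (cube k X) (%x. avg (cube k X) (%y. PROD om:Pow D. V (y j0) j (mix om x y)))"
    by (rule avg_param_coord[OF X]) (use j0 noy[OF D(1)] in auto)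
   also have "... = avg (cube k X) (%x. avg (cube k X) (%y. PROD p:Z. nu (fst p) (mix (snd p) x y)))"
    by (simp only: eqV[OF D(1)] prZ)
   also have "... <= 1 + et"
   proof -
    have "Z \<subseteq> Sigma {..<k} (%j. Pow ({..<k} - {j}))" using D JI j0 by (auto simp: Z_def)
    from lfc_Z[OF lf this] show ?thesis by simp
   qed
   finally show ?thesis using et by simp
  qed
  define W where "W x y = (PROD j:J. (PROD om:Pow (J - {j}). u j (mix om x y)) * (PROD om:Pow (J - {j}). u' j (mix (insert j0 om) x y)))" for x y
  define A where "A = Pow J"
  have fA: "finite A" "A ~= {}" using JI by (auto simp: A_def)
  have term_S: "\<bar>avg Om (%x. avg Om (%y. (PROD om:S. nu j0 (mix om x y)) * W x y)) - 1\<bar> <= et" if S: "S \<in> Pow A" for S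
  proof -
   define e where "e j om = (if j = j0 then om \<in> S else if j0 \<in> om then j \<in> U' else j \<in> U)" for j om
   have "(\<Prod>j<k. PROD om:Pow ({..<k} - {j}). if e j om then nu j (mix om x y) else 1) = (PROD om:S. nu j0 (mix om x y)) * W x y" for x y
   proof -
    have "(PROD om:Pow ({..<k} - {j0}). if e j0 om then nu j0 (mix om x y) else 1) = (PROD om:S. nu j0 (mix om x y))"
    proof -
     have "A \<inter> S = S" using S by auto
     thus ?thesis using prod.inter_restrict[OF fA(1), of "%om. nu j0 (mix om x y)" S] by (simp add: e_def A_def J_def)
    qed
    moreover have "(PROD om:Pow ({..<k} - {j}). if e j om then nu j (mix om x y) else 1)
     = (PROD om:Pow (J - {j}). u j (mix om x y)) * (PROD om:Pow (J - {j}). u' j (mix (insert j0 om) x y))" if j: "j \<in> J" for j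
    proof -
     have Ij: "{..<k} - {j} = insert j0 (J - {j})" using j j0 by (auto simp: J_def)
     have jj: "j ~= j0" using j JI by auto
     have "(PROD om:Pow ({..<k} - {j}). if e j om then nu j (mix om x y) else 1) =
      (PROD om:Pow (J - {j}). if e j om then nu j (mix om x y) else 1) * (PROD om:Pow (J - {j}). if e j (insert j0 om) then nu j (mix (insert j0 om) x y) else 1)"
      unfolding Ij by (rule prod_Pow_insert) (use JI in auto)
     also have "(PROD om:Pow (J - {j}). if e j om then nu j (mix om x y) else 1) = (PROD om:Pow (J - {j}). u j (mix om x y))"
     proof (rule prod.cong)
      fix om assume "om \<in> Pow (J - {j})"
      thus "(if e j om then nu j (mix om x y) else 1) = u j (mix om x y)" using JI jj by (auto simp: e_def u_def)
     qed simp
     also have "(PROD om:Pow (J - {j}). if e j (insert j0 om) then nu j (mix (insert j0 om) x y) else 1) = (PROD om:Pow (J - {j}). u' j (mix (insert j0 om) x y))"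
      using jj by (simp add: e_def u'_def)
     finally show ?thesis .
    qed
    ultimately show ?thesis using prod.remove[of "{..<k}" j0 "%j. PROD om:Pow ({..<k} - {j}). if e j om then nu j (mix om x y) else 1"] j0
     by (simp add: J_def[symmetric] W_def)
   qed
   thus ?thesis using lf[unfolded lfc_def, THEN spec[of _ e]] by (simp add: Om_def)
  qed
  have "avg X (%b. avg (cube k X) (%x. avg (cube k X) (%y. (PROD om:Pow J. nu j0 (mix om x y) - 1) * (PROD j:J. PROD om:Pow (J - {j}). V b j (mix om x y)))))
    = avg Om (%x. avg Om (%y. (PROD om:Pow J. nu j0 (mix om x y) - 1) * (PROD j:J. PROD om:Pow (J - {j}). V (y j0) j (mix om x y))))"
   unfolding Om_def
  proof (rule avg_param_coord[OF X])
   show "j0 \<in> {..<k}" using j0 by simp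
   fix b x and y :: "nat => 'a" and a
   have "(PROD om:Pow J. nu j0 (mix om x (y(j0 := a))) - 1) = (PROD om:Pow J. nu j0 (mix om x y) - 1)" by (rule noy) simp
   moreover have "(PROD om:Pow (J - {j}). V b j (mix om x (y(j0 := a)))) = (PROD om:Pow (J - {j}). V b j (mix om x y))" for j by (rule noy) auto
   ultimately show "(PROD om:Pow J. nu j0 (mix om x (y(j0 := a))) - 1) * (PROD j:J. PROD om:Pow (J - {j}). V b j (mix om x (y(j0 := a))))
     = (PROD om:Pow J. nu j0 (mix om x y) - 1) * (PROD j:J. PROD om:Pow (J - {j}). V b j (mix om x y))" by simp
  qed
  also have "... = avg Om (%x. avg Om (%y. (PROD om:A. nu j0 (mix om x y) + -1) * W x y))"
   unfolding W_def A_def by (simp add: eqV)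
  also have "... = avg Om (%x. avg Om (%y. SUM S:Pow A. (-1) ^ card (A - S) * ((PROD om:S. nu j0 (mix om x y)) * W x y)))"
   by (subst prod_add[OF fA(1)]) (simp add: sum_distrib_left mult_ac)
  also have "... = (SUM S:Pow A. (-1) ^ card (A - S) * avg Om (%x. avg Om (%y. (PROD om:S. nu j0 (mix om x y)) * W x y)))"
   by (simp only: avg_sum avg_cmult)
  also have "... = (SUM S:Pow A. (-1) ^ card (A - S) * (avg Om (%x. avg Om (%y. (PROD om:S. nu j0 (mix om x y)) * W x y)) - 1))"
   using alternating_Pow_sum[OF fA] by (simp add: right_diff_distrib sum_subtractf)
  also have "\<bar>\<dots>\<bar> <= (SUM S:Pow A. et)"
   using term_S by (intro order_trans[OF sum_abs] sum_mono) (simp add: abs_mult)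
  also have "... <= 2 * ep ^ (2 ^ card J)" using fA ep(2) by (simp add: A_def card_Pow cJ)
  finally show "\<bar>avg X (%b. avg (cube k X) (%x. avg (cube k X) (%y. (PROD om:Pow J. nu j0 (mix om x y) - 1) * (PROD j:J. PROD om:Pow (J - {j}). V b j (mix om x y)))))\<bar> <= 2 * ep ^ (2 ^ card J)" .
 qed (use X JI ep in auto)
 also have "avg X (%b. avg Om (%x. (nu j0 x - 1) * (PROD j:J. G b j x))) = avg Om (%x. avg X (%b. (nu j0 x - 1) * (PROD j:J. G b j x)))"
  by (rule avg_swap)
 finally show ?thesis by (simp add: G_def prod.distrib Om_def)
qed

section \<open>Cut norms and the counting lemma\<close>

definition cutsmall :: "'a set => nat => nat => ((nat => 'a) => real) => real => bool" where
 "cutsmall X k j h ep \<longleftrightarrow> (ALL B. (ALL i:{..<k} - {j}. indep {..<k} X i (B i) & (ALL x:cube k X. 0 <= B i x & B i x <= 1)) -->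
   \<bar>avg (cube k X) (%x. h x * (PROD i:{..<k} - {j}. B i x))\<bar> <= ep)"

text \<open>T collects the sparse indices, where f is bounded only by nu; at all other indices f is
  bounded by 1. Counting proceeds by induction on the size of T.\<close>

definition cnt_hyp :: "'a set => nat => (nat => (nat => 'a) => real) => (nat => (nat => 'a) => real) =>
  (nat => (nat => 'a) => real) => nat set => real => real => bool" where
 "cnt_hyp X k nu f g T ep et \<longleftrightarrow> finite X & X ~= {} & T \<subseteq> {..<k} & lfc X k nu et &
   (\<forall>j<k. indep {..<k} X j (nu j) & indep {..<k} X j (f j) & indep {..<k} X j (g j) &
    cutsmall X k j (%x. f j x - g j x) ep &
    (ALL x:cube k X. 0 <= nu j x & 0 <= f j x & f j x <= (if j \<in> T then nu j x else 1) & 0 <= g j x & g j x <= 1))"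

lemma prod_diff_telescope:
 fixes f g :: "nat => real"
 shows "(\<Prod>j<k. f j) - (\<Prod>j<k. g j) = (\<Sum>j<k. (f j - g j) * (PROD i:{..<k} - {j}. if i < j then g i else f i))"
proof (induction k)
 case (Suc k)
 have "(\<Sum>j<k. (f j - g j) * (PROD i:{..<Suc k} - {j}. if i < j then g i else f i))
   = (\<Sum>j<k. ((f j - g j) * (PROD i:{..<k} - {j}. if i < j then g i else f i)) * f k)"
 proof (rule sum.cong)
  fix j assume "j \<in> {..<k}"
  hence "{..<Suc k} - {j} = insert k ({..<k} - {j})" "\<not> k < j" by auto
  thus "(f j - g j) * (PROD i:{..<Suc k} - {j}. if i < j then g i else f i)
    = ((f j - g j) * (PROD i:{..<k} - {j}. if i < j then g i else f i)) * f k" by simp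
 qed simp
 also have "... = ((\<Prod>j<k. f j) - (\<Prod>j<k. g j)) * f k" by (simp add: Suc.IH sum_distrib_right[symmetric])
 finally have 1: "(\<Sum>j<k. (f j - g j) * (PROD i:{..<Suc k} - {j}. if i < j then g i else f i)) = ((\<Prod>j<k. f j) - (\<Prod>j<k. g j)) * f k" .
 have "{..<Suc k} - {k} = {..<k}" by auto
 hence "(PROD i:{..<Suc k} - {k}. if i < k then g i else f i) = (\<Prod>i<k. g i)" by simp
 thus ?case using 1 by (simp add: algebra_simps)
qed simp

lemma counting_base:
 assumes "cnt_hyp X k nu f g {} ep et"
 shows "\<bar>avg (cube k X) (%x. \<Prod>j<k. f j x) - avg (cube k X) (%x. \<Prod>j<k. g j x)\<bar> <= k * ep"
proof -
 have "avg (cube k X) (%x. \<Prod>j<k. f j x) - avg (cube k X) (%x. \<Prod>j<k. g j x)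
   = (\<Sum>j<k. avg (cube k X) (%x. (f j x - g j x) * (PROD i:{..<k} - {j}. (if i < j then g i else f i) x)))"
  unfolding avg_diff[symmetric] avg_sum[symmetric] prod_diff_telescope
  by (intro avg_cong sum.cong refl arg_cong2[of _ _ _ _ "(*)"] prod.cong) auto
 also have "\<bar>\<dots>\<bar> <= (\<Sum>j<k. ep)"
 proof (intro order_trans[OF sum_abs] sum_mono)
  fix j assume j: "j \<in> {..<k}"
  have "cutsmall X k j (%x. f j x - g j x) ep" using assms j by (simp add: cnt_hyp_def)
  from this[unfolded cutsmall_def, rule_format, of "%i. if i < j then g i else f i"]
  show "\<bar>avg (cube k X) (%x. (f j x - g j x) * (PROD i:{..<k} - {j}. (if i < j then g i else f i) x))\<bar> <= ep"
   using assms by (simp add: cnt_hyp_def)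
 qed
 finally show ?thesis by simp
qed

text \<open>Densification: the sparse factor at j0 is removed by Cauchy-Schwarz, and the weight nu
  that appears may be replaced by 1 by \<open>nu_minus_one_small\<close>. What is left is the mean
  square of f' - g', where f' and g' average the other factors over coordinate j0. These are almost
  bounded by 1 and can serve as bounded weights at index j0, which leaves one sparse index
  less.\<close>

lemma counting_step:
 fixes X :: "'a set" and nu f g :: "nat => (nat => 'a) => real"
 assumes hyp: "cnt_hyp X k nu f g T ep et" and j0: "j0 \<in> T"
  and IH: "!!f g. cnt_hyp X k nu f g (T - {j0}) ep et ==> \<bar>avg (cube k X) (%x. \<Prod>j<k. f j x) - avg (cube k X) (%x. \<Prod>j<k. g j x)\<bar> <= ta'"
  and ep: "ep >= 0" and et: "0 <= et" "et <= 1" and ep1: "ep1 >= 0" "2 ^ (2 ^ (k - 1)) * et <= 2 * ep1 ^ (2 ^ (k - 1))"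
 shows "\<bar>avg (cube k X) (%x. \<Prod>j<k. f j x) - avg (cube k X) (%x. \<Prod>j<k. g j x)\<bar>
  <= sqrt (2 * (8 * ep1 + (2 * ta' + (3 * et + 2 * sqrt (3 * et))))) + ep"
proof -
 let ?I = "{..<k}"
 define Om where "Om = cube k X"
 define J where "J = ?I - {j0}"
 have X: "finite X" "X ~= {}" and TI: "T \<subseteq> ?I" and lf: "lfc X k nu et" using hyp by (auto simp: cnt_hyp_def)
 have j0k: "j0 < k" using j0 TI by auto
 have J: "finite J" "J \<subseteq> ?I" "j0 \<notin> J" by (auto simp: J_def)
 note H = hyp[unfolded cnt_hyp_def, THEN conjunct2, THEN conjunct2, THEN conjunct2, THEN conjunct2, rule_format]
 have inu: "indep ?I X j (nu j)" and ifj: "indep ?I X j (f j)" and ig: "indep ?I X j (g j)"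
  and cs: "cutsmall X k j (%x. f j x - g j x) ep" if "j < k" for j using H[OF that] by auto
 have pw: "0 <= nu j x" "0 <= f j x" "f j x <= (if j \<in> T then nu j x else 1)" "0 <= g j x" "g j x <= 1"
  if "j < k" "x \<in> Om" for j x using H[OF that(1)] that(2) by (auto simp: Om_def)
 have J0: "j < k" if "j \<in> J" for j using that J by auto
 have finOm: "finite Om" "Om ~= {}" unfolding Om_def using finite_cube[of ?I X] cube_nonempty[of X ?I] X by auto
 have up: "x(j0 := a) \<in> Om" if "x \<in> Om" "a \<in> X" for x a
  unfolding Om_def by (rule upd_in_PiE) (use that j0k in \<open>auto simp: Om_def\<close>)
 have split: "(\<Prod>j<k. h j) = h j0 * (PROD j:J. h j)" for h :: "nat => real"
  unfolding J_def using j0k by (intro prod.remove) auto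
 define av where "av P x = avg X (%a. P (x(j0 := a)))" for P :: "(nat => 'a) => real" and x
 have iav: "indep ?I X j0 (av P)" for P unfolding av_def by (rule indep_avg)
 have res: "avg Om (%x. ph x * av P x) = avg Om (%x. ph x * P x)" if "indep ?I X j0 ph" for ph P
  unfolding av_def Om_def by (rule avg_resample_product[OF X _ that]) (use j0k in simp)
 have res2: "avg Om (%x. ph x * av P x * av Q x) = avg Om (%x. avg X (%b. ph x * (P x * Q (x(j0 := b)))))" if "indep ?I X j0 ph" for ph P Q
  unfolding av_def Om_def by (rule avg_resample_product2[OF X _ that]) (use j0k in simp)
 have av_le: "av P x <= av Q x" if "!!x. x \<in> Om ==> P x <= Q x" "x \<in> Om" for P Q x
  unfolding av_def using that up by (intro avg_mono) auto
 have av_const: "av (%_. c) x = c" for c x unfolding av_def by (rule avg_const[OF X])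
 define pf where "pf x = (PROD j:J. f j x)" for x
 define pg where "pg x = (PROD j:J. g j x)" for x
 define pn where "pn x = (PROD j:J. if j \<in> T then nu j x else 1)" for x
 define f' where "f' = av pf"
 define g' where "g' = av pg"
 define n' where "n' = av pn"
 \<comment> \<open>The majorant n' of f' is close to 1 in mean square, so the truncation changes f'
   little; it is needed for an admissible bounded weight.\<close>
 define f'' where "f'' x = min (f' x) 1" for x
 have pf0: "0 <= pf x" "pf x <= pn x" "0 <= pg x" "pg x <= 1" if x: "x \<in> Om" for x
 proof -
  show "0 <= pf x" "0 <= pg x" unfolding pf_def pg_def using pw x J0 by (auto intro!: prod_nonneg)
  show "pf x <= pn x" unfolding pf_def pn_def using pw x J0 by (intro prod_mono) auto
  show "pg x <= 1" unfolding pg_def using pw x J0 by (intro prod_le_1) auto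
 qed
 have f'0: "0 <= f' x" "f' x <= n' x" "0 <= g' x" "g' x <= 1" if x: "x \<in> Om" for x
  unfolding f'_def g'_def n'_def using av_le[OF pf0(2) x] av_le[OF pf0(4) x] av_le[OF pf0(1) x] av_le[OF pf0(3) x]
  by (simp_all add: av_const)
 have if': "indep ?I X j0 f'" "indep ?I X j0 g'" "indep ?I X j0 n'" unfolding f'_def g'_def n'_def by (rule iav)+
 have if'': "indep ?I X j0 f''" using if'(1) by (simp add: f''_def indep_def)
 have iJ: "indep ?I X j0 (nu j0)" "indep ?I X j0 (f j0)" "indep ?I X j0 (g j0)" using inu ifj ig j0k by auto
 \<comment> \<open>replacing the dense weight \<open>f j0\<close> or \<open>g j0\<close> by a bounded one lowers the number of sparse weights\<close>
 have IH': "\<bar>avg Om (%x. ph x * f' x) - avg Om (%x. ph x * g' x)\<bar> <= ta'"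
  if ph: "indep ?I X j0 ph" "!!x. x \<in> Om ==> 0 <= ph x & ph x <= 1" for ph
 proof -
  define f1 where "f1 = f(j0 := ph)"
  define g1 where "g1 = g(j0 := ph)"
  have "cutsmall X k j (%x. f1 j x - g1 j x) ep" if "j < k" for j
  proof (cases "j = j0")
   case True
   thus ?thesis using ep by (simp add: cutsmall_def f1_def g1_def avg_def)
  qed (use cs[OF that] in \<open>simp add: f1_def g1_def\<close>)
  moreover have "indep ?I X j (f1 j)" "indep ?I X j (g1 j)" if "j < k" for j
   using ifj ig ph that by (auto simp: f1_def g1_def)
  moreover have "0 <= f1 j x & f1 j x <= (if j \<in> T - {j0} then nu j x else 1) & 0 <= g1 j x & g1 j x <= 1" if "j < k" "x \<in> Om" for j x
   using pw[OF that] ph(2)[OF that(2)] by (simp add: f1_def g1_def)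
  ultimately have "cnt_hyp X k nu f1 g1 (T - {j0}) ep et"
   unfolding cnt_hyp_def using X TI lf inu pw(1) by (auto simp: Om_def)
  from IH[OF this] have "\<bar>avg Om (%x. \<Prod>j<k. f1 j x) - avg Om (%x. \<Prod>j<k. g1 j x)\<bar> <= ta'" by (simp add: Om_def)
  moreover have "(PROD j:J. f1 j x) = pf x" "(PROD j:J. g1 j x) = pg x" for x
   unfolding pf_def pg_def f1_def g1_def using J(3) by (auto intro!: prod.cong)
  hence "avg Om (%x. \<Prod>j<k. f1 j x) = avg Om (%x. ph x * f' x)" "avg Om (%x. \<Prod>j<k. g1 j x) = avg Om (%x. ph x * g' x)"
   unfolding split f'_def g'_def res[OF ph(1)] by (simp_all add: f1_def g1_def)
  ultimately show ?thesis by simp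
 qed
 have small: "\<bar>avg Om (%x. (nu j0 x - 1) * av (%x. PROD j:J. F j x) x * av (%x. PROD j:J. F' j x) x)\<bar> <= 2 * ep1"
  if F: "!!j. j \<in> J ==> indep ?I X j (F j)" "!!j x. j \<in> J ==> x \<in> Om ==> \<bar>F j x\<bar> <= (if j \<in> U then nu j x else 1)"
  and F': "!!j. j \<in> J ==> indep ?I X j (F' j)" "!!j x. j \<in> J ==> x \<in> Om ==> \<bar>F' j x\<bar> <= (if j \<in> U' then nu j x else 1)"
  for F F' U U'
 proof -
  have i1: "indep ?I X j0 (%x. nu j0 x - 1)" using iJ(1) by (simp add: indep_def)
  show ?thesis unfolding res2[OF i1] unfolding Om_def J_def
   by (rule nu_minus_one_small[OF X j0k inu _ lf et(2) ep1, of F U F' U'])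
    (use F F' pw in \<open>auto simp: Om_def J_def\<close>)
 qed
 have fb: "\<bar>f j x\<bar> <= (if j \<in> T then nu j x else 1)" "\<bar>g j x\<bar> <= (if j \<in> {} then nu j x else 1)" if "j \<in> J" "x \<in> Om" for j x
  using pw[OF J0[OF that(1)] that(2)] by auto
 have iJf: "indep ?I X j (f j)" "indep ?I X j (g j)" if "j \<in> J" for j using ifj ig J0[OF that] by auto
 have small_ff: "\<bar>avg Om (%x. (nu j0 x - 1) * f' x * f' x)\<bar> <= 2 * ep1"
  unfolding f'_def pf_def[abs_def] by (rule small[OF iJf(1) fb(1) iJf(1) fb(1)])
 have small_fg: "\<bar>avg Om (%x. (nu j0 x - 1) * f' x * g' x)\<bar> <= 2 * ep1"
  unfolding f'_def pf_def[abs_def] g'_def pg_def[abs_def] by (rule small[OF iJf(1) fb(1) iJf(2) fb(2)])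
 have small_gg: "\<bar>avg Om (%x. (nu j0 x - 1) * g' x * g' x)\<bar> <= 2 * ep1"
  unfolding g'_def pg_def[abs_def] by (rule small[OF iJf(2) fb(2) iJf(2) fb(2)])
 have part1: "avg Om (%x. (nu j0 x - 1) * (f' x - g' x)\<^sup>2) <= 8 * ep1"
 proof -
  have "avg Om (%x. (nu j0 x - 1) * (f' x - g' x)\<^sup>2) = avg Om (%x. (nu j0 x - 1) * f' x * f' x + (nu j0 x - 1) * g' x * g' x + (-2) * ((nu j0 x - 1) * f' x * g' x))"
   by (intro avg_cong) (simp add: power2_eq_square algebra_simps)
  also have "... = avg Om (%x. (nu j0 x - 1) * f' x * f' x) + avg Om (%x. (nu j0 x - 1) * g' x * g' x) + (-2) * avg Om (%x. (nu j0 x - 1) * f' x * g' x)"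
   by (simp only: avg_add avg_cmult)
  finally show ?thesis using small_ff small_fg small_gg by simp
 qed
 have pn_Z: "pn x = (PROD j:J \<inter> T. nu j x)" for x unfolding pn_def by (rule prod.inter_restrict[OF J(1), symmetric])
 have lf2: "\<bar>avg Om n' - 1\<bar> <= et"
 proof -
  have "avg Om n' = avg Om pn" using res[of "%_. 1" pn] by (simp add: n'_def indep_def)
  also have "... = avg Om (%x. avg Om (%y. PROD p:(J \<inter> T) \<times> {{}}. nu (fst p) (mix (snd p) x y)))"
  proof -
   have "(PROD p:(J \<inter> T) \<times> {{}}. nu (fst p) (mix (snd p) x y)) = pn x" for x y
    unfolding pn_Z by (rule prod.reindex_cong[of "%j. (j, {})"]) (auto simp: inj_on_def)
   thus ?thesis by (simp add: avg_const[OF finOm])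
  qed
  finally show ?thesis using lfc_Z[OF lf, of "(J \<inter> T) \<times> {{}}"] J by (auto simp: Om_def)
 qed
 have lf3: "\<bar>avg Om (%x. (n' x)\<^sup>2) - 1\<bar> <= et"
 proof -
  have "avg Om (%x. (n' x)\<^sup>2) = avg Om (%x. 1 * av pn x * av pn x)" by (simp add: n'_def power2_eq_square)
  also have "... = avg Om (%x. avg X (%b. 1 * (pn x * pn (x(j0 := b)))))" by (rule res2) (simp add: indep_def)
  also have "... = avg X (%b. avg Om (%x. avg Om (%y. pn x * pn (x(j0 := b)))))"
   by (subst avg_swap) (simp add: avg_const[OF finOm])
  also have "... = avg Om (%x. avg Om (%y. pn x * pn (x(j0 := y j0))))"
   unfolding Om_def by (rule avg_param_coord[OF X]) (use j0k in auto)
  also have "... = avg Om (%x. avg Om (%y. PROD p:(J \<inter> T) \<times> {{}, {j0}}. nu (fst p) (mix (snd p) x y)))"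
  proof -
   have "(PROD p:(J \<inter> T) \<times> {{}, {j0}}. nu (fst p) (mix (snd p) x y)) = pn x * pn (x(j0 := y j0))" for x y
   proof -
    have "(PROD p:(J \<inter> T) \<times> {{}, {j0}}. nu (fst p) (mix (snd p) x y)) = (PROD j:J \<inter> T. PROD om:{{}, {j0}}. nu j (mix om x y))"
     by (subst prod.cartesian_product) (simp add: case_prod_unfold)
    also have "... = (PROD j:J \<inter> T. nu j x * nu j (x(j0 := y j0)))"
     using mix_insert[of j0 "{}" x y] by simp
    finally show ?thesis by (simp add: pn_Z prod.distrib)
   qed
   thus ?thesis by simp
  qed
  finally show ?thesis using lfc_Z[OF lf, of "(J \<inter> T) \<times> {{}, {j0}}"] J j0k by (auto simp: Om_def)
 qed
 define s where "s = avg Om (%x. (n' x - 1)\<^sup>2)"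
 have s: "0 <= s" "s <= 3 * et"
 proof -
  show "0 <= s" unfolding s_def by (rule avg_nonneg) simp
  have "s = avg Om (%x. ((n' x)\<^sup>2 + (-2) * n' x) + 1)"
   unfolding s_def by (intro avg_cong) (simp add: power2_eq_square algebra_simps)
  also have "... = avg Om (%x. (n' x)\<^sup>2) + (-2) * avg Om n' + 1"
   by (simp only: avg_add avg_cmult avg_const[OF finOm])
  finally show "s <= 3 * et" using lf2 lf3 by simp
 qed
 \<comment> \<open>One of the two factors f' - g' is split as (f'' - g') + (f' - f''). The first
   part gives two instances of the induction hypothesis, with weights f'' and g' at index j0; the
   second lives where n' exceeds 1.\<close>
 have part2: "avg Om (%x. (f' x - g' x)\<^sup>2) <= 2 * ta' + (3 * et + 2 * sqrt (3 * et))"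
 proof -
  let ?D = "avg Om (%x. f'' x * f' x) - avg Om (%x. f'' x * g' x)"
  let ?E = "avg Om (%x. g' x * f' x) - avg Om (%x. g' x * g' x)"
  have "avg Om (%x. (f' x - g' x)\<^sup>2) = avg Om (%x. (((f'' x * f' x - f'' x * g' x) - (g' x * f' x - g' x * g' x)) + (f' x - g' x) * (f' x - f'' x)))"
   by (intro avg_cong) (simp add: power2_eq_square algebra_simps)
  also have "... = ?D - ?E + avg Om (%x. (f' x - g' x) * (f' x - f'' x))"
   by (simp only: avg_add avg_diff)
  finally have eq: "avg Om (%x. (f' x - g' x)\<^sup>2) = ?D - ?E + avg Om (%x. (f' x - g' x) * (f' x - f'' x))" .
  have "\<bar>avg Om (%x. f'' x * f' x) - avg Om (%x. f'' x * g' x)\<bar> <= ta'"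
   by (rule IH'[OF if'']) (use f'0 in \<open>auto simp: f''_def\<close>)
  moreover have "\<bar>avg Om (%x. g' x * f' x) - avg Om (%x. g' x * g' x)\<bar> <= ta'"
   by (rule IH'[OF if'(2)]) (use f'0 in auto)
  moreover have "avg Om (%x. (f' x - g' x) * (f' x - f'' x)) <= 3 * et + 2 * sqrt (3 * et)"
  proof -
   have "avg Om (%x. (f' x - g' x) * (f' x - f'' x)) <= avg Om (%x. (n' x - 1)\<^sup>2 + 2 * \<bar>n' x - 1\<bar>)"
   proof (rule avg_mono)
    fix x assume x: "x \<in> Om"
    note b = f'0[OF x]
    have a: "0 <= f' x - f'' x" "f' x - f'' x <= \<bar>n' x - 1\<bar>" using b by (auto simp: f''_def)
    have "(f' x - g' x) * (f' x - f'' x) <= (\<bar>n' x - 1\<bar> + 2) * (f' x - f'' x)" using b a(1) by (simp add: mult_right_mono)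
    also have "... <= (\<bar>n' x - 1\<bar> + 2) * \<bar>n' x - 1\<bar>" using a(2) by (intro mult_left_mono) auto
    also have "... = (n' x - 1)\<^sup>2 + 2 * \<bar>n' x - 1\<bar>" by (simp add: algebra_simps flip: abs_mult power2_eq_square)
    finally show "(f' x - g' x) * (f' x - f'' x) <= (n' x - 1)\<^sup>2 + 2 * \<bar>n' x - 1\<bar>" .
   qed
   also have "... = s + 2 * avg Om (%x. \<bar>n' x - 1\<bar>)" by (simp only: avg_add avg_cmult s_def)
   also have "avg Om (%x. \<bar>n' x - 1\<bar>) <= sqrt s"
   proof (rule real_le_rsqrt)
    have "(avg Om (%x. 1 * \<bar>n' x - 1\<bar> * 1))\<^sup>2 <= avg Om (%x. 1 * \<bar>n' x - 1\<bar>\<^sup>2) * avg Om (%x. 1 * 1\<^sup>2)" by (rule avg_CS) simp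
    thus "(avg Om (%x. \<bar>n' x - 1\<bar>))\<^sup>2 <= s" by (simp add: avg_const[OF finOm] s_def)
   qed
   also have "s + 2 * sqrt s <= 3 * et + 2 * sqrt (3 * et)" using s by (intro add_mono mult_left_mono real_sqrt_le_mono) auto
   finally show ?thesis by simp
  qed
  ultimately show ?thesis unfolding eq by simp
 qed
 let ?C = "%x. f j0 x * (f' x - g' x)"
 have main: "avg Om (%x. \<Prod>j<k. f j x) - avg Om (%x. \<Prod>j<k. g j x)
   = avg Om ?C + avg Om (%x. (f j0 x - g j0 x) * pg x)"
 proof -
  have "avg Om (%x. f j0 x * f' x) = avg Om (%x. \<Prod>j<k. f j x)" "avg Om (%x. f j0 x * g' x) = avg Om (%x. f j0 x * pg x)"
   unfolding f'_def g'_def res[OF iJ(2)] split pf_def by auto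
  moreover have "avg Om (%x. g j0 x * pg x) = avg Om (%x. \<Prod>j<k. g j x)" unfolding split pg_def ..
  ultimately show ?thesis by (simp add: right_diff_distrib left_diff_distrib avg_diff)
 qed
 let ?A = "8 * ep1 + (2 * ta' + (3 * et + 2 * sqrt (3 * et)))"
 have "\<bar>avg Om (%x. (f j0 x - g j0 x) * pg x)\<bar> <= ep"
  using cs[OF j0k, unfolded cutsmall_def, rule_format, of g] ig pw by (simp add: Om_def pg_def J_def)
 moreover have "\<bar>avg Om ?C\<bar> <= sqrt (2 * ?A)"
 proof (rule real_le_rsqrt, unfold power2_abs)
  have b: "\<bar>f j0 x\<bar> <= nu j0 x" if "x \<in> Om" for x using pw[OF j0k that] j0 by auto
  let ?B = "%x. nu j0 x * (f' x - g' x)\<^sup>2"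
  have "(avg Om ?C)\<^sup>2 <= avg Om (nu j0) * avg Om ?B"
   by (rule avg_CS_dominated[OF b])
  also have "... <= 2 * avg Om ?B"
  proof (rule mult_right_mono)
   show "avg Om (nu j0) <= 2" using et lfc_Z[OF lf, of "{(j0, {})}"] j0k by (simp add: Om_def avg_const[OF finOm[unfolded Om_def]])
   show "0 <= avg Om ?B" using pw j0k by (intro avg_nonneg) auto
  qed
  also have "avg Om ?B = avg Om (%x. (nu j0 x - 1) * (f' x - g' x)\<^sup>2 + (f' x - g' x)\<^sup>2)"
   by (intro avg_cong) (simp add: algebra_simps)
  also have "... = avg Om (%x. (nu j0 x - 1) * (f' x - g' x)\<^sup>2) + avg Om (%x. (f' x - g' x)\<^sup>2)" by (rule avg_add)
  also have "2 * ... <= 2 * ?A"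
   by (intro mult_left_mono add_mono part1 part2) simp
  finally show "(avg Om ?C)\<^sup>2 <= 2 * ?A" .
 qed
 ultimately show ?thesis using main unfolding Om_def by simp
qed

lemma cutsmall_mono: "cutsmall X k j h ep ==> ep <= ep' ==> cutsmall X k j h ep'"
 unfolding cutsmall_def by (meson order_trans)

lemma lfc_mono: "lfc X k nu et ==> et <= et' ==> lfc X k nu et'"
 unfolding lfc_def by (meson order_trans)

lemma cnt_hyp_mono: "cnt_hyp X k nu f g T ep et ==> ep <= ep' ==> et <= et' ==> cnt_hyp X k nu f g T ep' et'"
 unfolding cnt_hyp_def using cutsmall_mono[of X k _ _ ep ep'] lfc_mono[of X k nu et et'] by simp

lemma counting_lemma:
 assumes "ta > (0::real)"
 shows "\<exists>ep>0. \<exists>et>0. \<forall>(X::'a set) nu f g T. card T = n --> cnt_hyp X k nu f g T ep et -->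
   \<bar>avg (cube k X) (%x. \<Prod>j<k. f j x) - avg (cube k X) (%x. \<Prod>j<k. g j x)\<bar> <= ta"
 using assms
proof (induction n arbitrary: ta)
 case 0
 show ?case
 proof (intro exI[of _ "ta / (k + 1)"] conjI allI impI)
  fix X :: "'a set" and nu f g T assume T: "card T = 0" and h: "cnt_hyp X k nu f g T (ta / (k + 1)) (ta / (k + 1))"
  have "T \<subseteq> {..<k}" using h by (simp add: cnt_hyp_def)
  hence "finite T" by (rule finite_subset) simp
  hence "\<bar>avg (cube k X) (%x. \<Prod>j<k. f j x) - avg (cube k X) (%x. \<Prod>j<k. g j x)\<bar> <= k * (ta / (k + 1))" using T by (intro counting_base[of X k nu f g _ "ta / (k + 1)"]) (use h in simp)
  also have "... <= ta" using 0 by (simp add: field_simps)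
  finally show "\<bar>avg (cube k X) (%x. \<Prod>j<k. f j x) - avg (cube k X) (%x. \<Prod>j<k. g j x)\<bar> <= ta" .
 qed (use 0 in auto)
next
 case (Suc n)
 \<comment> \<open>The square root in \<open>counting_step\<close> must not exceed ta/2. Here 4 ta'
   and 16 ep1 are each ta^2/16, and the terms with et contribute at most 6 r, again at most
   ta^2/16.\<close>
 define ta' where "ta' = ta\<^sup>2 / 64"
 have ta': "ta' > 0" using Suc.prems by (simp add: ta'_def)
 obtain ep' et' where e': "ep' > 0" "et' > 0" and IH: "\<forall>(X::'a set) nu f g T. card T = n --> cnt_hyp X k nu f g T ep' et' -->
   \<bar>avg (cube k X) (%x. \<Prod>j<k. f j x) - avg (cube k X) (%x. \<Prod>j<k. g j x)\<bar> <= ta'"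
  using Suc.IH[OF ta'] by auto
 define ep1 where "ep1 = ta\<^sup>2 / 256"
 have ep1: "ep1 > 0" using Suc.prems by (simp add: ep1_def)
 define r where "r = min 1 (ta\<^sup>2 / 96)"
 have r: "r > 0" "r <= 1" "6 * r <= ta\<^sup>2 / 16" using Suc.prems by (auto simp: r_def)
 define ep where "ep = min ep' (ta / 2)"
 define c where "c = 2 * ep1 ^ (2 ^ (k - 1)) / 2 ^ (2 ^ (k - 1))"
 have c: "c > 0" using ep1 by (simp add: c_def)
 define et where "et = min (min et' 1) (min (r\<^sup>2 / 3) c)"
 have et: "et > 0" "et <= et'" "et <= 1" "et <= r\<^sup>2 / 3" "et <= c"
  using e' r c by (auto simp: et_def)
 have ep: "ep > 0" "ep <= ep'" "ep <= ta/2" using e' Suc.prems by (auto simp: ep_def)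
 show ?case
 proof (intro exI[of _ "min ep et"] conjI allI impI)
  fix X :: "'a set" and nu f g T assume T: "card T = Suc n" and h0: "cnt_hyp X k nu f g T (min ep et) (min ep et)"
  have h: "cnt_hyp X k nu f g T ep et" by (rule cnt_hyp_mono[OF h0]) auto
  obtain j0 where j0: "j0 \<in> T" using T by fastforce
  have cT: "card (T - {j0}) = n" using T j0 by simp
  let ?A = "8 * ep1 + (2 * ta' + (3 * et + 2 * sqrt (3 * et)))"
  have "\<bar>avg (cube k X) (%x. \<Prod>j<k. f j x) - avg (cube k X) (%x. \<Prod>j<k. g j x)\<bar>
   <= sqrt (2 * ?A) + ep"
  proof (rule counting_step[OF h j0])
   show "\<bar>avg (cube k X) (%x. \<Prod>j<k. f j x) - avg (cube k X) (%x. \<Prod>j<k. g j x)\<bar> <= ta'"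
    if "cnt_hyp X k nu f g (T - {j0}) ep et" for f g
    using IH[rule_format, OF cT cnt_hyp_mono[OF that ep(2) et(2)]] .
  qed (use ep et ep1 in \<open>auto simp: field_simps c_def\<close>)
  also have "sqrt (2 * ?A) <= ta/2"
  proof (rule real_le_lsqrt)
   have 1: "3 * et <= r\<^sup>2" using et(4) by simp
   hence "sqrt (3 * et) <= r" using r et by (intro real_le_lsqrt) auto
   moreover have "r\<^sup>2 <= r" using r by (simp add: power2_eq_square)
   ultimately have "3 * et + 2 * sqrt (3 * et) <= 3 * r" using 1 by simp
   moreover have "2 * (8 * ep1 + (2 * ta' + x)) <= ta\<^sup>2/4" if "x <= 3 * r" for x
   proof -
    have "2 * (8 * ep1 + (2 * ta' + x)) = ta\<^sup>2/8 + 2 * x" unfolding ep1_def ta'_def by simp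
    thus ?thesis using that r(3) zero_le_power2[of ta] by linarith
   qed
   moreover have "(ta/2)\<^sup>2 = ta\<^sup>2/4" by (simp add: power_divide)
   ultimately show "2 * ?A <= (ta/2)\<^sup>2" by metis
   show "0 <= ta/2" using Suc.prems by simp
  qed
  finally show "\<bar>avg (cube k X) (%x. \<Prod>j<k. f j x) - avg (cube k X) (%x. \<Prod>j<k. g j x)\<bar> <= ta" using ep(3) by simp
 qed (use ep et in auto)
qed

section \<open>Dense models by boosting\<close>

definition clip :: "real => real" where "clip s = max 0 (min 1 s)"

text \<open>The convex potential with derivative \<open>clip\<close>; it drives the boosting argument below.\<close>

definition pot :: "real => real" where
 "pot s = (if s <= 0 then 0 else if s <= 1 then s\<^sup>2 / 2 else s - 1/2)"

text \<open>The derivative \<open>clip\<close> of the potential is 1-Lipschitz, hence the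
  second-order term h^2/2.\<close>

lemma pot_step: "pot (s + h) <= pot s + clip s * h + h\<^sup>2 / 2"
proof -
 have sq: "0 <= (s + h)\<^sup>2" "0 <= h\<^sup>2" "0 <= (s + h - 1)\<^sup>2" "0 <= s\<^sup>2" "0 <= (h - 1)\<^sup>2" by auto
 have e: "(s + h)\<^sup>2 = s\<^sup>2 + 2 * s * h + h\<^sup>2" "(s + h - 1)\<^sup>2 = s\<^sup>2 + 2 * s * h + h\<^sup>2 - 2 * s - 2 * h + 1" "(h - 1)\<^sup>2 = h\<^sup>2 - 2 * h + 1"
  by (simp_all add: power2_eq_square algebra_simps)
 consider "s <= 0" | "0 < s" "s <= 1" | "1 < s" by linarith
 thus ?thesis
 proof cases
  case 1
  have c: "clip s = 0" "pot s = 0" using 1 by (simp_all add: clip_def pot_def)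
  have "pot (s + h) <= h\<^sup>2 / 2"
  proof (cases "h <= 0")
   case True thus ?thesis using 1 by (simp add: pot_def)
  next
   case False
   have "s + h <= 1 ==> 0 < s + h ==> (s + h)\<^sup>2 <= h\<^sup>2" using 1 False by (intro power_mono) auto
   thus ?thesis using 1 False sq e by (auto simp: pot_def)
  qed
  thus ?thesis using c by simp
 next
  case 2
  have c: "clip s = s" "pot s = s\<^sup>2 / 2" using 2 by (simp_all add: clip_def pot_def)
  show ?thesis using sq c e by (auto simp: pot_def)
 next
  case 3
  have c: "clip s = 1" "pot s = s - 1/2" using 3 by (simp_all add: clip_def pot_def)
  have "pot (s + h) <= s - 1/2 + h + h\<^sup>2 / 2"
  proof -
   consider "s + h <= 0" | "0 < s + h" "s + h <= 1" | "1 < s + h" by linarith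
   thus ?thesis
   proof cases
    case 1
    have "0 <= (h + 1)\<^sup>2" by simp
    thus ?thesis using 1 3 by (simp add: power2_eq_square algebra_simps pot_def)
   next
    case 2
    have "(1 - (s + h))\<^sup>2 <= (- h)\<^sup>2" using 2 3 by (intro power_mono) auto
    thus ?thesis using 2 by (simp add: power2_eq_square algebra_simps pot_def field_simps)
   qed (use 3 sq in \<open>simp add: pot_def\<close>)
  qed
  thus ?thesis using c by simp
 qed
qed

lemma max_minus_pot_le: "max s 0 - pot s <= 1/2"
proof -
 have "0 <= (s - 1)\<^sup>2" by simp
 thus ?thesis by (simp add: power2_eq_square algebra_simps pot_def)
qed

text \<open>Pseudorandomness is available for products of test functions, hence for polynomials in
  them; the positive part has to be approximated by such a polynomial.\<close>

lemma max_poly_approx: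
 assumes "e > 0"
 obtains a :: "nat => real" and n where "!!s. \<bar>s\<bar> <= M ==> \<bar>max s 0 - (\<Sum>i\<le>n. a i * s ^ i)\<bar> < e"
proof -
 have "compact {-M..M}" "continuous_on {-M..M} (%s::real. max s 0)" by (auto intro!: continuous_intros)
 then obtain p where p: "real_polynomial_function p" "!!x. x \<in> {-M..M} ==> \<bar>max x 0 - p x\<bar> < e"
  using Stone_Weierstrass_real_polynomial_function[of "{-M..M}" "%s::real. max s 0" e] assms by auto
 obtain a n where "p = (%x. \<Sum>i\<le>n. a i * x ^ i)" using real_polynomial_function_iff_sum p(1) by blast
 thus ?thesis using that[of a n] p(2) by (simp add: abs_le_iff)
qed

text \<open>\<open>DD\<close> is a set of test functions whose products all have small correlation with \<open>nu - 1\<close>.\<close>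

lemma dense_model:
 assumes ep: "ep > (0::real)"
 shows "\<exists>et>0. \<forall>(Y :: 'a set) nu f DD. finite Y --> Y ~= {} --> (ALL y:Y. 0 <= f y & f y <= nu y) -->
   (ALL D:DD. ALL y:Y. 0 <= D y & D y <= 1) -->
   (ALL Ds. set Ds \<subseteq> DD --> \<bar>avg Y (%y. (nu y - 1) * prod_list (map (%D. D y) Ds))\<bar> <= et) -->
   (EX g. (ALL y:Y. 0 <= g y & g y <= 1) & (ALL D:DD. \<bar>avg Y (%y. (f y - g y) * D y)\<bar> <= ep))"
proof -
 \<comment> \<open>Each boosting round gains ep^2/2, so T rounds lift \<open>val\<close> to 2,
   beyond the bound 4/10 + 1/2 that pseudorandomness of nu permits. The degree and coefficients of
   the polynomial depend only on T and ep, so et can be fixed before Y.\<close>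
 define T where "T = nat \<lceil>4 / ep\<^sup>2\<rceil>"
 have T: "4 / ep\<^sup>2 <= T" by (simp add: T_def)
 define M where "M = ep * T"
 obtain a :: "nat => real" and n where ap: "!!s. \<bar>s\<bar> <= M ==> \<bar>max s 0 - (\<Sum>i\<le>n. a i * s ^ i)\<bar> < 1/10"
  using max_poly_approx[of "1/10" M] by auto
 define B where "B = (\<Sum>i\<le>n. \<bar>a i\<bar> * M ^ i)"
 have M0: "M >= 0" using ep by (simp add: M_def)
 have B0: "B >= 0" unfolding B_def using M0 by (intro sum_nonneg) auto
 define et where "et = min 1 (1 / (10 * (B + 1)))"
 have et: "et > 0" "et <= 1" "et * B <= 1/10"
 proof -
  show "et > 0" using B0 by (simp add: et_def)
  show "et <= 1" by (simp add: et_def)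
  show "et * B <= 1/10" using B0 by (simp add: et_def)
 qed
 have main: "EX g. (ALL y:Y. 0 <= g y & g y <= 1) & (ALL D:DD. \<bar>avg Y (%y. (f y - g y) * D y)\<bar> <= ep)"
  if Y: "finite Y" "Y ~= {}" and f: "ALL y:Y. 0 <= f y & f y <= nu y" and D: "ALL D:DD. ALL y:Y. 0 <= D y & D y <= 1"
   and small: "ALL Ds. set Ds \<subseteq> DD --> \<bar>avg Y (%y. (nu y - 1) * prod_list (map (%D. D y) Ds))\<bar> <= et"
  for Y :: "'a set" and nu f DD
 proof (rule ccontr)
  assume no: "\<not> ?thesis"
  have ex: "EX D:DD. \<bar>avg Y (%y. (f y - clip (S y)) * D y)\<bar> > ep" for S
  proof (rule ccontr)
   assume "\<not> ?thesis"
   hence "ALL D:DD. \<bar>avg Y (%y. (f y - clip (S y)) * D y)\<bar> <= ep" by auto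
   moreover have "ALL y:Y. 0 <= clip (S y) & clip (S y) <= 1" by (simp add: clip_def)
   ultimately have "EX g. (ALL y:Y. 0 <= g y & g y <= 1) & (ALL D:DD. \<bar>avg Y (%y. (f y - g y) * D y)\<bar> <= ep)"
    by auto
   thus False using no by simp
  qed
  define val where "val S = avg Y (%y. f y * S y - pot (S y))" for S
  \<comment> \<open>If no dense model exists, \<open>clip\<close> of the current S fails as one, and
    some test function with a suitable sign correlates with f - clip S by more than ep. Adding ep
    times it to S raises \<open>val\<close> by ep^2 to first order and loses at most half of that to
    second order.\<close>
  have "EX ps. length ps = t & (ALL p:set ps. snd p \<in> DD & (fst p = 1 \<or> fst p = -1)) &
    val (%y. ep * (\<Sum>p\<leftarrow>ps. fst p * snd p y)) >= t * (ep\<^sup>2 / 2)" for t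
  proof (induction t)
   case 0
   show ?case by (rule exI[of _ "[]"]) (simp add: val_def pot_def avg_def)
  next
   case (Suc t)
   then obtain ps where ps: "length ps = t" "ALL p:set ps. snd p \<in> DD & (fst p = 1 \<or> fst p = -1)"
    "val (%y. ep * (\<Sum>p\<leftarrow>ps. fst p * snd p y)) >= t * (ep\<^sup>2 / 2)" by auto
   define S where "S y = ep * (\<Sum>p\<leftarrow>ps. fst p * snd p y)" for y
   obtain E where E: "E \<in> DD" "\<bar>avg Y (%y. (f y - clip (S y)) * E y)\<bar> > ep" using ex by blast
   define c where "c = (if avg Y (%y. (f y - clip (S y)) * E y) >= 0 then 1 else -1 :: real)"
   have c: "c = 1 \<or> c = -1" "c * avg Y (%y. (f y - clip (S y)) * E y) > ep" using E by (auto simp: c_def)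
   have "val S + ep * (c * avg Y (%y. (f y - clip (S y)) * E y)) - ep\<^sup>2 / 2 <= val (%y. S y + ep * (c * E y))"
   proof -
    have "val S + ep * (c * avg Y (%y. (f y - clip (S y)) * E y)) - ep\<^sup>2 / 2
     = avg Y (%y. (f y * S y - pot (S y)) + ep * (c * ((f y - clip (S y)) * E y)) - ep\<^sup>2 / 2)"
     unfolding val_def avg_diff avg_add avg_cmult avg_const[OF Y] ..
    also have "... <= val (%y. S y + ep * (c * E y))"
     unfolding val_def
    proof (rule avg_mono)
     fix y assume y: "y \<in> Y"
     have "(ep * (c * E y))\<^sup>2 <= ep\<^sup>2" using D E(1) y c(1) by (auto simp: power_le_one power_mult_distrib mult_left_le)
     thus "(f y * S y - pot (S y)) + ep * (c * ((f y - clip (S y)) * E y)) - ep\<^sup>2 / 2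
      <= f y * (S y + ep * (c * E y)) - pot (S y + ep * (c * E y))"
      using pot_step[of "S y" "ep * (c * E y)"] by (simp add: algebra_simps)
    qed
    finally show ?thesis .
   qed
   moreover have "ep * ep <= ep * (c * avg Y (%y. (f y - clip (S y)) * E y))" using c(2) ep by (intro mult_left_mono) auto
   moreover have "val S >= t * (ep\<^sup>2 / 2)" using ps(3) by (simp add: S_def[abs_def])
   ultimately have "(Suc t) * (ep\<^sup>2 / 2) <= val (%y. S y + ep * (c * E y))" by (simp add: power2_eq_square algebra_simps)
   moreover have "(%y. ep * (\<Sum>p\<leftarrow>(c, E) # ps. fst p * snd p y)) = (%y. S y + ep * (c * E y))"
    by (simp add: S_def algebra_simps)
   ultimately show ?case using ps c(1) E(1) by (intro exI[of _ "(c, E) # ps"]) auto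
  qed
  from this[of T] obtain ps where ps: "length ps = T" "ALL p:set ps. snd p \<in> DD & (fst p = 1 \<or> fst p = -1)"
   and v: "val (%y. ep * (\<Sum>p\<leftarrow>ps. fst p * snd p y)) >= T * (ep\<^sup>2 / 2)" by (elim exE conjE)
  define S where "S y = ep * (\<Sum>p\<leftarrow>ps. fst p * snd p y)" for y
  have SM: "\<bar>S y\<bar> <= M" if y: "y \<in> Y" for y
  proof -
   have "\<bar>\<Sum>p\<leftarrow>ps. fst p * snd p y\<bar> <= length ps"
    using ps(2)
   proof (induction ps)
    case (Cons p ps)
    have "\<bar>fst p * snd p y\<bar> <= 1" using Cons.prems D y by auto
    thus ?case using Cons by simp
   qed simp
   thus ?thesis using ep ps(1) by (simp add: S_def M_def abs_mult)
  qed
  \<comment> \<open>Powers of the signed sum expand into products of test functions; the extra list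
    Ds holds those already split off, so that the induction on i closes.\<close>
  have pw: "\<bar>avg Y (%y. (nu y - 1) * ((\<Sum>p\<leftarrow>ps. fst p * snd p y) ^ i * prod_list (map (%D. D y) Ds)))\<bar> <= real T ^ i * et"
   if "set Ds \<subseteq> DD" for i Ds
   using that
  proof (induction i arbitrary: Ds)
   case 0
   thus ?case using small by simp
  next
   case (Suc i)
   have "\<bar>avg Y (%y. (nu y - 1) * ((\<Sum>p\<leftarrow>qs. fst p * snd p y) * ((\<Sum>p\<leftarrow>ps. fst p * snd p y) ^ i * prod_list (map (%D. D y) Ds))))\<bar> <= length qs * (real T ^ i * et)"
    if "set qs \<subseteq> set ps" for qs
    using that
   proof (induction qs)
    case Nil thus ?case by (simp add: avg_def)
   next
    case (Cons q qs)
    have q: "snd q \<in> DD" "fst q = 1 \<or> fst q = -1" using Cons.prems ps(2) by auto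
    have "avg Y (%y. (nu y - 1) * ((\<Sum>p\<leftarrow>q # qs. fst p * snd p y) * ((\<Sum>p\<leftarrow>ps. fst p * snd p y) ^ i * prod_list (map (%D. D y) Ds))))
     = avg Y (%y. fst q * ((nu y - 1) * ((\<Sum>p\<leftarrow>ps. fst p * snd p y) ^ i * prod_list (map (%D. D y) (snd q # Ds))))
      + (nu y - 1) * ((\<Sum>p\<leftarrow>qs. fst p * snd p y) * ((\<Sum>p\<leftarrow>ps. fst p * snd p y) ^ i * prod_list (map (%D. D y) Ds))))"
     by (intro avg_cong) (simp add: algebra_simps)
    also have "... = fst q * avg Y (%y. (nu y - 1) * ((\<Sum>p\<leftarrow>ps. fst p * snd p y) ^ i * prod_list (map (%D. D y) (snd q # Ds))))
      + avg Y (%y. (nu y - 1) * ((\<Sum>p\<leftarrow>qs. fst p * snd p y) * ((\<Sum>p\<leftarrow>ps. fst p * snd p y) ^ i * prod_list (map (%D. D y) Ds))))"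
     by (simp only: avg_add avg_cmult)
    also have "\<bar>\<dots>\<bar> <= real T ^ i * et + length qs * (real T ^ i * et)"
    proof (rule order_trans[OF abs_triangle_ineq], rule add_mono)
     show "\<bar>fst q * avg Y (%y. (nu y - 1) * ((\<Sum>p\<leftarrow>ps. fst p * snd p y) ^ i * prod_list (map (%D. D y) (snd q # Ds))))\<bar> <= real T ^ i * et"
      using Suc.IH[of "snd q # Ds"] q Suc.prems by (auto simp: abs_mult)
    qed (use Cons in auto)
    finally show ?case by (simp add: algebra_simps)
   qed
   from this[of ps] show ?case using ps(1) by (simp add: mult.assoc)
  qed
  have nu_S: "\<bar>avg Y (%y. (nu y - 1) * S y ^ i)\<bar> <= M ^ i * et" for i
  proof -
   have "avg Y (%y. (nu y - 1) * S y ^ i) = avg Y (%y. ep ^ i * ((nu y - 1) * ((\<Sum>p\<leftarrow>ps. fst p * snd p y) ^ i * prod_list (map (%D. D y) []))))"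
    by (intro avg_cong) (simp add: S_def power_mult_distrib)
   also have "\<bar>\<dots>\<bar> <= ep ^ i * (real T ^ i * et)"
    unfolding avg_cmult abs_mult using ep by (intro mult_mono pw) auto
   finally show ?thesis by (simp add: M_def power_mult_distrib mult.assoc)
  qed
  have nu1: "avg Y nu <= 2"
  proof -
   show ?thesis using small[rule_format, of "[]"] et(2) by (simp add: avg_diff avg_const[OF Y])
  qed
  have "avg Y (%y. (nu y - 1) * max (S y) 0) <= 1/10 + 3/10"
  proof -
   define q where "q s = (\<Sum>i\<le>n. a i * s ^ i)" for s
   have "avg Y (%y. (nu y - 1) * max (S y) 0) = avg Y (%y. (nu y - 1) * q (S y) + (nu y - 1) * (max (S y) 0 - q (S y)))"
    by (intro avg_cong) (simp add: algebra_simps)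
   also have "... = avg Y (%y. (nu y - 1) * q (S y)) + avg Y (%y. (nu y - 1) * (max (S y) 0 - q (S y)))" by (rule avg_add)
   also have "... <= 1/10 + 3/10"
   proof (rule add_mono)
    have "avg Y (%y. (nu y - 1) * q (S y)) = (\<Sum>i\<le>n. a i * avg Y (%y. (nu y - 1) * S y ^ i))"
     unfolding avg_cmult[symmetric] avg_sum[symmetric] q_def by (intro avg_cong) (simp add: sum_distrib_left mult_ac)
    also have "... <= (\<Sum>i\<le>n. \<bar>a i\<bar> * (M ^ i * et))"
    proof (rule sum_mono)
     fix i
     have "a i * avg Y (%y. (nu y - 1) * S y ^ i) <= \<bar>a i * avg Y (%y. (nu y - 1) * S y ^ i)\<bar>" by simp
     also have "... <= \<bar>a i\<bar> * (M ^ i * et)" unfolding abs_mult by (intro mult_left_mono nu_S) simp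
     finally show "a i * avg Y (%y. (nu y - 1) * S y ^ i) <= \<bar>a i\<bar> * (M ^ i * et)" .
    qed
    also have "... = et * B" by (simp add: B_def sum_distrib_left mult_ac)
    finally show "avg Y (%y. (nu y - 1) * q (S y)) <= 1/10" using et(3) by simp
    have "avg Y (%y. (nu y - 1) * (max (S y) 0 - q (S y))) <= avg Y (%y. (nu y + 1) * (1/10))"
    proof (rule avg_mono)
     fix y assume y: "y \<in> Y"
     have "(nu y - 1) * (max (S y) 0 - q (S y)) <= \<bar>nu y - 1\<bar> * \<bar>max (S y) 0 - q (S y)\<bar>" by (simp add: abs_mult[symmetric])
     also have "... <= (nu y + 1) * (1/10)"
     proof (intro mult_mono)
      show "\<bar>nu y - 1\<bar> <= nu y + 1" "0 <= nu y + 1" using f y by auto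
      show "\<bar>max (S y) 0 - q (S y)\<bar> <= 1/10" using ap[OF SM[OF y]] by (simp add: q_def)
     qed simp
     finally show "(nu y - 1) * (max (S y) 0 - q (S y)) <= (nu y + 1) * (1/10)" .
    qed
    also have "... = (avg Y nu + 1) * (1/10)" unfolding avg_cmult_right avg_add avg_const[OF Y] ..
    finally show "avg Y (%y. (nu y - 1) * (max (S y) 0 - q (S y))) <= 3/10" using nu1 by simp
   qed
   finally show ?thesis .
  qed
  \<comment> \<open>On the positive part of S the function f may be raised to nu; then one copy of
    max S 0 is compared with the potential, from which it differs by at most 1/2.\<close>
  moreover have "val S <= avg Y (%y. (nu y - 1) * max (S y) 0) + 1/2"
  proof -
   have "val S <= avg Y (%y. (nu y - 1) * max (S y) 0 + 1/2)" unfolding val_def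
   proof (rule avg_mono)
    fix y assume y: "y \<in> Y"
    have "f y * S y <= f y * max (S y) 0" using f y by (intro mult_left_mono) auto
    also have "... <= nu y * max (S y) 0" using f y by (intro mult_right_mono) auto
    finally show "f y * S y - pot (S y) <= (nu y - 1) * max (S y) 0 + 1/2"
     using max_minus_pot_le[of "S y"] by (simp add: left_diff_distrib)
   qed
   thus ?thesis by (simp add: avg_add avg_const[OF Y])
  qed
  moreover have "2 <= val S"
  proof -
   show ?thesis using T ep v by (simp add: field_simps S_def[abs_def])
  qed
  ultimately show False by linarith
 qed
 show ?thesis by (rule exI[of _ et], rule conjI[OF et(1)]) (intro allI impI, rule main; assumption)
qed

section \<open>Dual functions modulo N\<close>

lemma bij_betw_PiE_coord:
 assumes "!!i. i \<in> I ==> bij_betw (g i) X X"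
 shows "bij_betw (%w. \<lambda>i\<in>I. g i (w i)) (PiE I (%_. X)) (PiE I (%_. X))"
proof (rule bij_betw_byWitness[where f' = "%w. \<lambda>i\<in>I. inv_into X (g i) (w i)"])
 have inj: "inj_on (g i) X" and im: "g i ` X = X" if "i \<in> I" for i using assms[OF that] by (auto simp: bij_betw_def)
 show "ALL w:PiE I (%_. X). (\<lambda>i\<in>I. inv_into X (g i) ((\<lambda>i\<in>I. g i (w i)) i)) = w"
  using inj by (auto simp: fun_eq_iff PiE_iff extensional_def restrict_def intro!: inv_into_f_f)
 show "ALL w:PiE I (%_. X). (\<lambda>i\<in>I. g i ((\<lambda>i\<in>I. inv_into X (g i) (w i)) i)) = w"
  using im by (auto simp: fun_eq_iff PiE_iff extensional_def restrict_def intro!: f_inv_into_f)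
 have in1: "g i a \<in> X" if "i \<in> I" "a \<in> X" for i a using im[OF that(1)] that(2) by auto
 have in2: "inv_into X (g i) a \<in> X" if "i \<in> I" "a \<in> X" for i a using im[OF that(1)] that(2) by (intro inv_into_into) auto
 show "(%w. \<lambda>i\<in>I. g i (w i)) ` PiE I (%_. X) \<subseteq> PiE I (%_. X)" using in1 by (auto simp: PiE_iff)
 show "(%w. \<lambda>i\<in>I. inv_into X (g i) (w i)) ` PiE I (%_. X) \<subseteq> PiE I (%_. X)" using in2 by (auto simp: PiE_iff)
qed

lemma avg_shift_mod: "N > 0 ==> avg (zN N) (%y. F ((y + a) mod int N)) = avg (zN N) F"
 by (rule avg_reindex[OF bij_shift_mod])

lemma avg_mult_mod: "N > 0 ==> coprime e (int N) ==> avg (zN N) (%y. F ((e * y) mod int N)) = avg (zN N) F"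
 by (rule avg_reindex[OF bij_mult_mod])

definition smod :: "nat => nat => (nat => int) => int" where
 "smod N r x = (\<Sum>i<r. x i) mod int N"

lemma sum_split_0: "r > 0 ==> (\<Sum>i<r. f i) = f 0 + (SUM i:{1..<r}. f i)" for f :: "nat => 'a::comm_monoid_add"
 using sum.atLeast_Suc_lessThan[of 0 r f] by (simp add: lessThan_atLeast0)

lemma mod_in_zN [simp]: "N > 0 ==> a mod int N \<in> zN N" by simp

lemma mod_diff_sum: "((a mod n) - (SUM i:I. f i mod n)) mod n = (a - (SUM i:I. f i)) mod (n::int)"
 using mod_diff_eq[of a n "SUM i:I. f i mod n"] mod_diff_eq[of a n "SUM i:I. f i"] mod_sum_eq[of f n I]
 by (metis mod_diff_left_eq)

lemma cube_zN: "N > 0 ==> finite (cube r (zN N))" "N > 0 ==> cube r (zN N) ~= {}"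
 by (auto intro!: finite_cube simp: PiE_eq_empty_iff)

lemma avg_smod:
 assumes "N > 0" "r > 0"
 shows "avg (cube r (zN N)) (%x. F (smod N r x)) = avg (zN N) F"
proof -
 have "avg (cube r (zN N)) (%x. F (smod N r x)) = avg (cube r (zN N)) (%x. avg (zN N) (%a. F (smod N r (x(0 := a)))))"
  by (rule avg_resample[symmetric]) (use assms in auto)
 also have "... = avg (cube r (zN N)) (%x. avg (zN N) F)"
  unfolding smod_def sum_split_0[OF assms(2)] by (rule avg_cong) (simp add: avg_shift_mod[OF assms(1)])
 also have "... = avg (zN N) F" by (rule avg_const) (rule cube_zN[OF assms(1)])+
 finally show ?thesis .
qed

text \<open>The average runs over the tuples with coordinate sum y; coordinate 0 is solved for and
  its entry in z is overwritten.\<close>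

definition dual :: "nat => nat => (nat => (nat => int) => real) => int => real" where
 "dual N r C y = avg (cube r (zN N)) (%z. \<Prod>i<r. C i (z(0 := (y - (SUM i:{1..<r}. z i)) mod int N)))"

definition ctest :: "nat => nat => (nat => (nat => int) => real) => bool" where
 "ctest N r B \<longleftrightarrow> (\<forall>i<r. indep {..<r} (zN N) i (B i) & (ALL x:cube r (zN N). 0 <= B i x & B i x <= 1))"

text \<open>Evaluated at the sum of x, a dual function is the average of a test function over
  translates of x by vectors of sum zero. Such translations act coordinatewise, so test functions
  stay test functions, and a product with duals is an average of ordinary test products. This gives
  the dense model theorem its closure under products.\<close>

lemma dual_product:
 assumes N: "N > 0" and r: "r > 0"
  and small: "!!B. ctest N r B ==> \<bar>avg (cube r (zN N)) (%x. h (smod N r x) * (\<Prod>i<r. B i x))\<bar> <= e"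
  and Cs: "ALL C:set Cs. ctest N r C" and B: "ctest N r B"
 shows "\<bar>avg (cube r (zN N)) (%x. h (smod N r x) * (\<Prod>i<r. B i x) * prod_list (map (%C. dual N r C (smod N r x)) Cs))\<bar> <= e"
 using Cs B
proof (induction Cs arbitrary: B)
 case Nil
 thus ?case using small by simp
next
 case (Cons C Cs)
 let ?Q = "cube r (zN N)"
 have fQ: "finite ?Q" "?Q ~= {}" using N by (auto intro!: finite_cube simp: PiE_eq_empty_iff)
 \<comment> \<open>Translation by w with coordinate 0 corrected so that the total shift is zero;
   \<open>smod\<close> does not change.\<close>
 define tr where "tr w x = (\<lambda>i\<in>{..<r}. (x i + (if i = 0 then - (SUM i:{1..<r}. w i) else w i)) mod int N)" for w x :: "nat => int"
 define P where "P x = prod_list (map (%C. dual N r C (smod N r x)) Cs)" for x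
 have tr_in: "tr w x \<in> ?Q" for w x using N by (simp add: tr_def)
 have du: "dual N r C (smod N r x) = avg ?Q (%w. \<Prod>i<r. C i (tr w x))" if x: "x \<in> ?Q" for x
 proof -
  have bij: "bij_betw (%w. \<lambda>i\<in>{..<r}. (w i + x i) mod int N) ?Q ?Q"
   using bij_betw_PiE_coord[of "{..<r}" "%i a. (a + x i) mod int N" "zN N"] bij_shift_mod[OF N] by simp
  show ?thesis unfolding dual_def
  proof (rule trans[OF avg_reindex[OF bij, symmetric]], rule avg_cong, rule prod.cong[OF refl])
   fix w i
   have "((\<lambda>i\<in>{..<r}. (w i + x i) mod int N)(0 := (smod N r x - (\<Sum>i = 1..<r. (\<lambda>i\<in>{..<r}. (w i + x i) mod int N) i)) mod int N)) = tr w x"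
   proof
    fix j
    have "(smod N r x - (\<Sum>i = 1..<r. (\<lambda>i\<in>{..<r}. (w i + x i) mod int N) i)) mod int N = ((\<Sum>i<r. x i) - (\<Sum>i = 1..<r. (w i + x i))) mod int N" by (simp add: smod_def mod_diff_sum)
    also have "... = (x 0 + - (SUM i:{1..<r}. w i)) mod int N" by (simp add: sum_split_0[OF r] sum.distrib)
    finally have *: "(smod N r x - (\<Sum>i = 1..<r. (\<lambda>i\<in>{..<r}. (w i + x i) mod int N) i)) mod int N = (x 0 + - (SUM i:{1..<r}. w i)) mod int N" .
    show "((\<lambda>i\<in>{..<r}. (w i + x i) mod int N)(0 := (smod N r x - (\<Sum>i = 1..<r. (\<lambda>i\<in>{..<r}. (w i + x i) mod int N) i)) mod int N)) j = tr w x j"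
     unfolding * using r by (simp add: tr_def add.commute)
   qed
   thus "C i ((\<lambda>i\<in>{..<r}. (w i + x i) mod int N)(0 := (smod N r x - (\<Sum>i = 1..<r. (\<lambda>i\<in>{..<r}. (w i + x i) mod int N) i)) mod int N)) = C i (tr w x)"
    by simp
  qed
 qed
 have ct: "ctest N r (%i x. B i x * C i (tr w x))" for w
  unfolding ctest_def
 proof (intro allI impI conjI ballI)
  fix i assume i: "i < r"
  have Bi: "indep {..<r} (zN N) i (B i)" "ALL x:?Q. 0 <= B i x & B i x <= 1" using Cons.prems(2) i by (auto simp: ctest_def)
  have Ci: "indep {..<r} (zN N) i (C i)" "ALL x:?Q. 0 <= C i x & C i x <= 1" using Cons.prems(1) i by (auto simp: ctest_def)
  have "C i (tr w (x(i := a))) = C i (tr w x)" if "x \<in> ?Q" "a \<in> zN N" for x a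
  proof -
   have "tr w (x(i := a)) = (tr w x)(i := (a + (if i = 0 then - (SUM i:{1..<r}. w i) else w i)) mod int N)"
    using i by (simp add: tr_def fun_eq_iff)
   thus ?thesis using indepD[OF Ci(1) tr_in, of "(a + (if i = 0 then - (SUM i:{1..<r}. w i) else w i)) mod int N" w x] N by simp
  qed
  thus "indep {..<r} (zN N) i (%x. B i x * C i (tr w x))" using Bi(1) by (simp add: indep_def)
  fix x assume x: "x \<in> ?Q"
  show "0 <= B i x * C i (tr w x)" "B i x * C i (tr w x) <= 1"
   using Bi(2) Ci(2) x tr_in[of w x] by (auto intro!: mult_nonneg_nonneg mult_le_one)
 qed
 have "avg ?Q (%x. h (smod N r x) * (\<Prod>i<r. B i x) * prod_list (map (%C. dual N r C (smod N r x)) (C # Cs)))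
   = avg ?Q (%x. avg ?Q (%w. h (smod N r x) * (\<Prod>i<r. B i x * C i (tr w x)) * P x))"
 proof (rule avg_cong)
  fix x assume x: "x \<in> ?Q"
  have "h (smod N r x) * (\<Prod>i<r. B i x) * prod_list (map (%C. dual N r C (smod N r x)) (C # Cs))
   = (h (smod N r x) * (\<Prod>i<r. B i x) * P x) * avg ?Q (%w. \<Prod>i<r. C i (tr w x))"
   by (simp add: du[OF x] P_def)
  also have "... = avg ?Q (%w. h (smod N r x) * (\<Prod>i<r. B i x * C i (tr w x)) * P x)"
   unfolding avg_cmult[symmetric] by (rule avg_cong) (simp add: prod.distrib)
  finally show "h (smod N r x) * (\<Prod>i<r. B i x) * prod_list (map (%C. dual N r C (smod N r x)) (C # Cs)) = ..." .
 qed
 also have "... = avg ?Q (%w. avg ?Q (%x. h (smod N r x) * (\<Prod>i<r. B i x * C i (tr w x)) * P x))" by (rule avg_swap)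
 also have "\<bar>\<dots>\<bar> <= e"
  by (rule avg_abs_le_const[OF fQ]) (unfold P_def, rule Cons.IH[OF _ ct], use Cons.prems(1) in auto)
 finally show ?case .
qed

lemma ctest_one: "ctest N r (%_ _. 1)"
 by (simp add: ctest_def indep_def)

lemma dual_product_uniform:
 assumes N: "N > 0" and r: "r > 0"
  and small: "!!B. ctest N r B ==> \<bar>avg (cube r (zN N)) (%x. h (smod N r x) * (\<Prod>i<r. B i x))\<bar> <= e"
  and Cs: "ALL C:set Cs. ctest N r C"
 shows "\<bar>avg (zN N) (%y. h y * prod_list (map (%C. dual N r C y) Cs))\<bar> <= e"
 using dual_product[OF N r small Cs ctest_one] avg_smod[OF N r, of "%y. h y * prod_list (map (%C. dual N r C y) Cs)"]
 by simp

lemma avg_dual: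
 assumes N: "N > 0" and r: "r > 0"
 shows "avg (zN N) (%y. h y * dual N r B y) = avg (cube r (zN N)) (%x. h (smod N r x) * (\<Prod>i<r. B i x))"
proof -
 let ?Q = "cube r (zN N)"
 have "avg (zN N) (%y. h y * dual N r B y)
   = avg ?Q (%z. avg (zN N) (%y. h y * (\<Prod>i<r. B i (z(0 := (y - (SUM i:{1..<r}. z i)) mod int N)))))"
  unfolding dual_def avg_cmult[symmetric] by (rule avg_swap)
 also have "... = avg ?Q (%z. avg (zN N) (%a. h (smod N r (z(0 := a))) * (\<Prod>i<r. B i (z(0 := a)))))"
 proof (rule avg_cong)
  fix z assume "z \<in> ?Q"
  define s where "s = (SUM i:{1..<r}. z i)"
  have "avg (zN N) (%y. h y * (\<Prod>i<r. B i (z(0 := (y - s) mod int N))))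
   = avg (zN N) (%a. h ((a + s) mod int N) * (\<Prod>i<r. B i (z(0 := ((a + s) mod int N - s) mod int N))))"
   by (rule avg_shift_mod[OF N, symmetric])
  also have "... = avg (zN N) (%a. h (smod N r (z(0 := a))) * (\<Prod>i<r. B i (z(0 := a))))"
   by (rule avg_cong) (simp add: mod_simps smod_def sum_split_0[OF r] s_def)
  finally show "avg (zN N) (%y. h y * (\<Prod>i<r. B i (z(0 := (y - (SUM i:{1..<r}. z i)) mod int N)))) = ..."
   by (simp only: s_def)
 qed
 also have "... = avg ?Q (%x. h (smod N r x) * (\<Prod>i<r. B i x))"
  by (rule avg_resample) (use N r in auto)
 finally show ?thesis .
qed

text \<open>The forms entering the Gowers norm that controls \<open>nu - 1\<close>.\<close>

definition sum_lfc :: "nat => nat => (int => real) => real => bool" where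
 "sum_lfc N r nu et \<longleftrightarrow> (\<forall>S\<subseteq>Pow {..<r}. \<bar>avg (cube r (zN N)) (%x. avg (cube r (zN N)) (%y. PROD om:S. nu (smod N r (mix om x y)))) - 1\<bar> <= et)"

text \<open>The test functions are bounded by 1, so Gowers-Cauchy-Schwarz runs with trivial
  majorants and a one-point parameter space; the last average is again an alternating expansion with
  cancelling signs.\<close>

lemma sum_lfc_small:
 assumes N: "N > 0" and l: "sum_lfc N r nu et" and ep: "ep >= 0" "2 ^ (2 ^ r) * et <= 2 * ep ^ (2 ^ r)" and B: "ctest N r B"
 shows "\<bar>avg (cube r (zN N)) (%x. (nu (smod N r x) - 1) * (\<Prod>i<r. B i x))\<bar> <= 2 * ep"
proof -
 let ?Q = "cube r (zN N)"
 have fQ: "finite ?Q" "?Q ~= {}" using N by (auto intro!: finite_cube simp: PiE_eq_empty_iff)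
 have "\<bar>avg {()} (%p. avg ?Q (%x. (nu (smod N r x) - 1) * (\<Prod>i<r. B i x)))\<bar> <= 2 * ep"
 proof (rule gowers_cauchy_schwarz[where V = "%_ _ _. 1"])
  show "avg {()} (%p. avg ?Q (%x. avg ?Q (%y. PROD om:Pow D. 1))) <= 2" for D :: "nat set"
   using fQ by (simp add: avg_const)
  define A where "A = Pow {..<r}"
  have fA: "finite A" "A ~= {}" by (auto simp: A_def)
  have "avg {()} (%p. avg ?Q (%x. avg ?Q (%y. (PROD om:Pow {..<r}. nu (smod N r (mix om x y)) - 1) * (\<Prod>j<r. PROD om:Pow ({..<r} - {j}). 1))))
   = avg ?Q (%x. avg ?Q (%y. PROD om:A. nu (smod N r (mix om x y)) + -1))"
   by (simp add: avg_const A_def)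
  also have "... = avg ?Q (%x. avg ?Q (%y. SUM S:Pow A. (-1) ^ card (A - S) * (PROD om:S. nu (smod N r (mix om x y)))))"
   by (subst prod_add[OF fA(1)]) (simp add: mult.commute)
  also have "... = (SUM S:Pow A. (-1) ^ card (A - S) * avg ?Q (%x. avg ?Q (%y. PROD om:S. nu (smod N r (mix om x y)))))"
   by (simp only: avg_sum avg_cmult)
  also have "... = (SUM S:Pow A. (-1) ^ card (A - S) * (avg ?Q (%x. avg ?Q (%y. PROD om:S. nu (smod N r (mix om x y)))) - 1))"
   using alternating_Pow_sum[OF fA] by (simp add: right_diff_distrib sum_subtractf)
  also have "\<bar>\<dots>\<bar> <= (SUM S:Pow A. et)"
   using l unfolding sum_lfc_def A_def by (intro order_trans[OF sum_abs] sum_mono) (simp add: abs_mult)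
  also have "... <= 2 * ep ^ (2 ^ card {..<r})" using ep(2) by (simp add: A_def card_Pow)
  finally show "\<bar>avg {()} (%p. avg ?Q (%x. avg ?Q (%y. (PROD om:Pow {..<r}. nu (smod N r (mix om x y)) - 1) * (\<Prod>j<r. PROD om:Pow ({..<r} - {j}). 1))))\<bar> <= ..." .
 qed (use N ep B in \<open>auto simp: ctest_def indep_def\<close>)
 thus ?thesis by (simp add: avg_const)
qed

section \<open>The forms of a k-term progression\<close>

definition psi :: "nat => nat => nat => (nat => int) => int" where
 "psi N k j x = (\<Sum>i<k. (int i - int j) * x i) mod int N"

text \<open>The coefficient of x j is j - j = 0. This places the weight of the j-th term on the
  hypergraph edges that avoid the j-th vertex class.\<close>

lemma psi_upd: "j < k ==> psi N k j (x(j := a)) = psi N k j x"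
 unfolding psi_def by (rule arg_cong[of _ _ "%s. s mod int N"], rule sum.cong) auto

lemma psi_indep: "j < k ==> indep {..<k} X j (%x. F (psi N k j x))"
 by (simp add: indep_def psi_upd)

lemma mod_mult_inv:
 assumes "(c * c') mod n = 1 mod (n::int)" "0 <= x" "x < n" shows "(c * ((c' * x) mod n)) mod n = x"
proof -
 have "(c * ((c' * x) mod n)) mod n = ((c * c') mod n * x) mod n" by (simp add: mod_simps mult.assoc)
 also have "... = x mod n" unfolding assms(1) by (simp add: mod_simps)
 finally show ?thesis using assms by simp
qed

text \<open>Fix x j = a and rescale every other coordinate by the inverse of i - j, which exists
  because N is coprime to k!. The form becomes a plain sum of k - 1 coordinates and the test
  functions remain test functions, so one estimate for sums serves all k forms.\<close>

lemma cutsmall_psi: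
 assumes N: "N > 0" and j: "j < k" and cop: "coprime N (fact k)"
  and small: "!!B. ctest N (k - 1) B ==> \<bar>avg (cube (k - 1) (zN N)) (%x. h (smod N (k - 1) x) * (\<Prod>i<k - 1. B i x))\<bar> <= e"
 shows "cutsmall (zN N) k j (%x. h (psi N k j x)) e"
 unfolding cutsmall_def
proof (intro allI impI)
 fix F assume F: "ALL i:{..<k} - {j}. indep {..<k} (zN N) i (F i) & (ALL x:cube k (zN N). 0 <= F i x & F i x <= 1)"
 define r where "r = k - 1"
 have k: "k = Suc r" using j by (simp add: r_def)
 define c where "c i = int i - int j" for i
 have "EX d. (c i * d) mod int N = 1 mod int N" if i: "i < k" "i ~= j" for i
 proof -
  have "nat \<bar>c i\<bar> dvd fact k" by (rule dvd_fact) (use i j in \<open>auto simp: c_def\<close>)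
  hence "coprime (nat \<bar>c i\<bar>) N" using cop by (metis coprime_commute coprime_divisors dvd_refl)
  hence "coprime (c i) (int N)" by simp
  from cong_solve_coprime_int[OF this] show ?thesis by (simp add: cong_def)
 qed
 then obtain iv where iv: "!!i. i < k ==> i ~= j ==> (c i * iv i) mod int N = 1 mod int N" by metis
 define si where "si i = (if i < j then i else Suc i)" for i
 define ta where "ta i = (if i < j then i else i - 1)" for i
 have tasi: "ta (si i) = i" and sij: "si i ~= j" for i by (auto simp: si_def ta_def)
 have sita: "si (ta i) = i" if "i ~= j" for i using that by (auto simp: si_def ta_def)
 have sik: "si i < k" if "i < r" for i using that by (simp add: si_def k)
 have tar: "ta i < r" if "i < k" "i ~= j" for i using that j by (auto simp: ta_def k)
 have sib: "bij_betw si {..<r} ({..<k} - {j})"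
  by (rule bij_betw_byWitness[where f' = ta]) (use tasi sita sij sik in \<open>auto intro: tar\<close>)
 \<comment> \<open>\<open>si\<close> and \<open>ta\<close> enumerate the indices other than j by 0,
   ..., r - 1 and back; E inserts a at j and undoes the rescaling elsewhere.\<close>
 define E where "E a u = (\<lambda>i\<in>{..<k}. if i = j then a else (iv i * u (ta i)) mod int N)" for a :: int and u :: "nat => int"
 have E_in: "E a u \<in> cube k (zN N)" if "a \<in> zN N" for a u using that by (simp add: E_def)
 let ?Q = "cube r (zN N)"
 have bij: "bij_betw (%p. E (fst p) (snd p)) (zN N \<times> ?Q) (cube k (zN N))"
 proof (rule bij_betw_byWitness[where f' = "%x. (x j, \<lambda>i\<in>{..<r}. (c (si i) * x (si i)) mod int N)"])
  show "ALL p:zN N \<times> ?Q. (E (fst p) (snd p) j, \<lambda>i\<in>{..<r}. (c (si i) * E (fst p) (snd p) (si i)) mod int N) = p"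
  proof
   fix p assume p: "p \<in> zN N \<times> ?Q"
   obtain a u where au1: "p = (a, u)" by (rule prod.exhaust)
   have au: "p = (a, u)" "a \<in> zN N" "u \<in> ?Q" using au1 SigmaD1[OF p[unfolded au1]] SigmaD2[OF p[unfolded au1]] by -
   have "(\<lambda>i\<in>{..<r}. (c (si i) * E a u (si i)) mod int N) = u"
   proof (rule ext)
    fix i
    show "(\<lambda>i\<in>{..<r}. (c (si i) * E a u (si i)) mod int N) i = u i"
    proof (cases "i < r")
     case True
     have "u i \<in> zN N" by (rule PiE_mem[OF au(3)]) (simp add: True)
     hence "(c (si i) * ((iv (si i) * u i) mod int N)) mod int N = u i"
      by (intro mod_mult_inv iv sik True sij) auto
     moreover have "E a u (si i) = (iv (si i) * u i) mod int N"
      using sik[OF True] sij[of i] by (simp add: E_def tasi)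
     ultimately show ?thesis using True by simp
    next
     case False
     thus ?thesis using PiE_arb[OF au(3), of i] by simp
    qed
   qed
   thus "(E (fst p) (snd p) j, \<lambda>i\<in>{..<r}. (c (si i) * E (fst p) (snd p) (si i)) mod int N) = p"
    using j by (simp add: au(1) E_def)
  qed
  show "ALL x:cube k (zN N). E (fst (x j, \<lambda>i\<in>{..<r}. (c (si i) * x (si i)) mod int N)) (snd (x j, \<lambda>i\<in>{..<r}. (c (si i) * x (si i)) mod int N)) = x"
  proof
   fix x assume x: "x \<in> cube k (zN N)"
   have "E (x j) (\<lambda>i\<in>{..<r}. (c (si i) * x (si i)) mod int N) i = x i" for i
   proof (cases "i < k & i ~= j")
    case True
    hence "x i \<in> zN N" using PiE_mem[OF x, of i] by simp
    moreover have "(iv i * c i) mod int N = 1 mod int N" using iv[of i] True by (simp add: mult.commute)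
    ultimately have "(iv i * ((c i * x i) mod int N)) mod int N = x i" by (intro mod_mult_inv) auto
    moreover have "E (x j) v i = (iv i * v (ta i)) mod int N" for v using True by (simp add: E_def)
    moreover have "ta i < r" "si (ta i) = i" using True tar sita by auto
    ultimately show ?thesis by simp
   next
    case False
    thus ?thesis using PiE_arb[OF x, of i] by (simp add: E_def)
   qed
   thus "E (fst (x j, \<lambda>i\<in>{..<r}. (c (si i) * x (si i)) mod int N)) (snd (x j, \<lambda>i\<in>{..<r}. (c (si i) * x (si i)) mod int N)) = x"
    by auto
  qed
  show "(%p. E (fst p) (snd p)) ` (zN N \<times> ?Q) \<subseteq> cube k (zN N)"
  proof (rule image_subsetI)
   fix p assume "p \<in> zN N \<times> ?Q"
   hence "fst p \<in> zN N" by (simp only: mem_Times_iff)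
   thus "E (fst p) (snd p) \<in> cube k (zN N)" by (rule E_in)
  qed
  show "(%x. (x j, \<lambda>i\<in>{..<r}. (c (si i) * x (si i)) mod int N)) ` cube k (zN N) \<subseteq> zN N \<times> ?Q"
  proof (intro image_subsetI SigmaI)
   fix x assume x: "x \<in> cube k (zN N)"
   show "x j \<in> zN N" by (rule PiE_mem[OF x]) (simp add: j)
   show "(\<lambda>i\<in>{..<r}. (c (si i) * x (si i)) mod int N) \<in> ?Q" using N by auto
  qed
 qed
 have ps: "psi N k j (E a u) = smod N r u" for a u
 proof -
  have "psi N k j (E a u) = (SUM i:{..<k} - {j}. c i * ((iv i * u (ta i)) mod int N)) mod int N"
   unfolding psi_def using j by (subst sum.remove[of _ j]) (auto simp: E_def c_def intro!: arg_cong2[of _ _ _ _ "(mod)"] sum.cong)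
  also have "... = (SUM i:{..<k} - {j}. (c i * ((iv i * u (ta i)) mod int N)) mod int N) mod int N" by (rule mod_sum_eq[symmetric])
  also have "... = (SUM i:{..<k} - {j}. u (ta i) mod int N) mod int N"
  proof (rule arg_cong2[of _ _ _ _ "(mod)"], rule sum.cong)
   fix i assume "i \<in> {..<k} - {j}"
   hence *: "(c i * iv i) mod int N = 1 mod int N" using iv by auto
   have "(c i * ((iv i * u (ta i)) mod int N)) mod int N = ((c i * iv i) mod int N * u (ta i)) mod int N"
    by (simp add: mod_simps mult.assoc)
   thus "(c i * ((iv i * u (ta i)) mod int N)) mod int N = u (ta i) mod int N" unfolding * by (simp add: mod_simps)
  qed auto
  also have "... = (SUM i:{..<k} - {j}. u (ta i)) mod int N" by (rule mod_sum_eq)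
  also have "(SUM i:{..<k} - {j}. u (ta i)) = (\<Sum>i<r. u i)"
   using sum.reindex_bij_betw[OF sib, of "%i. u (ta i)"] by (simp add: tasi)
  finally show ?thesis by (simp add: smod_def)
 qed
 have ct: "ctest N r (%i u. F (si i) (E a u))" if a: "a \<in> zN N" for a
  unfolding ctest_def
 proof (intro allI impI conjI ballI)
  fix i assume i: "i < r"
  have Fi: "indep {..<k} (zN N) (si i) (F (si i))" "ALL x:cube k (zN N). 0 <= F (si i) x & F (si i) x <= 1"
   using F sik[OF i] sij[of i] by auto
  have "F (si i) (E a (u(i := b))) = F (si i) (E a u)" for u b
  proof -
   have "E a (u(i := b)) = (E a u)(si i := (iv (si i) * b) mod int N)"
   proof
    fix l show "E a (u(i := b)) l = ((E a u)(si i := (iv (si i) * b) mod int N)) l"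
     using sik[OF i] sij[of i] tasi[of i] sita[of l] by (auto simp: E_def)
   qed
   thus ?thesis using indepD[OF Fi(1) E_in[OF a], of "(iv (si i) * b) mod int N" u] N by simp
  qed
  thus "indep {..<r} (zN N) i (%u. F (si i) (E a u))" by (simp add: indep_def)
  fix u show "0 <= F (si i) (E a u)" "F (si i) (E a u) <= 1" using Fi(2) E_in[OF a] by auto
 qed
 have "avg (cube k (zN N)) (%x. h (psi N k j x) * (PROD i:{..<k} - {j}. F i x))
   = avg (zN N \<times> ?Q) (%p. h (smod N r (snd p)) * (PROD i:{..<k} - {j}. F i (E (fst p) (snd p))))"
  by (subst avg_reindex[OF bij, symmetric]) (simp add: ps)
 also have "... = avg (zN N) (%a. avg ?Q (%u. h (smod N r u) * (\<Prod>i<r. F (si i) (E a u))))"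
  unfolding avg_Times by (simp add: prod.reindex_bij_betw[OF sib, symmetric])
 also have "\<bar>\<dots>\<bar> <= e"
  by (rule avg_abs_le_const) (use N small[folded r_def, OF ct] in auto)
 finally show "\<bar>avg (cube k (zN N)) (%x. h (psi N k j x) * (PROD i:{..<k} - {j}. F i x))\<bar> <= e" .
qed

lemma mod_lin_right: "(A + i * (B mod N)) mod N = (A + i * B) mod (N::int)"
 by (metis mod_add_right_eq mod_mult_right_eq)

text \<open>The values of the forms at x are y + j d with y the sum of i * x i and d minus the sum
  of the x i. Resampling the coordinates 0 and 1 alone already makes the pair (y, d)
  uniform.\<close>

lemma avg_psi_AP:
 assumes N: "N > 0" and k: "k >= 2"
 shows "avg (cube k (zN N)) (%x. \<Prod>j<k. G (psi N k j x)) = avg (zN N) (%y. avg (zN N) (%d. \<Prod>j<k. G ((y + int j * d) mod int N)))"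
proof -
 let ?X = "zN N" and ?Q = "cube k (zN N)"
 have "avg ?Q (%x. \<Prod>j<k. G (psi N k j x)) = avg ?Q (%x. avg ?X (%b. \<Prod>j<k. G (psi N k j (x(1 := b)))))"
  by (rule avg_resample[symmetric]) (use N k in auto)
 also have "... = avg ?Q (%x. avg ?X (%a. avg ?X (%b. \<Prod>j<k. G (psi N k j (x(0 := a, 1 := b))))))"
  by (rule avg_resample[symmetric]) (use N k in auto)
 also have "... = avg ?Q (%x. avg ?X (%y. avg ?X (%d. \<Prod>j<k. G ((y + int j * d) mod int N))))"
 proof (rule avg_cong)
  fix x assume "x \<in> ?Q"
  define s where "s = (SUM i:{2..<k}. int i * x i)"
  define t where "t = (SUM i:{2..<k}. x i)"
  have ps: "psi N k j (x(0 := a, 1 := b)) = (b + s + int j * (- a - b - t)) mod int N" for j a b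
  proof -
   have "{..<k} = insert 0 (insert 1 {2..<k})" using k by auto
   hence "(\<Sum>i<k. (int i - int j) * (x(0 := a, 1 := b)) i) = (0 - int j) * a + ((1 - int j) * b + (SUM i:{2..<k}. (int i - int j) * x i))"
    by simp
   also have "(SUM i:{2..<k}. (int i - int j) * x i) = s - int j * t"
    by (simp add: s_def t_def left_diff_distrib sum_subtractf sum_distrib_left)
   also have "(0 - int j) * a + ((1 - int j) * b + (s - int j * t)) = b + s + int j * (- a - b - t)" by (simp add: algebra_simps)
   finally show ?thesis unfolding psi_def by (rule arg_cong)
  qed
  have "avg ?X (%a. avg ?X (%b. \<Prod>j<k. G (psi N k j (x(0 := a, 1 := b)))))
   = avg ?X (%b. avg ?X (%a. \<Prod>j<k. G ((b + s + int j * (- a - b - t)) mod int N)))"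
   unfolding ps by (rule avg_swap)
  also have "... = avg ?X (%b. avg ?X (%d. \<Prod>j<k. G ((b + s + int j * d) mod int N)))"
  proof (rule avg_cong)
   fix b assume "b \<in> ?X"
   have "avg ?X (%d. \<Prod>j<k. G ((b + s + int j * d) mod int N))
    = avg ?X (%d. \<Prod>j<k. G ((b + s + int j * ((d + (- b - t)) mod int N)) mod int N))"
    by (rule avg_shift_mod[OF N, symmetric])
   also have "... = avg ?X (%a. \<Prod>j<k. G ((b + s + int j * (((-1 * a) mod int N + (- b - t)) mod int N)) mod int N))"
    by (rule avg_mult_mod[OF N, symmetric]) simp
   also have "... = avg ?X (%a. \<Prod>j<k. G ((b + s + int j * (- a - b - t)) mod int N))"
   proof (rule avg_cong, rule prod.cong[OF refl])
    fix a :: int and j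
    have "(b + s + int j * (((-1 * a) mod int N + (- b - t)) mod int N)) mod int N = (b + s + int j * (- a + (- b - t))) mod int N"
     by (simp only: mod_lin_right mod_add_left_eq) simp
    thus "G ((b + s + int j * (((-1 * a) mod int N + (- b - t)) mod int N)) mod int N) = G ((b + s + int j * (- a - b - t)) mod int N)"
     by (simp add: algebra_simps)
   qed
   finally show "avg ?X (%a. \<Prod>j<k. G ((b + s + int j * (- a - b - t)) mod int N)) = avg ?X (%d. \<Prod>j<k. G ((b + s + int j * d) mod int N))" ..
  qed
  also have "... = avg ?X (%b. avg ?X (%d. \<Prod>j<k. G (((b + s) mod int N + int j * d) mod int N)))"
   by (simp add: mod_simps)
  also have "... = avg ?X (%y. avg ?X (%d. \<Prod>j<k. G ((y + int j * d) mod int N)))"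
   by (rule avg_shift_mod[OF N])
  finally show "avg ?X (%a. avg ?X (%b. \<Prod>j<k. G (psi N k j (x(0 := a, 1 := b))))) = ..." .
 qed
 also have "... = avg ?X (%y. avg ?X (%d. \<Prod>j<k. G ((y + int j * d) mod int N)))"
  by (rule avg_const) (rule cube_zN[OF N])+
 finally show ?thesis .
qed

text \<open>The level set where g is at least de/2 has density at least de/2, and each progression
  inside it has weight at least (de/2)^k.\<close>

lemma Varnavides_functional:
 assumes k: "k > 0" and de: "de > (0::real)"
 shows "\<exists>c>0. \<exists>Q>0. ALL N g. N > 0 --> coprime N Q --> (ALL y:zN N. 0 <= g y & g y <= 1) --> de <= avg (zN N) g -->
  c <= avg (zN N) (%y. avg (zN N) (%d. \<Prod>j<k. g ((y + int j * d) mod int N)))"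
proof -
 have d2: "de / 2 > 0" using de by simp
 from Szemeredi_Varnavides[OF k d2] obtain c Q where c: "c > 0" "Q > 0" and
  S: "!!N S. N > 0 ==> coprime N Q ==> S \<subseteq> zN N ==> de / 2 * real N <= card S ==>
   c * real N ^ 2 <= (SUM y:zN N. SUM d:zN N. of_bool (\<forall>j<k. (y + int j * d) mod int N \<in> S))" by blast
 show ?thesis
 proof (intro exI[of _ "c * (de/2) ^ k"] exI[of _ Q] conjI allI impI)
  fix N and g :: "int => real"
  assume N: "N > 0" "coprime N Q" and g: "ALL y:zN N. 0 <= g y & g y <= 1" and av: "de <= avg (zN N) g"
  define S where "S = {y\<in>zN N. g y >= de/2}"
  let ?A = "SUM y:zN N. SUM d:zN N. of_bool (\<forall>j<k. (y + int j * d) mod int N \<in> S)"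
  let ?B = "SUM y:zN N. SUM d:zN N. \<Prod>j<k. g ((y + int j * d) mod int N)"
  have "de * N <= (SUM y:zN N. g y)" using av N by (simp add: avg_def field_simps)
  also have "... <= (SUM y:zN N. de/2 + of_bool (y \<in> S))"
  proof (rule sum_mono)
   fix y assume y: "y \<in> zN N"
   hence "g y <= 1" using g by simp
   thus "g y <= de/2 + of_bool (y \<in> S)" using y de by (cases "y \<in> S") (auto simp: S_def)
  qed
  also have "... = de/2 * N + card S"
  proof -
   have "(SUM y:zN N. of_bool (y \<in> S) :: real) = card S"
    by (subst sum.mono_neutral_right[of "zN N" S]) (auto simp: S_def)
   thus ?thesis by (simp add: sum.distrib)
  qed
  finally have "de / 2 * N <= card S" by simp
  hence "c * real N ^ 2 <= ?A"
   by (intro S[OF N]) (auto simp: S_def)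
  moreover have "(de/2) ^ k * of_bool (\<forall>j<k. (y + int j * d) mod int N \<in> S) <= (\<Prod>j<k. g ((y + int j * d) mod int N))" for y d
  proof (cases "\<forall>j<k. (y + int j * d) mod int N \<in> S")
   case True
   have "(\<Prod>j<k. de/2) <= (\<Prod>j<k. g ((y + int j * d) mod int N))"
    using True de by (intro prod_mono) (auto simp: S_def)
   thus ?thesis using True by simp
  next
   case False
   have "0 <= (\<Prod>j<k. g ((y + int j * d) mod int N))" using g N by (intro prod_nonneg) auto
   with False show ?thesis by auto
  qed
  hence "(de/2) ^ k * ?A <= ?B"
   unfolding sum_distrib_left by (intro sum_mono)
  ultimately have "(de/2) ^ k * (c * real N ^ 2) <= ?B"
   by (meson mult_left_mono order_trans d2 less_imp_le zero_le_power)
  thus "c * (de/2) ^ k <= avg (zN N) (%y. avg (zN N) (%d. \<Prod>j<k. g ((y + int j * d) mod int N)))"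
   using N by (simp add: avg_def sum_divide_distrib[symmetric] power2_eq_square field_simps)
 qed (use c de in auto)
qed

text \<open>The Green-Tao relative Szemeredi theorem, with the linear forms condition of
 Conlon, Fox and Zhao.\<close>

theorem relative_Szemeredi:
 assumes k: "k >= 2" and de: "de > (0::real)"
 shows "\<exists>c>0. \<exists>et>0. \<exists>Q>0. ALL N nu f. N > 0 --> coprime N Q -->
  lfc (zN N) k (%j x. nu (psi N k j x)) et --> sum_lfc N (k - 1) nu et -->
  (ALL y:zN N. 0 <= f y & f y <= nu y) --> de <= avg (zN N) f -->
  c <= avg (zN N) (%y. avg (zN N) (%d. \<Prod>j<k. f ((y + int j * d) mod int N)))"
proof -
 define r where "r = k - 1"
 have r: "r > 0" using k by (simp add: r_def)
 have k0: "k > 0" and d2: "de / 2 > 0" using k de by auto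
 obtain c Q where c: "c > 0" and Q: "Q > 0" and V: "ALL N g. N > 0 --> coprime N Q --> (ALL y:zN N. 0 <= g y & g y <= 1) --> de / 2 <= avg (zN N) g -->
  c <= avg (zN N) (%y. avg (zN N) (%d. \<Prod>j<k. g ((y + int j * d) mod int N)))"
  using Varnavides_functional[OF k0 d2] by auto
 have c2: "c / 2 > 0" using c by simp
 obtain ep et1 where e: "ep > 0" "et1 > 0" and cl: "\<forall>(X::int set) nu f g T. card T = k --> cnt_hyp X k nu f g T ep et1 -->
   \<bar>avg (cube k X) (%x. \<Prod>j<k. f j x) - avg (cube k X) (%x. \<Prod>j<k. g j x)\<bar> <= c / 2"
  using counting_lemma[OF c2, of k k] by auto
 \<comment> \<open>Small enough for the counting lemma, and at most de/2, so that testing against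
   the constant 1 leaves the model with mean at least de/2.\<close>
 define ep' where "ep' = min ep (de / 2)"
 have e': "ep' > 0" "ep' <= ep" "ep' <= de / 2" using e de by (auto simp: ep'_def)
 obtain et2 where e2: "et2 > 0" and dm: "\<forall>(Y :: int set) nu f DD. finite Y --> Y ~= {} --> (ALL y:Y. 0 <= f y & f y <= nu y) -->
   (ALL D:DD. ALL y:Y. 0 <= D y & D y <= 1) -->
   (ALL Ds. set Ds \<subseteq> DD --> \<bar>avg Y (%y. (nu y - 1) * prod_list (map (%D. D y) Ds))\<bar> <= et2) -->
   (EX g. (ALL y:Y. 0 <= g y & g y <= 1) & (ALL D:DD. \<bar>avg Y (%y. (f y - g y) * D y)\<bar> <= ep'))"
  using dense_model[OF e'(1)] by (elim exE conjE)
 \<comment> \<open>Solved from the hypothesis of \<open>sum_lfc_small\<close> with ep = et2/2, whose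
   conclusion is then the bound et2 that the dense model asks for.\<close>
 define et3 where "et3 = 2 * (et2 / 2) ^ (2 ^ r) / 2 ^ (2 ^ r)"
 define et where "et = min et1 et3"
 have eta: "et > 0" "et <= et1" "et <= et3" using e e2 by (auto simp: et3_def et_def)
 have "c / 2 <= avg (zN N) (%y. avg (zN N) (%d. \<Prod>j<k. f ((y + int j * d) mod int N)))"
  if N: "N > 0" and cop: "coprime N (Q * fact k)" and l1: "lfc (zN N) k (%j x. nu (psi N k j x)) et" and l2: "sum_lfc N (k - 1) nu et"
   and f: "ALL y:zN N. 0 <= f y & f y <= nu y" and av: "de <= avg (zN N) f" for N nu f
 proof -
  have X: "finite (zN N)" "zN N ~= {}" using N by auto
  define DD where "DD = dual N r ` {B. ctest N r B}"
  have small: "\<bar>avg (cube r (zN N)) (%x. (nu (smod N r x) - 1) * (\<Prod>i<r. B i x))\<bar> <= et2" if "ctest N r B" for B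
  proof -
   have "2 ^ (2 ^ r) * et <= 2 * (et2 / 2) ^ (2 ^ r)" using eta(3) by (simp add: et3_def field_simps)
   thus ?thesis using sum_lfc_small[OF N l2[folded r_def] _ _ that, of "et2 / 2"] e2 by simp
  qed
  have "EX g. (ALL y:zN N. 0 <= g y & g y <= 1) & (ALL D:DD. \<bar>avg (zN N) (%y. (f y - g y) * D y)\<bar> <= ep')"
  proof (rule dm[rule_format, OF X])
   show "0 <= f y & f y <= nu y" if "y \<in> zN N" for y using f that by simp
   show "0 <= D y & D y <= 1" if D: "D \<in> DD" and y: "y \<in> zN N" for D y
   proof -
    obtain B where B: "ctest N r B" "D = dual N r B" using D by (auto simp: DD_def)
    have "z(0 := (y - (SUM i:{1..<r}. z i)) mod int N) \<in> cube r (zN N)" if "z \<in> cube r (zN N)" for z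
     by (rule upd_in_PiE[OF that]) (use r N in auto)
    hence "0 <= (\<Prod>i<r. B i (z(0 := (y - (SUM i:{1..<r}. z i)) mod int N)))" "(\<Prod>i<r. B i (z(0 := (y - (SUM i:{1..<r}. z i)) mod int N))) <= 1"
     if "z \<in> cube r (zN N)" for z
     using B(1) that unfolding ctest_def by (auto intro!: prod_nonneg prod_le_1)
    thus ?thesis unfolding B(2) dual_def by (intro conjI avg_nonneg avg_le_const cube_zN[OF N])
   qed
   show "\<bar>avg (zN N) (%y. (nu y - 1) * prod_list (map (%D. D y) Ds))\<bar> <= et2" if "set Ds \<subseteq> DD" for Ds
   proof -
    have "EX Bs. Ds = map (dual N r) Bs & (ALL B:set Bs. ctest N r B)"
     using that unfolding DD_def
    proof (induction Ds)
     case (Cons D Ds)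
     then obtain B Bs where "D = dual N r B" "ctest N r B" "Ds = map (dual N r) Bs" "ALL B:set Bs. ctest N r B" by auto
     thus ?case by (intro exI[of _ "B # Bs"]) auto
    qed auto
    then obtain Bs where Bs: "Ds = map (dual N r) Bs" "ALL B:set Bs. ctest N r B" by blast
    show ?thesis using dual_product_uniform[OF N r small Bs(2)] by (simp add: Bs(1) o_def)
   qed
  qed
  then obtain g where g: "ALL y:zN N. 0 <= g y & g y <= 1" and fg: "ALL D:DD. \<bar>avg (zN N) (%y. (f y - g y) * D y)\<bar> <= ep'"
   by auto
  have cut: "\<bar>avg (cube r (zN N)) (%x. (f (smod N r x) - g (smod N r x)) * (\<Prod>i<r. B i x))\<bar> <= ep'" if "ctest N r B" for B
   using fg that avg_dual[OF N r, of "%y. f y - g y" B] by (auto simp: DD_def)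
  have "de / 2 <= avg (zN N) g"
  proof -
   show ?thesis using cut[OF ctest_one] avg_smod[OF N r, of "%y. f y - g y"] av e'(3) by (simp add: avg_diff)
  qed
  moreover have copQ: "coprime N Q" and copk: "coprime N (fact k)" using cop by auto
  ultimately have cg: "c <= avg (zN N) (%y. avg (zN N) (%d. \<Prod>j<k. g ((y + int j * d) mod int N)))"
   using V N g by simp
  have pin: "psi N k j x \<in> zN N" for j x using N by (simp add: psi_def)
  \<comment> \<open>Every index is sparse here, so the counting lemma enters with a set T of full
    size k.\<close>
  have ch: "cnt_hyp (zN N) k (%j x. nu (psi N k j x)) (%j x. f (psi N k j x)) (%j x. g (psi N k j x)) {..<k} ep et1"
    unfolding cnt_hyp_def
   proof (intro conjI allI impI ballI X psi_indep lfc_mono[OF l1 eta(2)])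
    fix j assume j: "j < k"
    show "cutsmall (zN N) k j (%x. f (psi N k j x) - g (psi N k j x)) ep" using cutsmall_psi[OF N j copk, of "%y. f y - g y" ep'] cut e'(2) by (simp add: r_def cutsmall_mono)
    fix x assume "x \<in> cube k (zN N)"
    show "0 <= nu (psi N k j x)" using f pin[of j x] by (meson order_trans)
    show "0 <= f (psi N k j x)" "f (psi N k j x) <= (if j \<in> {..<k} then nu (psi N k j x) else 1)"
     "0 <= g (psi N k j x)" "g (psi N k j x) <= 1" using f g pin[of j x] j by auto
   qed auto
  have "\<bar>avg (cube k (zN N)) (%x. \<Prod>j<k. f (psi N k j x)) - avg (cube k (zN N)) (%x. \<Prod>j<k. g (psi N k j x))\<bar> <= c / 2"
   by (rule cl[THEN spec, THEN spec, THEN spec, THEN spec, THEN spec, THEN mp, THEN mp, OF _ ch]) simp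
  thus ?thesis using cg unfolding avg_psi_AP[OF N k] by linarith
 qed
 thus ?thesis
  using c2 eta(1) Q by (intro exI[of _ "c / 2"] conjI exI[of _ et] exI[of _ "Q * fact k"] allI impI) auto
qed

section \<open>The Selberg sieve as a pseudorandom majorant\<close>

abbreviation primes_le :: "nat => nat set" where
 "primes_le R \<equiv> {p. prime p & p <= R}"

lemma finite_primes_le: "finite (primes_le R)"
 by simp

text \<open>A squarefree integer is encoded by its set of prime factors; its Moebius value is then
  \<open>(-1) ^ card S\<close>, and sums over its divisors are sums over
  \<open>Pow S\<close>.\<close>

definition pprod :: "nat set => nat" where
 "pprod S = \<Prod>S"

lemma pprod_empty [simp]: "pprod {} = 1"
 by (simp add: pprod_def)

lemma pprod_insert: "finite S ==> p \<notin> S ==> pprod (insert p S) = p * pprod S"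
 by (simp add: pprod_def)

lemma prod_primes_pos: "ALL p:S. prime p ==> pprod S > 0"
 unfolding pprod_def by (induction S rule: infinite_finite_induct) (auto simp: prime_gt_0_nat)

lemma prime_dvd_prod_primes_iff:
 fixes S :: "nat set"
 assumes "finite S" "ALL p:S. prime p" "prime q"
 shows "q dvd pprod S \<longleftrightarrow> q \<in> S"
proof
 assume "q dvd pprod S"
 then obtain p where "p \<in> S" "q dvd p" using prime_dvd_prod_iff[OF assms(1,3), of "%x. x"] by (auto simp: pprod_def)
 thus "q \<in> S" using assms(2,3) primes_dvd_imp_eq by blast
qed (use assms dvd_prodI[of S q "%x. x"] in \<open>auto simp: pprod_def\<close>)

lemma prod_primes_inj: "inj_on pprod {S :: nat set. finite S & (ALL p:S. prime p)}"
proof (rule inj_onI)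
 fix S T :: "nat set"
 let ?A = "{S. finite S & (ALL p:S. prime p)}"
 assume S: "S \<in> ?A" and T: "T \<in> ?A" and eq: "pprod S = pprod T"
 have "q \<in> S \<longleftrightarrow> q \<in> T" for q
  using S T eq prime_dvd_prod_primes_iff[of S q] prime_dvd_prod_primes_iff[of T q] by auto
 thus "S = T" by blast
qed

lemma prod_primes_dvd_iff:
 fixes S :: "nat set"
 assumes "finite S" "ALL p:S. prime p"
 shows "pprod S dvd m \<longleftrightarrow> (ALL p:S. p dvd m)"
 using assms
proof (induction S)
 case (insert p S)
 have "coprime p (pprod S)"
  using insert prime_dvd_prod_primes_iff[of S p] by (intro prime_imp_coprime) auto
 thus ?case using insert divides_mult[of p m "pprod S"] by (auto simp: pprod_insert dest: dvd_mult_left dvd_mult_right)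
qed simp

lemma subsets_bounded_prod:
 fixes P :: "nat set"
 assumes "finite P" "ALL p:P. prime p"
 shows "inj_on pprod {S\<in>Pow P. pprod S <= (X::nat)}" "pprod ` {S\<in>Pow P. pprod S <= X} \<subseteq> {1..X}"
  "finite {S\<in>Pow P. pprod S <= X}"
proof -
 let ?A = "{S\<in>Pow P. pprod S <= X}"
 show "inj_on pprod ?A"
  by (rule inj_on_subset[OF prod_primes_inj]) (use assms finite_subset in auto)
 show "pprod ` ?A \<subseteq> {1..X}"
  using assms prod_primes_pos by (auto simp: Suc_le_eq subset_iff)
 show "finite ?A" using assms by auto
qed

lemma card_subsets_bounded_prod:
 fixes P :: "nat set"
 assumes "finite P" "ALL p:P. prime p" shows "card {S\<in>Pow P. pprod S <= (X::nat)} <= X"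
 using card_inj_on_le[OF subsets_bounded_prod(1,2)[OF assms, of X]] by simp

lemma sum_subsets_bounded_prod:
 fixes P :: "nat set"
 assumes "finite P" "ALL p:P. prime p" "!!n. F n >= (0::real)"
 shows "(SUM S:{S\<in>Pow P. pprod S <= X}. F (pprod S)) <= (SUM n:{1..X}. F n)"
proof -
 have "(SUM S:{S\<in>Pow P. pprod S <= X}. F (pprod S)) = (SUM n:pprod ` {S\<in>Pow P. pprod S <= X}. F n)"
  using sum.reindex[OF subsets_bounded_prod(1)[OF assms(1,2)], of F] by simp
 also have "... <= (SUM n:{1..X}. F n)" by (rule sum_mono2) (use subsets_bounded_prod(2)[OF assms(1,2)] assms(3) in auto)
 finally show ?thesis .
qed

lemma harm_le: "X >= 1 ==> harm X <= 1 + ln (X)"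
 using euler_mascheroni_sequence_decreasing[of 1 X] by (simp add: harm_def)

lemma sum_inverse_subsets:
 fixes P :: "nat set"
 assumes "finite P" "ALL p:P. prime p" "X >= 1"
 shows "(SUM S:{S\<in>Pow P. pprod S <= X}. 1 / (pprod S)) <= 1 + ln (X)"
proof -
 have "(SUM S:{S\<in>Pow P. pprod S <= X}. 1 / (pprod S)) <= (SUM n:{1..X}. 1 / n)"
  by (rule sum_subsets_bounded_prod) (use assms in auto)
 also have "... = harm X" by (simp add: harm_def inverse_eq_divide)
 finally show ?thesis using harm_le[OF assms(3)] by simp
qed

section \<open>Elementary Moebius sums\<close>

lemma moebius_sum:
 assumes "m >= 1" "m <= X" "X <= R"
 shows "(SUM S:{S\<in>Pow (primes_le R). pprod S <= X & pprod S dvd m}. (-1) ^ card S) = (of_bool (m = 1) :: real)"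
proof -
 have fin: "finite (primes_le R)" by simp
 have sub: "prime_factors m \<subseteq> primes_le R"
 proof
  fix p assume "p \<in> prime_factors m"
  hence "prime p" "p dvd m" by auto
  thus "p \<in> primes_le R" using assms dvd_imp_le[of p m] by simp
 qed
 let ?A = "{S\<in>Pow (primes_le R). pprod S <= X & pprod S dvd m}"
 have *: "?A = Pow (prime_factors m)"
 proof (intro Set.set_eqI iffI)
  fix S assume S: "S \<in> ?A"
  hence "finite S" "ALL p:S. prime p" using finite_subset[OF _ fin, of S] by auto
  thus "S \<in> Pow (prime_factors m)" using S assms by (auto simp: prod_primes_dvd_iff in_prime_factors_iff)
 next
  fix S assume S: "S \<in> Pow (prime_factors m)"
  hence "finite S" "ALL p:S. prime p" using finite_subset[of S "prime_factors m"] by auto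
  hence "pprod S dvd m" using S by (auto simp: prod_primes_dvd_iff)
  moreover hence "pprod S <= X" using assms dvd_imp_le[of "pprod S" m] by simp
  ultimately show "S \<in> ?A" using S sub by auto
 qed
 have "(SUM S:Pow (prime_factors m). (-1) ^ card S) = (of_bool (m = 1) :: real)"
 proof (cases "m = 1")
  case False
  hence "prime_factors m ~= {}" using assms prime_factorization_empty_iff[of m] by auto
  thus ?thesis using prod_add[of "prime_factors m" "%_. -1::real" "%_. 1"] False by (simp add: power_0_left)
 qed simp
 thus ?thesis unfolding * .
qed

text \<open>Collecting the terms with a given m = pprod S * j leaves a Moebius sum over the divisors
  of m, which vanishes unless m = 1. The choices F = 1 and F m = 1/m give the two identities behind
  \<open>moebius_log_sum\<close>.\<close>

lemma moebius_convolution: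
 fixes F :: "nat => real"
 assumes "1 <= X" "X <= R"
 shows "(SUM S:{S\<in>Pow (primes_le R). pprod S <= X}. (-1) ^ card S * (SUM j:{1..X div pprod S}. F (pprod S * j))) = F 1"
proof -
 let ?A = "{S\<in>Pow (primes_le R). pprod S <= X}"
 have fA: "finite ?A" by auto
 have conv: "(SUM j:{1..X div pprod S}. F (pprod S * j)) = (SUM m:{1..X}. of_bool (pprod S dvd m) * F m)" if S: "S \<in> ?A" for S
 proof -
  have pos: "pprod S > 0" using S by (intro prod_primes_pos) auto
  have "(SUM j:{1..X div pprod S}. F (pprod S * j)) = (SUM m:(%j. pprod S * j) ` {1..X div pprod S}. F m)"
   by (subst sum.reindex) (auto simp: inj_on_def)
  also have "(%j. pprod S * j) ` {1..X div pprod S} = {m\<in>{1..X}. pprod S dvd m}"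
  proof (intro Set.set_eqI iffI)
   fix m assume "m \<in> {m\<in>{1..X}. pprod S dvd m}"
   then obtain j where j: "m = pprod S * j" "1 <= m" "m <= X" by auto
   hence "1 <= j" "j <= X div pprod S" by (auto simp: less_eq_div_iff_mult_less_eq mult.commute)
   thus "m \<in> (%j. pprod S * j) ` {1..X div pprod S}" using j(1) by auto
  qed (use pos in \<open>auto simp: less_eq_div_iff_mult_less_eq mult.commute Suc_le_eq\<close>)
  also have "(SUM m:{m\<in>{1..X}. pprod S dvd m}. F m) = (SUM m:{1..X}. of_bool (pprod S dvd m) * F m)"
   unfolding sum.inter_filter[OF finite_atLeastAtMost] by (rule sum.cong) auto
  finally show ?thesis .
 qed
 have "(SUM S:?A. (-1) ^ card S * (SUM j:{1..X div pprod S}. F (pprod S * j))) = (SUM S:?A. SUM m:{1..X}. (-1) ^ card S * (of_bool (pprod S dvd m) * F m))"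
  by (rule sum.cong[OF refl]) (simp only: conv sum_distrib_left)
 also have "... = (SUM m:{1..X}. (SUM S:?A. of_bool (pprod S dvd m) * (-1) ^ card S) * F m)"
  unfolding sum_distrib_right by (subst sum.swap) (intro sum.cong refl, simp only: mult_ac)
 also have "... = (SUM m:{1..X}. of_bool (m = 1) * F m)"
 proof (rule sum.cong)
  fix m assume m: "m \<in> {1..X}"
  have "(SUM S:?A. of_bool (pprod S dvd m) * (-1) ^ card S :: real) = (SUM S:{S\<in>?A. pprod S dvd m}. (-1) ^ card S)"
   unfolding sum.inter_filter[OF fA] by (rule sum.cong) auto
  also have "{S\<in>?A. pprod S dvd m} = {S\<in>Pow (primes_le R). pprod S <= X & pprod S dvd m}" by auto
  finally show "(SUM S:?A. of_bool (pprod S dvd m) * (-1) ^ card S) * F m = of_bool (m = 1) * F m"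
   using moebius_sum[of m X R] m assms by simp
 qed simp
 also have "... = F 1" using assms(1) by simp
 finally show ?thesis .
qed

lemma harm_approx:
 assumes "z >= (1::real)"
 shows "\<bar>harm (nat \<lfloor>z\<rfloor>) - ln z - euler_mascheroni\<bar> <= 2 / z"
proof -
 define n where "n = nat \<lfloor>z\<rfloor>"
 have n: "n >= 1" "n <= z" "z < real n + 1" using assms by (auto simp: n_def le_nat_iff)
 define t where "t = harm n - ln ((Suc n))"
 have b0: "t + inverse ((2 * (n + 1))) <= euler_mascheroni" "euler_mascheroni <= t + inverse ((2 * n))"
  using euler_mascheroni_bounds[OF n(1)] by (auto simp: t_def)
 have "0 <= inverse ((2 * (n + 1)))" "inverse ((2 * n)) = 1 / (2 * real n)" by (auto simp: inverse_eq_divide)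
 hence b: "t <= euler_mascheroni" "euler_mascheroni <= t + 1 / (2 * real n)" using b0 by linarith+
 have l1: "ln z <= ln ((Suc n))" "ln (n) <= ln z" using n by auto
 have l2: "ln ((Suc n)) - ln (n) < 1 / n" using ln_diff_le_inverse[of "real n"] n by (simp add: add.commute)
 have "1 / (2 * real n) <= 1 / n" using n by (simp add: field_simps)
 hence "\<bar>harm n - ln z - euler_mascheroni\<bar> <= 1 / n" using b l1 l2 unfolding t_def by simp
 also have "... <= 2 / z"
 proof -
  have "0 < real n" "0 < z" "z <= 2 * real n" using n by auto
  thus ?thesis by (simp add: field_simps)
 qed
 finally show ?thesis by (simp add: n_def)
qed

text \<open>The logarithm of y/d is the harmonic number of X div d minus Euler's constant, up to 2
  d/y. The harmonic part sums to exactly 1, the constant contributes at most 2 because the Moebius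
  sum of 1/d is at most 2, and the errors contribute at most 2.\<close>

lemma moebius_log_sum:
 fixes y :: real
 assumes y: "1 <= y" "y <= R"
 shows "\<bar>SUM S:{S\<in>Pow (primes_le R). real (pprod S) <= y}. (-1) ^ card S / (pprod S) * ln (y / (pprod S))\<bar> <= 5"
proof -
 define X where "X = nat \<lfloor>y\<rfloor>"
 have X: "1 <= X" "X <= y" "y < real X + 1" using y by (auto simp: X_def le_nat_iff)
 have XR: "X <= R" using X y by simp
 have iff: "real n <= y \<longleftrightarrow> n <= X" for n using X by auto
 define A where "A = {S\<in>Pow (primes_le R). pprod S <= X}"
 have A: "{S\<in>Pow (primes_le R). (pprod S) <= y} = A" unfolding A_def iff ..
 have cA: "card A <= X" unfolding A_def by (rule card_subsets_bounded_prod) auto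
 have pos: "pprod S > 0" if "S \<in> A" for S using that by (intro prod_primes_pos) (auto simp: A_def)
 have divX: "nat \<lfloor>y / real d\<rfloor> = X div d" for d :: nat
 proof -
  have "\<lfloor>y\<rfloor> = int X" using y by (simp add: X_def)
  hence "\<lfloor>y / real_of_int (int d)\<rfloor> = int X div int d" by (simp only: floor_divide_real_eq_div[OF of_nat_0_le_iff])
  thus ?thesis by (simp add: zdiv_int[symmetric])
 qed
 let ?A = "SUM S:A. (-1) ^ card S / (pprod S)"
 let ?C = "SUM S:A. (-1) ^ card S / real (pprod S)"
 have m0: "\<bar>SUM S:A. (-1) ^ card S / (pprod S)\<bar> <= 2"
 proof -
  let ?B = "SUM S:A. (-1) ^ card S * real (X div pprod S)"
  have one: "?B = 1"
   using moebius_convolution[OF X(1) XR, of "%_. 1"] by (simp add: A_def)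
  have "real X * ?C - ?B
    = (SUM S:A. (-1) ^ card S * (real X / real (pprod S) - real (X div pprod S)))"
   by (simp add: sum_distrib_left sum_subtractf right_diff_distrib mult_ac)
  hence "\<bar>real X * ?A - 1\<bar> = \<bar>SUM S:A. (-1) ^ card S * (X / (pprod S) - (X div pprod S))\<bar>"
   unfolding one by simp
  also have "... <= (SUM S:A. 1)"
  proof (intro order_trans[OF sum_abs] sum_mono)
   fix S assume "S \<in> A"
   hence p: "pprod S > 0" by (rule pos)
   have "X / (pprod S) - (X div pprod S) = (X mod pprod S) / (pprod S)"
   proof -
    have "X = real (X div pprod S) * (pprod S) + (X mod pprod S)"
     using div_mult_mod_eq[of X "pprod S"] by (metis of_nat_add of_nat_mult)
    thus ?thesis using p by (simp add: field_simps)
   qed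
   moreover have "X mod pprod S < pprod S" using p by simp
   ultimately show "\<bar>(-1) ^ card S * (X / (pprod S) - (X div pprod S))\<bar> <= 1"
    by (simp add: abs_mult)
  qed
  also have "... <= X" using cA by simp
  finally have "\<bar>real X * ?A\<bar> <= real X * 2" using X(1) by simp
  thus ?thesis using X(1) by (simp add: abs_mult)
 qed
 have m1: "(SUM S:A. (-1) ^ card S / (pprod S) * harm (X div pprod S)) = 1"
 proof -
  have "(SUM j:{1..n}. 1 / real (d * j)) = harm n / real d" for n d
   by (simp add: harm_def sum_divide_distrib inverse_eq_divide mult.commute)
  thus ?thesis using moebius_convolution[OF X(1) XR, of "%m. 1 / real m"] by (simp add: A_def)
 qed
 define g where "g = (euler_mascheroni::real)"
 have g: "0 <= g" "g <= 1"
  using euler_mascheroni_pos euler_mascheroni_bounds[of 1] ln2_ge_two_thirds by (auto simp: g_def harm_def)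
 have "(SUM S:A. (-1) ^ card S / real (pprod S) * ln (y / real (pprod S)))
   = (SUM S:A. (-1) ^ card S / real (pprod S) * harm (X div pprod S)) - g * ?C
    - (SUM S:A. (-1) ^ card S / real (pprod S) * (harm (X div pprod S) - ln (y / real (pprod S)) - g))"
  unfolding sum_distrib_left sum_subtractf[symmetric] by (intro sum.cong refl) (simp add: algebra_simps add_divide_distrib)
 moreover have "\<bar>SUM S:A. (-1) ^ card S / (pprod S) * (harm (X div pprod S) - ln (y / (pprod S)) - g)\<bar> <= (SUM S:A. 2 / y)"
 proof (intro order_trans[OF sum_abs] sum_mono)
  fix S assume S: "S \<in> A"
  hence p: "pprod S > 0" "(pprod S) <= y" using pos iff by (auto simp: A_def)
  hence "1 <= y / (pprod S)" by simp
  from harm_approx[OF this] have "\<bar>harm (X div pprod S) - ln (y / (pprod S)) - g\<bar> <= 2 * real (pprod S) / y"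
   unfolding divX g_def by simp
  hence "1 / (pprod S) * \<bar>harm (X div pprod S) - ln (y / (pprod S)) - g\<bar> <= 1 / (pprod S) * (2 * real (pprod S) / y)"
   by (intro mult_left_mono) auto
  thus "\<bar>(-1) ^ card S / (pprod S) * (harm (X div pprod S) - ln (y / (pprod S)) - g)\<bar> <= 2 / y"
   using p by (simp add: abs_mult)
 qed
 moreover have "(SUM S:A. 2 / y) <= 2"
 proof -
  show ?thesis using cA X by (simp add: field_simps)
 qed
 moreover have "\<bar>g * ?A\<bar> <= 1 * 2"
  unfolding abs_mult using g m0 by (intro mult_mono) auto
 ultimately show ?thesis unfolding A using m1 by linarith
qed

lemma sum_Pow_insert:
 fixes f :: "'a set => 'b::comm_monoid_add"
 assumes "finite P" "p \<notin> P"
 shows "(SUM T:Pow (insert p P). f T) = (SUM T:Pow P. f T) + (SUM T:Pow P. f (insert p T))"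
proof -
 have "inj_on (insert p) (Pow P)" using assms(2) by (auto simp: inj_on_def)
 moreover have "Pow P \<inter> insert p ` Pow P = {}" using assms(2) by auto
 ultimately show ?thesis
  unfolding Pow_insert using assms(1) by (subst sum.union_disjoint) (auto simp: sum.reindex)
qed

section \<open>Selberg's quadratic form\<close>

definition chi :: "real => real => real" where
 "chi L u = max 0 (1 - u / L)"

lemma chi_0 [simp]: "chi L 0 = 1"
 by (simp add: chi_def)

lemma chi_zero: "L > 0 ==> u >= L ==> chi L u = 0"
 by (simp add: chi_def)

lemma chi_bounds: "L > 0 ==> u >= 0 ==> 0 <= chi L u & chi L u <= 1"
 by (simp add: chi_def)

definition Psi :: "real => nat set => real => real" where
 "Psi L P a = (SUM T:Pow P. (-1) ^ card T / real (pprod T) * chi L (a + ln (real (pprod T))))"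

definition phi_inv :: "nat set => real" where
 "phi_inv S = (PROD p:S. 1 / (real p - 1))"

definition selw :: "nat set => real" where
 "selw S = (PROD p:S. 1 / real p * (1 - 1 / real p))"

text \<open>This is the sum over d and e of mu(d) mu(e) / lcm(d, e) times the two cutoffs, in
  diagonal form: gcd(d, e) is expanded as the sum of phi(s) over its divisors s, and
  \<open>selw S\<close> is phi(s)/s^2.\<close>

definition selG :: "real => nat set => real => real => real" where
 "selG L P a b = (SUM S:Pow P. selw S * (Psi L (P - S) (a + ln (real (pprod S))) * Psi L (P - S) (b + ln (real (pprod S)))))"

lemma ln_pprod_insert:
 assumes "finite S" "p \<notin> S" "ALL q:insert p S. prime q"
 shows "ln ((pprod (insert p S))) = ln (p) + ln ((pprod S))"
 using assms prod_primes_pos[of S] by (simp add: pprod_insert ln_mult prime_gt_0_nat)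

lemma ln_pprod_nonneg: "ALL p:S. prime p ==> 0 <= ln ((pprod S))"
 using prod_primes_pos[of S] by simp

lemma Psi_insert:
 assumes "finite P" "p \<notin> P" "ALL q:insert p P. prime q"
 shows "Psi L (insert p P) a = Psi L P a - Psi L P (a + ln (p)) / p"
proof -
 have "(SUM T:Pow P. (-1) ^ card (insert p T) / real (pprod (insert p T)) * chi L (a + ln (real (pprod (insert p T)))))
   = (SUM T:Pow P. - ((-1) ^ card T / real (pprod T) * chi L (a + ln (real p) + ln (real (pprod T)))) / real p)"
 proof (rule sum.cong[OF refl])
  fix T assume T: "T \<in> Pow P"
  hence f: "finite T" "p \<notin> T" "ALL q:insert p T. prime q" using assms finite_subset[of T P] by auto
  show "(-1) ^ card (insert p T) / real (pprod (insert p T)) * chi L (a + ln (real (pprod (insert p T))))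
   = - ((-1) ^ card T / real (pprod T) * chi L (a + ln (real p) + ln (real (pprod T)))) / real p"
   unfolding ln_pprod_insert[OF f] using f by (simp add: pprod_insert add.assoc)
 qed
 thus ?thesis
  unfolding Psi_def sum_Pow_insert[OF assms(1,2)] by (simp add: sum_divide_distrib sum_negf)
qed

lemma Psi_zero:
 assumes "L > 0" "a >= L" "ALL p:P. prime p" shows "Psi L P a = 0"
 unfolding Psi_def
proof (rule sum.neutral, rule ballI)
 fix T assume "T \<in> Pow P"
 hence "0 <= ln ((pprod T))" using assms(3) by (intro ln_pprod_nonneg) auto
 thus "(-1) ^ card T / (pprod T) * chi L (a + ln ((pprod T))) = 0"
  using assms chi_zero[of L "a + ln (real (pprod T))"] by simp
qed

text \<open>The local factor at p before diagonalisation: p may divide d, e or both, each time with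
  density 1/p, and each division shifts the argument of a cutoff by ln p. \<open>Op_product\<close>
  uses the form only through this recurrence.\<close>

lemma selG_insert:
 assumes P: "finite P" "p \<notin> P" "ALL q:insert p P. prime q"
 shows "selG L (insert p P) a b = selG L P a b - selG L P (a + ln (real p)) b / real p - selG L P a (b + ln (real p)) / real p
   + selG L P (a + ln (real p)) (b + ln (real p)) / real p"
proof -
 define l where "l = ln (p)"
 have p: "real p > 0" using P(3) by (simp add: prime_gt_0_nat)
 define F where "F S a = Psi L (P - S) (a + ln (real (pprod S)))" for S a
 have 1: "selw S * (Psi L (insert p P - S) (a + ln (real (pprod S))) * Psi L (insert p P - S) (b + ln (real (pprod S))))
  = selw S * ((F S a - F S (a + l) / real p) * (F S b - F S (b + l) / real p))" if S: "S \<in> Pow P" for S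
 proof -
  have e: "insert p P - S = insert p (P - S)" using S P(2) by auto
  have "Psi L (insert p P - S) (c + ln (real (pprod S))) = F S c - F S (c + l) / real p" for c
   unfolding e F_def l_def using P by (subst Psi_insert) (auto simp: algebra_simps)
  thus ?thesis by simp
 qed
 have 2: "selw (insert p S) * (Psi L (insert p P - insert p S) (a + ln (real (pprod (insert p S)))) * Psi L (insert p P - insert p S) (b + ln (real (pprod (insert p S)))))
  = selw S * (1 / real p * (1 - 1 / real p) * (F S (a + l) * F S (b + l)))" if S: "S \<in> Pow P" for S
 proof -
  have f: "finite S" "p \<notin> S" "ALL q:insert p S. prime q" using S P finite_subset[of S P] by auto
  have e: "insert p P - insert p S = P - S" using P(2) by auto
  show ?thesis unfolding e ln_pprod_insert[OF f] F_def l_def using f by (simp add: selw_def add.assoc)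
 qed
 have "selG L (insert p P) a b = (SUM S:Pow P. selw S * ((F S a - F S (a + l) / real p) * (F S b - F S (b + l) / real p)))
   + (SUM S:Pow P. selw S * (1 / real p * (1 - 1 / real p) * (F S (a + l) * F S (b + l))))"
  unfolding selG_def sum_Pow_insert[OF P(1,2)] by (intro arg_cong2[of _ _ _ _ "(+)"] sum.cong refl 1 2)
 also have "... = (SUM S:Pow P. selw S * (F S a * F S b) - selw S * (F S (a + l) * F S b) / real p - selw S * (F S a * F S (b + l)) / real p
    + selw S * (F S (a + l) * F S (b + l)) / real p)"
  unfolding sum.distrib[symmetric] using p by (intro sum.cong refl) (simp add: field_simps)
 also have "... = selG L P a b - selG L P (a + l) b / p - selG L P a (b + l) / p + selG L P (a + l) (b + l) / p"
  unfolding selG_def F_def by (simp add: sum.distrib sum_subtractf sum_divide_distrib)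
 finally show ?thesis by (simp add: l_def)
qed

text \<open>Moebius inversion of the sum defining \<open>Psi\<close>; the two contributions of each
  new prime cancel.\<close>

lemma Psi_unity:
 assumes "finite P" "ALL q:P. prime q"
 shows "(SUM S:Pow P. Psi L (P - S) (a + ln ((pprod S))) / (pprod S)) = chi L a"
 using assms
proof (induction P arbitrary: a)
 case (insert p P)
 have P: "finite P" "p \<notin> P" "ALL q:insert p P. prime q" using insert by auto
 have p: "real p > 0" using P(3) by (simp add: prime_gt_0_nat)
 define F where "F S = Psi L (P - S) (a + ln (real p) + ln (real (pprod S))) / real (pprod S) / real p" for S
 have "Psi L (insert p P - S) (a + ln (real (pprod S))) / real (pprod S) = Psi L (P - S) (a + ln (real (pprod S))) / real (pprod S) - F S"
  if S: "S \<in> Pow P" for S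
 proof -
  have e: "insert p P - S = insert p (P - S)" using S P(2) by auto
  show ?thesis unfolding e F_def using P by (subst Psi_insert) (auto simp: diff_divide_distrib add_ac)
 qed
 moreover have "Psi L (insert p P - insert p S) (a + ln (real (pprod (insert p S)))) / real (pprod (insert p S)) = F S"
  if S: "S \<in> Pow P" for S
 proof -
  have f: "finite S" "p \<notin> S" "ALL q:insert p S. prime q" using S P finite_subset[of S P] by auto
  have e: "insert p P - insert p S = P - S" using P(2) by auto
  show ?thesis unfolding e ln_pprod_insert[OF f] F_def using f by (simp add: pprod_insert add.assoc)
 qed
 ultimately have "(SUM S:Pow (insert p P). Psi L (insert p P - S) (a + ln (real (pprod S))) / real (pprod S))
   = (SUM S:Pow P. Psi L (P - S) (a + ln (real (pprod S))) / real (pprod S) - F S) + (SUM S:Pow P. F S)"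
  unfolding sum_Pow_insert[OF P(1,2)] by simp
 thus ?case using insert by (simp add: sum_subtractf)
qed (simp add: Psi_def)

text \<open>\<open>Psi_insert\<close> expresses Psi without p through Psi with p and a copy of
  itself at a + ln p divided by p. Iterating gives a geometric series of ratio 1/p, which stops
  because Psi vanishes beyond L; n counts steps of length at least ln 2.\<close>

lemma Psi_remove:
 assumes L: "L > 0" and P: "finite P" "p \<notin> P" "ALL q:insert p P. prime q"
  and B: "!!a. a >= 0 ==> \<bar>Psi L (insert p P) a\<bar> <= B" and a: "a >= 0"
 shows "\<bar>Psi L P a\<bar> <= B * (1 / (1 - 1 / p))"
proof -
 have p2: "real p >= 2" using P(3) prime_ge_2_nat[of p] by simp
 define B' where "B' = B * (1 / (1 - 1 / p))"
 have B': "B + B' / p = B'" using p2 by (simp add: B'_def field_simps)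
 have B'0: "B' >= 0" using p2 B[of 0] by (simp add: B'_def)
 have "\<bar>Psi L P a\<bar> <= B'" if "a >= 0" "L <= a + real n * ln 2" for n a
  using that
 proof (induction n arbitrary: a)
  case 0
  thus ?case using Psi_zero[of L a P] L P(3) B'0 by simp
 next
  case (Suc n)
  have l: "ln 2 <= ln (p)" using p2 by simp
  have l0: "0 <= ln (2::real)" by simp
  have "\<bar>Psi L P (a + ln (p))\<bar> <= B'"
  proof (rule Suc.IH)
   show "0 <= a + ln (p)" using Suc.prems l l0 by linarith
   show "L <= a + ln (p) + n * ln 2" using Suc.prems l by (simp add: algebra_simps)
  qed
  hence "\<bar>Psi L P (a + ln (p)) / p\<bar> <= B' / p" by (simp add: divide_right_mono)
  moreover have "\<bar>Psi L P a - Psi L P (a + ln (p)) / p\<bar> <= B"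
   using B[OF Suc.prems(1)] unfolding Psi_insert[OF P] .
  ultimately show ?case using B' by linarith
 qed
 moreover obtain n :: nat where "L / ln 2 <= real n" using real_arch_simple by blast
 hence "L <= a + n * ln 2" using a by (simp add: field_simps)
 ultimately show ?thesis using a by (simp add: B'_def)
qed

lemma Psi_remove_set:
 assumes L: "L > 0" and T: "finite T" and P: "finite P" "T \<inter> P = {}" "ALL q:T \<union> P. prime q"
  and B: "!!a. a >= 0 ==> \<bar>Psi L (T \<union> P) a\<bar> <= B" and a: "a >= 0"
 shows "\<bar>Psi L P a\<bar> <= B * (PROD p:T. 1 / (1 - 1 / p))"
 using T P B a
proof (induction T arbitrary: P a)
 case (insert p T)
 have "\<bar>Psi L (insert p P) a\<bar> <= B * (PROD p:T. 1 / (1 - 1 / real p))" if "a >= 0" for a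
  by (rule insert.IH) (use insert that in auto)
 hence "\<bar>Psi L P a\<bar> <= B * (PROD p:T. 1 / (1 - 1 / p)) * (1 / (1 - 1 / p))"
  using insert by (intro Psi_remove[OF L]) auto
 thus ?case using insert by simp
qed auto

text \<open>With y = R exp(-a) the cutoff is ln(y/d)/L on d \<le> y and zero beyond, so Psi over all
  primes up to R is the sum of \<open>moebius_log_sum\<close> divided by L.\<close>

lemma Psi_full:
 assumes R: "R >= 2" and a: "a >= 0"
 shows "\<bar>Psi (ln (R)) (primes_le R) a\<bar> <= 5 / ln (R)"
proof -
 define L where "L = ln (R)"
 have L: "L > 0" using R by (simp add: L_def)
 define y where "y = R * exp (- a)"
 have y: "y > 0" "y <= R" "ln y = L - a" using R a by (auto simp: y_def L_def ln_mult)
 have ch: "chi L (a + ln (real n)) = (if real n <= y then ln (y / real n) / L else 0)" if "n > 0" for n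
 proof -
  have n: "real n > 0" using that by simp
  have "1 - (a + ln (n)) / L = ln (y / n) / L" using L y n by (simp add: ln_div field_simps)
  moreover have "ln (y / n) >= 0 \<longleftrightarrow> n <= y" using y(1) n by simp
  ultimately show ?thesis using L by (simp add: chi_def max_def zero_le_divide_iff)
 qed
 define A where "A = {S\<in>Pow (primes_le R). (pprod S) <= y}"
 have fin: "finite (Pow (primes_le R))" by simp
 have "Psi L (primes_le R) a = (SUM T:Pow (primes_le R). if (pprod T) <= y then ((-1) ^ card T / (pprod T) * ln (y / (pprod T))) / L else 0)"
  unfolding Psi_def
 proof (rule sum.cong[OF refl])
  fix T assume "T \<in> Pow (primes_le R)"
  hence "pprod T > 0" by (intro prod_primes_pos) auto
  thus "(-1) ^ card T / real (pprod T) * chi L (a + ln (real (pprod T)))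
   = (if real (pprod T) <= y then ((-1) ^ card T / real (pprod T) * ln (y / real (pprod T))) / L else 0)" using ch by simp
 qed
 also have "... = (SUM S:A. (-1) ^ card S / (pprod S) * ln (y / (pprod S))) / L"
  unfolding A_def sum_divide_distrib by (rule sum.inter_filter[OF fin, symmetric])
 also have "\<bar>\<dots>\<bar> <= 5 / L"
 proof (cases "1 <= y")
  case True
  show ?thesis using moebius_log_sum[OF True y(2)] L by (simp add: A_def divide_right_mono)
 next
  case False
  have "A = {}"
  proof (rule ccontr)
   assume "A ~= {}"
   then obtain S where S: "S \<in> A" by blast
   hence "pprod S > 0" by (intro prod_primes_pos) (auto simp: A_def)
   thus False using S False by (simp add: A_def)
  qed
  thus ?thesis using L by simp
 qed
 finally show ?thesis by (simp add: L_def)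
qed

lemma phi_inv_nonneg: "ALL p:S. prime p ==> 0 <= phi_inv S"
 unfolding phi_inv_def using prime_ge_1_nat by (intro prod_nonneg) auto

lemma phi_inv_le_1:
 assumes "ALL p:S. prime p" shows "phi_inv S <= 1"
 unfolding phi_inv_def
proof (rule prod_le_1)
 fix p assume "p \<in> S"
 thus "0 <= 1 / (real p - 1) & 1 / (real p - 1) <= 1" using assms prime_ge_2_nat[of p] by simp
qed

text \<open>From 1/phi(s) = (1/s) times the sum of 1/phi(t) over t dividing s, the sum is at most
  the product of a sum of 1/u over u \<le> X and a sum of 1/(t phi(t)). The latter is at most the
  exponential of a telescoping series with total below 1, hence at most 3.\<close>

lemma phi_inv_sum_bound:
 assumes Q: "finite Q" "ALL p:Q. prime p" and X: "X >= 1"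
 shows "(SUM S:{S\<in>Pow Q. pprod S <= X}. phi_inv S) <= 3 * (1 + ln (X))"
proof -
 have l0: "0 <= ln (X)" using X by simp
 have e: "phi_inv S = (SUM T:Pow S. phi_inv T / real (pprod S))" if "S \<in> Pow Q" for S
 proof -
  have fS: "finite S" using that Q finite_subset by auto
  have "phi_inv S = (PROD p:S. (1 / (real p - 1) + 1) / p)"
   unfolding phi_inv_def
  proof (rule prod.cong[OF refl])
   fix p assume "p \<in> S"
   thus "1 / (real p - 1) = (1 / (real p - 1) + 1) / p" using Q(2) that prime_ge_2_nat[of p] by (auto simp: field_simps)
  qed
  also have "... = (PROD p:S. 1 / (real p - 1) + 1) / (pprod S)" by (simp add: prod_dividef pprod_def)
  also have "(PROD p:S. 1 / (real p - 1) + 1) = (SUM T:Pow S. phi_inv T)"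
   using prod_add[OF fS, of "%p. 1 / (real p - 1)" "%_. 1"] by (simp add: phi_inv_def)
  finally show ?thesis by (simp add: sum_divide_distrib)
 qed
 define A where "A = {S\<in>Pow Q. pprod S <= X}"
 have fA: "finite A" using Q by (simp add: A_def)
 let ?A = "SUM T:Pow Q. phi_inv T / (pprod T)"
 let ?B = "\<Sum>(T, U)\<in>Pow Q \<times> A. phi_inv T / (pprod T) * (1 / (pprod U))"
 let ?C = "\<Sum>(S, T)\<in>Sigma A Pow. phi_inv T / (pprod S)"
 have "(SUM S:A. phi_inv S) = (SUM S:A. SUM T:Pow S. phi_inv T / (pprod S))"
  using e by (intro sum.cong) (auto simp: A_def)
 also have "... = ?C"
  using Q finite_subset by (subst sum.Sigma) (auto simp: A_def)
 also have "... <= ?B"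
 proof -
  define h where "h = (%(S, T). (T, S - T) :: nat set \<times> nat set)"
  have inj: "inj_on h (Sigma A Pow)" unfolding h_def inj_on_def by auto
  have fac: "pprod S = pprod T * pprod (S - T)" "pprod (S - T) <= pprod S" if "S \<in> A" "T \<subseteq> S" for S T
  proof -
   have "finite S" using that Q finite_subset by (auto simp: A_def)
   thus 1: "pprod S = pprod T * pprod (S - T)" using that(2)
    unfolding pprod_def by (metis mult.commute prod.subset_diff)
   have "pprod T > 0" using that Q by (intro prod_primes_pos) (auto simp: A_def)
   thus "pprod (S - T) <= pprod S" unfolding 1 by simp
  qed
  have "?C = (\<Sum>(T, U)\<in>h ` Sigma A Pow. phi_inv T / (pprod T) * (1 / (pprod U)))"
   unfolding sum.reindex[OF inj]
  proof (rule sum.cong[OF refl])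
   fix x assume "x \<in> Sigma A Pow"
   then obtain S T where x: "x = (S, T)" "S \<in> A" "T \<subseteq> S" by auto
   show "(case x of (S, T) => phi_inv T / (pprod S)) = ((%(T, U). phi_inv T / (pprod T) * (1 / (pprod U))) \<circ> h) x"
    using fac(1)[OF x(2,3)] by (simp add: x(1) h_def)
  qed
  also have "... <= ?B"
  proof (rule sum_mono2)
   show "finite (Pow Q \<times> A)" using Q fA by simp
   show "h ` Sigma A Pow \<subseteq> Pow Q \<times> A"
   proof
    fix y assume "y \<in> h ` Sigma A Pow"
    then obtain S T where x: "y = (T, S - T)" "S \<in> A" "T \<subseteq> S" by (auto simp: h_def)
    thus "y \<in> Pow Q \<times> A" using fac(2)[OF x(2,3)] by (auto simp: A_def)
   qed
   fix y assume "y \<in> Pow Q \<times> A - h ` Sigma A Pow"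
   thus "0 <= (case y of (T, U) => phi_inv T / (pprod T) * (1 / (pprod U)))"
    using Q(2) by (auto intro!: divide_nonneg_nonneg phi_inv_nonneg)
  qed
  finally show ?thesis .
 qed
 also have "... = ?A * (SUM U:A. 1 / (pprod U))"
  by (simp add: sum.cartesian_product[symmetric] sum_product)
 also have "... <= 3 * (1 + ln (X))"
 proof (rule mult_mono)
  show "(SUM U:A. 1 / (pprod U)) <= 1 + ln (X)" unfolding A_def by (rule sum_inverse_subsets[OF Q X])
  have "?A = (PROD p:Q. 1 / (real p - 1) / p + 1)"
   unfolding prod_add[OF Q(1)]
   by (intro sum.cong refl) (simp only: phi_inv_def pprod_def prod_dividef of_nat_prod prod.neutral_const mult_1_right)
  also have "... <= (PROD p:Q. exp (1 / (real p - 1) / p))"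
  proof (rule prod_mono)
   fix p assume "p \<in> Q"
   thus "0 <= 1 / (real p - 1) / p + 1 & 1 / (real p - 1) / p + 1 <= exp (1 / (real p - 1) / p)" using Q(2) prime_ge_2_nat[of p] by (simp add: add.commute)
  qed
  also have "... = exp (SUM p:Q. 1 / (real p - 1) / p)" by (rule exp_sum[OF Q(1), symmetric])
  also have "... <= exp 1"
  proof -
   obtain n where n: "Q \<subseteq> {2..Suc n}"
   proof -
    obtain m where m: "ALL n:Q. n <= m" using Q(1) unfolding finite_nat_set_iff_bounded_le by blast
    have "Q \<subseteq> {2..Suc m}"
    proof
     fix p assume "p \<in> Q"
     thus "p \<in> {2..Suc m}" using m Q(2) prime_ge_2_nat[of p] by auto
    qed
    thus ?thesis by (rule that)
   qed
   have "(SUM p:Q. 1 / (real p - 1) / p) <= (SUM p:{2..Suc n}. 1 / (real p - 1) / p)"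
    by (rule sum_mono2) (use n in auto)
   also have "... = 1 - 1 / (Suc n)"
   proof (induction n)
    case (Suc n)
    have "(SUM p:{2..Suc (Suc n)}. 1 / (real p - 1) / real p)
     = 1 / (real (Suc (Suc n)) - 1) / real (Suc (Suc n)) + (SUM p:{2..Suc n}. 1 / (real p - 1) / real p)"
     by simp
    also have "... = 1 / (real n + 1) / (real n + 2) + (1 - 1 / (real n + 1))" unfolding Suc.IH by (simp add: add_ac)
    also have "... = 1 - 1 / (real n + 2)"
    proof -
     have "0 < real n + 1" "0 < real n + 2" by auto
     thus ?thesis by (simp add: divide_simps) (simp add: algebra_simps)
    qed
    finally show ?case by simp
   qed simp
   also have "... <= 1" by simp
   finally show ?thesis by simp
  qed
  also have "... <= 3" by (rule exp_le)
  finally show "?A <= 3" .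
 qed (auto intro!: sum_nonneg)
 finally show ?thesis by (simp add: A_def)
qed

section \<open>The size of the quadratic form\<close>

definition sieve_primes :: "nat => nat => nat set" where
 "sieve_primes w R = {p. prime p & w < p & p <= R}"

text \<open>This is W/phi(W) for the primorial W of w.\<close>

definition smoothV :: "nat => real" where
 "smoothV w = (PROD p:primes_le w. 1 / (1 - 1 / real p))"

lemma finite_sieve_primes: "finite (sieve_primes w R)" "ALL p:sieve_primes w R. prime p"
 by (auto simp: sieve_primes_def)

lemma smoothV_pos: "smoothV w > 0"
 unfolding smoothV_def
proof (rule prod_pos)
 fix p assume "p \<in> primes_le w"
 thus "0 < 1 / (1 - 1 / p)" using prime_ge_2_nat[of p] by simp
qed

definition selZ :: "nat => nat => real" where
 "selZ w R = (SUM S:{S\<in>Pow (sieve_primes w R). pprod S <= R}. phi_inv S)"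

lemma selZ_le: "selZ w R <= R"
proof -
 have "selZ w R <= (SUM S:{S\<in>Pow (sieve_primes w R). pprod S <= R}. 1)"
  unfolding selZ_def by (intro sum_mono phi_inv_le_1) (auto simp: sieve_primes_def)
 also have "... <= R" using card_subsets_bounded_prod[OF finite_sieve_primes, of w R R] by simp
 finally show ?thesis .
qed

text \<open>\<open>smoothV w\<close> is the sum of 1/phi(t) over the divisors t of the primorial,
  which are coprime to everything counted by \<open>selZ\<close>. The product is therefore a sum of
  1/phi over distinct squarefree numbers up to R W \<le> R^2, with no gap at the small
  primes.\<close>

lemma selZ_V_le:
 assumes R: "R >= 2" "w <= R" and W: "pprod (primes_le w) <= W" "W <= R"
 shows "selZ w R * smoothV w <= 11 * ln (R)"
proof -
 define P where "P = sieve_primes w R"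
 define A where "A = {S\<in>Pow P. pprod S <= R}"
 have fA: "finite A" using finite_sieve_primes by (simp add: A_def P_def)
 have fw: "finite (primes_le w)" by simp
 let ?C = "SUM T:Pow (primes_le w). phi_inv T"
 have "smoothV w = (PROD p:primes_le w. 1 / (real p - 1) + 1)"
  unfolding smoothV_def
 proof (rule prod.cong[OF refl])
  fix p assume "p \<in> primes_le w"
  thus "1 / (1 - 1 / p) = 1 / (real p - 1) + 1" using prime_ge_2_nat[of p] by (simp add: field_simps)
 qed
 also have "... = ?C"
  using prod_add[OF fw, of "%p. 1 / (real p - 1)" "%_. 1"] by (simp add: phi_inv_def)
 finally have V: "smoothV w = ?C" .
 define h where "h = (%(S, T). S \<union> T :: nat set)"
 have dis: "P \<inter> primes_le w = {}" by (auto simp: P_def sieve_primes_def)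
 let ?B = "A \<times> Pow (primes_le w)"
 have inj: "inj_on h ?B"
 proof (rule inj_onI)
  fix x y assume x: "x \<in> A \<times> Pow (primes_le w)" and y: "y \<in> A \<times> Pow (primes_le w)" and e: "h x = h y"
  have "fst z = h z \<inter> P" "snd z = h z \<inter> primes_le w" if "z \<in> A \<times> Pow (primes_le w)" for z
   using that dis by (auto simp: h_def A_def)
  thus "x = y" using x y e by (metis prod_eqI)
 qed
 have ST: "finite S" "finite T" "S \<inter> T = {}" if "S \<in> A" "T \<subseteq> primes_le w" for S T
  using that dis finite_subset[of S P] finite_subset[OF _ fw, of T] finite_sieve_primes(1)[of w R] by (auto simp: A_def P_def)
 let ?A = "{S\<in>Pow (primes_le R). pprod S <= R * W}"
 have "selZ w R * smoothV w = (SUM x:A \<times> Pow (primes_le w). phi_inv (fst x) * phi_inv (snd x))"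
  unfolding V selZ_def A_def[symmetric] P_def[symmetric] by (simp add: sum_product sum.cartesian_product case_prod_unfold)
 also have "... = (SUM x:A \<times> Pow (primes_le w). phi_inv (h x))"
 proof (rule sum.cong[OF refl])
  fix x assume "x \<in> A \<times> Pow (primes_le w)"
  then obtain S T where x: "x = (S, T)" "S \<in> A" "T \<subseteq> primes_le w" by auto
  show "phi_inv (fst x) * phi_inv (snd x) = phi_inv (h x)"
   using ST[OF x(2,3)] by (simp add: x(1) h_def phi_inv_def prod.union_disjoint)
 qed
 also have "... = (SUM U:h ` ?B. phi_inv U)" using sum.reindex[OF inj, of phi_inv] by simp
 also have "... <= (SUM U:?A. phi_inv U)"
 proof (rule sum_mono2)
  show "finite ?A" by simp
  show "h ` ?B \<subseteq> ?A"
  proof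
   fix U assume "U \<in> h ` ?B"
   then obtain S T where x: "U = S \<union> T" "S \<in> A" "T \<subseteq> primes_le w" by (auto simp: h_def)
   have "pprod U = pprod S * pprod T" using ST[OF x(2,3)] by (simp add: x(1) pprod_def prod.union_disjoint)
   also have "... <= R * W"
   proof (rule mult_mono)
    have "pprod T dvd pprod (primes_le w)" unfolding pprod_def by (rule prod_dvd_prod_subset[OF fw x(3)])
    moreover have "pprod (primes_le w) > 0" by (rule prod_primes_pos) auto
    ultimately show "pprod T <= W" using W dvd_imp_le by (meson order_trans)
   qed (use x in \<open>auto simp: A_def\<close>)
   finally show "U \<in> ?A" using x R(2) by (auto simp: A_def P_def sieve_primes_def)
  qed
  fix U assume "U \<in> ?A - h ` ?B"
  thus "0 <= phi_inv U" by (intro phi_inv_nonneg) auto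
 qed
 also have "... <= 3 * (1 + ln ((R * W)))"
 proof (rule phi_inv_sum_bound[OF finite_primes_le])
  have "pprod (primes_le w) > 0" by (rule prod_primes_pos) auto
  thus "1 <= R * W" using W by simp
 qed auto
 also have "... <= 11 * ln (R)"
 proof -
  have "pprod (primes_le w) > 0" by (rule prod_primes_pos) auto
  have "ln ((R * W)) <= 2 * ln (R)" using R W by (simp add: ln_mult)
  moreover have "2/3 <= ln (R)" using R by (intro order_trans[OF ln2_ge_two_thirds]) simp
  moreover have "3 * (1 + u) <= 11 * v" if "u <= 2 * v" "2/3 <= v" for u v :: real
  proof -
   show ?thesis using that by simp
  qed
  ultimately show ?thesis by simp
 qed
 finally show ?thesis .
qed

lemma selw_nonneg: "ALL p:S. prime p ==> 0 <= selw S"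
 unfolding selw_def
proof (rule prod_nonneg)
 fix p assume "ALL p:S. prime p" "p \<in> S"
 thus "0 <= 1 / p * (1 - 1 / p)" using prime_ge_2_nat[of p] by simp
qed

text \<open>Cauchy-Schwarz applied to \<open>Psi_unity\<close> at 0, with 1/pprod S split as the
  square root of phi_inv S times selw S. This is the duality that makes Selberg's weights
  optimal.\<close>

lemma selG_00_lower:
 assumes R: "R >= 2"
 shows "1 <= selZ w R * selG (ln (R)) (sieve_primes w R) 0 0"
proof -
 define L where "L = ln (R)"
 have L: "L > 0" using R by (simp add: L_def)
 define P where "P = sieve_primes w R"
 have P: "finite P" "ALL p:P. prime p" using finite_sieve_primes by (auto simp: P_def)
 define A where "A = {S\<in>Pow P. pprod S <= R}"
 have fA: "finite A" using P by (simp add: A_def)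
 define \<psi> where "\<psi> S = Psi L (P - S) (ln (real (pprod S)))" for S
 have z: "\<psi> S = 0" if "S \<in> Pow P - A" for S
 proof -
  have "L <= ln ((pprod S))" using that R by (auto simp: L_def A_def)
  thus ?thesis unfolding \<psi>_def using P(2) by (intro Psi_zero[OF L]) auto
 qed
 let ?A = "SUM S:A. sqrt (phi_inv S) * (sqrt (selw S) * \<psi> S)"
 let ?B = "SUM S:A. (sqrt (selw S) * \<psi> S)\<^sup>2"
 let ?C = "SUM S:A. (sqrt (phi_inv S))\<^sup>2"
 have "1 = (SUM S:Pow P. \<psi> S / (pprod S))" using Psi_unity[OF P, of L 0] by (simp add: \<psi>_def)
 also have "... = (SUM S:A. \<psi> S / (pprod S))"
  by (rule sum.mono_neutral_right) (use P z in \<open>auto simp: A_def\<close>)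
 also have "... = ?A"
 proof (rule sum.cong[OF refl])
  fix S assume S: "S \<in> A"
  have "phi_inv S * selw S = (PROD p:S. 1 / p * (1 / p))"
   unfolding phi_inv_def selw_def prod.distrib[symmetric]
  proof (rule prod.cong[OF refl])
   fix p assume "p \<in> S"
   thus "1 / (real p - 1) * (1 / p * (1 - 1 / p)) = 1 / p * (1 / p)" using S P prime_ge_2_nat[of p] by (auto simp: A_def field_simps)
  qed
  also have "... = (1 / (pprod S))\<^sup>2" unfolding prod.distrib by (simp add: power2_eq_square pprod_def prod_dividef)
  finally have "sqrt (phi_inv S) * sqrt (selw S) = 1 / (pprod S)" by (simp add: real_sqrt_mult[symmetric])
  thus "\<psi> S / (pprod S) = sqrt (phi_inv S) * (sqrt (selw S) * \<psi> S)" by (simp add: mult.assoc[symmetric])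
 qed
 finally have "1\<^sup>2 = ?A\<^sup>2" by simp
 also have "... <= ?C * ?B" by (rule Cauchy_Schwarz_ineq_sum)
 also have "?C = selZ w R"
  unfolding selZ_def A_def[symmetric] P_def[symmetric]
  by (rule sum.cong[OF refl]) (use P in \<open>auto simp: A_def intro!: real_sqrt_pow2 phi_inv_nonneg\<close>)
 also have "?B = (SUM S:A. selw S * (\<psi> S * \<psi> S))"
 proof (rule sum.cong[OF refl])
  fix S assume S: "S \<in> A"
  have "selw S >= 0" using S P by (intro selw_nonneg) (auto simp: A_def)
  thus "(sqrt (selw S) * \<psi> S)\<^sup>2 = selw S * (\<psi> S * \<psi> S)" by (simp add: power_mult_distrib power2_eq_square[of "\<psi> S"])
 qed
 also have "... = (SUM S:Pow P. selw S * (\<psi> S * \<psi> S))"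
  by (rule sum.mono_neutral_left) (use P z in \<open>auto simp: A_def\<close>)
 also have "... = selG L P 0 0" by (simp add: selG_def \<psi>_def)
 finally show ?thesis by (simp add: L_def P_def)
qed

text \<open>The bound 5/L for the full set of primes passes to P - S by removing the primes up to w
  and those of S, each at the cost 1/(1 - 1/p). The squares of the factors at S combine with
  \<open>selw S\<close> to give exactly \<open>phi_inv S\<close>.\<close>

lemma selG_upper:
 assumes R: "R >= 2" "w <= R" and ab: "a >= 0" "b >= 0"
 shows "\<bar>selG (ln (R)) (sieve_primes w R) a b\<bar> <= 25 * (smoothV w)\<^sup>2 / (ln (R))\<^sup>2 * selZ w R"
proof -
 define L where "L = ln (R)"
 have L: "L > 0" using R by (simp add: L_def)
 define P where "P = sieve_primes w R"
 have P: "finite P" "ALL p:P. prime p" using finite_sieve_primes by (auto simp: P_def)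
 define A where "A = {S\<in>Pow P. pprod S <= R}"
 define V where "V = smoothV w"
 define g where "g S = (PROD p:S. 1 / (1 - 1 / real p))" for S
 have ps: "\<bar>Psi L (P - S) (a + ln (real (pprod S)))\<bar> <= 5 / L * (V * g S)" if S: "S \<in> Pow P" and a: "a >= 0" for S a
 proof -
  have dis: "S \<inter> primes_le w = {}" using S by (auto simp: P_def sieve_primes_def)
  have fin: "finite S" "finite (primes_le w)" using S P finite_subset by auto
  have un: "(primes_le w \<union> S) \<union> (P - S) = primes_le R" using S R(2) by (auto simp: P_def sieve_primes_def)
  let ?A = "PROD p:primes_le w \<union> S. 1 / (1 - 1 / p)"
  have "\<bar>Psi L (P - S) (a + ln ((pprod S)))\<bar> <= 5 / L * ?A"
  proof (rule Psi_remove_set[OF L])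
   show "\<bar>Psi L ((primes_le w \<union> S) \<union> (P - S)) a\<bar> <= 5 / L" if "a >= 0" for a
    unfolding un L_def by (rule Psi_full[OF R(1) that])
   have "0 <= ln ((pprod S))" using S P by (intro ln_pprod_nonneg) auto
   thus "0 <= a + ln ((pprod S))" using a by simp
   show "(primes_le w \<union> S) \<inter> (P - S) = {}" by (auto simp: P_def sieve_primes_def)
   show "ALL q:primes_le w \<union> S \<union> (P - S). prime q" unfolding un by simp
  qed (use fin P in auto)
  also have "?A = V * g S"
   unfolding V_def smoothV_def g_def using fin dis by (intro prod.union_disjoint) auto
  finally show ?thesis .
 qed
 have wg: "selw S * (g S * g S) = phi_inv S" "selw S >= 0" "g S >= 0" if S: "S \<in> Pow P" for S
 proof -
  have p2: "real p >= 2" if "p \<in> S" for p using that S P prime_ge_2_nat[of p] by auto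
  show "selw S * (g S * g S) = phi_inv S"
   unfolding phi_inv_def selw_def g_def prod.distrib[symmetric]
  proof (rule prod.cong[OF refl])
   fix p assume "p \<in> S"
   hence p: "real p > 1" using p2[of p] by simp
   hence "1 - 1 / p = (real p - 1) / p" by (simp add: field_simps)
   thus "1 / p * (1 - 1 / p) * (1 / (1 - 1 / p) * (1 / (1 - 1 / p))) = 1 / (real p - 1)"
    using p by simp
  qed
  show "selw S >= 0" using S P by (intro selw_nonneg) auto
  show "g S >= 0" unfolding g_def
  proof (rule prod_nonneg)
   fix p assume "p \<in> S" thus "0 <= 1 / (1 - 1 / p)" using p2[of p] by simp
  qed
 qed
 have "\<bar>selG L P a b\<bar> <= (SUM S:Pow P. if pprod S <= R then 25 * V\<^sup>2 / L\<^sup>2 * phi_inv S else 0)"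
  unfolding selG_def
 proof (intro order_trans[OF sum_abs] sum_mono)
  fix S assume S: "S \<in> Pow P"
  show "\<bar>selw S * (Psi L (P - S) (a + ln (real (pprod S))) * Psi L (P - S) (b + ln (real (pprod S))))\<bar>
    <= (if pprod S <= R then 25 * V\<^sup>2 / L\<^sup>2 * phi_inv S else 0)"
  proof (cases "pprod S <= R")
   case True
   have "\<bar>selw S * (Psi L (P - S) (a + ln (real (pprod S))) * Psi L (P - S) (b + ln (real (pprod S))))\<bar>
    <= selw S * ((5 / L * (V * g S)) * (5 / L * (V * g S)))"
    unfolding abs_mult using wg[OF S] ps[OF S ab(1)] ps[OF S ab(2)] by (intro mult_mono) auto
   also have "... = 25 * V\<^sup>2 / L\<^sup>2 * (selw S * (g S * g S))" by (simp add: power2_eq_square)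
   finally show ?thesis using True wg(1)[OF S] by simp
  next
   case False
   have "L <= ln ((pprod S))" using False R by (simp add: L_def)
   hence "Psi L (P - S) (a + ln ((pprod S))) = 0" using ab P(2) by (intro Psi_zero[OF L]) auto
   thus ?thesis using False by simp
  qed
 qed
 also have "... = (SUM S:A. 25 * V\<^sup>2 / L\<^sup>2 * phi_inv S)"
  unfolding A_def using P(1) by (subst sum.inter_filter) auto
 also have "... = 25 * V\<^sup>2 / L\<^sup>2 * selZ w R" by (simp add: selZ_def A_def P_def sum_distrib_left)
 finally show ?thesis by (simp add: L_def P_def V_def)
qed

text \<open>The constants are 25 * 11 and 25 * 11^2, with 25 from the square of 5/L and 11 from
  \<open>selZ_V_le\<close>. The last bound controls all shifted values by the central one and keeps
  later errors relative to G 0 0; the crude 1 / G 0 0 \<le> R absorbs the normalisation where a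
  power of R is harmless.\<close>

lemma selG_bounds:
 assumes R: "R >= 2" "w <= R" and W: "pprod (primes_le w) <= W" "W <= R"
 defines "G \<equiv> selG (ln (R)) (sieve_primes w R)"
 shows "G 0 0 > 0" "1 / G 0 0 <= R" "G 0 0 <= 275 * smoothV w / ln (R)"
  "!!a b. a >= 0 ==> b >= 0 ==> \<bar>G a b\<bar> <= 3025 * G 0 0"
proof -
 define L where "L = ln (R)"
 have L: "L > 0" using R by (simp add: L_def)
 define V where "V = smoothV w"
 define Z where "Z = selZ w R"
 have V: "V > 0" using smoothV_pos by (simp add: V_def)
 have low: "1 <= Z * G 0 0" using selG_00_lower[OF R(1), of w] by (simp add: G_def Z_def)
 have Z0: "Z >= 0" unfolding Z_def selZ_def by (intro sum_nonneg phi_inv_nonneg) (auto simp: sieve_primes_def)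
 have Z: "Z > 0" using low Z0 by (cases "Z = 0") auto
 show G0: "G 0 0 > 0" using low Z zero_less_mult_pos[of Z "G 0 0"] by simp
 have "1 / G 0 0 <= Z" using low G0 by (simp add: field_simps)
 thus "1 / G 0 0 <= R" using selZ_le[of w R] by (simp add: Z_def)
 have up: "\<bar>G a b\<bar> <= 25 * V\<^sup>2 / L\<^sup>2 * Z" if "a >= 0" "b >= 0" for a b
  using selG_upper[OF R that] by (simp add: G_def V_def L_def Z_def)
 have e: "25 * V\<^sup>2 / L\<^sup>2 * Z = 25 * (V / L) * (Z * V / L)" by (simp add: power2_eq_square)
 have zl: "Z * V / L <= 11" using L selZ_V_le[OF R W] by (simp add: Z_def V_def L_def field_simps)
 have "25 * (V / L) * (Z * V / L) <= 25 * (V / L) * 11" using zl V L by (intro mult_left_mono) auto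
 thus "G 0 0 <= 275 * smoothV w / ln (R)" using up[of 0 0] unfolding e by (simp add: V_def L_def)
 fix a b :: real assume ab: "a >= 0" "b >= 0"
 have "25 * V\<^sup>2 / L\<^sup>2 * Z * 1 <= 25 * V\<^sup>2 / L\<^sup>2 * Z * (Z * G 0 0)" using Z by (intro mult_left_mono low) auto
 also have "... = 25 * (Z * V / L)\<^sup>2 * G 0 0" by (simp add: power2_eq_square)
 also have "... <= 25 * 11\<^sup>2 * G 0 0" using zl Z V L G0 by (intro mult_right_mono mult_left_mono power_mono) auto
 finally show "\<bar>G a b\<bar> <= 3025 * G 0 0" using up[OF ab] by simp
qed

text \<open>For an index set \<open>Q\<close> of linear forms, the square of the sieve weight has two summation
 variables per form; an assignment records which of them are divisible by a given prime.\<close>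

abbreviation asg :: "'q set => ('q => bool set) set" where
 "asg Q \<equiv> PiE Q (%_. UNIV)"

section \<open>Euler products as compositions of operators\<close>

definition sh :: "'q set => ('q => bool set) => real => ('q => bool => real) => 'q => bool => real" where
 "sh Q A l u = (%q i. if q \<in> Q & i \<in> A q then u q i + l else u q i)"

definition touched :: "'q set => ('q => bool set) => 'q set" where
 "touched Q A = {q\<in>Q. A q ~= {}}"

definition asgn_sign :: "'q set => ('q => bool set) => real" where
 "asgn_sign Q A = (PROD q:Q. (-1) ^ card (A q))"

text \<open>The contribution of one prime with l = ln p: every assignment shifts the logarithms of
  those summation variables that p divides. The cutoff sees only total logarithms, so the whole
  sieve sum is a composition of such operators applied to the cutoff function.\<close>

definition St :: "'q set => (('q => bool set) => real) => real => (('q => bool => real) => real) => ('q => bool => real) => real" where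
 "St Q c l F = (%u. SUM A:asg Q. c A * F (sh Q A l u))"

primrec Op :: "'q set => (nat => ('q => bool set) => real) => nat list => (('q => bool => real) => real) => ('q => bool => real) => real" where
 "Op Q c [] F = F"
| "Op Q c (p # ps) F = St Q (c p) (ln (real p)) (Op Q c ps F)"

definition bd :: "(('q => bool => real) => real) => real => bool" where
 "bd F B \<longleftrightarrow> (ALL u. (ALL q i. 0 <= u q i) --> \<bar>F u\<bar> <= B)"

lemma sh_commute: "sh Q A l (sh Q B l' u) = sh Q B l' (sh Q A l u)"
 by (simp add: sh_def fun_eq_iff)

lemma St_commute: "St Q c l (St Q c' l' F) = St Q c' l' (St Q c l F)"
proof
 fix u
 have "St Q c l (St Q c' l' F) u = (SUM A:asg Q. SUM B:asg Q. c A * (c' B * F (sh Q B l' (sh Q A l u))))"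
  by (simp add: St_def sum_distrib_left)
 also have "... = (SUM B:asg Q. SUM A:asg Q. c' B * (c A * F (sh Q A l (sh Q B l' u))))"
  by (subst sum.swap) (simp add: sh_commute mult.left_commute)
 also have "... = St Q c' l' (St Q c l F) u" by (simp add: St_def sum_distrib_left)
 finally show "St Q c l (St Q c' l' F) u = St Q c' l' (St Q c l F) u" .
qed

lemma Op_St: "Op Q c ps (St Q d l F) = St Q d l (Op Q c ps F)"
 by (induction ps) (simp_all add: St_commute)

lemma St_diff: "St Q (%A. c A - c' A) l F u = St Q c l F u - St Q c' l F u"
 by (simp add: St_def left_diff_distrib sum_subtractf)

lemma sh_nonneg: "l >= 0 ==> ALL q i. 0 <= u q i ==> ALL q i. 0 <= sh Q A l u q i"
 by (simp add: sh_def)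

lemma finite_asg: "finite Q ==> finite (asg Q)"
 by (rule finite_PiE) auto

lemma card_asg: "finite Q ==> card (asg Q) = 4 ^ card Q"
 by (simp add: card_PiE card_UNIV_set[where 'a = bool, folded Pow_UNIV] card_Pow del: Pow_UNIV flip: Pow_UNIV)

lemma St_bound:
 assumes "bd F B" "l >= 0" "(SUM A:asg Q. \<bar>c A\<bar>) <= C"
 shows "bd (St Q c l F) (C * B)"
 unfolding bd_def
proof (intro allI impI)
 fix u :: "'a => bool => real" assume u: "ALL q i. 0 <= u q i"
 have B: "\<bar>F (sh Q A l u)\<bar> <= B" for A using assms(1) sh_nonneg[OF assms(2) u] by (simp add: bd_def)
 hence B0: "B >= 0" by (meson abs_ge_zero order_trans)
 have "\<bar>St Q c l F u\<bar> <= (SUM A:asg Q. \<bar>c A\<bar> * B)"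
  unfolding St_def by (intro order_trans[OF sum_abs] sum_mono) (simp add: abs_mult B mult_left_mono)
 also have "... <= C * B" unfolding sum_distrib_right[symmetric] using assms(3) B0 by (rule mult_right_mono)
 finally show "\<bar>St Q c l F u\<bar> <= C * B" .
qed

lemma bd_add: "bd F A ==> bd G B ==> bd (%u. F u + G u) (A + B)"
 unfolding bd_def by (auto intro!: order_trans[OF abs_triangle_ineq] add_mono)

lemma Op_bounded:
 assumes "bd F B" "ALL p:set ps. p >= 1" shows "EX B. bd (Op Q c ps F) B"
 using assms(2)
proof (induction ps)
 case Nil thus ?case using assms(1) by auto
next
 case (Cons p ps)
 then obtain B' where "bd (Op Q c ps F) B'" by auto
 from St_bound[OF this _ order_refl, of "ln (real p)" Q "c p"] Cons.prems show ?case by auto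
qed

text \<open>\<open>St\<close> is the identity plus a perturbation of norm at most 1/2. For the
  supremum s of F over nonnegative arguments this gives s \<le> B + s/2; the a priori bound B0
  ensures that s is finite.\<close>

lemma St_inverse_bound:
 assumes Q: "finite Q" and F: "bd F B0" and l: "l >= 0" and SF: "bd (St Q c l F) B"
  and c0: "c (\<lambda>q\<in>Q. {}) = 1" and c1: "(SUM A:asg Q - {\<lambda>q\<in>Q. {}}. \<bar>c A\<bar>) <= 1/2"
 shows "bd F (2 * B)"
proof -
 define E where "E = (\<lambda>q\<in>Q. {} :: bool set)"
 define U where "U = {u :: 'a => bool => real. ALL q i. 0 <= u q i}"
 have U0: "U ~= {}" by (auto simp: U_def intro!: exI[of _ "%_ _. 0"])
 define s where "s = (SUP u\<in>U. \<bar>F u\<bar>)"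
 have bda: "bdd_above ((%u. \<bar>F u\<bar>) ` U)" using F by (auto simp: bd_def U_def intro!: bdd_aboveI2[of _ _ B0])
 have le: "\<bar>F u\<bar> <= s" if "u \<in> U" for u unfolding s_def by (rule cSUP_upper[OF that bda])
 have s0: "s >= 0" using le U0 by (meson abs_ge_zero all_not_in_conv order_trans)
 have "\<bar>F u\<bar> <= B + s / 2" if u: "u \<in> U" for u
 proof -
  have E: "E \<in> asg Q" "sh Q E l u = u" by (auto simp: E_def sh_def)
  let ?A = "SUM A:asg Q - {E}. \<bar>c A\<bar> * s"
  have "St Q c l F u = c E * F (sh Q E l u) + (SUM A:asg Q - {E}. c A * F (sh Q A l u))"
   unfolding St_def using E(1) finite_asg[OF Q] by (rule sum.remove[rotated])
  hence "St Q c l F u = F u + (SUM A:asg Q - {E}. c A * F (sh Q A l u))" using c0 E(2) by (simp add: E_def)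
  moreover have "\<bar>SUM A:asg Q - {E}. c A * F (sh Q A l u)\<bar> <= ?A"
  proof (intro order_trans[OF sum_abs] sum_mono)
   fix A
   have "sh Q A l u \<in> U" using sh_nonneg[OF l, of u Q A] u by (simp add: U_def)
   thus "\<bar>c A * F (sh Q A l u)\<bar> <= \<bar>c A\<bar> * s" unfolding abs_mult by (intro mult_left_mono le) auto
  qed
  moreover have "?A <= 1/2 * s"
   unfolding sum_distrib_right[symmetric] using c1 s0 by (intro mult_right_mono) (auto simp: E_def)
  moreover have "\<bar>St Q c l F u\<bar> <= B" using SF u by (simp add: bd_def U_def)
  ultimately show ?thesis by simp
 qed
 hence "s <= B + s / 2" unfolding s_def by (intro cSUP_least U0)
 hence "\<bar>F u\<bar> <= 2 * B" if "u \<in> U" for u using le[OF that] by simp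
 thus ?thesis by (simp add: bd_def U_def)
qed

text \<open>The error is relative to B, a bound for the complete model composition with all its
  cancellation, where summing absolute values would lose powers of ln R. Exchanging coefficients one
  prime at a time meets compositions that lack the model factor at that prime; by
  \<open>St_inverse_bound\<close> its absence costs a factor 2, whence 1 + 2 e p.\<close>

lemma Op_compare:
 assumes Q: "finite Q" and F: "bd F B0" and ps: "ALL p:set ps. p >= 1"
  and hm: "!!p. p \<in> set ps ==> (SUM A:asg Q. \<bar>h p A - m p A\<bar>) <= e p"
  and m0: "!!p. p \<in> set ps ==> m p (\<lambda>q\<in>Q. {}) = 1"
  and m1: "!!p. p \<in> set ps ==> (SUM A:asg Q - {\<lambda>q\<in>Q. {}}. \<bar>m p A\<bar>) <= 1/2"
  and B: "bd (Op Q m ps F) B"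
 shows "bd (%u. Op Q h ps F u - Op Q m ps F u) ((prod_list (map (%p. 1 + 2 * e p) ps) - 1) * B)"
 using F ps hm m0 m1 B
proof (induction ps arbitrary: F B B0)
 case Nil
 thus ?case by (simp add: bd_def)
next
 case (Cons p ps)
 define X where "X = Op Q m ps F"
 define Y where "Y = Op Q h ps F"
 define pa where "pa = prod_list (map (%p. 1 + 2 * e p) ps)"
 have p: "p >= 1" "ln (p) >= 0" using Cons.prems(2) by auto
 have SX: "bd (St Q (m p) (ln (p)) X) B" using Cons.prems(6) by (simp add: X_def)
 obtain B1 where "bd X B1" using Op_bounded[OF Cons.prems(1), of ps Q m] Cons.prems(2) by (auto simp: X_def)
 from St_inverse_bound[OF Q this p(2) SX Cons.prems(4) Cons.prems(5)] have X2: "bd X (2 * B)" by simp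
 have "bd (%u. Y u - X u) ((pa - 1) * (2 * B))"
  unfolding X_def Y_def pa_def by (rule Cons.IH[OF Cons.prems(1)]) (use Cons.prems X2 in \<open>auto simp: X_def\<close>)
 from bd_add[OF this X2] have Y: "bd Y (2 * pa * B)" by (simp add: algebra_simps)
 obtain B2 where B2: "bd (St Q (m p) (ln (p)) F) B2" using St_bound[OF Cons.prems(1) p(2) order_refl] by blast
 have 1: "bd (%u. St Q (m p) (ln (p)) Y u - St Q (m p) (ln (p)) X u) ((pa - 1) * B)"
  unfolding X_def Y_def pa_def Op_St[symmetric]
  by (rule Cons.IH[OF B2]) (use Cons.prems in \<open>auto simp: Op_St\<close>)
 have 2: "bd (%u. St Q (h p) (ln (p)) Y u - St Q (m p) (ln (p)) Y u) (e p * (2 * pa * B))"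
  unfolding St_diff[symmetric] by (rule St_bound[OF Y p(2)]) (use Cons.prems in auto)
 have "(prod_list (map (%p. 1 + 2 * e p) (p # ps)) - 1) * B = (pa - 1) * B + e p * (2 * pa * B)"
  unfolding list.map prod_list.Cons pa_def[symmetric] by (simp add: algebra_simps)
 moreover have "(%u. Op Q h (p # ps) F u - Op Q m (p # ps) F u)
  = (%u. (St Q (m p) (ln (real p)) Y u - St Q (m p) (ln (real p)) X u) + (St Q (h p) (ln (real p)) Y u - St Q (m p) (ln (real p)) Y u))"
  by (simp add: X_def Y_def)
 ultimately show ?case using bd_add[OF 1 2] by simp
qed

definition local_coeff :: "'q set => ('q => real) => ('q => bool set) => real" where
 "local_coeff Q x A = (PROD q:Q. if A q = {} then 1 else (-1) ^ card (A q) * x q)"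

lemma local_coeff_alt: "finite Q ==> local_coeff Q x A = asgn_sign Q A * (PROD q:touched Q A. x q)"
proof -
 assume Q: "finite Q"
 have "local_coeff Q x A = (PROD q:Q. (-1) ^ card (A q) * (if A q ~= {} then x q else 1))"
  unfolding local_coeff_def by (rule prod.cong) auto
 also have "... = asgn_sign Q A * (PROD q:touched Q A. x q)"
  unfolding prod.distrib asgn_sign_def touched_def prod.inter_filter[OF Q] ..
 finally show ?thesis .
qed

lemma UNIV_bool_set: "(UNIV :: bool set set) = {{}, {False}, {True}, {False, True}}"
proof -
 have "(UNIV :: bool set set) = Pow UNIV" by simp
 also have "... = {{}, {False}, {True}, {False, True}}" unfolding UNIV_bool by auto
 finally show ?thesis .
qed

text \<open>Local coefficients that factor over the forms make the composition factor as well, and K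
  may be any kernel obeying the one-prime recurrence. It serves both the independent model
  (\<open>selG\<close>) and the actual sieve values at a point (\<open>sieveL\<close>).\<close>

lemma Op_product:
 assumes Q: "finite Q" and ps: "distinct ps" "ALL p:set ps. prime p"
  and K: "!!p ps q a b. distinct (p # ps) ==> ALL p':set (p # ps). prime p' ==> q \<in> Q ==>
   K q (p # ps) a b = K q ps a b - x p q * K q ps (a + ln (real p)) b - x p q * K q ps a (b + ln (real p))
    + x p q * K q ps (a + ln (real p)) (b + ln (real p))"
 shows "Op Q (%p. local_coeff Q (x p)) ps (%u. PROD q:Q. K q [] (u q False) (u q True)) u = (PROD q:Q. K q ps (u q False) (u q True :: real) :: real)"
 using ps
proof (induction ps arbitrary: u)
 case (Cons p ps)
 define l where "l = ln (p)"
 let ?A = "%u. PROD q:Q. K q [] (u q False) (u q True)"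
 have IH: "Op Q (%p. local_coeff Q (x p)) ps ?A = (%u. PROD q:Q. K q ps (u q False) (u q True))"
  using Cons by auto
 define t where "t q B = (if B = {} then 1 else (-1) ^ card B * x p q) * K q ps (if False \<in> B then u q False + l else u q False) (if True \<in> B then u q True + l else u q True)"
  for q and B :: "bool set"
 have "Op Q (%p. local_coeff Q (x p)) (p # ps) ?A u
  = (SUM A:asg Q. PROD q:Q. t q (A q))"
  unfolding Op.simps IH St_def local_coeff_def prod.distrib[symmetric] t_def sh_def l_def
  by simp
 also have "... = (PROD q:Q. SUM B:UNIV. t q B)" by (rule prod_sum_PiE[symmetric]) (use Q in auto)
 also have "... = (PROD q:Q. K q (p # ps) (u q False) (u q True))"
 proof (rule prod.cong[OF refl])
  fix q assume q: "q \<in> Q"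
  show "(SUM B:UNIV. t q B) = K q (p # ps) (u q False) (u q True)" using K[OF Cons.prems q, of "u q False" "u q True"] by (simp add: t_def l_def UNIV_bool_set)
 qed
 finally show ?case .
qed simp

definition chi2 :: "'q set => real => ('q => bool => real) => real" where
 "chi2 Q L u = (PROD q:Q. chi L (u q False) * chi L (u q True))"

lemma bd_chi2: "L > 0 ==> bd (chi2 Q L) 1"
 unfolding bd_def chi2_def abs_prod
 by (intro allI impI prod_le_1) (auto simp: chi_bounds mult_le_one)

lemma Op_chi2_selG:
 assumes "finite Q" "distinct ps" "ALL p:set ps. prime p"
 shows "Op Q (%p. local_coeff Q (%_. 1 / p)) ps (chi2 Q L) u = (PROD q:Q. selG L (set ps) (u q False) (u q True))"
proof -
 have c: "chi2 Q L = (%u. PROD q:Q. selG L (set []) (u q False) (u q True))"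
  by (simp add: chi2_def fun_eq_iff selG_def selw_def Psi_def)
 show ?thesis unfolding c
  by (rule Op_product[where K = "%q ps. selG L (set ps)", OF assms]) (auto simp: selG_insert)
qed

text \<open>If e p says that p divides n, and a = 0, this is the truncated divisor sum of mu(d)
  chi(ln d) over divisors d of n composed of primes in P.\<close>

definition sieveL :: "real => nat set => (nat => bool) => real => real" where
 "sieveL L P e a = (SUM S:{S\<in>Pow P. ALL p:S. e p}. (-1) ^ card S * chi L (a + ln (real (pprod S))))"

lemma sieveL_alt: "finite P ==> sieveL L P e a = (SUM S:Pow P. if ALL p:S. e p then (-1) ^ card S * chi L (a + ln ((pprod S))) else 0)"
 unfolding sieveL_def by (rule sum.inter_filter) simp

lemma sieveL_insert:
 assumes P: "finite P" "p \<notin> P" "ALL q:insert p P. prime q"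
 shows "sieveL L (insert p P) e a = sieveL L P e a - of_bool (e p) * sieveL L P e (a + ln (p))"
proof -
 have "(SUM T:Pow P. if ALL q:insert p T. e q then (-1) ^ card (insert p T) * chi L (a + ln (real (pprod (insert p T)))) else 0)
   = (SUM T:Pow P. - (of_bool (e p) * (if ALL q:T. e q then (-1) ^ card T * chi L (a + ln (real p) + ln (real (pprod T))) else 0)))"
 proof (rule sum.cong[OF refl])
  fix T assume T: "T \<in> Pow P"
  hence f: "finite T" "p \<notin> T" "ALL q:insert p T. prime q" using P finite_subset[of T P] by auto
  show "(if ALL q:insert p T. e q then (-1) ^ card (insert p T) * chi L (a + ln (real (pprod (insert p T)))) else 0)
   = - (of_bool (e p) * (if ALL q:T. e q then (-1) ^ card T * chi L (a + ln (real p) + ln (real (pprod T))) else 0))"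
   unfolding ln_pprod_insert[OF f] using f by (simp add: add.assoc)
 qed
 moreover have "finite (insert p P)" using P(1) by simp
 ultimately show ?thesis
  unfolding sieveL_alt[OF P(1)] sieveL_alt[OF \<open>finite (insert p P)\<close>] sum_Pow_insert[OF P(1,2)]
  by (simp add: sum_negf)
qed

lemma Op_chi2_sieveL:
 assumes "finite Q" "distinct ps" "ALL p:set ps. prime p"
 shows "Op Q (%p. local_coeff Q (%q. of_bool (e q p))) ps (chi2 Q L) u
  = (PROD q:Q. sieveL L (set ps) (e q) (u q False) * sieveL L (set ps) (e q) (u q True))"
proof -
 have s0: "sieveL L {} e a = chi L a" for e a by (simp add: sieveL_alt)
 have c: "chi2 Q L = (%u. PROD q:Q. sieveL L (set []) (e q) (u q False) * sieveL L (set []) (e q) (u q True))"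
  by (simp add: chi2_def fun_eq_iff s0)
 show ?thesis unfolding c
  by (rule Op_product[where K = "%q ps a b. sieveL L (set ps) (e q) a * sieveL L (set ps) (e q) b", OF assms])
   (auto simp: sieveL_insert algebra_simps)
qed

lemma sum_PiE_insert:
 assumes "p \<notin> P"
 shows "(SUM s:PiE (insert p P) (%_. X). f s) = (SUM y:X. SUM g:PiE P (%_. X). f (g(p := y)))"
proof -
 have "(SUM s:PiE (insert p P) (%_. X). f s) = (SUM z:X \<times> PiE P (%_. X). f ((snd z)(p := fst z)))"
  unfolding PiE_insert_eq using inj_combinator[OF assms, of "%_. X"]
  by (subst sum.reindex) (auto simp: case_prod_unfold)
 thus ?thesis by (simp add: sum.cartesian_product case_prod_unfold)
qed

definition tot :: "'q set => nat set => (nat => 'q => bool set) => ('q => bool => real) => 'q => bool => real" where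
 "tot Q P s u = (%q i. if q \<in> Q then u q i + ln (real (pprod {p\<in>P. i \<in> s p q})) else u q i)"

lemma tot_insert:
 assumes "finite P" "p \<notin> P" "ALL q:insert p P. prime q"
 shows "tot Q (insert p P) (s(p := A)) u = tot Q P s (sh Q A (ln (p)) u)"
proof (intro ext)
 fix q i
 let ?A = "{p'\<in>P. i \<in> s p' q}"
 have e: "{p'\<in>insert p P. i \<in> (s(p := A)) p' q} = (if i \<in> A q then insert p ?A else ?A)"
  using assms(2) by auto
 have "ln ((pprod (insert p ?A))) = ln (p) + ln ((pprod ?A))"
  using assms by (intro ln_pprod_insert) auto
 thus "tot Q (insert p P) (s(p := A)) u q i = tot Q P s (sh Q A (ln (p)) u) q i"
  unfolding tot_def e sh_def by simp
qed

lemma Op_expand: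
 assumes "distinct ps" "ALL p:set ps. prime p"
 shows "Op Q c ps F u = (SUM s:PiE (set ps) (%_. asg Q). (PROD p:set ps. c p (s p)) * F (tot Q (set ps) s u))"
 using assms
proof (induction ps arbitrary: u)
 case Nil
 have "tot Q {} s u = u" for s by (simp add: tot_def fun_eq_iff)
 thus ?case by simp
next
 case (Cons p ps)
 have p: "p \<notin> set ps" "finite (set ps)" "ALL q:insert p (set ps). prime q" using Cons.prems by auto
 have "Op Q c (p # ps) F u = (SUM A:asg Q. c p A * (SUM s:PiE (set ps) (%_. asg Q). (PROD p:set ps. c p (s p)) * F (tot Q (set ps) s (sh Q A (ln (p)) u))))"
  unfolding Op.simps St_def using Cons by simp
 also have "... = (SUM A:asg Q. SUM s:PiE (set ps) (%_. asg Q). (PROD p':insert p (set ps). c p' ((s(p := A)) p')) * F (tot Q (insert p (set ps)) (s(p := A)) u))"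
  unfolding sum_distrib_left
 proof (intro sum.cong refl)
  fix A s
  have "(PROD p':set ps. c p' ((s(p := A)) p')) = (PROD p':set ps. c p' (s p'))" using p(1) by (intro prod.cong) auto
  thus "c p A * ((PROD p:set ps. c p (s p)) * F (tot Q (set ps) s (sh Q A (ln (real p)) u)))
   = (PROD p':insert p (set ps). c p' ((s(p := A)) p')) * F (tot Q (insert p (set ps)) (s(p := A)) u)"
   using p by (simp add: tot_insert)
 qed
 also have "... = (SUM s:PiE (insert p (set ps)) (%_. asg Q). (PROD p':insert p (set ps). c p' (s p')) * F (tot Q (insert p (set ps)) s u))"
  by (rule sum_PiE_insert[OF p(1), symmetric])
 finally show ?case by simp
qed

definition active :: "'q set => nat set => (nat => 'q => bool set) => nat set" where
 "active Q P s = {p\<in>P. touched Q (s p) ~= {}}"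

lemma pprod_UN_le:
 assumes "finite J" "finite P" "ALL p:P. prime p" "!!j. j \<in> J ==> S j \<subseteq> P"
 shows "pprod (\<Union>j\<in>J. S j) <= (PROD j:J. pprod (S j))"
 using assms(1,4)
proof (induction J)
 case (insert j J)
 let ?A = "S j" and ?B = "\<Union>j\<in>J. S j"
 have f: "finite ?A" "finite ?B" using insert assms(2) finite_subset[of _ P] by auto
 have pos: "pprod (?A \<inter> ?B) > 0" using insert.prems assms(3) by (intro prod_primes_pos) auto
 have "pprod (?A \<union> ?B) * pprod (?A \<inter> ?B) = pprod ?A * pprod ?B"
  unfolding pprod_def using prod.union_inter[OF f, of "%x. x"] by simp
 hence "pprod (?A \<union> ?B) <= pprod ?A * pprod ?B" using pos by (metis le_refl mult_le_mono2 mult.right_neutral Suc_leI One_nat_def)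
 also have "... <= pprod ?A * (PROD j:J. pprod (S j))" using insert by simp
 finally show ?case using insert by simp
qed simp

lemma active_pprod_le:
 assumes Q: "finite Q" and P: "finite P" "ALL p:P. prime p"
  and s: "ALL q:Q. ALL i. pprod {p\<in>P. i \<in> s p q} <= R"
 shows "pprod (active Q P s) <= R ^ (2 * card Q)"
proof -
 have "active Q P s = (\<Union>j\<in>Q \<times> UNIV. {p\<in>P. snd j \<in> s p (fst j)})" by (auto simp: active_def touched_def)
 hence "pprod (active Q P s) <= (PROD j:Q \<times> (UNIV::bool set). pprod {p\<in>P. snd j \<in> s p (fst j)})"
  using pprod_UN_le[of "Q \<times> UNIV" P "%j. {p\<in>P. snd j \<in> s p (fst j)}"] Q P by simp
 also have "... <= (PROD j:Q \<times> (UNIV::bool set). R)" by (rule prod_mono) (use s in auto)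
 finally show ?thesis using Q by (simp add: mult.commute)
qed

lemma card_bounded_assignments:
 assumes Q: "finite Q" and P: "finite P" "ALL p:P. prime p"
 shows "card {s\<in>PiE P (%_. asg Q). ALL q:Q. ALL i. pprod {p\<in>P. i \<in> s p q} <= R} <= R ^ (2 * card Q)"
proof -
 let ?S = "{s\<in>PiE P (%_. asg Q). ALL q:Q. ALL i. pprod {p\<in>P. i \<in> s p q} <= R}"
 define h where "h s = (\<lambda>j\<in>Q \<times> (UNIV::bool set). pprod {p\<in>P. snd j \<in> s p (fst j)})" for s :: "nat => 'a => bool set"
 have inj: "inj_on h ?S"
 proof (rule inj_onI)
  fix s s' assume s: "s \<in> ?S" and s': "s' \<in> ?S" and e: "h s = h s'"
  have "i \<in> s p q \<longleftrightarrow> i \<in> s' p q" if "p \<in> P" "q \<in> Q" for p q i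
  proof -
   have "pprod {p\<in>P. i \<in> s p q} = pprod {p\<in>P. i \<in> s' p q}" using fun_cong[OF e, of "(q, i)"] that by (simp add: h_def)
   hence "{p\<in>P. i \<in> s p q} = {p\<in>P. i \<in> s' p q}" using inj_onD[OF prod_primes_inj] P by auto
   thus ?thesis using that by auto
  qed
  hence "s p q = s' p q" if "p \<in> P" "q \<in> Q" for p q using that by blast
  moreover have sP: "s \<in> PiE P (%_. asg Q)" "s' \<in> PiE P (%_. asg Q)" using s s' by auto
  ultimately have "s p = s' p" if "p \<in> P" for p
   using that PiE_ext[OF PiE_mem[OF sP(1) that] PiE_mem[OF sP(2) that]] by simp
  thus "s = s'" using PiE_ext[OF sP] by simp
 qed
 let ?A = "PiE (Q \<times> (UNIV::bool set)) (%_. {1..R})"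
 have "h ` ?S \<subseteq> PiE (Q \<times> UNIV) (%_. {1..R})"
 proof
  fix y assume "y \<in> h ` ?S"
  then obtain s where s: "y = h s" "s \<in> ?S" by auto
  have "pprod {p\<in>P. i \<in> s p q} >= 1" for i q using prod_primes_pos[of "{p\<in>P. i \<in> s p q}"] P by simp
  thus "y \<in> PiE (Q \<times> UNIV) (%_. {1..R})" using s by (auto simp: h_def)
 qed
 moreover have "finite ?A" using Q by (intro finite_PiE) auto
 ultimately have "card ?S <= card ?A" by (rule card_inj_on_le[OF inj])
 also have "... = R ^ (2 * card Q)" using Q by (simp add: card_PiE mult.commute)
 finally show ?thesis .
qed

text \<open>The support of \<^const>\<open>chi\<close> leaves few assignments, each involving a modulus of moderate size.\<close>

lemma truncated_sum:
 assumes Q: "finite Q" and P: "finite P" "ALL p:P. prime p" and R: "R >= 2"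
  and g: "!!s. s \<in> PiE P (%_. asg Q) ==> pprod (active Q P s) <= R ^ (2 * card Q) ==> \<bar>g s\<bar> <= E" and E: "E >= 0"
 shows "\<bar>SUM s:PiE P (%_. asg Q). g s * chi2 Q (ln (R)) (tot Q P s (%_ _. 0))\<bar> <= R ^ (2 * card Q) * E"
proof -
 let ?X = "PiE P (%_. asg Q)"
 define SS where "SS = {s\<in>?X. ALL q:Q. ALL i. pprod {p\<in>P. i \<in> s p q} <= R}"
 have L: "ln (R) > 0" using R by simp
 have fX: "finite ?X" by (intro finite_PiE finite_asg P Q)
 have "(SUM s:?X. g s * chi2 Q (ln (R)) (tot Q P s (%_ _. 0))) = (SUM s:SS. g s * chi2 Q (ln (R)) (tot Q P s (%_ _. 0)))"
 proof (rule sum.mono_neutral_right[OF fX])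
  show "ALL s:?X - SS. g s * chi2 Q (ln (R)) (tot Q P s (%_ _. 0)) = 0"
  proof
   fix s assume "s \<in> ?X - SS"
   then obtain q i where qi: "q \<in> Q" "R < pprod {p\<in>P. i \<in> s p q}" by (auto simp: SS_def not_le)
   have "chi (ln (R)) (ln ((pprod {p\<in>P. i \<in> s p q}))) = 0"
    using qi(2) R by (intro chi_zero L) auto
   hence "chi2 Q (ln (R)) (tot Q P s (%_ _. 0)) = 0"
    unfolding chi2_def using Q qi(1) by (intro prod_zero bexI[of _ q]) (cases i; auto simp: tot_def)+
   thus "g s * chi2 Q (ln (R)) (tot Q P s (%_ _. 0)) = 0" by simp
  qed
 qed (auto simp: SS_def)
 also have "\<bar>\<dots>\<bar> <= (SUM s:SS. E * 1)"
 proof (intro order_trans[OF sum_abs] sum_mono)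
  fix s assume s: "s \<in> SS"
  have "ALL q i. 0 <= tot Q P s (%_ _. 0) q i" using P by (auto simp: tot_def intro!: ln_pprod_nonneg)
  hence "\<bar>chi2 Q (ln (R)) (tot Q P s (%_ _. 0))\<bar> <= 1" using bd_chi2[OF L, of Q] by (simp add: bd_def)
  moreover have "\<bar>g s\<bar> <= E" using s active_pprod_le[OF Q P] by (intro g) (auto simp: SS_def)
  ultimately show "\<bar>g s * chi2 Q (ln (R)) (tot Q P s (%_ _. 0))\<bar> <= E * 1"
   unfolding abs_mult by (intro mult_mono) auto
 qed
 also have "... = (card SS) * E" by simp
 also have "... <= real R ^ (2 * card Q) * E"
 proof (rule mult_right_mono[OF _ E])
  have "card SS <= R ^ (2 * card Q)" unfolding SS_def by (rule card_bounded_assignments[OF Q P])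
  thus "(card SS) <= real R ^ (2 * card Q)" by simp
 qed
 finally show ?thesis .
qed

text \<open>True and independent densities agree on at most one form and differ by O(1/p^2) on two
  or more, so the deviations over all p > w add up to O(1/w). This is why the primes up to w are
  sieved out beforehand. The bound \<open>2 * 4 ^ card Q <= w\<close> makes each model operator a
  perturbation of the identity of norm at most 1/2.\<close>

lemma local_densities_compare:
 fixes Q :: "'q set"
 assumes Q: "finite Q" and R: "R >= 2" "w <= R" and W: "pprod (primes_le w) <= R" and w: "2 * 4 ^ card Q <= w"
  and al0: "!!p. p \<in> sieve_primes w R ==> al p {} = 1"
  and al1: "!!p q. p \<in> sieve_primes w R ==> q \<in> Q ==> al p {q} = 1 / real p"
  and al2: "!!p I. p \<in> sieve_primes w R ==> I \<subseteq> Q ==> card I >= 2 ==> \<bar>al p I\<bar> <= 1 / (real p)\<^sup>2"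
  and ps: "distinct ps" "set ps = sieve_primes w R"
 defines "G \<equiv> selG (ln (real R)) (sieve_primes w R) 0 0"
 shows "\<bar>Op Q (%p A. asgn_sign Q A * al p (touched Q A)) ps (chi2 Q (ln (real R))) (%_ _. 0) - G ^ card Q\<bar>
   <= (exp (4 ^ (card Q + 1) / real w) - 1) * (3025 * G) ^ card Q"
proof -
 define L where "L = ln (R)"
 have L: "L > 0" using R by (simp add: L_def)
 define h where "h p A = asgn_sign Q A * al p (touched Q A)" for p A
 define m where "m p = local_coeff Q (%_. 1 / real p)" for p :: nat
 define e where "e p = 4 ^ card Q * (2 / (real p)\<^sup>2)" for p :: nat
 have pr: "prime p" "w < p" if "p \<in> set ps" for p using that ps(2) by (auto simp: sieve_primes_def)
 have w0: "w > 0" using w by (cases w) auto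
 have sg: "\<bar>asgn_sign Q A\<bar> = 1" for A by (simp add: asgn_sign_def abs_prod)
 have m_alt: "m p A = asgn_sign Q A * (1 / real p) ^ card (touched Q A)" for p A
  unfolding m_def local_coeff_alt[OF Q] by simp
 have tQ: "touched Q A \<subseteq> Q" for A by (simp add: touched_def)

 have selb: "G > 0" "!!a b. a >= 0 ==> b >= 0 ==> \<bar>selG L (set ps) a b\<bar> <= 3025 * G"
  using selG_bounds[OF R W order_refl] by (auto simp: G_def L_def ps(2))
 have OpM: "Op Q m ps (chi2 Q L) u = (PROD q:Q. selG L (set ps) (u q False) (u q True))" for u
  unfolding m_def using Q ps pr by (intro Op_chi2_selG) auto
 let ?C = "4 ^ (card Q + 1) / w"
 have "bd (%u. Op Q h ps (chi2 Q L) u - Op Q m ps (chi2 Q L) u) ((prod_list (map (%p. 1 + 2 * e p) ps) - 1) * (3025 * G) ^ card Q)"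
 proof (rule Op_compare[OF Q bd_chi2[OF L]])
  show "ALL p:set ps. 1 <= p" using pr prime_ge_1_nat by simp
  show "(SUM A:asg Q. \<bar>h p A - m p A\<bar>) <= e p" if p: "p \<in> set ps" for p
  proof -
   have p0: "real p >= 1" using pr(1)[OF p] prime_ge_1_nat[of p] by simp
   have "\<bar>h p A - m p A\<bar> <= 2 / (real p)\<^sup>2" for A
   proof -
    have e: "\<bar>h p A - m p A\<bar> = \<bar>al p (touched Q A) - (1 / p) ^ card (touched Q A)\<bar>"
     unfolding h_def m_alt right_diff_distrib[symmetric] abs_mult sg by simp
    have fin: "finite (touched Q A)" using tQ Q by (rule finite_subset)
    consider "card (touched Q A) = 0" | "card (touched Q A) = 1" | "card (touched Q A) >= 2" by linarith
    thus ?thesis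
    proof cases
     case 1
     thus ?thesis unfolding e using fin al0 p ps(2) by simp
    next
     case 2
     then obtain q where q: "touched Q A = {q}" using card_1_singletonE by blast
     thus ?thesis unfolding e using al1[of p q] tQ[of A] p ps(2) by simp
    next
     case 3
     have "(1 / p) ^ card (touched Q A) <= (1 / p)\<^sup>2" using 3 p0 by (intro power_decreasing) auto
     moreover have "0 <= (1 / p) ^ card (touched Q A)" by simp
     moreover have "\<bar>al p (touched Q A)\<bar> <= 1 / (real p)\<^sup>2" using al2[OF _ tQ 3] p ps(2) by simp
     moreover have "(1 / p)\<^sup>2 = 1 / (real p)\<^sup>2" "2 / (real p)\<^sup>2 = 1 / (real p)\<^sup>2 + 1 / (real p)\<^sup>2"
      by (simp_all add: power_one_over)
     ultimately show ?thesis unfolding e by linarith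
    qed
   qed
   hence "(SUM A:asg Q. \<bar>h p A - m p A\<bar>) <= (SUM A:asg Q. 2 / (real p)\<^sup>2)" by (intro sum_mono)
   thus ?thesis by (simp add: card_asg[OF Q] e_def)
  qed
  show "m p (\<lambda>q\<in>Q. {}) = 1" for p by (simp add: m_def local_coeff_def)
  let ?A = "{\<lambda>q\<in>Q. {}}"
  show "(SUM A:asg Q - ?A. \<bar>m p A\<bar>) <= 1/2" if p: "p \<in> set ps" for p
  proof -
   have p0: "real p >= 1" using pr(1)[OF p] prime_ge_1_nat[of p] by simp
   have "(SUM A:asg Q - ?A. \<bar>m p A\<bar>) <= (SUM A:asg Q - ?A. 1 / p)"
   proof (rule sum_mono)
    fix A assume A: "A \<in> asg Q - ?A"
    have "touched Q A ~= {}"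
    proof
     assume "touched Q A = {}"
     hence "A = (\<lambda>q\<in>Q. {})" using A by (intro PiE_ext[of A Q]) (auto simp: touched_def)
     thus False using A by simp
    qed
    hence "card (touched Q A) >= 1" using finite_subset[OF tQ Q] by (simp add: Suc_le_eq card_gt_0_iff)
    hence "(1 / p) ^ card (touched Q A) <= (1 / p) ^ 1" using p0 by (intro power_decreasing) auto
    thus "\<bar>m p A\<bar> <= 1 / p" unfolding m_alt abs_mult sg by simp
   qed
   also have "... <= (SUM A:asg Q. 1 / p)" by (rule sum_mono2) (use finite_asg[OF Q] in auto)
   also have "... = 4 ^ card Q / p" by (simp add: card_asg[OF Q])
   also have "... <= 1/2"
   proof -
    have "2 * 4 ^ card Q <= p" using w pr(2)[OF p] by simp
    hence "real (2 * 4 ^ card Q) <= p" by linarith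
    thus ?thesis using p0 by simp
   qed
   finally show ?thesis .
  qed
  show "bd (Op Q m ps (chi2 Q L)) ((3025 * G) ^ card Q)"
   unfolding bd_def OpM
  proof (intro allI impI)
   fix u :: "'q => bool => real" assume u: "ALL q i. 0 <= u q i"
   have "(PROD q:Q. \<bar>selG L (set ps) (u q False) (u q True)\<bar>) <= (PROD q:Q. 3025 * G)"
    using selb(2) u by (intro prod_mono) auto
   thus "\<bar>PROD q:Q. selG L (set ps) (u q False) (u q True)\<bar> <= (3025 * G) ^ card Q"
    unfolding abs_prod by simp
  qed
 qed
 hence "\<bar>Op Q h ps (chi2 Q L) (%_ _. 0) - Op Q m ps (chi2 Q L) (%_ _. 0)\<bar> <= (prod_list (map (%p. 1 + 2 * e p) ps) - 1) * (3025 * G) ^ card Q"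
  by (simp add: bd_def)
 also have "Op Q m ps (chi2 Q L) (%_ _. 0) = G ^ card Q" by (simp only: OpM G_def L_def[symmetric] ps(2) prod_constant)
 also have "(prod_list (map (%p. 1 + 2 * e p) ps) - 1) * (3025 * G) ^ card Q <= (exp ?C - 1) * (3025 * G) ^ card Q"
 proof (rule mult_right_mono)
  have "prod_list (map (%p. 1 + 2 * e p) ps) = (PROD p:set ps. 1 + 2 * e p)" using ps(1) by (simp add: prod.distinct_set_conv_list)
  also have "... <= (PROD p:set ps. exp (2 * e p))"
   by (intro prod_mono) (auto simp: e_def intro!: exp_ge_add_one_self add_nonneg_nonneg)
  also have "... = exp (SUM p:set ps. 2 * e p)" by (rule exp_sum[symmetric]) simp
  also have "... <= exp ?C"
  proof -
   have "(SUM p:set ps. 2 * e p) <= (SUM p:{Suc w..R}. 4 ^ (card Q + 1) * (1 / (real p)\<^sup>2))"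
    unfolding e_def by (rule order_trans[OF _ sum_mono2[of "{Suc w..R}" "set ps"]]) (auto simp: ps(2) sieve_primes_def)
   also have "... <= 4 ^ (card Q + 1) * (1 / w)"
    unfolding sum_distrib_left[symmetric]
   proof (rule mult_left_mono)
    let ?B = "SUM p:{Suc w..R}. 1 / (real p)\<^sup>2"
    have "(SUM p:{Suc w..w + n}. 1 / (real p)\<^sup>2) <= 1 / real w - 1 / real (w + n)" for n
    proof (induction n)
     case (Suc n)
     define y where "y = real (w + n)"
     have y: "y > 0" using w0 by (simp add: y_def)
     have "(SUM p:{Suc w..w + Suc n}. 1 / (real p)\<^sup>2) = 1 / (y + 1)\<^sup>2 + (SUM p:{Suc w..w + n}. 1 / (real p)\<^sup>2)"
      by (simp add: y_def)
     also have "... <= 1 / (y + 1)\<^sup>2 + (1 / w - 1 / y)" using Suc by (simp add: y_def)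
     also have "... <= 1 / w - 1 / (y + 1)"
     proof -
      have "1 / (y + 1)\<^sup>2 <= 1 / (y * (y + 1))"
      proof (rule frac_le)
       show "0 < y * (y + 1)" using y by simp
       show "y * (y + 1) <= (y + 1)\<^sup>2" using y by (simp add: power2_eq_square)
      qed auto
      also have "... = 1 / y - 1 / (y + 1)" using y by (simp add: field_simps)
      finally show ?thesis by simp
     qed
     finally show ?case by (simp add: y_def add_ac)
    qed simp
    from this[of "R - w"] R(2) have "?B <= 1 / w - 1 / R" by simp
    also have "... <= 1 / w" by simp
    finally show "?B <= 1 / w" .
   qed simp
   finally show ?thesis by simp
  qed
  finally show "prod_list (map (%p. 1 + 2 * e p) ps) - 1 <= exp ?C - 1" by simp
 qed (use selb in auto)
 finally show ?thesis by (simp add: h_def[abs_def] L_def)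
qed

section \<open>Linear forms: local densities and equidistribution\<close>

definition lform :: "nat => (nat => int) => (nat => int) => int" where
 "lform t a x = (\<Sum>i<t. a i * x i)"

lemma lform_upd: "i < t ==> lform t a (x(i := y)) = a i * y + (SUM j:{..<t} - {i}. a j * x j)"
 unfolding lform_def by (subst sum.remove[of _ i]) auto

lemma avg_affine_mod:
 assumes "N > 0" "coprime c (int N)"
 shows "avg (zN N) (%y. G ((c * y + d) mod int N)) = avg (zN N) G"
proof -
 have "avg (zN N) (%y. G ((c * y + d) mod int N)) = avg (zN N) (%y. G (((c * y) mod int N + d) mod int N))"
  by (simp add: mod_simps)
 also have "... = avg (zN N) (%y. G ((y + d) mod int N))"
  by (rule avg_mult_mod[OF assms, of "%y. G ((y + d) mod int N)"])
 finally show ?thesis using avg_shift_mod[OF assms(1)] by simp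
qed

lemma lform_uniform:
 assumes "N > 0" "i < t" "coprime (a i) (int N)"
 shows "avg (cube t (zN N)) (%x. G (lform t a x mod int N)) = avg (zN N) G"
proof -
 have "avg (cube t (zN N)) (%x. G (lform t a x mod int N)) = avg (cube t (zN N)) (%x. avg (zN N) (%y. G (lform t a (x(i := y)) mod int N)))"
  by (rule avg_resample[symmetric]) (use assms in auto)
 also have "... = avg (cube t (zN N)) (%x. avg (zN N) G)"
  unfolding lform_upd[OF assms(2)] avg_affine_mod[OF assms(1,3)] ..
 also have "... = avg (zN N) G" by (rule avg_const) (rule cube_zN[OF assms(1)])+
 finally show ?thesis .
qed

lemma coord_uniform:
 assumes "N > 0" "i < t"
 shows "avg (cube t (zN N)) (%x. G (x i)) = avg (zN N) G"
proof -
 have "avg (cube t (zN N)) (%x. G (x i)) = avg (cube t (zN N)) (%x. avg (zN N) (%y. G ((x(i := y)) i)))"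
  by (rule avg_resample[symmetric]) (use assms in auto)
 also have "... = avg (zN N) G" by (simp add: avg_const[OF cube_zN[OF assms(1)]])
 finally show ?thesis .
qed

lemma avg_near_ends:
 assumes "N > 0" "H >= 0"
 shows "avg (zN N) (%y. of_bool (y < H \<or> int N - H <= y)) <= 2 * real_of_int H / N"
proof -
 let ?A = "SUM y:zN N. of_bool (y < H \<or> int N - H <= y) :: real"
 have "?A = card {y\<in>zN N. y < H \<or> int N - H <= y}"
  unfolding real_of_card sum.inter_filter[OF finite_atLeastLessThan_int] by (rule sum.cong) auto
 also have "card {y\<in>zN N. y < H \<or> int N - H <= y} <= card ({0..<H} \<union> {int N - H..<int N})"
  by (rule card_mono) auto
 also have "card ({0..<H} \<union> {int N - H..<int N}) <= nat H + nat H"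
  by (rule order_trans[OF card_Un_le]) simp
 finally have "?A <= 2 * real_of_int H" using assms(2) by simp
 thus ?thesis by (simp add: avg_def divide_right_mono)
qed

lemma shift_bij:
 assumes "N > 0"
 shows "bij_betw (%x. \<lambda>i\<in>{..<t}. (x i + h i) mod int N) (cube t (zN N)) (cube t (zN N))"
 using bij_betw_PiE_coord[of "{..<t}" "%i y. (y + h i) mod int N" "zN N"] bij_shift_mod[OF assms] by simp

lemma coprime_small:
 assumes "coprime N (fact K)" "c ~= 0" "\<bar>c\<bar> <= int K" shows "coprime c (int N)"
proof -
 have "nat \<bar>c\<bar> dvd fact K" by (rule dvd_fact) (use assms in auto)
 hence "coprime (nat \<bar>c\<bar>) N" using assms(1) by (metis coprime_commute coprime_divisors dvd_refl)
 thus ?thesis by simp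
qed

lemma dvd_iff_of_dvd_diff: "(n::int) dvd A - B ==> n dvd A \<longleftrightarrow> n dvd B"
 by (metis diff_add_cancel dvd_add_right_iff)

lemma abs_diff_chain: "\<bar>x - y\<bar> <= e ==> \<bar>y - z\<bar> <= f ==> \<bar>x - z\<bar> <= e + (f::real)"
 by simp

lemma not_dvd_small: "(c::int) ~= 0 ==> \<bar>c\<bar> < int p ==> \<not> int p dvd c"
 by (metis abs_of_nat dvd_imp_le_int linorder_not_le)

locale lin_forms =
 fixes t :: nat and Q :: "'q set" and a :: "'q => nat => int" and K :: nat
 assumes finQ: "finite Q" and K: "K >= 1"
  and coef: "!!q i. q \<in> Q ==> i < t ==> \<bar>a q i\<bar> <= int K"
  and nonzero: "!!q. q \<in> Q ==> \<exists>i<t. a q i ~= 0"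
  and indep2: "!!q q'. q \<in> Q ==> q' \<in> Q ==> q ~= q' ==> \<exists>i<t. \<exists>j<t. a q i * a q' j ~= a q j * a q' i"
begin

text \<open>Divisibility of the values of the forms in \<open>I\<close>, reduced modulo \<open>N\<close> with quotients \<open>pa\<close>.\<close>

definition cond :: "nat => nat => nat => ('q => int) => nat => 'q set => (nat => int) => bool" where
 "cond N W b pa p I x \<longleftrightarrow> (ALL q:I. int p dvd int W * (lform t (a q) x - int N * pa q) + int b)"

definition dens :: "nat => nat => nat => ('q => int) => nat => 'q set => real" where
 "dens N W b pa p I = avg (cube t (zN p)) (%z. of_bool (cond N W b pa p I z))"

lemma cond_cong:
 assumes "!!i. i < t ==> int p dvd x i - y i"
 shows "cond N W b pa p I x = cond N W b pa p I y"
proof -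
 have lf: "int p dvd lform t (a q) x - lform t (a q) y" for q
  unfolding lform_def sum_subtractf[symmetric] right_diff_distrib[symmetric]
  by (rule dvd_sum) (use assms in auto)
 have "int p dvd (int W * (lform t (a q) x - int N * pa q) + int b) - (int W * (lform t (a q) y - int N * pa q) + int b)" for q
 proof -
  show ?thesis using lf[of q] by (auto simp: algebra_simps)
 qed
 thus ?thesis unfolding cond_def by (intro ball_cong refl dvd_iff_of_dvd_diff)
qed

lemma dens_bounds: "p > 0 ==> 0 <= dens N W b pa p I & dens N W b pa p I <= 1"
 unfolding dens_def by (intro conjI avg_nonneg avg_le_const cube_zN) auto

lemma dens_empty: "p > 0 ==> dens N W b pa p {} = 1"
 unfolding dens_def cond_def by (simp add: avg_const[OF cube_zN])

lemma dens_single: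
 assumes p: "prime p" "p > K" "\<not> p dvd W" and q: "q \<in> Q"
 shows "dens N W b pa p {q} = 1 / p"
proof -
 have p0: "p > 0" using p(1) by (simp add: prime_gt_0_nat)
 obtain i where i: "i < t" "a q i ~= 0" using nonzero[OF q] by blast
 have "\<not> int p dvd a q i" using coef[OF q i(1)] i p by (intro not_dvd_small) auto
 hence ci: "coprime (a q i) (int p)" using p(1) by (metis coprime_commute prime_imp_coprime prime_nat_int_transfer)
 have cW: "coprime (int W) (int p)" using p(1,3) prime_imp_coprime[of p W] by (simp add: coprime_commute)
 define G where "G s = (of_bool (int p dvd int W * (s - int N * pa q) + int b) :: real)" for s
 have "G (s mod int p) = G s" for s
 proof -
  have "int p dvd (int W * (s mod int p - int N * pa q) + int b) - (int W * (s - int N * pa q) + int b)"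
  proof -
   have "(int W * (s mod int p - int N * pa q) + int b) - (int W * (s - int N * pa q) + int b) = int W * (s mod int p - s)"
    by (simp add: algebra_simps)
   moreover have "int p dvd s mod int p - s" by (metis dvd_minus_mod dvd_diff_commute)
   ultimately show ?thesis by simp
  qed
  thus ?thesis unfolding G_def by (intro arg_cong[of _ _ of_bool] dvd_iff_of_dvd_diff)
 qed
 hence "dens N W b pa p {q} = avg (cube t (zN p)) (%z. G (lform t (a q) z mod int p))"
  unfolding dens_def cond_def by (simp add: G_def)
 also have "... = avg (zN p) G" by (rule lform_uniform[where a = "a q", OF p0 i(1) ci])
 also have "... = avg (zN p) (%s. of_bool ((int W * s + (int b - int W * (int N * pa q))) mod int p = 0))"
  unfolding G_def by (intro avg_cong) (simp add: algebra_simps dvd_eq_mod_eq_0)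
 also have "... = avg (zN p) (%s. of_bool (s = 0))"
  by (rule avg_affine_mod[OF p0 cW])
 also have "... = 1 / p"
 proof -
  show ?thesis using p0 by (simp add: avg_def)
 qed
 finally show ?thesis .
qed

text \<open>Two forms of I have a 2x2 minor that is nonzero and smaller than p in absolute value,
  hence invertible modulo p. With the other coordinates fixed, at most one pair of values for the
  two coordinates of that minor satisfies both conditions.\<close>

lemma dens_double:
 assumes p: "prime p" "p > 2 * K ^ 2" "\<not> p dvd W" and I: "I \<subseteq> Q" "card I >= 2"
 shows "\<bar>dens N W b pa p I\<bar> <= 1 / (p)\<^sup>2"
proof -
 have p0: "p > 0" using p(1) by (simp add: prime_gt_0_nat)
 have fI: "finite I" using I finQ finite_subset by blast
 obtain q q' where q: "q \<in> I" "q' \<in> I" "q ~= q'"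
  using I(2) card_le_Suc0_iff_eq[OF fI] by auto
 hence qQ: "q \<in> Q" "q' \<in> Q" using I by auto
 obtain i j where ij: "i < t" "j < t" "a q i * a q' j ~= a q j * a q' i" using indep2[OF qQ q(3)] by blast
 define A B A' B' where "A = a q i" "B = a q j" "A' = a q' i" "B' = a q' j"
 note AB = this
 have minor: "\<not> int p dvd A * B' - B * A'"
 proof (rule not_dvd_small)
  have "\<bar>A * B' - B * A'\<bar> <= \<bar>A\<bar> * \<bar>B'\<bar> + \<bar>B\<bar> * \<bar>A'\<bar>" by (metis abs_mult abs_triangle_ineq4)
  also have "... <= int K * int K + int K * int K"
   unfolding AB using coef qQ ij by (intro add_mono mult_mono) auto
  also have "... = int (2 * K ^ 2)" by (simp add: power2_eq_square)
  also have "... < int p" using p(2) by linarith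
  finally show "\<bar>A * B' - B * A'\<bar> < int p" .
 qed (use ij in \<open>simp add: AB\<close>)
 have pp: "prime (int p)" using p(1) by simp
 have pW: "\<not> int p dvd int W" using p(3) by simp
 have lf: "lform t c (x(i := u, j := v)) = c i * u + c j * v + (SUM l:{..<t} - {i} - {j}. c l * x l)" for c x u v
 proof -
  have "lform t c (x(i := u, j := v)) = c j * v + (SUM l:{..<t} - {j}. c l * (x(i := u)) l)" by (rule lform_upd[OF ij(2)])
  also have "(SUM l:{..<t} - {j}. c l * (x(i := u)) l) = c i * u + (SUM l:{..<t} - {j} - {i}. c l * x l)"
   using ij by (subst sum.remove[of _ i]) auto
  finally have "lform t c (x(i := u, j := v)) = c j * v + (c i * u + (SUM l:{..<t} - {j} - {i}. c l * x l))" .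
  moreover have "{..<t} - {j} - {i} = {..<t} - {i} - {j}" by auto
  ultimately show ?thesis by simp
 qed
 have one: "avg (zN p) (%u. avg (zN p) (%v. of_bool (cond N W b pa p I (x(i := u, j := v))))) <= 1 / (real p)\<^sup>2" for x
 proof -
  define T where "T = {z\<in>zN p \<times> zN p. cond N W b pa p I (x(i := fst z, j := snd z))}"
  have fT: "finite T" by (simp add: T_def)
  have "card T <= Suc 0"
   unfolding card_le_Suc0_iff_eq[OF fT]
  proof (intro ballI)
   fix z z' assume z: "z \<in> T" "z' \<in> T"
   have d: "int p dvd a r i * (fst z - fst z') + a r j * (snd z - snd z')" if r: "r \<in> I" for r
   proof -
    have "int p dvd (int W * (lform t (a r) (x(i := fst z, j := snd z)) - int N * pa r) + int b)
      - (int W * (lform t (a r) (x(i := fst z', j := snd z')) - int N * pa r) + int b)"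
     using z r by (intro dvd_diff) (auto simp: T_def cond_def)
    also have "... = int W * (a r i * (fst z - fst z') + a r j * (snd z - snd z'))" unfolding lf by (simp add: algebra_simps)
    finally show ?thesis using pp pW by (simp add: prime_dvd_mult_iff)
   qed
   have d1: "int p dvd A * (fst z - fst z') + B * (snd z - snd z')" and d2: "int p dvd A' * (fst z - fst z') + B' * (snd z - snd z')"
    using d[OF q(1)] d[OF q(2)] by (auto simp: AB)
   have "int p dvd B' * (A * (fst z - fst z') + B * (snd z - snd z')) - B * (A' * (fst z - fst z') + B' * (snd z - snd z'))"
    using d1 d2 by simp
   also have "... = (A * B' - B * A') * (fst z - fst z')" by (simp add: algebra_simps)
   finally have e1: "int p dvd fst z - fst z'" using pp minor by (simp add: prime_dvd_mult_iff)
   have "int p dvd A * (A' * (fst z - fst z') + B' * (snd z - snd z')) - A' * (A * (fst z - fst z') + B * (snd z - snd z'))"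
    using d1 d2 by simp
   also have "... = (A * B' - B * A') * (snd z - snd z')" by (simp add: algebra_simps)
   finally have e2: "int p dvd snd z - snd z'" using pp minor by (simp add: prime_dvd_mult_iff)
   have bnd: "0 <= fst z & fst z < int p & 0 <= snd z & snd z < int p" if "z \<in> T" for z
    using that by (auto simp: T_def)
   have "\<bar>fst z - fst z'\<bar> < int p" "\<bar>snd z - snd z'\<bar> < int p" using bnd[OF z(1)] bnd[OF z(2)] by auto
   hence "fst z - fst z' = 0" "snd z - snd z' = 0" using e1 e2 not_dvd_small by blast+
   hence "fst z = fst z'" "snd z = snd z'" by auto
   thus "z = z'" by (rule prod_eqI)
  qed
  hence cT: "real (card T) <= 1" by simp
  have "(SUM u:zN p. SUM v:zN p. of_bool (cond N W b pa p I (x(i := u, j := v))) :: real) = (card T)"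
   unfolding T_def sum.cartesian_product real_of_card
   by (subst sum.inter_filter) (auto intro!: sum.cong)
  thus ?thesis using cT by (simp add: avg_def sum_divide_distrib[symmetric] power2_eq_square divide_right_mono)
 qed
 have "dens N W b pa p I = avg (cube t (zN p)) (%x. avg (zN p) (%v. of_bool (cond N W b pa p I (x(j := v)))))"
  unfolding dens_def by (rule avg_resample[symmetric]) (use p0 ij in auto)
 also have "... = avg (cube t (zN p)) (%x. avg (zN p) (%u. avg (zN p) (%v. of_bool (cond N W b pa p I (x(i := u, j := v))))))"
  by (rule avg_resample[symmetric]) (use p0 ij in auto)
 also have "... <= 1 / (real p)\<^sup>2" by (rule avg_le_const[OF cube_zN[OF p0] one])
 finally show ?thesis using dens_bounds[OF p0] by simp
qed

text \<open>The residue of a form modulo N is not affine modulo p. It becomes affine once its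
  quotient by N is prescribed, and only boundedly many quotients occur.\<close>

definition pat :: "nat => ('q => int) => (nat => int) => bool" where
 "pat N pa x \<longleftrightarrow> (ALL q:Q. lform t (a q) x div int N = pa q)"

text \<open>The points at which a shift of size up to H might wrap a coordinate around or alter a
  quotient.\<close>

definition near_end :: "nat => int => (nat => int) => bool" where
 "near_end N H x \<longleftrightarrow> (\<exists>i<t. x i < H \<or> int N - H <= x i) \<or> (EX q:Q. lform t (a q) x mod int N < H \<or> int N - H <= lform t (a q) x mod int N)"

lemma avg_near_end:
 assumes N: "N > 0" "coprime N (fact K)" and H: "H >= 0"
 shows "avg (cube t (zN N)) (%x. of_bool (near_end N H x)) <= 2 * real (t + card Q) * real_of_int H / N"
proof -
 let ?Om = "cube t (zN N)"
 have "avg ?Om (%x. of_bool (near_end N H x)) <= avg ?Om (%x. (\<Sum>i<t. of_bool (x i < H \<or> int N - H <= x i))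
   + (SUM q:Q. of_bool (lform t (a q) x mod int N < H \<or> int N - H <= lform t (a q) x mod int N)))"
 proof (rule avg_mono)
  fix x
  show "of_bool (near_end N H x) <= (\<Sum>i<t. of_bool (x i < H \<or> int N - H <= x i))
   + (SUM q:Q. of_bool (lform t (a q) x mod int N < H \<or> int N - H <= lform t (a q) x mod int N) :: real)"
  proof (cases "near_end N H x")
   case True
   then consider i where "i < t" "x i < H \<or> int N - H <= x i"
    | q where "q \<in> Q" "lform t (a q) x mod int N < H \<or> int N - H <= lform t (a q) x mod int N" by (auto simp: near_end_def)
   thus ?thesis
   proof cases
    case 1
    thus ?thesis using member_le_sum[of i "{..<t}" "%i. of_bool (x i < H \<or> int N - H <= x i) :: real"] by (simp add: sum_nonneg add_increasing2)
   next
    case 2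
    thus ?thesis using member_le_sum[of q Q "%q. of_bool (lform t (a q) x mod int N < H \<or> int N - H <= lform t (a q) x mod int N) :: real"] finQ by (simp add: sum_nonneg add_increasing)
   qed
  qed (simp add: sum_nonneg)
 qed
 also have "... = (\<Sum>i<t. avg ?Om (%x. of_bool (x i < H \<or> int N - H <= x i)))
   + (SUM q:Q. avg ?Om (%x. of_bool (lform t (a q) x mod int N < H \<or> int N - H <= lform t (a q) x mod int N)))"
  by (simp only: avg_add avg_sum)
 also have "... <= (\<Sum>i<t. 2 * real_of_int H / N) + (SUM q:Q. 2 * real_of_int H / N)"
 proof (intro add_mono sum_mono)
  fix i assume "i \<in> {..<t}"
  thus "avg ?Om (%x. of_bool (x i < H \<or> int N - H <= x i)) <= 2 * real_of_int H / N"
   using coord_uniform[OF N(1), of i t "%y. of_bool (y < H \<or> int N - H <= y)"] avg_near_ends[OF N(1) H] by simp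
 next
  fix q assume q: "q \<in> Q"
  obtain i where i: "i < t" "a q i ~= 0" using nonzero[OF q] by blast
  have "coprime (a q i) (int N)" by (rule coprime_small[OF N(2) i(2) coef[OF q i(1)]])
  from lform_uniform[where G = "%y. of_bool (y < H \<or> int N - H <= y)" and a = "a q", OF N(1) i(1) this]
  show "avg ?Om (%x. of_bool (lform t (a q) x mod int N < H \<or> int N - H <= lform t (a q) x mod int N)) <= 2 * real_of_int H / N"
   using avg_near_ends[OF N(1) H] by simp
 qed
 also have "... = 2 * real (t + card Q) * real_of_int H / N" by (simp add: field_simps add_divide_distrib)
 finally show ?thesis .
qed

lemma div_add_small: "0 <= s mod n + d ==> s mod n + d < n ==> (s + d) div n = s div (n::int)"
proof -
 assume *: "0 <= s mod n + d" "s mod n + d < n"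
 have "(s + d) div n = ((s mod n + d) + s div n * n) div n" by simp
 also have "... = s div n + (s mod n + d) div n" by (rule div_mult_self1) (use * in linarith)
 also have "... = s div n" using * by simp
 finally show ?thesis .
qed

text \<open>Primes are added one at a time. Translating x by D v, with D the product of the earlier
  primes, preserves the earlier conditions and, away from \<open>near_end\<close>, the pattern; as v
  runs over residues modulo p it decouples the condition at p, because D is invertible modulo
  p.\<close>

lemma equidistribution:
 assumes N: "N > 0" "coprime N (fact K)" and P: "finite P" "ALL p:P. prime p" and I: "!!p. p \<in> P ==> I p \<subseteq> Q"
 defines "C \<equiv> 2 * real (t + card Q) * real (K * (t + 1))"
 shows "\<bar>avg (cube t (zN N)) (%x. of_bool (pat N pa x) * (PROD p:P. of_bool (cond N W b pa p (I p) x)))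
   - avg (cube t (zN N)) (%x. of_bool (pat N pa x)) * (PROD p:P. dens N W b pa p (I p))\<bar> <= 2 * C * real (pprod P) / real N"
 using P I
proof (induction P)
 case empty
 thus ?case by (simp add: C_def)
next
 case (insert p P)
 let ?Om = "cube t (zN N)"
 have C0: "C >= 0" by (simp add: C_def)
 have pr: "prime p" "p >= 2" "p > 0" using insert.prems(1) prime_ge_2_nat[of p] by auto
 define D where "D = pprod P"
 have D1: "D >= 1" using prod_primes_pos[of P] insert.prems by (simp add: D_def)
 have pD: "pprod (insert p P) = p * D" using insert.hyps by (simp add: pprod_insert D_def)
 have dD: "p' dvd D" if "p' \<in> P" for p' using that insert.hyps prime_dvd_prod_primes_iff[of P p'] insert.prems by (simp add: D_def)
 have cop: "coprime (int D) (int p)"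
 proof -
  have "coprime p D" using insert.hyps insert.prems prime_dvd_prod_primes_iff[of P p] by (simp add: D_def prime_imp_coprime)
  thus ?thesis by (simp add: coprime_commute)
 qed
 \<comment> \<open>Large enough for the coordinate shifts D * v i as well as for the shifts D *
   lform v that they induce on the forms.\<close>
 define H where "H = int (K * (t + 1) * D * p)"
 define f where "f x = of_bool (pat N pa x) * (PROD p:P. of_bool (cond N W b pa p (I p) x) :: real)" for x
 define F where "F x = of_bool (cond N W b pa p (I p) x) * f x" for x
 define al where "al = dens N W b pa p (I p)"
 have al: "0 <= al" "al <= 1" using dens_bounds[OF pr(3)] by (auto simp: al_def)
 have f01: "0 <= f x" "f x <= 1" for x unfolding f_def by (auto intro!: prod_nonneg mult_le_one prod_le_1)
 have F01: "0 <= F x" "F x <= 1" for x unfolding F_def using f01[of x] by auto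
 define sft where "sft v = (%x. \<lambda>i\<in>{..<t}. (x i + int D * v i) mod int N)" for v x :: "nat => int"
 have key: "\<bar>avg (cube t (zN p)) (%v. F (sft v x)) - al * f x\<bar> <= of_bool (near_end N H x)" if x: "x \<in> ?Om" for x
 proof (cases "near_end N H x")
  case True
  have "0 <= avg (cube t (zN p)) (%v. F (sft v x))" "avg (cube t (zN p)) (%v. F (sft v x)) <= 1"
   by (intro avg_nonneg avg_le_const cube_zN[OF pr(3)] F01)+
  moreover have "0 <= al * f x" "al * f x <= 1" using al f01[of x] by (auto intro: mult_le_one)
  ultimately show ?thesis using True by simp
 next
  case False
  have good: "H <= x i" "x i < int N - H" if "i < t" for i
  proof -
   show "H <= x i" "x i < int N - H" using False that by (auto simp: near_end_def)
  qed
  have goodq: "H <= lform t (a q) x mod int N" "lform t (a q) x mod int N < int N - H" if "q \<in> Q" for q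
  proof -
   show "H <= lform t (a q) x mod int N" "lform t (a q) x mod int N < int N - H" using False that by (auto simp: near_end_def)
  qed
  have Fv: "F (sft v x) = of_bool (cond N W b pa p (I p) (%i. x i + int D * v i)) * f x" if v: "v \<in> cube t (zN p)" for v
  proof -
   have vb: "0 <= v i" "v i <= int p" if "i < t" for i using that PiE_mem[OF v, of i] by auto
   have Dv: "0 <= int D * v i" "int D * v i <= H" if "i < t" for i
   proof -
    show "0 <= int D * v i" using vb[OF that] by simp
    have "int D * v i <= int D * int p" using vb[OF that] by (intro mult_left_mono) auto
    also have "... = 1 * (int D * int p)" by simp
    also have "... <= int (K * (t + 1)) * (int D * int p)"
    proof (rule mult_right_mono)
     have "1 <= K * (t + 1)" using K by simp
     thus "1 <= int (K * (t + 1))" by linarith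
    qed simp
    finally show "int D * v i <= H" by (simp add: H_def)
   qed
   have sx: "sft v x i = x i + int D * v i" if "i < t" for i
   proof -
    have "0 <= x i + int D * v i" "x i + int D * v i < int N" using good[OF that] Dv[OF that] by auto
    thus ?thesis using that by (simp add: sft_def)
   qed
   have lfs: "lform t (a q) (sft v x) = lform t (a q) x + int D * lform t (a q) v" for q
    unfolding lform_def sum_distrib_left sum.distrib[symmetric] by (rule sum.cong) (auto simp: sx algebra_simps)
   have lfb: "\<bar>int D * lform t (a q) v\<bar> <= H" if q: "q \<in> Q" for q
   proof -
    have "\<bar>lform t (a q) v\<bar> <= (\<Sum>i<t. int K * int p)"
     unfolding lform_def using coef[OF q] vb by (intro order_trans[OF sum_abs] sum_mono) (auto simp: abs_mult intro!: mult_mono)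
    also have "... <= int (K * (t + 1) * p)" by (simp add: algebra_simps)
    finally have "int D * \<bar>lform t (a q) v\<bar> <= int D * int (K * (t + 1) * p)" by (intro mult_left_mono) auto
    thus ?thesis by (simp add: H_def abs_mult mult_ac)
   qed
   have "lform t (a q) (sft v x) div int N = lform t (a q) x div int N" if q: "q \<in> Q" for q
    unfolding lfs using lfb[OF q] goodq[OF q] by (intro div_add_small) auto
   hence 1: "pat N pa (sft v x) = pat N pa x" by (simp add: pat_def)
   have "cond N W b pa p' (I p') (sft v x) = cond N W b pa p' (I p') x" if "p' \<in> P" for p'
   proof (rule cond_cong)
    fix i assume "i < t"
    thus "int p' dvd sft v x i - x i" using dD[OF that] by (simp add: sx)
   qed
   hence 2: "f (sft v x) = f x" unfolding f_def 1 by simp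
   have "cond N W b pa p (I p) (sft v x) = cond N W b pa p (I p) (%i. x i + int D * v i)"
    by (rule cond_cong) (simp add: sx)
   thus ?thesis by (simp add: F_def 2)
  qed
  have "avg (cube t (zN p)) (%v. F (sft v x)) = avg (cube t (zN p)) (%v. of_bool (cond N W b pa p (I p) (%i. x i + int D * v i))) * f x"
   unfolding avg_cmult_right[symmetric] by (rule avg_cong) (rule Fv)
  also have "avg (cube t (zN p)) (%v. of_bool (cond N W b pa p (I p) (%i. x i + int D * v i))) = al"
  proof -
   define g where "g i y = (int D * y + x i) mod int p" for i y
   have "bij_betw (g i) (zN p) (zN p)" for i
   proof -
    have "bij_betw ((%y. (y + x i) mod int p) \<circ> (%y. (int D * y) mod int p)) (zN p) (zN p)"
     by (rule bij_betw_trans[OF bij_mult_mod[OF pr(3) cop] bij_shift_mod[OF pr(3)]])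
    thus ?thesis by (simp add: g_def[abs_def] o_def mod_simps)
   qed
   hence bij: "bij_betw (%v. \<lambda>i\<in>{..<t}. g i (v i)) (cube t (zN p)) (cube t (zN p))" by (intro bij_betw_PiE_coord)
   have "al = avg (cube t (zN p)) (%v. of_bool (cond N W b pa p (I p) (\<lambda>i\<in>{..<t}. g i (v i))))"
    unfolding al_def dens_def by (rule avg_reindex[OF bij, symmetric])
   also have "... = avg (cube t (zN p)) (%v. of_bool (cond N W b pa p (I p) (%i. x i + int D * v i)))"
   proof (rule avg_cong, rule arg_cong[of _ _ of_bool], rule cond_cong)
    fix v and i assume "i < t"
    thus "int p dvd (\<lambda>i\<in>{..<t}. g i (v i)) i - (x i + int D * v i)"
     by (simp add: g_def add.commute dvd_diff_commute)
   qed
   finally show ?thesis by simp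
  qed
  finally show ?thesis by simp
 qed
 have "avg ?Om F = avg (cube t (zN p)) (%v. avg ?Om F)" by (simp add: avg_const[OF cube_zN[OF pr(3)]])
 also have "... = avg (cube t (zN p)) (%v. avg ?Om (%x. F (sft v x)))"
 proof (rule avg_cong)
  fix v
  show "avg ?Om F = avg ?Om (%x. F (sft v x))"
   unfolding sft_def by (rule avg_reindex[OF shift_bij[OF N(1)], symmetric])
 qed
 also have "... = avg ?Om (%x. avg (cube t (zN p)) (%v. F (sft v x)))" by (rule avg_swap)
 finally have "avg ?Om F - al * avg ?Om f = avg ?Om (%x. avg (cube t (zN p)) (%v. F (sft v x)) - al * f x)"
  by (simp add: avg_diff avg_cmult)
 also have "\<bar>\<dots>\<bar> <= avg ?Om (%x. of_bool (near_end N H x))"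
  by (rule order_trans[OF avg_abs avg_mono]) (rule key)
 also have "... <= 2 * real (t + card Q) * real_of_int H / N" by (rule avg_near_end[OF N]) (simp add: H_def)
 also have "... = C * (p * D) / N" by (simp add: C_def H_def)
 finally have s1: "\<bar>avg ?Om F - al * avg ?Om f\<bar> <= C * (p * D) / N" .
 define m where "m = avg ?Om (%x. of_bool (pat N pa x)) * (PROD p:P. dens N W b pa p (I p))"
 have IH: "\<bar>avg ?Om f - m\<bar> <= 2 * C * D / N"
  using insert by (simp add: f_def[abs_def] m_def D_def)
 have "\<bar>al * avg ?Om f - al * m\<bar> <= 1 * (2 * C * D / N)"
  unfolding right_diff_distrib[symmetric] abs_mult using al IH by (intro mult_mono) auto
 \<comment> \<open>Because p \<ge> 2, the inherited error 2 C D/N fits into C p D/N; together with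
   the new error of the same size the factor 2 is restored and does not accumulate.\<close>
 also have "... <= C * (p * D) / N"
 proof -
  have "2 * D <= p * D" using pr(2) by simp
  hence "2 * real D <= (p * D)" by linarith
  thus ?thesis using C0 by (simp add: divide_right_mono mult_ac mult_left_mono)
 qed
 finally have s2: "\<bar>al * avg ?Om f - al * m\<bar> <= C * (p * D) / N" .
 have "\<bar>avg ?Om F - al * m\<bar> <= C * (p * D) / N + C * (p * D) / N" by (rule abs_diff_chain[OF s1 s2])
 moreover have "C * (p * D) / N + C * (p * D) / N = 2 * C * (p * D) / N" by simp
 ultimately show ?case
  using insert.hyps unfolding pD by (simp add: F_def[abs_def] f_def m_def al_def mult_ac)
qed

end

section \<open>The normalised sieve weight and its linear forms estimate\<close>

definition selnu :: "nat => nat => nat => int => real" where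
 "selnu w R b y = (sieveL (ln (real R)) (sieve_primes w R) (%p. int p dvd int (pprod (primes_le w)) * y + int b) 0)\<^sup>2
   / selG (ln (real R)) (sieve_primes w R) 0 0"

lemma sieve_prime_not_dvd: "p \<in> sieve_primes w R ==> \<not> p dvd pprod (primes_le w)"
 by (subst prime_dvd_prod_primes_iff[OF finite_primes_le]) (auto simp: sieve_primes_def)

context lin_forms
begin

text \<open>Coefficients bounded by K and entries below N keep the quotients between -K t and K t,
  so the patterns form a partition of unity whose size is independent of N.\<close>

lemma pattern_unique:
 assumes N: "N > 0" and x: "x \<in> cube t (zN N)"
 shows "(SUM pa:PiE Q (%_. {- int (K * t)..int (K * t)}). of_bool (pat N pa x)) = (1::real)"
proof -
 define pa where "pa = (\<lambda>q\<in>Q. lform t (a q) x div int N)"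
 let ?Pats = "PiE Q (%_. {- int (K * t)..int (K * t)})"
 have "lform t (a q) x div int N \<in> {- int (K * t)..int (K * t)}" if q: "q \<in> Q" for q
 proof -
  have "\<bar>lform t (a q) x\<bar> <= (\<Sum>i<t. int K * int N)"
   unfolding lform_def
  proof (intro order_trans[OF sum_abs] sum_mono)
   fix i assume i: "i \<in> {..<t}"
   show "\<bar>a q i * x i\<bar> <= int K * int N" unfolding abs_mult using PiE_mem[OF x, of i] coef[OF q, of i] i by (intro mult_mono) auto
  qed
  also have "... = int (K * t) * int N" by simp
  finally have b: "- int (K * t) * int N <= lform t (a q) x" "lform t (a q) x <= int (K * t) * int N" by auto
  have "- int (K * t) <= lform t (a q) x div int N"
  proof -
   have "(- int (K * t) * int N) div int N = - int (K * t)" by (rule nonzero_mult_div_cancel_right) (use N in simp)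
   thus ?thesis using zdiv_mono1[OF b(1), of "int N"] N by simp
  qed
  moreover have "lform t (a q) x div int N <= int (K * t)" using zdiv_mono1[OF b(2), of "int N"] N by simp
  ultimately show ?thesis by simp
 qed
 hence in_Pats: "pa \<in> ?Pats" by (simp add: pa_def)
 have "pat N pa' x \<longleftrightarrow> pa' = pa" if pa': "pa' \<in> ?Pats" for pa'
 proof
  assume "pat N pa' x"
  thus "pa' = pa" by (intro PiE_ext[OF pa' in_Pats]) (simp add: pat_def pa_def)
 qed (simp add: pat_def pa_def)
 hence "(SUM pa':?Pats. of_bool (pat N pa' x)) = (SUM pa':?Pats. of_bool (pa' = pa) :: real)" by simp
 also have "... = (SUM pa':{pa}. of_bool (pa' = pa))"
  by (rule sum.mono_neutral_right) (use in_Pats finQ in \<open>auto intro!: finite_PiE\<close>)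
 finally show ?thesis by simp
qed

text \<open>The product of squares is expanded over patterns and assignments, averages are replaced
  by products of local densities, and these are resummed by \<open>Op\<close> and compared with
  \<open>G ^ card Q\<close>, which the normalisation cancels. Of the five exponents at R, two per
  form count assignments, two bound the modulus in \<open>equidistribution\<close>, and one comes
  from 1/G \<le> R.\<close>

theorem linear_forms_estimate:
 assumes N: "N > 0" "coprime N (fact K)"
  and R: "R >= 2" "w <= R" and WR: "pprod (primes_le w) <= R"
  and w: "2 * 4 ^ card Q <= w" "2 * K ^ 2 <= w"
 shows "\<bar>avg (cube t (zN N)) (%x. PROD q:Q. selnu w R b (lform t (a q) x mod int N)) - 1\<bar>
  <= (exp (4 ^ (card Q + 1) / real w) - 1) * 3025 ^ card Q
   + real (2 * K * t + 1) ^ card Q * (4 * real (t + card Q) * real (K * (t + 1)) * real R ^ (5 * card Q) / real N)"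
proof -
 let ?Om = "cube t (zN N)"
 define m where "m = card Q"
 define L where "L = ln (R)"
 define P where "P = sieve_primes w R"
 define W where "W = pprod (primes_le w)"
 define G where "G = selG L P 0 0"
 define Pats where "Pats = PiE Q (%_. {- int (K * t)..int (K * t)})"
 define C where "C = 2 * real (t + card Q) * (K * (t + 1))"
 have P: "finite P" "ALL p:P. prime p" using finite_sieve_primes by (auto simp: P_def)
 obtain ps where ps: "set ps = P" "distinct ps" using finite_distinct_list[OF P(1)] by blast
 have G: "G > 0" "1 / G <= R" using selG_bounds[OF R WR order_refl] by (auto simp: G_def L_def P_def)
 have C0: "C >= 0" by (simp add: C_def)
 have pw: "p > w" "prime p" "\<not> p dvd W" if "p \<in> P" for p using that sieve_prime_not_dvd[of p w R] by (auto simp: P_def W_def sieve_primes_def)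
 have fO: "finite ?Om" "?Om ~= {}" using cube_zN[OF N(1)] by auto
 define S where "S = PiE P (%_. asg Q)"
 define sg where "sg s = (PROD p:P. asgn_sign Q (s p))" for s
 define Ph where "Ph s = chi2 Q L (tot Q P s (%_ _. 0))" for s
 define A where "A pa s = avg ?Om (%x. of_bool (pat N pa x) * (PROD p:P. of_bool (cond N W b pa p (touched Q (s p)) x)))" for pa s
 define ppa where "ppa pa = avg ?Om (%x. of_bool (pat N pa x))" for pa
 define dn where "dn pa s = (PROD p:P. dens N W b pa p (touched Q (s p)))" for pa s
 define H where "H pa = Op Q (%p A. asgn_sign Q A * dens N W b pa p (touched Q A)) ps (chi2 Q L) (%_ _. 0)" for pa
 have tQ: "touched Q B \<subseteq> Q" for B by (simp add: touched_def)
 have H_exp: "H pa = (SUM s:S. sg s * dn pa s * Ph s)" for pa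
  unfolding H_def S_def sg_def dn_def Ph_def prod.distrib[symmetric] using ps P by (simp add: Op_expand)
 define La where "La y = sieveL L P (%p. int p dvd int W * y + int b) 0" for y
 have pt: "(PROD q:Q. (La (lform t (a q) x mod int N))\<^sup>2) = (SUM pa:Pats. SUM s:S. sg s * Ph s * (of_bool (pat N pa x) * (PROD p:P. of_bool (cond N W b pa p (touched Q (s p)) x))))"
  if x: "x \<in> ?Om" for x
 proof -
  define e where "e q p = (int p dvd int W * (lform t (a q) x mod int N) + int b)" for q and p :: nat
  have "(PROD q:Q. (La (lform t (a q) x mod int N))\<^sup>2) = (SUM s:S. (PROD p:P. local_coeff Q (%q. of_bool (e q p)) (s p)) * Ph s)" using Op_chi2_sieveL[where L = L and e = e and u = "%_ _. 0", OF finQ ps(2)] P(2) ps(1) Op_expand[OF ps(2), of Q] by (simp add: La_def power2_eq_square e_def[abs_def] S_def Ph_def)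
  also have "... = (SUM pa:Pats. of_bool (pat N pa x)) * (SUM s:S. sg s * Ph s * (PROD p:P. PROD q:touched Q (s p). of_bool (e q p)))" using pattern_unique[OF N(1) x] by (simp add: mult_ac Pats_def local_coeff_alt[OF finQ] prod.distrib sg_def)
  also have "... = (SUM pa:Pats. SUM s:S. of_bool (pat N pa x) * (sg s * Ph s * (PROD p:P. PROD q:touched Q (s p). of_bool (e q p))))"
   by (rule sum_product)
  also have "... = (SUM pa:Pats. SUM s:S. sg s * Ph s * (of_bool (pat N pa x) * (PROD p:P. of_bool (cond N W b pa p (touched Q (s p)) x))))"
  proof (intro sum.cong refl)
   fix pa s
   show "of_bool (pat N pa x) * (sg s * Ph s * (PROD p:P. PROD q:touched Q (s p). of_bool (e q p)))
    = sg s * Ph s * (of_bool (pat N pa x) * (PROD p:P. of_bool (cond N W b pa p (touched Q (s p)) x)))"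
   proof (cases "pat N pa x")
    case True
    have "(PROD q:touched Q (s p). of_bool (e q p)) = (of_bool (cond N W b pa p (touched Q (s p)) x) :: real)" for p
    proof -
     have "e q p \<longleftrightarrow> int p dvd int W * (lform t (a q) x - int N * pa q) + int b" if "q \<in> touched Q (s p)" for q
     proof -
      have "q \<in> Q" using that tQ by blast
      hence "pa q = lform t (a q) x div int N" using True by (simp add: pat_def)
      thus ?thesis unfolding e_def by (simp add: minus_mult_div_eq_mod)
     qed
     hence "cond N W b pa p (touched Q (s p)) x \<longleftrightarrow> (ALL q:touched Q (s p). e q p)" by (simp add: cond_def)
     moreover have "(PROD q:F. of_bool (e q p)) = (of_bool (ALL q:F. e q p) :: real)" if "finite F" for F
      using that by simp
     ultimately show ?thesis using finite_subset[OF tQ finQ] by simp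
    qed
    thus ?thesis by simp
   qed simp
  qed
  finally show ?thesis .
 qed
 let ?B = "SUM pa:Pats. SUM s:S. sg s * Ph s * A pa s"
 have "avg ?Om (%x. PROD q:Q. (La (lform t (a q) x mod int N))\<^sup>2)
  = avg ?Om (%x. SUM pa:Pats. SUM s:S. sg s * Ph s * (of_bool (pat N pa x) * (PROD p:P. of_bool (cond N W b pa p (touched Q (s p)) x))))"
  by (rule avg_cong) (rule pt)
 also have "... = ?B" unfolding A_def by (simp only: avg_sum avg_cmult)
 finally have av: "avg ?Om (%x. PROD q:Q. (La (lform t (a q) x mod int N))\<^sup>2) = ?B" .
 have app: "\<bar>(SUM s:S. sg s * Ph s * A pa s) - ppa pa * H pa\<bar> <= real R ^ (2 * m) * (2 * C * real R ^ (2 * m) / real N)" for pa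
 proof -
  have "(SUM s:S. sg s * Ph s * A pa s) - ppa pa * H pa = (SUM s:S. (sg s * (A pa s - ppa pa * dn pa s)) * Ph s)"
   unfolding H_exp sum_distrib_left sum_subtractf[symmetric] by (intro sum.cong refl) (simp add: algebra_simps)
  also have "\<bar>\<dots>\<bar> <= real R ^ (2 * m) * (2 * C * real R ^ (2 * m) / N)"
   unfolding S_def Ph_def m_def L_def
  proof (rule truncated_sum[OF finQ P R(1)])
   fix s assume s: "pprod (active Q P s) <= R ^ (2 * card Q)"
   let ?P' = "active Q P s"
   have P': "finite ?P'" "ALL p:?P'. prime p" "?P' \<subseteq> P" using P by (auto simp: active_def)
   have tr: "touched Q (s p) = {}" if "p \<in> P - ?P'" for p using that by (simp add: active_def)
   have 1: "(PROD p:P. of_bool (cond N W b pa p (touched Q (s p)) x)) = (PROD p:?P'. of_bool (cond N W b pa p (touched Q (s p)) x) :: real)" for x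
    by (rule prod.mono_neutral_right[OF P(1) P'(3)]) (simp add: tr cond_def)
   have 2: "dn pa s = (PROD p:?P'. dens N W b pa p (touched Q (s p)))"
    unfolding dn_def by (rule prod.mono_neutral_right[OF P(1) P'(3)]) (use P in \<open>simp add: tr dens_empty prime_gt_0_nat\<close>)
   have "\<bar>A pa s - ppa pa * dn pa s\<bar> <= 2 * C * (pprod ?P') / N"
    unfolding A_def ppa_def 1 2 C_def by (rule equidistribution[OF N P'(1,2) tQ])
   also have "... <= 2 * C * real R ^ (2 * card Q) / N"
   proof -
    show ?thesis using s C0 by (intro divide_right_mono mult_left_mono) auto
   qed
   finally have "\<bar>A pa s - ppa pa * dn pa s\<bar> <= 2 * C * real R ^ (2 * card Q) / N" .
   moreover have "\<bar>sg s\<bar> = 1" by (simp add: sg_def asgn_sign_def abs_prod)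
   ultimately show "\<bar>sg s * (A pa s - ppa pa * dn pa s)\<bar> <= 2 * C * real R ^ (2 * card Q) / N" by (simp add: abs_mult)
  qed (use C0 in auto)
  finally show ?thesis .
 qed
 define de where "de = (exp (4 ^ (m + 1) / w) - 1) * (3025 * G) ^ m"
 have Hb: "\<bar>H pa - G ^ m\<bar> <= de" for pa
  unfolding H_def G_def m_def de_def L_def P_def
 proof (rule local_densities_compare[OF finQ R WR w(1)])
  fix p assume "p \<in> sieve_primes w R"
  hence p: "p \<in> P" by (simp add: P_def)
  have big: "p > 2 * K ^ 2" using pw(1)[OF p] w(2) by simp
  have "K <= 2 * K ^ 2" by (simp add: power2_eq_square)
  hence bigK: "p > K" using big by simp
  show "dens N W b pa p {} = 1" using pw(2)[OF p] by (simp add: dens_empty prime_gt_0_nat)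
  show "dens N W b pa p {q} = 1 / real p" if "q \<in> Q" for q by (rule dens_single[OF pw(2)[OF p] bigK pw(3)[OF p] that])
  show "\<bar>dens N W b pa p I\<bar> <= 1 / (real p)\<^sup>2" if "I \<subseteq> Q" "card I >= 2" for I by (rule dens_double[OF pw(2)[OF p] big pw(3)[OF p] that])
 qed (use ps in \<open>auto simp: P_def\<close>)
 have ppa0: "ppa pa >= 0" for pa unfolding ppa_def by (intro avg_nonneg) auto
 have ppa1: "(SUM pa:Pats. ppa pa) = 1"
 proof -
  have "(SUM pa:Pats. ppa pa) = avg ?Om (%x. SUM pa:Pats. of_bool (pat N pa x))" unfolding ppa_def by (rule avg_sum[symmetric])
  also have "... = avg ?Om (%x. 1)" unfolding Pats_def by (rule avg_cong) (rule pattern_unique[OF N(1)])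
  finally show ?thesis by (simp add: avg_const[OF fO])
 qed
 have fP: "finite Pats" "card Pats = (2 * K * t + 1) ^ m"
 proof -
  show "finite Pats" unfolding Pats_def by (intro finite_PiE finQ) auto
  have "nat (1 + int (K * t) * 2) = 2 * K * t + 1" by linarith
  thus "card Pats = (2 * K * t + 1) ^ m" unfolding Pats_def m_def using finQ by (simp add: card_PiE algebra_simps)
 qed
 define T where "T = avg ?Om (%x. PROD q:Q. (La (lform t (a q) x mod int N))\<^sup>2)"
 define E where "E = (card Pats) * (real R ^ (2 * m) * (2 * C * real R ^ (2 * m) / N))"
 let ?A = "SUM pa:Pats. ppa pa * H pa"
 have TE: "\<bar>T - ?A\<bar> <= E"
  unfolding T_def av sum_subtractf[symmetric] E_def
  by (rule order_trans[OF sum_abs], rule order_trans[OF sum_mono[OF app]]) simp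
 have TH: "\<bar>?A - G ^ m\<bar> <= de"
 proof -
  have "?A - G ^ m = (SUM pa:Pats. ppa pa * (H pa - G ^ m))"
   using ppa1 by (simp add: right_diff_distrib sum_subtractf sum_distrib_right[symmetric])
  also have "\<bar>\<dots>\<bar> <= (SUM pa:Pats. ppa pa * de)"
   by (intro order_trans[OF sum_abs] sum_mono) (simp add: abs_mult ppa0 mult_left_mono Hb)
  also have "... = de" unfolding sum_distrib_right[symmetric] ppa1 by simp
  finally show ?thesis .
 qed
 have "\<bar>T - G ^ m\<bar> <= E + de" by (rule abs_diff_chain[OF TE TH])
 hence f1: "\<bar>T - G ^ m\<bar> / G ^ m <= (E + de) / G ^ m" using G by (intro divide_right_mono) auto
 have f2: "\<bar>T - G ^ m\<bar> / G ^ m = \<bar>T / G ^ m - 1\<bar>"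
 proof -
  have "T / G ^ m - 1 = (T - G ^ m) / G ^ m" using G by (simp add: diff_divide_distrib)
  thus ?thesis using G by simp
 qed
 have f3: "T / G ^ m = avg ?Om (%x. PROD q:Q. selnu w R b (lform t (a q) x mod int N))"
  unfolding T_def selnu_def La_def L_def[symmetric] P_def[symmetric] W_def[symmetric] G_def[symmetric] prod_dividef m_def prod_constant
  by (simp add: avg_def sum_divide_distrib mult.commute)
 have f4: "de / G ^ m = (exp (4 ^ (m + 1) / w) - 1) * 3025 ^ m"
  using G by (simp add: de_def)
 have f5: "E / G ^ m <= real (2 * K * t + 1) ^ m * (4 * real (t + card Q) * (K * (t + 1)) * real R ^ (5 * m) / N)"
 proof -
  have "E / G ^ m = E * (1 / G) ^ m" by (simp add: power_one_over)
  also have "... <= E * real R ^ m"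
   using G C0 by (intro mult_left_mono power_mono) (auto simp: E_def)
  also have "... = real (2 * K * t + 1) ^ m * (2 * C * (real R ^ (2 * m) * real R ^ (2 * m) * real R ^ m) / N)"
   by (simp add: E_def fP(2))
  also have "real R ^ (2 * m) * real R ^ (2 * m) * real R ^ m = real R ^ (5 * m)" by (simp add: power_add[symmetric])
  finally have "E / G ^ m <= real (2 * K * t + 1) ^ m * (2 * C * real R ^ (5 * m) / N)" .
  moreover have "2 * C = 4 * real (t + card Q) * (K * (t + 1))" by (simp add: C_def)
  ultimately show ?thesis by simp
 qed
 have "\<bar>T / G ^ m - 1\<bar> <= de / G ^ m + E / G ^ m" using f1 unfolding f2 add_divide_distrib by simp
 also have "... <= (exp (4 ^ (m + 1) / real w) - 1) * 3025 ^ m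
  + real (2 * K * t + 1) ^ m * (4 * real (t + card Q) * real (K * (t + 1)) * real R ^ (5 * m) / real N)"
  by (rule add_mono[OF eq_refl[OF f4] f5])
 finally show ?thesis unfolding f3 unfolding m_def .
qed

end

text \<open>A version uniform over all systems of at most m0 forms in at most T variables: half of
  et is paid by a large w, the other half by a large R.\<close>

lemma (in lin_forms) linear_forms_small:
 assumes N: "N > 0" "coprime N (fact K)"
  and R: "R >= 2" "w <= R" and WR: "pprod (primes_le w) <= R"
  and w: "2 * 4 ^ card Q <= w" "2 * K ^ 2 <= w"
  and m0: "card Q <= m0" "t <= T"
  and et: "0 < et" "et <= 1" "4 * 4 ^ (m0 + 1) * 3025 ^ m0 <= et * real w"
   "2 * (real (2 * K * T + 1) ^ m0 * (4 * real (T + m0) * (K * (T + 1)))) <= et * R"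
  and RN: "R ^ (5 * m0 + 1) <= N"
 shows "\<bar>avg (cube t (zN N)) (%x. PROD q:Q. selnu w R b (lform t (a q) x mod int N)) - 1\<bar> <= et"
proof -
 define m where "m = card Q"
 have mm: "m <= m0" using m0 by (simp add: m_def)
 have w0: "real w > 0" using w(1) by (metis gr0I mult_eq_0_iff not_numeral_le_zero of_nat_0_less_iff le_0_eq power_eq_0_iff zero_neq_numeral)
 have 1: "(exp (4 ^ (m + 1) / w) - 1) * 3025 ^ m <= et / 2"
 proof -
  define x where "x = 4 ^ (m0 + 1) / w"
  have p1: "(1::real) <= 3025 ^ m0" by simp
  have x0: "x >= 0" by (simp add: x_def)
  have key: "4 * x * 3025 ^ m0 <= et" using et(3) w0 by (simp add: x_def field_simps)
  have "x * 1 <= x * 3025 ^ m0" by (rule mult_left_mono[OF p1 x0])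
  hence x1: "x <= 1" using key et(2) by simp
  have "exp (4 ^ (m + 1) / w) <= exp x" unfolding x_def using mm by (simp add: divide_right_mono)
  also have "... <= 1 + x + x\<^sup>2" by (rule exp_bound[OF x0 x1])
  also have "... <= 1 + 2 * x" using x0 x1 by (simp add: power2_eq_square mult_left_le)
  finally have "(exp (4 ^ (m + 1) / w) - 1) * 3025 ^ m <= (2 * x) * 3025 ^ m0"
   using x0 mm by (intro mult_mono power_increasing) auto
  also have "... <= et / 2" using key by simp
  finally show ?thesis .
 qed
 have 2: "real (2 * K * t + 1) ^ m * (4 * real (t + card Q) * (K * (t + 1)) * real R ^ (5 * m) / N) <= et / 2"
 proof -
  define B where "B = real (2 * K * T + 1) ^ m0 * (4 * real (T + m0) * (K * (T + 1)))"
  have B0: "B >= 0" by (simp add: B_def)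
  have R1: "real R >= 1" "real R > 0" using R by auto
  have c1: "real (2 * K * t + 1) ^ m <= real (2 * K * T + 1) ^ m0"
  proof -
   have "real (2 * K * t + 1) ^ m <= real (2 * K * T + 1) ^ m" using m0(2) by (intro power_mono) (auto intro!: mult_left_mono)
   also have "... <= real (2 * K * T + 1) ^ m0" using mm by (intro power_increasing) auto
   finally show ?thesis .
  qed
  have c2: "4 * real (t + card Q) * (K * (t + 1)) <= 4 * real (T + m0) * (K * (T + 1))"
   using m0 by (intro mult_mono) (auto intro!: mult_left_mono)
  have b1: "real (2 * K * t + 1) ^ m * (4 * real (t + card Q) * (K * (t + 1))) <= B"
   unfolding B_def by (rule mult_mono[OF c1 c2]) auto
  have "real R ^ (5 * m) * R <= N"
  proof -
   have "real R ^ (5 * m) * R = real R ^ (5 * m + 1)" by simp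
   also have "... <= real R ^ (5 * m0 + 1)" using mm R1 by (intro power_increasing) auto
   also have "... <= N" using RN by (metis of_nat_le_iff of_nat_power)
   finally show ?thesis .
  qed
  hence "real R ^ (5 * m) / N <= 1 / R" using R1 N by (simp add: field_simps)
  hence "real (2 * K * t + 1) ^ m * (4 * real (t + card Q) * (K * (t + 1))) * (real R ^ (5 * m) / N) <= B * (1 / R)"
   by (rule mult_mono[OF b1 _ B0]) simp
  also have "... <= et / 2"
  proof -
   have "2 * B <= et * R" using et(4) by (simp only: B_def)
   thus ?thesis using R1 by (simp add: field_simps)
  qed
  finally show ?thesis by simp
 qed
 show ?thesis
  using order_trans[OF linear_forms_estimate[OF N R WR w, of b, folded m_def] add_mono[OF 1 2[folded m_def]]] by simp
qed

section \<open>The two systems of forms for progressions\<close>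

definition dbl :: "nat => (nat => int) => nat set => nat => int" where
 "dbl k c om i = (if i < k then (if i \<in> om then 0 else c i) else (if i - k \<in> om then c (i - k) else 0))"

lemma sum_lessThan_double: "(\<Sum>i<k + n. f i) = (\<Sum>i<k. f i) + (\<Sum>i<n. f (k + i))" for f :: "nat => 'a::comm_monoid_add"
 by (induction n) (simp_all add: add.assoc)

text \<open>Variables below k are the entries of x and those from k on the entries of y; om tells
  from which copy each coordinate is taken.\<close>

lemma lform_dbl:
 "lform (k + k) (dbl k c om) z = (\<Sum>i<k. c i * mix om (\<lambda>i\<in>{..<k}. z i) (\<lambda>i\<in>{..<k}. z (k + i)) i)"
 unfolding lform_def sum_lessThan_double sum.distrib[symmetric] by (rule sum.cong) (auto simp: dbl_def mix_def)

lemma avg_cube_double: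
 assumes X: "finite X" "X ~= {}"
 shows "avg (cube k X) (%x. avg (cube k X) (F x)) = avg (cube (k + k) X) (%z. F (\<lambda>i\<in>{..<k}. z i) (\<lambda>i\<in>{..<k}. z (k + i)))"
proof -
 have "bij_betw (%z. (\<lambda>i\<in>{..<k}. z i, \<lambda>i\<in>{..<k}. z (k + i))) (cube (k + k) X) (cube k X \<times> cube k X)"
 proof (rule bij_betw_byWitness[where f' = "%p. \<lambda>i\<in>{..<k + k}. if i < k then fst p i else snd p (i - k)"])
  show "ALL z:cube (k + k) X. (\<lambda>i\<in>{..<k + k}. if i < k then fst (\<lambda>i\<in>{..<k}. z i, \<lambda>i\<in>{..<k}. z (k + i)) i else snd (\<lambda>i\<in>{..<k}. z i, \<lambda>i\<in>{..<k}. z (k + i)) (i - k)) = z"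
  proof
   fix z assume z: "z \<in> cube (k + k) X"
   show "(\<lambda>i\<in>{..<k + k}. if i < k then fst (\<lambda>i\<in>{..<k}. z i, \<lambda>i\<in>{..<k}. z (k + i)) i else snd (\<lambda>i\<in>{..<k}. z i, \<lambda>i\<in>{..<k}. z (k + i)) (i - k)) = z"
    by (rule ext) (use PiE_arb[OF z] in auto)
  qed
  show "ALL p:cube k X \<times> cube k X. (\<lambda>i\<in>{..<k}. (\<lambda>i\<in>{..<k + k}. if i < k then fst p i else snd p (i - k)) i, \<lambda>i\<in>{..<k}. (\<lambda>i\<in>{..<k + k}. if i < k then fst p i else snd p (i - k)) (k + i)) = p"
  proof
   fix p assume p: "p \<in> cube k X \<times> cube k X"
   have "fst p \<in> cube k X" "snd p \<in> cube k X" using p by (simp_all only: mem_Times_iff)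
   note a = PiE_arb[OF this(1)] PiE_arb[OF this(2)]
   show "(\<lambda>i\<in>{..<k}. (\<lambda>i\<in>{..<k + k}. if i < k then fst p i else snd p (i - k)) i, \<lambda>i\<in>{..<k}. (\<lambda>i\<in>{..<k + k}. if i < k then fst p i else snd p (i - k)) (k + i)) = p"
    by (rule prod_eqI; rule ext) (use a in auto)
  qed
  show "(%z. (\<lambda>i\<in>{..<k}. z i, \<lambda>i\<in>{..<k}. z (k + i))) ` cube (k + k) X \<subseteq> cube k X \<times> cube k X"
  proof (rule image_subsetI, rule SigmaI)
   fix z assume z: "z \<in> cube (k + k) X"
   show "(\<lambda>i\<in>{..<k}. z i) \<in> cube k X" "(\<lambda>i\<in>{..<k}. z (k + i)) \<in> cube k X" using PiE_mem[OF z] by auto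
  qed
  show "(%p. \<lambda>i\<in>{..<k + k}. if i < k then fst p i else snd p (i - k)) ` (cube k X \<times> cube k X) \<subseteq> cube (k + k) X"
  proof (rule image_subsetI)
   fix p assume "p \<in> cube k X \<times> cube k X"
   hence p: "fst p \<in> cube k X" "snd p \<in> cube k X" by (simp_all only: mem_Times_iff)
   show "(\<lambda>i\<in>{..<k + k}. if i < k then fst p i else snd p (i - k)) \<in> cube (k + k) X" using PiE_mem[OF p(1)] PiE_mem[OF p(2)] by auto
  qed
 qed
 from avg_reindex[OF this, of "%p. F (fst p) (snd p)"] show ?thesis by (simp add: avg_Times)
qed

lemma dbl_var:
 assumes "i < k"
 shows "dbl k c om (if i \<in> om then k + i else i) = c i"
  and "(i \<in> om) ~= b ==> dbl k c om (if b then k + i else i) = 0"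
  and "c i = 0 ==> dbl k c om (if b then k + i else i) = 0"
 using assms by (auto simp: dbl_def)

lemma dbl_bound: "(!!i. i < k ==> \<bar>c i\<bar> <= B) ==> B >= 0 ==> i < k + k ==> \<bar>dbl k c om i\<bar> <= B"
 by (simp add: dbl_def)

text \<open>For equal indices two forms take some coordinate from different copies; for different
  indices each form has coefficient 0 at its own index while the other does not. Either way a
  variable of the second form is missing in the first, which produces a nonzero minor.\<close>

lemma lin_forms_psi:
 assumes k: "k >= 2" and Q: "Q \<subseteq> Sigma {..<k} (%j. Pow ({..<k} - {j}))"
 shows "lin_forms (k + k) Q (%q. dbl k (%i. int i - int (fst q)) (snd q)) k"
proof
 show "finite Q" by (rule finite_subset[OF Q]) simp
 show "1 <= k" using k by simp
 have q: "fst q < k" "snd q \<subseteq> {..<k}" "fst q \<notin> snd q" if "q \<in> Q" for q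
 proof -
  show "fst q < k" "snd q \<subseteq> {..<k}" "fst q \<notin> snd q" using Q that by (cases q; auto)+
 qed
 show "\<bar>dbl k (%i. int i - int (fst q)) (snd q) i\<bar> <= int k" if "q \<in> Q" "i < k + k" for q i
  by (rule dbl_bound) (use q[OF that(1)] that in auto)
 show "\<exists>i<k + k. dbl k (%i. int i - int (fst q)) (snd q) i ~= 0" if "q \<in> Q" for q
 proof -
  define i where "i = (if fst q = 0 then 1 else 0 :: nat)"
  have i: "i < k" "i ~= fst q" using k by (auto simp: i_def)
  have "dbl k (%i. int i - int (fst q)) (snd q) (if i \<in> snd q then k + i else i) ~= 0" unfolding dbl_var(1)[OF i(1)] using i by simp
  thus ?thesis using i(1) by (intro exI[of _ "if i \<in> snd q then k + i else i"]) auto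
 qed
 show "\<exists>i<k + k. \<exists>j<k + k. dbl k (%i. int i - int (fst q)) (snd q) i * dbl k (%i. int i - int (fst q')) (snd q') j
   ~= dbl k (%i. int i - int (fst q)) (snd q) j * dbl k (%i. int i - int (fst q')) (snd q') i"
  if qq: "q \<in> Q" "q' \<in> Q" "q ~= q'" for q q'
 proof (cases "fst q = fst q'")
  case True
  hence "snd q ~= snd q'" using qq(3) by (auto intro: prod_eqI)
  then obtain i where i: "(i \<in> snd q) ~= (i \<in> snd q')" by blast
  have ik: "i < k" "i ~= fst q" using i q[OF qq(1)] q[OF qq(2)] True by auto
  let ?u = "if i \<in> snd q then k + i else i" and ?v = "if i \<in> snd q' then k + i else i"
  have "dbl k (%i. int i - int (fst q)) (snd q) ?v = 0" by (rule dbl_var(2)[OF ik(1) i])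
  moreover have "dbl k (%i. int i - int (fst q)) (snd q) ?u ~= 0" "dbl k (%i. int i - int (fst q')) (snd q') ?v ~= 0"
   unfolding dbl_var(1)[OF ik(1)] using ik True by auto
  ultimately show ?thesis using ik(1) by (intro exI[of _ ?u] conjI exI[of _ ?v]) auto
 next
  case False
  let ?u = "if fst q' \<in> snd q then k + fst q' else fst q'" and ?v = "if fst q \<in> snd q' then k + fst q else fst q"
  have "dbl k (%i. int i - int (fst q)) (snd q) ?v = 0" by (rule dbl_var(3)) (use q[OF qq(1)] in auto)
  moreover have "dbl k (%i. int i - int (fst q)) (snd q) ?u ~= 0" "dbl k (%i. int i - int (fst q')) (snd q') ?v ~= 0"
   unfolding dbl_var(1)[OF q(1)[OF qq(1)]] dbl_var(1)[OF q(1)[OF qq(2)]] using False by auto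
  ultimately show ?thesis using q(1)[OF qq(1)] q(1)[OF qq(2)] by (intro exI[of _ ?u] conjI exI[of _ ?v]) auto
 qed
qed

lemma lin_forms_sum:
 assumes r: "r >= 1" "r <= K" and Q: "Q \<subseteq> Pow {..<r}"
 shows "lin_forms (r + r) Q (%om. dbl r (%_. 1) om) K"
proof
 show "finite Q" by (rule finite_subset[OF Q]) simp
 show "1 <= K" using r by simp
 show "\<bar>dbl r (%_. 1) om i\<bar> <= int K" if "om \<in> Q" "i < r + r" for om i
  by (rule dbl_bound) (use r that in auto)
 show "\<exists>i<r + r. dbl r (%_. 1) om i ~= 0" for om
 proof -
  show ?thesis using dbl_var(1)[of 0 r "%_. 1" om] r by (intro exI[of _ "if 0 \<in> om then r + 0 else 0"]) auto
 qed
 show "\<exists>i<r + r. \<exists>j<r + r. dbl r (%_. 1) q i * dbl r (%_. 1) q' j ~= dbl r (%_. 1) q j * dbl r (%_. 1) q' i"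
  if qq: "q \<in> Q" "q' \<in> Q" "q ~= q'" for q q'
 proof -
  obtain i where i: "(i \<in> q) ~= (i \<in> q')" using qq(3) by blast
  have ik: "i < r" using i Q qq by auto
  let ?u = "if i \<in> q then r + i else i" and ?v = "if i \<in> q' then r + i else i"
  have "dbl r (%_. 1) q ?v = 0" by (rule dbl_var(2)[OF ik i])
  moreover have "dbl r (%_. 1) q ?u ~= 0" "dbl r (%_. 1) q' ?v ~= 0" unfolding dbl_var(1)[OF ik] by auto
  ultimately show ?thesis using ik by (intro exI[of _ ?u] conjI exI[of _ ?v]) auto
 qed
qed

text \<open>The order of choice matters: w depends on et only, while R0 depends on w, since R must
  exceed the primorial of w. The number k 2^k bounds the forms in both systems, which fixes the
  power of R that N has to dominate.\<close>

theorem sieve_majorant: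
 assumes k: "k >= 2" and et: "et > (0::real)"
 shows "EX w0. \<forall>w\<ge>w0. EX R0. \<forall>R\<ge>R0. ALL N b. R ^ (5 * (k * 2 ^ k) + 1) <= N --> coprime N (fact k) -->
  lfc (zN N) k (%j x. selnu w R b (psi N k j x)) et & sum_lfc N (k - 1) (selnu w R b) et"
proof -
 define m0 where "m0 = k * 2 ^ k"
 define T where "T = k + k"
 define et' where "et' = min et 1"
 have e': "0 < et'" "et' <= 1" "et' <= et" using et by (auto simp: et'_def)
 define w0 where "w0 = 2 * 4 ^ m0 + 2 * k ^ 2 + nat \<lceil>4 * 4 ^ (m0 + 1) * 3025 ^ m0 / et'\<rceil>"
 define B where "B = 2 * (real (2 * k * T + 1) ^ m0 * (4 * real (T + m0) * (k * (T + 1))))"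
 have main: "lfc (zN N) k (%j x. selnu w R b (psi N k j x)) et & sum_lfc N (k - 1) (selnu w R b) et"
  if w: "w >= w0" and R: "R >= 2 + w + pprod (primes_le w) + nat \<lceil>B / et'\<rceil>" and RN: "R ^ (5 * m0 + 1) <= N" and cop: "coprime N (fact k)" for w R N b
 proof -
  have N0: "N > 0" using RN R by (metis gr0I le_0_eq power_eq_0_iff add_is_0 zero_neq_numeral)
  have R': "R >= 2" "w <= R" "pprod (primes_le w) <= R" using R by auto
  have hw: "2 * 4 ^ m0 <= w" "2 * k ^ 2 <= w" using w unfolding w0_def by auto
  have h3: "4 * 4 ^ (m0 + 1) * 3025 ^ m0 <= et' * w"
  proof -
   have "4 * 4 ^ (m0 + 1) * 3025 ^ m0 / et' <= (nat \<lceil>4 * 4 ^ (m0 + 1) * 3025 ^ m0 / et'\<rceil>)" by linarith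
   also have "... <= w" using w unfolding w0_def by linarith
   finally show ?thesis using e' by (simp add: field_simps)
  qed
  have h4: "B <= et' * R"
  proof -
   have "B / et' <= R" using R by linarith
   thus ?thesis using e' by (simp add: field_simps)
  qed
  have hc: "2 * 4 ^ c <= w" if "c <= m0" for c
  proof -
   have "2 * 4 ^ c <= (2 * 4 ^ m0 :: nat)" using that by simp
   thus ?thesis using hw(1) by linarith
  qed
  have X: "finite (zN N)" "zN N ~= {}" using N0 by auto
  show ?thesis
  proof
   show "lfc (zN N) k (%j x. selnu w R b (psi N k j x)) et"
    unfolding lfc_def
   proof
    fix e
    define S where "S = Sigma {..<k} (%j. Pow ({..<k} - {j}))"
    define Q where "Q = {q\<in>S. e (fst q) (snd q)}"
    define a where "a q = dbl k (%i. int i - int (fst q)) (snd q)" for q :: "nat \<times> nat set"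
    have fS: "finite S" by (simp add: S_def)
    have "lin_forms (k + k) Q a k" unfolding a_def by (rule lin_forms_psi[OF k]) (auto simp: Q_def S_def)
    moreover have "card Q <= m0"
    proof -
     have "Q \<subseteq> {..<k} \<times> Pow {..<k}" by (auto simp: Q_def S_def)
     hence "card Q <= card ({..<k} \<times> Pow {..<k})" by (intro card_mono) auto
     thus ?thesis by (simp add: m0_def card_Pow)
    qed
    ultimately have "\<bar>avg (cube (k + k) (zN N)) (%x. PROD q:Q. selnu w R b (lform (k + k) (a q) x mod int N)) - 1\<bar> <= et'"
     by (intro lin_forms.linear_forms_small[where ?m0.0 = m0 and T = T, OF _ N0 cop R' hc hw(2) _ _ e'(1,2) h3 h4[unfolded B_def] RN])
      (auto simp: T_def)
    moreover have "avg (cube k (zN N)) (%x. avg (cube k (zN N)) (%y. \<Prod>j<k. PROD om:Pow ({..<k} - {j}). if e j om then selnu w R b (psi N k j (mix om x y)) else 1))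
     = avg (cube (k + k) (zN N)) (%x. PROD q:Q. selnu w R b (lform (k + k) (a q) x mod int N))"
     unfolding avg_cube_double[OF X]
    proof (rule avg_cong)
     fix z
     have "(\<Prod>j<k. PROD om:Pow ({..<k} - {j}). if e j om then selnu w R b (psi N k j (mix om (\<lambda>i\<in>{..<k}. z i) (\<lambda>i\<in>{..<k}. z (k + i)))) else 1)
      = (PROD q:S. if e (fst q) (snd q) then selnu w R b (lform (k + k) (a q) z mod int N) else 1)"
      unfolding S_def by (subst prod.Sigma) (auto simp: case_prod_unfold psi_def a_def lform_dbl intro!: prod.cong)
     also have "... = (PROD q:Q. selnu w R b (lform (k + k) (a q) z mod int N))"
      unfolding Q_def by (rule prod.inter_filter[OF fS, symmetric])
     finally show "(\<Prod>j<k. PROD om:Pow ({..<k} - {j}). if e j om then selnu w R b (psi N k j (mix om (\<lambda>i\<in>{..<k}. z i) (\<lambda>i\<in>{..<k}. z (k + i)))) else 1) = ..." .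
    qed
    ultimately show "\<bar>avg (cube k (zN N)) (%x. avg (cube k (zN N)) (%y. \<Prod>j<k. PROD om:Pow ({..<k} - {j}). if e j om then selnu w R b (psi N k j (mix om x y)) else 1)) - 1\<bar> <= et"
     using e'(3) by simp
   qed
   show "sum_lfc N (k - 1) (selnu w R b) et"
    unfolding sum_lfc_def
   proof (intro allI impI)
    fix Q assume Q: "Q \<subseteq> Pow {..<k - 1}"
    define r where "r = k - 1"
    have "lin_forms (r + r) Q (%om. dbl r (%_. 1) om) k" by (rule lin_forms_sum) (use k Q in \<open>auto simp: r_def\<close>)
    moreover have "card Q <= m0"
    proof -
     have "Q \<subseteq> Pow {..<k}" by (rule order_trans[OF Q Pow_mono]) auto
     hence "card Q <= card (Pow {..<k})" by (intro card_mono) auto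
     also have "... <= m0" using k by (simp add: m0_def card_Pow)
     finally show ?thesis .
    qed
    ultimately have "\<bar>avg (cube (r + r) (zN N)) (%x. PROD q:Q. selnu w R b (lform (r + r) (dbl r (%_. 1) q) x mod int N)) - 1\<bar> <= et'"
     by (intro lin_forms.linear_forms_small[where ?m0.0 = m0 and T = T, OF _ N0 cop R' hc hw(2) _ _ e'(1,2) h3 h4[unfolded B_def] RN])
      (auto simp: T_def r_def)
    moreover have "avg (cube r (zN N)) (%x. avg (cube r (zN N)) (%y. PROD om:Q. selnu w R b (smod N r (mix om x y))))
     = avg (cube (r + r) (zN N)) (%x. PROD q:Q. selnu w R b (lform (r + r) (dbl r (%_. 1) q) x mod int N))"
     unfolding avg_cube_double[OF X] lform_dbl by (simp add: smod_def)
    ultimately show "\<bar>avg (cube (k - 1) (zN N)) (%x. avg (cube (k - 1) (zN N)) (%y. PROD om:Q. selnu w R b (smod N (k - 1) (mix om x y)))) - 1\<bar> <= et"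
     using e'(3) by (simp add: r_def)
   qed
  qed
 qed
 show ?thesis unfolding m0_def[symmetric]
 proof (rule exI[of _ w0], intro allI impI)
  fix w assume "w0 <= w"
  thus "EX R0. \<forall>R\<ge>R0. ALL N b. R ^ (5 * m0 + 1) <= N --> coprime N (fact k) -->
   lfc (zN N) k (%j x. selnu w R b (psi N k j x)) et & sum_lfc N (k - 1) (selnu w R b) et"
   using main by blast
 qed
qed

section \<open>Primes congruent to 3 modulo 4\<close>

lemma sum_divisors_swap:
 fixes F :: "nat => nat => real"
 shows "(SUM m:{1..x}. \<Sum>d | d dvd m. F d (m div d)) = (SUM d:{1..x}. SUM j:{1..x div d}. F d j)"
proof -
 let ?A = "%m. {d. d dvd m}"
 have "(SUM m:{1..x}. \<Sum>d | d dvd m. F d (m div d)) = (SUM z:Sigma {1..x} ?A. F (snd z) (fst z div snd z))"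
  by (subst sum.Sigma) (auto simp: case_prod_unfold intro: finite_divisors_nat)
 also have "... = (SUM z:Sigma {1..x} (%d. {1..x div d}). F (fst z) (snd z))"
 proof (rule sum.reindex_bij_witness[where i = "%z. (fst z * snd z, fst z)" and j = "%z. (snd z, fst z div snd z)"])
  fix z assume z: "z \<in> Sigma {1..x} ?A"
  then obtain m d where md: "z = (m, d)" "1 <= m" "m <= x" "d dvd m" by auto
  hence "d >= 1" "d <= m" by auto
  moreover have "m div d >= 1" using md by auto
  ultimately show "(snd z, fst z div snd z) \<in> Sigma {1..x} (%d. {1..x div d})" using md by (auto intro: div_le_mono)
  show "(fst (snd z, fst z div snd z) * snd (snd z, fst z div snd z), fst (snd z, fst z div snd z)) = z"
   using md by simp
  show "F (fst (snd z, fst z div snd z)) (snd (snd z, fst z div snd z)) = F (snd z) (fst z div snd z)" by simp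
 next
  fix z assume "z \<in> Sigma {1..x} (%d. {1..x div d})"
  then obtain d j where dj: "z = (d, j)" "1 <= d" "1 <= j" "j <= x div d" by auto
  show "(fst z * snd z, fst z) \<in> Sigma {1..x} ?A" using less_eq_div_iff_mult_less_eq[of d j x] dj by (auto simp: mult.commute)
  show "(snd (fst z * snd z, fst z), fst (fst z * snd z, fst z) div snd (fst z * snd z, fst z)) = z" using dj by simp
 qed
 also have "... = (SUM d:{1..x}. SUM j:{1..x div d}. F d j)" by (subst sum.Sigma) (auto simp: case_prod_unfold)
 finally show ?thesis .
qed

abbreviation Lam :: "nat => real" where "Lam \<equiv> mangoldt"

lemma sum_mangoldt_div: "(SUM d:{1..x}. Lam d * (x div d)) = ln (fact x)"
proof -
 have "(SUM d:{1..x}. Lam d * (x div d)) = (SUM d:{1..x}. SUM j:{1..x div d}. Lam d)" by (simp add: mult.commute)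
 also have "... = (SUM m:{1..x}. \<Sum>d | d dvd m. Lam d)" by (rule sum_divisors_swap[symmetric, where F = "%d j. Lam d"])
 also have "... = (SUM m:{1..x}. ln (m))" by (intro sum.cong refl) (simp add: mangoldt_sum)
 also have "... = ln (fact x)"
 proof (induction x)
  case (Suc x)
  have "ln (fact (Suc x)) = ln ((Suc x)) + ln (fact x)" by (simp add: ln_mult)
  thus ?case using Suc by simp
 qed simp
 finally show ?thesis .
qed

lemma ln_fact_lower: "x >= 1 ==> x * ln (x) - x <= ln (fact x)"
proof (induction x rule: dec_induct)
 case (step x)
 have x: "real x >= 1" using step by simp
 have "x * ln (real x + 1) <= x * ln (x) + 1" using ln_diff_le_inverse[OF x] x by (simp add: field_simps)
 moreover have "ln (fact (Suc x)) = ln (real x + 1) + ln (fact x)" by (simp add: ln_mult)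
 moreover have "(Suc x) * ln ((Suc x)) - (Suc x) = x * ln (real x + 1) + ln (real x + 1) - x - 1"
  by (simp add: algebra_simps)
 ultimately show ?case using step.IH by simp
qed simp

lemma real_div_le: "real (x div d) <= x / d"
proof (cases "d = 0")
 case False
 have "real (x div d * d) <= x" using div_times_less_eq_dividend[of x d] by linarith
 thus ?thesis using False by (simp add: field_simps)
qed simp

lemma mangoldt_sum_lower:
 assumes "x >= 1" shows "ln (x) - 1 <= (SUM d:{1..x}. Lam d / d)"
proof -
 have x: "real x > 0" using assms by simp
 have "x * ln (x) - x <= (SUM d:{1..x}. Lam d * (x div d))"
  using ln_fact_lower[OF assms] by (simp only: sum_mangoldt_div)
 also have "... <= (SUM d:{1..x}. Lam d * (x / d))"
  by (intro sum_mono mult_left_mono real_div_le mangoldt_nonneg)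
 also have "... = x * (SUM d:{1..x}. Lam d / d)" by (simp add: sum_distrib_left mult_ac)
 finally have "x * (ln (x) - 1) <= x * (SUM d:{1..x}. Lam d / d)" by (simp add: right_diff_distrib)
 thus ?thesis using x by simp
qed

text \<open>Chebyshev's argument with the central binomial coefficient: (2n div d) - 2 (n div d) is
  nonnegative, and it is 1 for n < d \<le> 2n.\<close>

lemma mangoldt_doubling:
 assumes "n >= 1" shows "(SUM d:{1..2 * n}. Lam d) <= (SUM d:{1..n}. Lam d) + 2 * n * ln 2"
proof -
 let ?A = "SUM d:{1..2 * n}. Lam d * ((2 * n div d) - 2 * real (n div d))"
 let ?B = "SUM d:{n<..2 * n}. Lam d"
 have "(SUM d:{1..2 * n}. Lam d) - (SUM d:{1..n}. Lam d) = ?B"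
 proof -
  have "{1..2 * n} = {1..n} \<union> {n<..2 * n}" by auto
  hence "(SUM d:{1..2 * n}. Lam d) = (SUM d:{1..n} \<union> {n<..2 * n}. Lam d)" by simp
  also have "... = (SUM d:{1..n}. Lam d) + ?B"
   by (rule sum.union_disjoint) auto
  finally show ?thesis by simp
 qed
 also have "... <= ?A"
 proof -
  have "?B = (SUM d:{n<..2 * n}. Lam d * ((2 * n div d) - 2 * real (n div d)))"
  proof (rule sum.cong[OF refl])
   fix d assume d: "d \<in> {n<..2 * n}"
   hence "2 * n div d = 1" "n div d = 0" by (auto intro!: div_nat_eqI)
   thus "Lam d = Lam d * ((2 * n div d) - 2 * real (n div d))" by simp
  qed
  also have "... <= ?A"
  proof (rule sum_mono2)
   fix d assume "d \<in> {1..2 * n} - {n<..2 * n}"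
   hence d: "d > 0" by simp
   have "2 * (n div d) <= 2 * n div d" using d by (simp add: less_eq_div_iff_mult_less_eq)
   hence "0 <= (2 * n div d) - 2 * real (n div d)" by simp
   thus "0 <= Lam d * ((2 * n div d) - 2 * real (n div d))" by (intro mult_nonneg_nonneg mangoldt_nonneg)
  qed auto
  finally show ?thesis .
 qed
 also have "... = ln (fact (2 * n)) - 2 * ln (fact n)"
 proof -
  let ?C = "SUM d:{1..2 * n}. Lam d * (n div d)"
  have "?C = (SUM d:{1..n}. Lam d * (n div d))"
   by (rule sum.mono_neutral_right) auto
  hence e: "?C = ln (fact n)" by (simp only: sum_mangoldt_div)
  have "(SUM d:{1..2 * n}. Lam d * (real (2 * n div d) - 2 * real (n div d)))
   = (SUM d:{1..2 * n}. Lam d * real (2 * n div d)) - 2 * (SUM d:{1..2 * n}. Lam d * real (n div d))"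
   by (simp add: right_diff_distrib sum_subtractf sum_distrib_left mult_ac)
  thus ?thesis by (simp only: e sum_mangoldt_div)
 qed
 also have "... <= 2 * real n * ln 2"
 proof -
  have "real (fact (2 * n)) = (fact n * fact n * ((2 * n) choose n))" using binomial_fact_lemma[of n "2 * n"] by simp
  hence "ln (fact (2 * n)) = ln (fact n) + ln (fact n) + ln (((2 * n) choose n))" by (simp add: ln_mult)
  moreover have "ln (((2 * n) choose n)) <= ln (2 ^ (2 * n))"
  proof -
   have "((2 * n) choose n) <= real (2 ^ (2 * n))" using binomial_le_pow2[of "2 * n" n] by simp
   moreover have "0 < real ((2 * n) choose n)" by simp
   ultimately show ?thesis by simp
  qed
  moreover have "ln (2 ^ (2 * n)) = 2 * real n * ln (2::real)" by (simp add: ln_realpow)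
  ultimately show ?thesis by simp
 qed
 finally show ?thesis by simp
qed

lemma chebyshev_upper: "(SUM d:{1..2 ^ k}. Lam d) <= 2 * 2 ^ k * ln 2"
proof (induction k)
 case (Suc k)
 have "(SUM d:{1..2 ^ Suc k}. Lam d) <= (SUM d:{1..2 ^ k}. Lam d) + 2 * real (2 ^ k) * ln 2"
  using mangoldt_doubling[of "2 ^ k"] by simp
 also have "... <= 2 * 2 ^ k * ln 2 + 2 * real (2 ^ k) * ln 2" by (rule add_right_mono[OF Suc])
 also have "... = 2 * 2 ^ Suc k * ln 2" by simp
 finally show ?case .
qed simp

definition chi4 :: "nat => real" where
 "chi4 n = (if n mod 4 = 1 then 1 else if n mod 4 = 3 then -1 else 0)"

lemma chi4_mult: "chi4 (a * b) = chi4 a * chi4 b"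
proof -
 have "a mod 4 \<in> {0, 1, 2, 3}" "b mod 4 \<in> {0, 1, 2, 3}" by auto
 moreover have "(a * b) mod 4 = ((a mod 4) * (b mod 4)) mod 4" by (simp add: mod_mult_eq)
 ultimately show ?thesis unfolding chi4_def by auto
qed

lemma alternating_sum_bounds:
 assumes "!!i. 0 <= g i" "!!i. g (Suc i) <= (g i :: real)"
 shows "0 <= (\<Sum>i<n. (-1) ^ i * g (a + i)) & (\<Sum>i<n. (-1) ^ i * g (a + i)) <= g a"
proof (induction n arbitrary: a)
 case (Suc n)
 have "(\<Sum>i<Suc n. (-1) ^ i * g (a + i)) = g a - (\<Sum>i<n. (-1) ^ i * g (Suc a + i))"
  unfolding sum.lessThan_Suc_shift by (simp add: sum_negf)
 thus ?case using Suc[of "Suc a"] assms(2)[of a] by auto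
qed (simp add: assms)

lemma sum_chi4: "(SUM m:{1..x}. chi4 m * F m) = (\<Sum>i<(x + 1) div 2. (-1) ^ i * F (2 * i + 1))"
proof (induction x)
 case (Suc x)
 show ?case
 proof (cases "even x")
  case True
  then obtain i where i: "x = 2 * i" by blast
  have "chi4 (Suc x) = (-1) ^ i"
  proof (cases "even i")
   case True
   then obtain j where "i = 2 * j" by blast
   thus ?thesis using i by (simp add: chi4_def)
  next
   case False
   then obtain j where "i = 2 * j + 1" by (rule oddE)
   thus ?thesis using i by (simp add: chi4_def)
  qed
  moreover have "(Suc x + 1) div 2 = Suc i" "(x + 1) div 2 = i" using i by auto
  ultimately show ?thesis using Suc by (simp add: i)
 next
  case False
  then obtain i where i: "x = 2 * i + 1" by (rule oddE)
  hence "Suc x mod 4 = 0 \<or> Suc x mod 4 = 2" by presburger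
  hence "chi4 (Suc x) = 0" by (auto simp: chi4_def)
  moreover have "(Suc x + 1) div 2 = (x + 1) div 2" using i by auto
  ultimately show ?thesis using Suc by simp
 qed
qed simp

definition A4 :: "nat => real" where
 "A4 x = (SUM m:{1..x}. chi4 m / real m)"

lemma A4_alt: "A4 x = (\<Sum>i<(x + 1) div 2. (-1) ^ i * (1 / real (2 * i + 1)))"
 using sum_chi4[of "%m. 1 / real m" x] by (simp add: A4_def)

lemma A4_diff:
 assumes "y <= z" shows "\<bar>A4 z - A4 y\<bar> <= 1 / real (y + 1)"
proof -
 define a where "a = (y + 1) div 2"
 obtain n where n: "(z + 1) div 2 = a + n" using assms div_le_mono[of "y + 1" "z + 1" 2] by (auto simp: a_def le_iff_add)
 let ?A = "\<Sum>i<n. (-1) ^ i * (1 / (2 * (a + i) + 1))"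
 have "A4 z - A4 y = (\<Sum>i<n. (-1) ^ (a + i) * (1 / (2 * (a + i) + 1)))"
  unfolding A4_alt n a_def[symmetric] by (induction n) auto
 also have "... = (-1) ^ a * ?A" by (simp add: sum_distrib_left power_add)
 also have "\<bar>\<dots>\<bar> <= 1 / (2 * a + 1)"
 proof -
  have "0 <= ?A & ?A <= 1 / (2 * a + 1)"
   by (rule alternating_sum_bounds[where g = "%i. 1 / real (2 * i + 1)"]) (auto intro: frac_le)
  thus ?thesis by (simp add: abs_mult)
 qed
 also have "... <= 1 / (y + 1)"
 proof (rule divide_left_mono)
  show "real (y + 1) <= (2 * a + 1)" by (simp add: a_def)
 qed auto
 finally show ?thesis .
qed

text \<open>The alternating series begins 1 - 1/3, so its partial sums stay away from 0; this is the
  nonvanishing of L(1) for the character modulo 4.\<close>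

lemma A4_lower:
 assumes "x >= 1" shows "A4 x >= 2/3"
proof -
 obtain n where n: "(x + 1) div 2 = Suc n" using assms by (cases "(x + 1) div 2") auto
 let ?A = "\<Sum>i<n. (-1) ^ i * (1 / (2 * (1 + i) + 1))"
 have "A4 x = 1 - ?A"
  unfolding A4_alt n sum.lessThan_Suc_shift by (simp add: sum_negf)
 moreover have "0 <= ?A & ?A <= 1 / real (2 * 1 + 1)"
  by (rule alternating_sum_bounds[where g = "%i. 1 / real (2 * i + 1)"]) (auto intro: frac_le)
 ultimately show ?thesis by simp
qed

lemma ln_over_antimono:
 assumes "3 <= x" "x <= y" shows "ln y / y <= ln x / (x::real)"
proof -
 have x: "x > 0" "y > 0" using assms by auto
 have l1: "1 <= ln x"
 proof -
  have "ln (exp 1) <= ln x" using assms exp_le by (subst ln_le_cancel_iff) auto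
  thus ?thesis by simp
 qed
 have "ln (y / x) <= y / x - 1" using x by (intro ln_le_minus_one) auto
 hence "x * ln y <= x * (ln x + (y / x - 1))" using x by (simp add: ln_div)
 also have "... = x * ln x + (y - x) * 1" using x by (simp add: field_simps)
 also have "... <= x * ln x + (y - x) * ln x" using l1 assms by (intro add_left_mono mult_left_mono) auto
 also have "... = y * ln x" by (simp add: algebra_simps)
 finally show ?thesis using x by (simp add: field_simps)
qed

lemma sum_chi4_ln: "\<bar>SUM m:{1..x}. chi4 m * (ln (m) / m)\<bar> <= 1"
proof (cases "(x + 1) div 2")
 case 0
 thus ?thesis unfolding sum_chi4 by simp
next
 case (Suc n)
 define g where "g i = ln (real (2 * i + 3)) / real (2 * i + 3)" for i
 let ?A = "\<Sum>i<n. (-1) ^ i * g (0 + i)"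
 have "(SUM m:{1..x}. chi4 m * (ln (m) / m)) = - ?A"
  unfolding sum_chi4 Suc sum.lessThan_Suc_shift by (simp add: g_def sum_negf numeral_eq_Suc)
 moreover have "0 <= ?A & ?A <= g 0"
 proof (rule alternating_sum_bounds)
  show "0 <= g i" for i by (simp add: g_def)
  show "g (Suc i) <= g i" for i unfolding g_def by (rule ln_over_antimono) auto
 qed
 moreover have "g 0 <= 1" using ln_le_minus_one[of "3::real"] by (simp add: g_def)
 ultimately show ?thesis by auto
qed

text \<open>Writing ln as a divisor sum of Lam, the bounded sum of chi4(m) ln(m)/m becomes the sum
  of chi4(d) Lam(d)/d times A4(x div d). Replacing A4(x div d) by A4 x costs d/x per term, which
  Chebyshev's bound controls, and A4 x \<ge> 2/3 can be divided out.\<close>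

lemma sum_chi4_mangoldt: "\<bar>SUM d:{1..2 ^ k}. chi4 d * Lam d / d\<bar> <= 4"
proof -
 define x where "x = (2::nat) ^ k"
 have x: "x >= 1" by (simp add: x_def)
 let ?A = "SUM d:{1..x}. chi4 d * Lam d / d * A4 (x div d)"
 let ?B = "SUM m:{1..x}. chi4 m * (ln (m) / m)"
 have "?B = (SUM m:{1..x}. \<Sum>d | d dvd m. chi4 d * Lam d / d * (chi4 (m div d) / (m div d)))"
 proof (rule sum.cong[OF refl])
  fix m assume m: "m \<in> {1..x}"
  have "chi4 m * (ln (m) / m) = (\<Sum>d | d dvd m. chi4 m / m * Lam d)"
   unfolding sum_distrib_left[symmetric] using m mangoldt_sum[of m, where 'a = real] by simp
  also have "... = (\<Sum>d | d dvd m. chi4 d * Lam d / d * (chi4 (m div d) / (m div d)))"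
  proof (rule sum.cong[OF refl])
   fix d assume "d \<in> {d. d dvd m}"
   then obtain j where j: "m = d * j" by auto
   hence "d > 0" "j > 0" using m by auto
   thus "chi4 m / m * Lam d = chi4 d * Lam d / d * (chi4 (m div d) / (m div d))"
    by (simp add: j chi4_mult)
  qed
  finally show "chi4 m * (ln (m) / m) = ..." .
 qed
 also have "... = ?A"
  unfolding sum_divisors_swap[where F = "%d j. chi4 d * Lam d / real d * (chi4 j / real j)"] A4_def by (simp only: sum_distrib_left)
 finally have e: "?A = ?B" by simp
 define Sm where "Sm = (SUM d:{1..x}. chi4 d * Lam d / d)"
 have "A4 x * Sm = ?A + (SUM d:{1..x}. chi4 d * Lam d / d * (A4 x - A4 (x div d)))"
  unfolding Sm_def sum_distrib_left sum.distrib[symmetric] by (intro sum.cong refl) (simp add: right_diff_distrib mult_ac diff_divide_distrib)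
 moreover have "\<bar>SUM d:{1..x}. chi4 d * Lam d / d * (A4 x - A4 (x div d))\<bar> <= 2 * ln 2"
 proof -
  have "\<bar>SUM d:{1..x}. chi4 d * Lam d / d * (A4 x - A4 (x div d))\<bar> <= (SUM d:{1..x}. Lam d / x)"
  proof (intro order_trans[OF sum_abs] sum_mono)
   fix d assume d: "d \<in> {1..x}"
   have "x < (x div d + 1) * d" using d by (simp add: dividend_less_div_times)
   hence "x <= real (x div d + 1) * d" by (metis less_imp_le of_nat_le_iff of_nat_mult)
   hence "1 / (x div d + 1) <= d / x" using x by (simp add: field_simps)
   hence a: "\<bar>A4 x - A4 (x div d)\<bar> <= d / x" using A4_diff[of "x div d" x] by simp
   have "\<bar>chi4 d * Lam d / d * (A4 x - A4 (x div d))\<bar> = \<bar>chi4 d\<bar> * (Lam d / d) * \<bar>A4 x - A4 (x div d)\<bar>"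
    by (simp add: abs_mult)
   also have "... <= 1 * (Lam d / d) * (d / x)"
    using a by (intro mult_mono) (auto simp: chi4_def mangoldt_nonneg)
   also have "... = Lam d / x" by simp
   finally show "\<bar>chi4 d * Lam d / d * (A4 x - A4 (x div d))\<bar> <= Lam d / x" .
  qed
  also have "... = (SUM d:{1..x}. Lam d) / x" by (simp add: sum_divide_distrib)
  also have "... <= 2 * ln 2" using chebyshev_upper[of k] by (simp add: x_def field_simps)
  finally show ?thesis .
 qed
 ultimately have "\<bar>A4 x * Sm\<bar> <= 1 + 2 * ln 2" using sum_chi4_ln[of x] unfolding e by linarith
 also have "... <= 8/3" using ln2_le_25_over_36 by simp
 finally have "\<bar>A4 x\<bar> * \<bar>Sm\<bar> <= 8/3" by simp
 moreover have "2/3 * \<bar>Sm\<bar> <= \<bar>A4 x\<bar> * \<bar>Sm\<bar>" using A4_lower[OF x] by (intro mult_right_mono) auto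
 ultimately have "\<bar>Sm\<bar> <= 4" by simp
 thus ?thesis by (simp add: Sm_def x_def)
qed

lemma even_mangoldt_sum: "(SUM d:{d\<in>{1..2 ^ k}. even d}. Lam d / d) <= ln 2"
proof -
 let ?A = "{d\<in>{1..2 ^ k}. even d}"
 have "(SUM d:?A. Lam d / d) = (SUM d:(%j. 2 ^ j) ` {1..k}. Lam d / d)"
 proof (rule sum.mono_neutral_right)
  show "(%j. 2 ^ j) ` {1..k} \<subseteq> {d\<in>{1..2 ^ k}. even (d::nat)}" by auto
  show "ALL d:?A - (%j. 2 ^ j) ` {1..k}. Lam d / d = 0"
  proof
   fix d :: nat assume d: "d \<in> ?A - (%j. 2 ^ j) ` {1..k}"
   have "\<not> primepow d"
   proof
    assume "primepow d"
    then obtain p j where pj: "prime p" "j > 0" "d = p ^ j" by (auto simp: primepow_def)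
    have "p = 2" using d pj primes_dvd_imp_eq[of 2 p] by simp
    moreover have "j <= k" using d pj(3) \<open>p = 2\<close> by simp
    ultimately show False using d pj by auto
   qed
   thus "Lam d / d = 0" by (simp add: mangoldt_def)
  qed
 qed simp
 also have "... = (SUM j:{1..k}. ln 2 / 2 ^ j)"
  by (subst sum.reindex) (auto simp: inj_on_def)
 also have "... = ln 2 * (1 - 1 / 2 ^ k)"
  by (induction k) (auto simp: field_simps)
 also have "... <= ln 2" by simp
 finally show ?thesis .
qed

definition S3 :: "nat => real" where
 "S3 k = (SUM d:{d\<in>{1..2 ^ k}. d mod 4 = 3}. Lam d / real d)"

text \<open>The function 1 - chi4 is 2 on the class 3, 1 on even numbers and 0 on the class 1. The
  constant 3 is half of 1 + 4 + 1, the errors of the full, twisted and even sums.\<close>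

lemma S3_lower: "k * ln 2 / 2 - 3 <= S3 k"
proof -
 let ?X = "{1..2 ^ k :: nat}"
 let ?A = "SUM d:{d\<in>?X. even d}. Lam d / d"
 have "(SUM d:?X. Lam d / real d) - (SUM d:?X. chi4 d * Lam d / real d)
   = (SUM d:?X. 2 * (if d mod 4 = 3 then Lam d / real d else 0) + (if even d then Lam d / real d else 0))"
  unfolding sum_subtractf[symmetric]
 proof (rule sum.cong[OF refl])
  fix d :: nat
  consider "d mod 4 = 0" | "d mod 4 = 1" | "d mod 4 = 2" | "d mod 4 = 3" by linarith
  thus "Lam d / d - chi4 d * Lam d / d = 2 * (if d mod 4 = 3 then Lam d / d else 0) + (if even d then Lam d / d else 0)"
  proof cases
   case 1
   show ?thesis using 1 by (auto simp: chi4_def)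
  next
   case 2
   hence "odd d" by presburger
   thus ?thesis using 2 by (simp add: chi4_def)
  next
   case 3
   hence "even d" by presburger
   thus ?thesis using 3 by (simp add: chi4_def)
  next
   case 4
   hence "odd d" by presburger
   thus ?thesis using 4 by (simp add: chi4_def)
  qed
 qed
 also have "... = 2 * S3 k + ?A"
  unfolding S3_def sum.inter_filter[OF finite_atLeastAtMost] by (simp only: sum.distrib sum_distrib_left)
 finally have e: "(SUM d:?X. Lam d / d) - (SUM d:?X. chi4 d * Lam d / d) = 2 * S3 k + ?A" .
 have "ln (real (2 ^ k)) - 1 <= (SUM d:?X. Lam d / d)" by (rule mangoldt_sum_lower) simp
 moreover have "ln (real (2 ^ k)) = k * ln 2" by (simp add: ln_realpow)
 moreover have "ln 2 <= (1::real)" using ln2_le_25_over_36 by simp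
 ultimately show ?thesis using e even_mangoldt_sum[of k] sum_chi4_mangoldt[of k] by simp
qed

lemma mangoldt_le_ln: "n >= 1 ==> Lam n <= ln (n)"
proof (cases "primepow n")
 case True
 then obtain p j where pj: "prime p" "j > 0" "n = p ^ j" by (auto simp: primepow_def)
 have "p ^ 1 <= p ^ j" using pj prime_ge_1_nat by (intro power_increasing) auto
 hence "real p <= n" using pj by simp
 moreover have "real p > 0" using pj(1) by (simp add: prime_gt_0_nat)
 ultimately show ?thesis using pj by simp
qed (simp add: mangoldt_def)

text \<open>If all late blocks were sparser than stated, S3 would grow by at most ln 2/3 per block,
  whereas \<open>S3_lower\<close> forces an average growth of ln 2/2.\<close>

lemma primepow_blocks:
 "\<exists>i\<ge>i0. 2 ^ i / (3 * real (i + 1)) <= (card {n\<in>{2 ^ i<..2 ^ Suc i}. n mod 4 = 3 & primepow (n::nat)})"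
proof (rule ccontr)
 assume no: "\<not> ?thesis"
 have step: "S3 (Suc i) <= S3 i + ln 2 / 3" if i: "i >= i0" for i
 proof -
  define Bl where "Bl = {n\<in>{2 ^ i<..2 ^ Suc i}. n mod 4 = 3 & primepow (n::nat)}"
  have c: "(card Bl) <= 2 ^ i / (3 * real (i + 1))" using no i unfolding Bl_def by auto
  have dis: "{d\<in>{1..2 ^ Suc i}. d mod 4 = 3} = {d\<in>{1..2 ^ i}. d mod 4 = 3} \<union> {d\<in>{2 ^ i<..2 ^ Suc i}. d mod 4 = (3::nat)}" by auto
  have "S3 (Suc i) = S3 i + (SUM d:{d\<in>{2 ^ i<..2 ^ Suc i}. d mod 4 = 3}. Lam d / d)"
   unfolding S3_def dis by (rule sum.union_disjoint) auto
  also have "(SUM d:{d\<in>{2 ^ i<..2 ^ Suc i}. d mod 4 = 3}. Lam d / d) = (SUM d:Bl. Lam d / d)"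
   by (rule sum.mono_neutral_right) (auto simp: Bl_def mangoldt_def)
  also have "... <= (SUM d:Bl. (i + 1) * ln 2 / 2 ^ i)"
  proof (rule sum_mono)
   fix d assume d: "d \<in> Bl"
   hence d': "2 ^ i < d" "d <= 2 ^ Suc i" "d >= 1" by (auto simp: Bl_def)
   have "Lam d <= ln (d)" by (rule mangoldt_le_ln[OF d'(3)])
   also have "... <= ln (real (2 ^ Suc i))" using d' by (subst ln_le_cancel_iff) (auto simp del: power_Suc simp flip: of_nat_power)
   also have "... = (i + 1) * ln 2" unfolding of_nat_power by (subst ln_realpow) auto
   finally have l: "Lam d <= (i + 1) * ln 2" .
   show "Lam d / d <= (i + 1) * ln 2 / 2 ^ i" using d'(1) l by (intro frac_le) auto
  qed
  also have "... = (card Bl) * ((i + 1) * ln 2 / 2 ^ i)" by simp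
  also have "... <= 2 ^ i / (3 * real (i + 1)) * ((i + 1) * ln 2 / 2 ^ i)" by (rule mult_right_mono[OF c]) simp
  also have "... = ln 2 / 3"
  proof -
   have h: "v / (3 * u) * (u * l / v) = l / 3" if "u > 0" "v > 0" for u v l :: real using that by simp
   show ?thesis by (rule h) auto
  qed
  finally show ?thesis by simp
 qed
 have up: "S3 (i0 + n) <= S3 i0 + real n * (ln 2 / 3)" for n
 proof (induction n)
  case (Suc n)
  have "S3 (i0 + Suc n) <= S3 i0 + n * (ln 2 / 3) + ln 2 / 3" using step[of "i0 + n"] Suc by simp
  thus ?case by (simp add: algebra_simps add_divide_distrib)
 qed simp
 obtain n :: nat where n: "9 * (S3 i0 + 4) < real n" using reals_Archimedean2[of "9 * (S3 i0 + 4)"] ..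
 have "(i0 + n) * ln 2 / 2 - 3 <= S3 i0 + n * (ln 2 / 3)" using S3_lower[of "i0 + n"] up[of n] by simp
 moreover have "n * ln 2 / 2 <= (i0 + n) * ln 2 / 2" by simp
 ultimately have "n * ln 2 / 6 <= S3 i0 + 3" by linarith
 moreover have "n * (2/3) <= n * ln 2" using ln2_ge_two_thirds by (intro mult_left_mono) auto
 ultimately show False using n by simp
qed

section \<open>Totient fibres and the two colour classes\<close>

definition proper_powers :: "nat => nat set" where
 "proper_powers Y = {n. n <= Y & primepow n & \<not> prime n}"

lemma finite_proper_powers: "finite (proper_powers Y)"
 by (rule finite_subset[of _ "{..Y}"]) (auto simp: proper_powers_def)

text \<open>A proper power r^j up to 2^k has j \<ge> 2, so r is at most the square root of 2^k, and
  j \<le> k because r \<ge> 2.\<close>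

lemma card_proper_powers: "(card (proper_powers (2 ^ k))) <= real (k + 1) * (sqrt (2 ^ k) + 1)"
proof -
 define s where "s = nat \<lfloor>sqrt (2 ^ k)\<rfloor>"
 have s: "s <= sqrt (2 ^ k)" by (simp add: s_def)
 let ?A = "{..s} \<times> {..k}"
 let ?B = "%(r, j). r ^ j"
 have "proper_powers (2 ^ k) \<subseteq> ?B ` ?A"
 proof
  fix n assume n: "n \<in> proper_powers (2 ^ k)"
  then obtain r j where rj: "prime r" "j > 0" "n = r ^ j" by (auto simp: proper_powers_def primepow_def)
  have "j ~= 1" using n rj by (auto simp: proper_powers_def)
  hence j2: "j >= 2" using rj by simp
  have r2: "r >= 2" using rj(1) by (rule prime_ge_2_nat)
  have "2 ^ j <= r ^ j" using r2 by (intro power_mono) auto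
  also have "... <= 2 ^ k" using n rj by (simp add: proper_powers_def)
  finally have "j <= k" by simp
  moreover have "r <= s"
  proof -
   have "r ^ 2 <= r ^ j" using j2 r2 by simp
   also have "... <= 2 ^ k" using n rj by (simp add: proper_powers_def)
   finally have "(r ^ 2) <= real (2 ^ k)" by linarith
   hence "r <= sqrt (2 ^ k)" by (intro real_le_rsqrt) simp
   thus ?thesis by (simp add: s_def le_nat_iff le_floor_iff)
  qed
  ultimately show "n \<in> ?B ` ?A" using rj by force
 qed
 hence "card (proper_powers (2 ^ k)) <= card (?B ` ?A)" by (intro card_mono) auto
 also have "... <= card ?A" by (rule card_image_le) simp
 also have "... = (s + 1) * (k + 1)" by simp
 finally have "real (card (proper_powers (2 ^ k))) <= ((s + 1) * (k + 1))" by linarith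
 also have "... = (k + 1) * (real s + 1)" by (simp add: algebra_simps)
 also have "... <= (k + 1) * (sqrt (2 ^ k) + 1)" using s by simp
 finally show ?thesis .
qed

text \<open>Every coprime factor larger than 2 has an even totient, so two of them would make the
  totient divisible by 4. Splitting off the power of an odd prime r leaves a cofactor 1 or 2;
  without odd primes x is a power of two that is at least 8, and 4 divides its totient.\<close>

lemma totient_2_mod_4:
 assumes x: "x > 4" and t: "totient x mod 4 = 2"
 shows "EX r j. prime r & odd r & j > 0 & (x = r ^ j \<or> x = 2 * r ^ j)"
proof (cases "EX r. prime r & odd r & r dvd x")
 case True
 then obtain r where r: "prime r" "odd r" "r dvd x" by blast
 have x0: "x ~= 0" "\<not> is_unit r" using x r(1) by auto
 define j where "j = multiplicity r x"
 obtain y where y: "x = r ^ j * y" "\<not> r dvd y" unfolding j_def by (rule multiplicity_decompose'[OF x0])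
 have j: "j > 0" unfolding j_def using r x0 by (simp add: prime_multiplicity_gt_zero_iff)
 have cop: "coprime (r ^ j) y" using y(2) r(1) by (simp add: prime_imp_coprime)
 have tx: "totient x = totient (r ^ j) * totient y" unfolding y(1) by (rule totient_mult_coprime[OF cop])
 have "r > 2" using r prime_ge_2_nat[of r] by (cases "r = 2") auto
 moreover have "r ^ 1 <= r ^ j" using j r(1) prime_ge_1_nat by (intro power_increasing) auto
 ultimately have ev: "even (totient (r ^ j))" by (intro totient_even) simp
 have "y <= 2"
 proof (rule ccontr)
  assume "\<not> y <= 2"
  hence "even (totient y)" by (intro totient_even) simp
  hence "4 dvd totient x" unfolding tx using ev mult_dvd_mono[of 2 "totient (r ^ j)" 2 "totient y"] by simp
  thus False using t by simp
 qed
 moreover have "y ~= 0" using y(1) x0 by simp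
 ultimately have "y = 1 \<or> y = 2" by auto
 hence "x = r ^ j \<or> x = 2 * r ^ j" using y(1) by auto
 thus ?thesis using r(1,2) j by auto
next
 case False
 have x0: "x ~= 0" "\<not> is_unit (2::nat)" using x by auto
 define a where "a = multiplicity 2 x"
 obtain y where y: "x = 2 ^ a * y" "\<not> 2 dvd y" unfolding a_def by (rule multiplicity_decompose'[OF x0])
 have "y = 1"
 proof (rule ccontr)
  assume "y ~= 1"
  then obtain r where r: "prime r" "r dvd y" using prime_factor_nat by blast
  have "r dvd x" unfolding y(1) using r(2) by simp
  moreover have "odd r" using r(2) y(2) dvd_trans by blast
  ultimately show False using False r(1) by blast
 qed
 hence xa: "x = 2 ^ a" using y(1) by simp
 have "a >= 3"
 proof (rule ccontr)
  assume "\<not> a >= 3"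
  hence "2 ^ a <= (2 ^ 2 :: nat)" by (intro power_increasing) auto
  thus False using xa x by simp
 qed
 then obtain b where b: "a = b + 3" using le_Suc_ex by (metis add.commute)
 have "totient x mod 4 = 0" using totient_prime_power[of 2 a] b xa by simp
 thus ?thesis using t by simp
qed

text \<open>For a prime \<open>p \<equiv> 3 (mod 4)\<close> the fibre over \<open>p - 1\<close> consists of \<open>p\<close>, \<open>2 p\<close>
 and possibly (doubles of) proper prime powers.\<close>

lemma fibre_of_prime:
 assumes p: "prime p" "p mod 4 = 3" "p > 5" and x: "totient x = p - 1"
 shows "x = p \<or> x = 2 * p \<or> (EX n:proper_powers (2 * p). x = n \<or> x = 2 * n)"
proof -
 have "totient x <= x" by (rule totient_le)
 hence x4: "x > 4" using x p(3) by simp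
 have "totient x mod 4 = 2"
 proof -
  have "p - 1 = 4 * (p div 4) + 2" using div_mult_mod_eq[of p 4] p(2) by simp
  moreover have h: "(4 * q + 2) mod 4 = 2" for q :: nat by presburger
  ultimately show ?thesis unfolding x by simp
 qed
 from totient_2_mod_4[OF x4 this] obtain r j where r: "prime r" "odd r" "j > 0" "x = r ^ j \<or> x = 2 * r ^ j" by blast
 have t: "totient x = r ^ (j - 1) * (r - 1)" using r totient_prime_power[OF r(1,3)] by (auto simp: totient_mult_coprime)
 show ?thesis
 proof (cases "j = 1")
  case True
  hence "r = p" using t x prime_ge_1_nat[OF r(1)] prime_ge_1_nat[OF p(1)] by simp
  thus ?thesis using r(4) True by auto
 next
  case False
  then obtain i where i: "j = Suc i" "i > 0" using r(3) by (cases j) auto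
  have r2: "r >= 2" using r(1) by (rule prime_ge_2_nat)
  have "r ^ j = r ^ i * r" by (simp add: i(1))
  also have "... <= 2 * (p - 1)" using r2 t x i by simp
  finally have "r ^ j <= 2 * p" by simp
  moreover have "primepow (r ^ j)" using r by simp
  moreover have "\<not> prime (r ^ j)" using False by (simp add: prime_power_iff)
  ultimately have "r ^ j \<in> proper_powers (2 * p)" by (simp add: proper_powers_def)
  thus ?thesis using r(4) by blast
 qed
qed

text \<open>The value f(p - 1) determines p through its totient, so exceptional primes inject into
  the proper powers and their doubles, which are about square-root many. Proper powers that occur
  among the prime powers of the block are discarded as well.\<close>

lemma colour_classes:
 fixes f :: "nat => nat"
 assumes f: "!!m. m \<in> totient_values ==> f m \<in> totient_fibre m"
 shows "EX c:{1, 2}. ALL i0. \<exists>i\<ge>i0. 1/8 * 2 ^ i / real (i + 1) <= (card {p\<in>{2 ^ i<..2 ^ Suc i}. prime p & f (p - 1) = c * p})"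
proof -
 define Cc where "Cc c i = {p\<in>{2 ^ i<..2 ^ Suc i}. prime p & f (p - 1) = c * p}" for c i :: nat
 have "eventually (%i. 3 * (real (i + 3) * (sqrt (2 ^ (i + 2)) + 1)) <= 1/12 * 2 ^ i / real (i + 1)) at_top" by real_asymp
 then obtain i1 where i1: "!!i. i >= i1 ==> 3 * (real (i + 3) * (sqrt (2 ^ (i + 2)) + 1)) <= 1/12 * 2 ^ i / real (i + 1)"
  by (auto simp: eventually_at_top_linorder)
 have two: "\<exists>i\<ge>i0. 1/4 * 2 ^ i / real (i + 1) <= real (card (Cc 1 i)) + real (card (Cc 2 i))" for i0
 proof -
  obtain i where i: "i >= max i0 (max i1 3)"
   and b: "2 ^ i / (3 * real (i + 1)) <= (card {n\<in>{2 ^ i<..2 ^ Suc i}. n mod 4 = 3 & primepow (n::nat)})"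
   using primepow_blocks[of "max i0 (max i1 3)"] by blast
  define E where "E = proper_powers (2 ^ (i + 2))"
  have fE: "finite E" unfolding E_def by (rule finite_proper_powers)
  define Ex where "Ex = {p\<in>{2 ^ i<..2 ^ Suc i}. prime p & f (p - 1) \<in> E \<union> (%n. 2 * n) ` E}"
  have tot: "p - 1 \<in> totient_values" "totient (f (p - 1)) = p - 1" if "prime p" for p
  proof -
   show 1: "p - 1 \<in> totient_values" using totient_prime[OF that] prime_gt_0_nat[OF that] by (force simp: totient_values_def)
   show "totient (f (p - 1)) = p - 1" using f[OF 1] by (simp add: totient_fibre_def)
  qed
  have sub: "{n\<in>{2 ^ i<..2 ^ Suc i}. n mod 4 = 3 & primepow (n::nat)} \<subseteq> E \<union> (Ex \<union> (Cc 1 i \<union> Cc 2 i))"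
  proof
   fix n assume n: "n \<in> {n\<in>{2 ^ i<..2 ^ Suc i}. n mod 4 = 3 & primepow (n::nat)}"
   have le: "n <= 2 ^ (i + 2)" "2 * n <= 2 ^ (i + 2)" using n by auto
   show "n \<in> E \<union> (Ex \<union> (Cc 1 i \<union> Cc 2 i))"
   proof (cases "prime n")
    case True
    have "2 ^ 3 <= (2 ^ i :: nat)" using i by (intro power_increasing) auto
    hence "n > 5" using n by simp
    from fibre_of_prime[OF True _ this tot(2)[OF True]] n
    consider "f (n - 1) = 1 * n" | "f (n - 1) = 2 * n" | m where "m \<in> proper_powers (2 * n)" "f (n - 1) = m \<or> f (n - 1) = 2 * m"
     by auto
    thus ?thesis
    proof cases
     case 3
     thus ?thesis using n by (auto simp: E_def proper_powers_def Ex_def)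
    qed (use True n in \<open>auto simp: Cc_def\<close>)
   next
    case False
    thus ?thesis using n by (simp add: E_def proper_powers_def)
   qed
  qed
  have cEx: "card Ex <= 2 * card E"
  proof -
   have "inj_on (%p. f (p - 1)) Ex"
   proof (rule inj_onI)
    fix p q assume p: "p \<in> Ex" and q: "q \<in> Ex" and e: "f (p - 1) = f (q - 1)"
    have pr: "prime p" "prime q" using p q by (auto simp: Ex_def)
    show "p = q" using e tot(2)[OF pr(1)] tot(2)[OF pr(2)] prime_ge_1_nat[OF pr(1)] prime_ge_1_nat[OF pr(2)] by simp
   qed
   hence "card Ex <= card (E \<union> (%n. 2 * n) ` E)" by (rule card_inj_on_le) (use fE in \<open>auto simp: Ex_def\<close>)
   also have "... <= card E + card E" using card_Un_le[of E "(%n. 2 * n) ` E"] card_image_le[OF fE, of "%n. 2 * n"] by simp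
   finally show ?thesis by simp
  qed
  have "card {n\<in>{2 ^ i<..2 ^ Suc i}. n mod 4 = 3 & primepow (n::nat)} <= card (E \<union> (Ex \<union> (Cc 1 i \<union> Cc 2 i)))"
   using fE sub by (intro card_mono) (auto simp: Ex_def Cc_def)
  also have "... <= 3 * card E + (card (Cc 1 i) + card (Cc 2 i))" using card_Un_le[of E "Ex \<union> (Cc 1 i \<union> Cc 2 i)"] card_Un_le[of Ex "Cc 1 i \<union> Cc 2 i"] card_Un_le[of "Cc 1 i" "Cc 2 i"] cEx by simp
  finally have "card {n\<in>{2 ^ i<..2 ^ Suc i}. n mod 4 = 3 & primepow (n::nat)} <= 3 * card E + (card (Cc 1 i) + card (Cc 2 i))" .
  hence 1: "2 ^ i / (3 * real (i + 1)) <= 3 * real (card E) + (real (card (Cc 1 i)) + (card (Cc 2 i)))" using b by simp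
  have 2: "3 * real (card E) <= 1/12 * 2 ^ i / (i + 1)" using card_proper_powers[of "i + 2"] i1[of i] i by (simp add: E_def add.commute)
  \<comment> \<open>Of the third supplied by \<open>primepow_blocks\<close>, 1/12 pays for the
    exceptions and 1/4 is left for the two colours, hence 1/8 for one of them.\<close>
  have 3: "2 ^ i / (3 * real (i + 1)) = 1/4 * 2 ^ i / (i + 1) + 1/12 * 2 ^ i / (i + 1)"
  proof -
   have h: "v / (3 * u) = 1/4 * v / u + 1/12 * v / u" if "u > 0" for u v :: real by simp
   show ?thesis by (rule h) simp
  qed
  show ?thesis using 1 2 i by (auto simp: field_simps)
 qed
 have "(ALL i0. \<exists>i\<ge>i0. 1/8 * 2 ^ i / real (i + 1) <= (card (Cc 1 i))) \<or> (ALL i0. \<exists>i\<ge>i0. 1/8 * 2 ^ i / real (i + 1) <= (card (Cc 2 i)))"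
 proof (rule ccontr)
  assume "\<not> ?thesis"
  then obtain i1 i2 where n1: "!!i. i >= i1 ==> (card (Cc 1 i)) < 1/8 * 2 ^ i / real (i + 1)"
   and n2: "!!i. i >= i2 ==> (card (Cc 2 i)) < 1/8 * 2 ^ i / real (i + 1)" by (meson not_le)
  obtain i where i: "i >= max i1 i2" "1/4 * 2 ^ i / real (i + 1) <= real (card (Cc 1 i)) + (card (Cc 2 i))" using two by blast
  have h: "1/8 * v / u + 1/8 * v / u = 1/4 * v / u" if "u > 0" for u v :: real by simp
  have "1/8 * 2 ^ i / (i + 1) + 1/8 * 2 ^ i / (i + 1) = 1/4 * 2 ^ i / (i + 1)" by linarith
  thus False using n1[of i] n2[of i] i by auto
 qed
 thus ?thesis unfolding Cc_def by simp
qed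

section \<open>Progressions in relatively dense sets of primes\<close>

lemma integer_root: "M > 0 ==> EX R. R ^ M <= N & N < Suc R ^ M" for M N :: nat
proof -
 assume M: "M > 0"
 have ex: "EX R. N < Suc R ^ M" using M by (metis Suc_leI less_le_trans lessI self_le_power zero_less_Suc One_nat_def)
 define R where "R = (LEAST R. N < Suc R ^ M)"
 have "N < Suc R ^ M" unfolding R_def by (rule LeastI_ex[OF ex])
 moreover have "R ^ M <= N"
 proof (cases R)
  case (Suc r)
  show ?thesis using not_less_Least[of r "%R. N < Suc R ^ M"] Suc by (simp add: R_def[symmetric])
 qed (use M in \<open>simp add: zero_power\<close>)
 ultimately show ?thesis by blast
qed

text \<open>When all terms lie in the lower half of the residues, a second difference is a multiple
  of N of absolute value below N, hence zero.\<close>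

lemma AP_mod_genuine:
 fixes a :: "nat => int"
 assumes a: "!!j. j < k ==> a j = (y + int j * d) mod N" "!!j. j < k ==> 2 * a j < N" and N: "N > 0" and j: "j < k"
 shows "a j = a 0 + int j * (a 1 - a 0)"
proof -
 have pos: "0 <= a j" if "j < k" for j using a(1)[OF that] N by simp
 have step: "a (Suc j) - a j = a 1 - a 0" if "Suc j < k" for j
  using that
 proof (induction j)
  case (Suc j)
  have h: "N dvd (y + int j * d) - a j" if "j < k" for j using a(1)[OF that] by simp
  have "N dvd ((y + int (Suc (Suc j)) * d - a (Suc (Suc j))) + (y + int j * d - a j)) - 2 * (y + int (Suc j) * d - a (Suc j))"
   by (intro dvd_diff dvd_add dvd_mult h) (use Suc.prems in auto)
  also have "... = 2 * a (Suc j) - a (Suc (Suc j)) - a j" by (simp add: algebra_simps)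
  finally have dv: "N dvd 2 * a (Suc j) - a (Suc (Suc j)) - a j" .
  have "2 * a (Suc j) - a (Suc (Suc j)) - a j = 0" using a(2)[of j] a(2)[of "Suc j"] a(2)[of "Suc (Suc j)"] pos[of j] pos[of "Suc j"] pos[of "Suc (Suc j)"] Suc.prems dvd_imp_le_int[OF _ dv] by linarith
  thus ?case using Suc by simp
 qed simp
 show ?thesis
  using j
 proof (induction j)
  case (Suc j)
  thus ?case using step[of j] by (simp add: algebra_simps)
 qed simp
qed

lemma dense_class:
 assumes W: "W > 1" and B: "finite B" "!!p. p \<in> B ==> coprime p W"
 shows "EX b:totatives W. card B <= totient W * card {p\<in>B. p mod W = b}"
proof (rule ccontr)
 assume "\<not> ?thesis"
 hence less: "totient W * card {p\<in>B. p mod W = b} < card B" if "b \<in> totatives W" for b using that by auto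
 have cl: "p mod W \<in> totatives W" if "p \<in> B" for p
 proof -
  have c: "coprime (p mod W) W" using B(2)[OF that] W by simp
  have "p mod W ~= 0"
  proof
   assume "p mod W = 0"
   hence "coprime 0 W" using c by simp
   thus False using W by simp
  qed
  thus ?thesis using c W by (auto simp: in_totatives_iff intro: less_imp_le)
 qed
 let ?A = "SUM b:totatives W. card {p\<in>B. p mod W = b}"
 have "card B = ?A"
 proof -
  let ?B = "\<Union>b\<in>totatives W. {p\<in>B. p mod W = b}"
  have "B = ?B" using cl by auto
  hence "card B = card ?B" by simp
  also have "... = ?A" using B(1) by (intro card_UN_disjoint) auto
  finally show ?thesis .
 qed
 hence "totient W * card B = (SUM b:totatives W. totient W * card {p\<in>B. p mod W = b})" by (simp add: sum_distrib_left)
 also have "... < (SUM b:totatives W. card B)"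
  by (rule sum_strict_mono) (use less W in \<open>auto simp: totatives_eq_empty_iff\<close>)
 also have "... = totient W * card B" by (simp add: totient_def)
 finally show False by simp
qed

lemma totient_primorial: "(totient (pprod (primes_le w))) * smoothV w = (pprod (primes_le w))"
proof -
 have pf: "prime_factors (pprod (primes_le w)) = primes_le w"
 proof -
  have "q \<in> prime_factors (pprod (primes_le w)) \<longleftrightarrow> q \<in> primes_le w" for q using prod_primes_pos[of "primes_le w"] prime_dvd_prod_primes_iff[OF finite_primes_le, of w q] by (auto simp: in_prime_factors_iff)
  thus ?thesis by blast
 qed
 have "(PROD p:primes_le w. 1 - 1 / p) * smoothV w = (PROD p:primes_le w. (1 - 1 / p) * (1 / (1 - 1 / p)))"
  unfolding smoothV_def by (rule prod.distrib[symmetric])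
 also have "... = 1"
 proof (rule prod.neutral, rule ballI)
  fix p assume "p \<in> primes_le w"
  hence "real p >= 2" using prime_ge_2_nat[of p] by auto
  thus "(1 - 1 / p) * (1 / (1 - 1 / p)) = 1" by simp
 qed
 finally show ?thesis unfolding totient_formula2 pf by simp
qed

lemma selnu_nonneg:
 assumes "R >= 2" "w <= R" "pprod (primes_le w) <= R" shows "0 <= selnu w R b y"
 using selG_bounds(1)[OF assms order_refl] by (simp add: selnu_def)

lemma selnu_prime:
 assumes y: "int (pprod (primes_le w)) * y + int b = int p" and p: "prime p" "p > R"
 shows "selnu w R b y = 1 / selG (ln (R)) (sieve_primes w R) 0 0"
proof -
 have "\<not> int q dvd int (pprod (primes_le w)) * y + int b" if "q \<in> sieve_primes w R" for q
 proof -
  have "prime q" "q <= R" using that by (auto simp: sieve_primes_def)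
  hence "\<not> q dvd p" using p primes_dvd_imp_eq[of q p] by auto
  thus ?thesis unfolding y by simp
 qed
 hence "{S\<in>Pow (sieve_primes w R). ALL q:S. int q dvd int (pprod (primes_le w)) * y + int b} = {{}}" by auto
 thus ?thesis unfolding selnu_def sieveL_def by simp
qed

text \<open>Residues modulo the primorial W are fixed by a pigeonhole over the phi(W) reduced
  classes, and y stands for W y + b. The factor W/phi(W) gained in density is the
  \<open>smoothV\<close> in the bound for G, so the weighted density does not depend on w.\<close>

theorem dense_primes_AP:
 fixes A :: "nat set"
 assumes A: "ALL p:A. prime p" and c: "0 < c" "c <= (1::real)"
  and dense: "ALL i0. \<exists>i\<ge>i0. c * 2 ^ i / (i + 1) <= (card {p\<in>{2 ^ i<..2 ^ Suc i}. p \<in> A})"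
  and k: "k >= 2"
 shows "EX a d. d > 0 & (\<forall>j<k. a + j * d \<in> A)"
proof -
 define M where "M = 5 * (k * 2 ^ k) + 1"
 have "k <= k * 2 ^ k" by simp
 hence M: "M >= k + 1" "M >= 2" "M > 0" using k unfolding M_def by auto
 \<comment> \<open>The weighted primes reach density c/(9900 M), where 9900 is 6 (from ln R) times
   275 (from G) times 6 (from W N); 20000 leaves room.\<close>
 define de where "de = c / (20000 * real M)"
 have de: "de > 0" using c M by (simp add: de_def)
 obtain c1 et Q where c1: "c1 > 0" and et: "et > 0" and Q: "Q > 0"
  and rS: "ALL N nu f. N > 0 --> coprime N Q --> lfc (zN N) k (%j x. nu (psi N k j x)) et --> sum_lfc N (k - 1) nu et -->
  (ALL y:zN N. 0 <= f y & f y <= nu y) --> de <= avg (zN N) f -->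
  c1 <= avg (zN N) (%y. avg (zN N) (%d. \<Prod>j<k. f ((y + int j * d) mod int N)))"
  using relative_Szemeredi[OF k de] by blast
 obtain w0 where w0: "\<forall>w\<ge>w0. EX R0. \<forall>R\<ge>R0. ALL N b. R ^ M <= N --> coprime N (fact k) -->
  lfc (zN N) k (%j x. selnu w R b (psi N k j x)) et & sum_lfc N (k - 1) (selnu w R b) et"
  using sieve_majorant[OF k et] unfolding M_def[symmetric] by auto
 define w where "w = max w0 2"
 have "w >= w0" by (simp add: w_def)
 then obtain R0 where R0: "\<forall>R\<ge>R0. ALL N b. R ^ M <= N --> coprime N (fact k) -->
  lfc (zN N) k (%j x. selnu w R b (psi N k j x)) et & sum_lfc N (k - 1) (selnu w R b) et"
  using w0[THEN spec[of _ w]] by auto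
 define W where "W = pprod (primes_le w)"
 have W2: "W > 1"
 proof -
  have "2 dvd W" unfolding W_def by (subst prime_dvd_prod_primes_iff[OF finite_primes_le]) (auto simp: w_def)
  moreover have "W > 0" unfolding W_def by (rule prod_primes_pos) simp
  ultimately show ?thesis by auto
 qed
 define R1 where "R1 = R0 + w + W + nat \<lceil>2 / c1\<rceil> + 2"
 define Q' where "Q' = Q * fact k"
 have Q': "Q' > 0" using Q by (simp add: Q'_def)
 have "eventually (%i. real (i + 1) * sqrt (6 * 2 ^ i) <= c / 2 * 2 ^ i) at_top" using c(1) by real_asymp
 then obtain i2 where i2: "!!i. i >= i2 ==> real (i + 1) * sqrt (6 * 2 ^ i) <= c / 2 * 2 ^ i"
  by (auto simp: eventually_at_top_linorder)
 obtain i where i: "i >= i2 + W * R1 ^ M + W * (2 * Q' + 2) + W * W"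
  and bl: "c * 2 ^ i / (i + 1) <= (card {p\<in>{2 ^ i<..2 ^ Suc i}. p \<in> A})"
  using dense[THEN spec[of _ "i2 + W * R1 ^ M + W * (2 * Q' + 2) + W * W"]] by auto
 define X where "X = (2::nat) ^ Suc i"
 have "i < (2::nat) ^ i" by simp
 hence Xi: "i <= X" unfolding X_def power_Suc by linarith
 from i Xi have Xa: "W * R1 ^ M <= X" and Xb: "W * (2 * Q' + 2) <= X" and Xc: "W * W <= X" by auto
 have X0: "X > 0" unfolding X_def by simp
 \<comment> \<open>This choice makes N congruent to 1 modulo Q', hence coprime to it, and puts W N
   between 2 X and 3 X, so that all relevant y lie in the lower half of the residues.\<close>
 define s where "s = 2 * X div (W * Q') + 1"
 define N where "N = Q' * s + 1"
 have WN: "2 * X < W * N" "W * N <= 3 * X"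
 proof -
  have WQ: "W * Q' > 0" using W2 Q' by simp
  show "2 * X < W * N" using dividend_less_div_times[OF WQ, of "2 * X"] by (simp add: N_def algebra_simps s_def)
  have "2 * X div (W * Q') * (W * Q') <= 2 * X" by simp
  hence "s * (W * Q') <= 2 * X + W * Q'" by (simp add: s_def)
  moreover have "W * N = s * (W * Q') + W" by (simp add: N_def)
  moreover have "W * Q' + W <= X" using Xb by simp
  ultimately show "W * N <= 3 * X" by simp
 qed
 have N0: "N > 0" by (simp add: N_def)
 have cQ': "coprime N Q'"
 proof -
  have "gcd N Q' dvd N - Q' * s" by simp
  moreover have "N - Q' * s = 1" unfolding N_def by simp
  ultimately have "gcd N Q' = 1" by simp
  thus ?thesis by blast
 qed
 have cop: "coprime N Q" "coprime N (fact k)"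
  using cQ' unfolding Q'_def coprime_mult_right_iff by auto
 obtain R where R: "R ^ M <= N" "N < Suc R ^ M" using integer_root[OF M(3)] by blast
 have RR1: "R >= R1"
 proof (rule ccontr)
  assume "\<not> R >= R1"
  hence "Suc R ^ M <= R1 ^ M" by (intro power_mono) auto
  hence "W * N < W * R1 ^ M" using R(2) W2 by simp
  thus False using Xa WN(1) by linarith
 qed
 have Rr: "R >= R0" "R >= 2" "w <= R" "W <= R" "nat \<lceil>2 / c1\<rceil> <= R" using RR1 unfolding R1_def by linarith+
 have WR: "pprod (primes_le w) <= R" using Rr by (simp add: W_def)
 have R1c: "1 / R < c1"
 proof -
  have "2 / c1 <= R" using Rr(5) by simp
  hence "2 <= c1 * R" using c1 by (simp add: field_simps)
  thus ?thesis using Rr(2) by (simp add: field_simps)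
 qed
 have X_real: "real X = 2 * 2 ^ i" by (simp add: X_def)
 \<comment> \<open>R + 1 exceeds the M-th root of N, and N is at least the square root of X because
   W^2 \<le> X. So ln R is at least a fixed proportion of the block index.\<close>
 have lnR: "(i + 1) / (6 * real M) <= ln (R)"
 proof -
  have "X * (W * W) <= X * X" using Xc by simp
  also have "... <= (W * N) * (W * N)" using WN(1) by (intro mult_mono) auto
  finally have "X * (W * W) <= (N * N) * (W * W)" by simp
  hence "X <= N * N" using W2 by simp
  hence "ln (X) <= ln ((N * N))" using X0 by (subst ln_le_cancel_iff) (auto simp del: of_nat_mult simp: N_def)
  also have "... = 2 * ln (N)" by (simp add: ln_mult)
  also have "... <= 2 * ln ((Suc R ^ M))" using R(2) N0 by (simp del: of_nat_power of_nat_Suc)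
  also have "... = 2 * (M * ln ((Suc R)))" unfolding of_nat_power by (simp add: ln_realpow)
  also have "... <= 2 * (M * (2 * ln (R)))"
  proof -
   have "Suc R <= R * R" using Rr(2) by (cases R) auto
   hence "ln ((Suc R)) <= ln ((R * R))" by (subst ln_le_cancel_iff) (use Rr(2) in \<open>auto simp del: of_nat_mult of_nat_Suc\<close>)
   also have "... = 2 * ln (R)" by (simp add: ln_mult)
   finally show ?thesis by (intro mult_left_mono) auto
  qed
  finally have l: "ln (X) <= 4 * real M * ln (R)" by simp
  have "ln (X) = (i + 1) * ln 2" unfolding X_def of_nat_power by (subst ln_realpow) auto
  moreover have "(i + 1) * (2/3) <= (i + 1) * ln 2" using ln2_ge_two_thirds by (intro mult_left_mono) auto
  ultimately have "(i + 1) * (2/3) <= 4 * real M * ln (R)" using l by simp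
  thus ?thesis using M by (simp add: field_simps)
 qed
 \<comment> \<open>The primes of the block then exceed R, so no sieving prime divides them and the
   majorant takes its value 1/G there.\<close>
 have Rsmall: "R < 2 ^ i"
 proof -
  have "R ^ 2 <= R ^ M" using M(2) Rr(2) by simp
  also have "... <= N" by (rule R(1))
  also have "... <= W * N" using W2 by simp
  also have "... <= 3 * X" by (rule WN(2))
  finally have "real (R ^ 2) <= (3 * X)" by linarith
  hence "R <= sqrt (6 * 2 ^ i)" by (simp add: X_real real_le_rsqrt)
  also have "... <= (i + 1) * sqrt (6 * 2 ^ i)" by simp
  also have "... <= c / 2 * 2 ^ i" using i2[of i] i by simp
  also have "... < 2 ^ i" using c by simp
  finally have "R < real (2 ^ i)" by simp
  thus ?thesis by simp
 qed
 define B where "B = {p\<in>{2 ^ i<..2 ^ Suc i}. p \<in> A}"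
 have fB: "finite B" by (simp add: B_def)
 have B: "prime p" "p > R" "p <= X" "p \<in> A" if "p \<in> B" for p using that A Rsmall by (auto simp: B_def X_def)
 have Bcop: "coprime p W" if "p \<in> B" for p
 proof -
  have "\<not> p dvd W" using B[OF that] Rr(4) W2 by (auto dest: dvd_imp_le)
  thus ?thesis using B(1)[OF that] by (simp add: prime_imp_coprime)
 qed
 obtain b where b: "card B <= totient W * card {p\<in>B. p mod W = b}" using dense_class[OF W2 fB Bcop] by blast
 define Bb where "Bb = {p\<in>B. p mod W = b}"
 define G where "G = selG (ln (R)) (sieve_primes w R) 0 0"
 note Gb = selG_bounds[OF Rr(2,3) WR order_refl, folded G_def]
 define V where "V = smoothV w"
 have V0: "V > 0" unfolding V_def by (rule smoothV_pos)
 have bW: "b < W" if "Bb ~= {}" using that W2 by (auto simp: Bb_def)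
 define f where "f y = (if int W * y + int b \<in> int ` B then 1 / G else 0)" for y
 have f0: "0 <= f y" "f y <= 1 / G" for y using Gb(1) by (auto simp: f_def)
 have fnu: "f y <= selnu w R b y" for y
 proof (cases "int W * y + int b \<in> int ` B")
  case True
  then obtain p where p: "int W * y + int b = int p" "p \<in> B" by blast
  thus ?thesis using selnu_prime[OF p(1)[unfolded W_def] B(1,2)[OF p(2)]] True by (simp add: f_def G_def)
 next
  case False
  thus ?thesis using selnu_nonneg[OF Rr(2,3) WR, of b y] by (simp add: f_def)
 qed
 have avf: "de <= avg (zN N) f"
 proof -
  have "(SUM y:(%p. int (p div W)) ` Bb. f y) <= (SUM y:zN N. f y)"
  proof (rule sum_mono2)
   show "(%p. int (p div W)) ` Bb \<subseteq> zN N"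
   proof (rule image_subsetI)
    fix p assume "p \<in> Bb"
    hence "p <= X" using B(3) by (simp add: Bb_def)
    hence "p div W < N" using WN(1) by (simp add: less_mult_imp_div_less mult.commute)
    thus "int (p div W) \<in> zN N" by simp
   qed
  qed (use f0 in auto)
  moreover have "(SUM y:(%p. int (p div W)) ` Bb. f y) = (card Bb) * (1 / G)"
  proof -
   have inj: "inj_on (%p. int (p div W)) Bb"
   proof (rule inj_onI)
    fix p q assume "p \<in> Bb" "q \<in> Bb" "int (p div W) = int (q div W)"
    hence "p div W = q div W" "p mod W = q mod W" by (auto simp: Bb_def)
    thus "p = q" by (metis div_mult_mod_eq)
   qed
   have "f (int (p div W)) = 1 / G" if p: "p \<in> Bb" for p
   proof -
    have "int W * int (p div W) + int b = int p" using p by (auto simp: Bb_def simp flip: of_nat_mult of_nat_add)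
    thus ?thesis using p by (simp add: f_def Bb_def)
   qed
   thus ?thesis unfolding sum.reindex[OF inj] by simp
  qed
  ultimately have "(card Bb) * (1 / G) <= (SUM y:zN N. f y)" by simp
  hence 1: "(card Bb) * (1 / G) / N <= avg (zN N) f"
  proof -
   have "card (zN N) = N" by simp
   thus ?thesis using \<open>real (card Bb) * (1 / G) <= (SUM y:zN N. f y)\<close>
    unfolding avg_def by (simp only: divide_right_mono of_nat_0_le_iff)
  qed
  have L0: "ln (R) > 0" using Rr(2) by simp
  have G2: "ln (R) / (275 * V) <= 1 / G"
   using Gb(1,3) V0 L0 by (simp add: V_def field_simps)
  have cB: "(card B) * V <= real W * (card Bb)"
  proof -
   have "(card B) * V <= ((totient W) * V) * (card Bb)" using b V0 by (simp add: Bb_def flip: of_nat_mult)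
   thus ?thesis using totient_primorial[of w] by (simp add: W_def V_def)
  qed
  have NX: "real W * N <= 6 * 2 ^ i"
  proof -
   have "real (W * N) <= (3 * X)" using WN(2) by linarith
   thus ?thesis by (simp add: X_real)
  qed
  have "de = c / (20000 * real M)" by (rule de_def)
  also have "... <= c / (9900 * real M)" using c M by (intro divide_left_mono) auto
  also have "... = (c * 2 ^ i / (i + 1)) * ((i + 1) / (6 * real M)) / (275 * (6 * 2 ^ i))"
  by simp
  also have "... <= (card B) * ln (R) / (275 * (6 * 2 ^ i))"
   using bl lnR unfolding B_def[symmetric] by (intro divide_right_mono mult_mono) auto
  also have "... <= (card B) * ln (R) / (275 * (real W * N))"
   by (rule divide_left_mono) (use NX L0 W2 N0 in \<open>auto intro: mult_pos_pos simp: mult.commute\<close>)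
  also have "... = ((card B) * V) * (ln (R) / (275 * V)) / (real W * N)" using V0 by simp
  also have "... <= (real W * (card Bb)) * (1 / G) / (real W * N)"
   by (intro divide_right_mono mult_mono[OF cB G2]) (use V0 L0 in auto)
  also have "... = (card Bb) * (1 / G) / N" using W2 by simp
  finally show ?thesis using 1 by simp
 qed
 have "c1 <= avg (zN N) (%y. avg (zN N) (%d. \<Prod>j<k. f ((y + int j * d) mod int N)))"
 proof (rule rS[THEN spec[of _ N], THEN spec[of _ "selnu w R b"], THEN spec[of _ f], THEN mp, THEN mp, THEN mp, THEN mp, THEN mp, THEN mp])
  show "N > 0" "coprime N Q" by fact+
  show "lfc (zN N) k (%j x. selnu w R b (psi N k j x)) et" "sum_lfc N (k - 1) (selnu w R b) et"
   using R0[THEN spec[of _ R], THEN mp, OF Rr(1), THEN spec[of _ N], THEN spec[of _ b], THEN mp, OF R(1), THEN mp, OF cop(2)]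
   by auto
  show "ALL y:zN N. 0 <= f y & f y <= selnu w R b y" using f0 fnu by simp
 qed (rule avf)
 \<comment> \<open>Progressions with d = 0 contribute at most R^k/N \<le> 1/R, which is below c1; so
   some nonconstant progression has positive weight.\<close>
 have "EX y:zN N. EX d:zN N. d ~= 0 & (\<forall>j<k. f ((y + int j * d) mod int N) ~= 0)"
 proof (rule ccontr)
  assume no: "\<not> ?thesis"
  have "avg (zN N) (%y. avg (zN N) (%d. \<Prod>j<k. f ((y + int j * d) mod int N))) <= 1 / R"
  proof (rule avg_le_const)
   fix y assume y: "y \<in> zN N"
   have z: "(\<Prod>j<k. f ((y + int j * d) mod int N)) = 0" if "d \<in> zN N - {0}" for d
   proof -
    have "\<not> (\<forall>j<k. f ((y + int j * d) mod int N) ~= 0)"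
    proof
     assume h: "\<forall>j<k. f ((y + int j * d) mod int N) ~= 0"
     have "d \<in> zN N" "d ~= 0" using that by auto
     show False by (rule notE[OF no], rule bexI[OF _ y], rule bexI[OF _ \<open>d \<in> zN N\<close>], rule conjI[OF \<open>d ~= 0\<close> h])
    qed
    then obtain j where "j < k" "f ((y + int j * d) mod int N) = 0" unfolding not_all not_imp not_not by auto
    thus ?thesis by auto
   qed
   have "(SUM d:zN N. \<Prod>j<k. f ((y + int j * d) mod int N)) = (SUM d:{0}. \<Prod>j<k. f ((y + int j * d) mod int N))"
    by (rule sum.mono_neutral_right) (use z N0 in auto)
   also have "... <= (\<Prod>j<k. real R)"
    using f0 Gb(2) by (simp del: prod_constant, intro prod_mono) (auto intro: order_trans[OF f0(2)])
   also have "... = real R ^ k" by simp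
   finally have "avg (zN N) (%d. \<Prod>j<k. f ((y + int j * d) mod int N)) <= real R ^ k / N"
    by (simp add: avg_def divide_right_mono)
   also have "... <= 1 / R"
   proof -
    have "R ^ (k + 1) <= R ^ M" using M(1) Rr(2) by (intro power_increasing) auto
    hence "real (R ^ (k + 1)) <= N" using R(1) by linarith
    thus ?thesis using N0 Rr(2) by (simp add: field_simps)
   qed
   finally show "avg (zN N) (%d. \<Prod>j<k. f ((y + int j * d) mod int N)) <= 1 / R" .
  qed (use N0 in auto)
  thus False using \<open>c1 <= _\<close> R1c by simp
 qed
 then obtain y d where yd: "y \<in> zN N" "d \<in> zN N" "d ~= 0" and nz': "\<forall>j<k. f ((y + int j * d) mod int N) ~= 0"
  by auto
 have nz: "f ((y + int j * d) mod int N) ~= 0" if "j < k" for j using nz' that by simp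
 define a where "a j = (y + int j * d) mod int N" for j
 have aB: "int W * a j + int b \<in> int ` B" if "j < k" for j using nz[OF that] by (auto simp: f_def a_def split: if_splits)
 have a0: "0 <= a j" for j using N0 by (simp add: a_def)
 have a2: "2 * a j < int N" if j: "j < k" for j
 proof -
  obtain p where "p \<in> B" "int W * a j + int b = int p" using aB[OF j] by auto
  hence "int W * (2 * a j) <= int (2 * X)" using B(3)[of p] by simp
  also have "... < int W * int N" using WN(1) by (simp only: of_nat_less_iff flip: of_nat_mult)
  finally show ?thesis using W2 by simp
 qed
 define e where "e = a 1 - a 0"
 have aj: "a j = a 0 + int j * e" if "j < k" for j
  unfolding e_def by (rule AP_mod_genuine[where N = "int N" and y = y and d = d, OF _ a2 _ that]) (use N0 in \<open>auto simp: a_def\<close>)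
 have e0: "e ~= 0"
 proof
  assume "e = 0"
  hence "(y + d) mod int N = y mod int N" by (simp add: e_def a_def)
  hence "int N dvd (y + d) - y" by (simp only: mod_eq_dvd_iff)
  hence "int N dvd d" by simp
  moreover have "0 < d" "d < int N" using yd by auto
  ultimately show False using zdvd_not_zless by simp
 qed
 define p where "p j = nat (int W * a j + int b)" for j
 have pA: "p j \<in> A" if "j < k" for j using aB[OF that] B(4) by (auto simp: p_def)
 have pint: "int (p j) = int W * a j + int b" for j using a0[of j] by (simp add: p_def)
 show ?thesis
 proof (cases "e > 0")
  case True
  have "p j = p 0 + j * (W * nat e)" if "j < k" for j
  proof -
   have "int (p j) = int (p 0 + j * (W * nat e))" using aj[OF that] True by (simp add: pint algebra_simps)
   thus ?thesis by linarith
  qed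
  hence "\<forall>j<k. p 0 + j * (W * nat e) \<in> A" using pA by metis
  thus ?thesis using True W2 by (intro exI[of _ "p 0"] exI[of _ "W * nat e"]) auto
 next
  case False
  hence en: "e < 0" using e0 by simp
  \<comment> \<open>A negative difference is handled by reading the progression from its last
    term.\<close>
  have "p (k - 1 - j) = p (k - 1) + j * (W * nat (- e))" if "j < k" for j
  proof -
   have "a (k - 1 - j) = a 0 + int (k - 1 - j) * e" "a (k - 1) = a 0 + int (k - 1) * e"
    by (rule aj, use that in simp)+
   moreover have "int (k - 1 - j) = int (k - 1) - int j" by (rule of_nat_diff) (use that in simp)
   ultimately have "a (k - 1 - j) = a (k - 1) - int j * e" by (simp only: left_diff_distrib add_diff_eq)
   hence "int W * a (k - 1 - j) + int b = (int W * a (k - 1) + int b) + int j * (int W * (- e))"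
    unfolding \<open>a (k - 1 - j) = a (k - 1) - int j * e\<close> by (simp only: algebra_simps)
   moreover have "int (nat (- e)) = - e" using en by simp
   ultimately have "int (p (k - 1 - j)) = int (p (k - 1) + j * (W * nat (- e)))"
    unfolding of_nat_add of_nat_mult pint by simp
   thus ?thesis by linarith
  qed
  moreover have "p (k - 1 - j) \<in> A" if "j < k" for j using that by (intro pA) auto
  ultimately have "\<forall>j<k. p (k - 1) + j * (W * nat (- e)) \<in> A" by metis
  thus ?thesis using en W2 by (intro exI[of _ "p (k - 1)"] exI[of _ "W * nat (- e)"]) auto
 qed
qed

theorem theorem1p7:
  fixes f :: "nat \<Rightarrow> nat"
  assumes "\<And>m. m \<in> totient_values \<Longrightarrow> f m \<in> totient_fibre m"
  shows "has_arbitrarily_long_APs (f ` totient_values)"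
 unfolding has_arbitrarily_long_APs_def
proof
 fix k
 have "EX c:{1, 2}. ALL i0. \<exists>i\<ge>i0. 1/8 * 2 ^ i / real (i + 1) <= (card {p\<in>{2 ^ i<..2 ^ Suc i}. prime p & f (p - 1) = c * p})"
  by (rule colour_classes) (rule assms)
 then obtain c where c: "c \<in> {1, 2 :: nat}" and d: "ALL i0. \<exists>i\<ge>i0. 1/8 * 2 ^ i / real (i + 1) <= (card {p\<in>{2 ^ i<..2 ^ Suc i}. prime p & f (p - 1) = c * p})"
  by blast
 define A where "A = {p. prime p & f (p - 1) = c * p}"
 \<comment> \<open>Asking for k + 2 terms meets the requirement of at least two terms for every
   k.\<close>
 have "EX a d. d > 0 & (\<forall>j<k + 2. a + j * d \<in> A)"
  by (rule dense_primes_AP[of A "1/8"]) (use d in \<open>auto simp: A_def\<close>)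
 then obtain a d where ad: "d > 0" "\<forall>j<k + 2. a + j * d \<in> A" by blast
 have "c * a + j * (c * d) \<in> f ` totient_values" if "j < k" for j
 proof -
  have p: "prime (a + j * d)" "f (a + j * d - 1) = c * (a + j * d)" using ad(2) that by (auto simp: A_def)
  have "a + j * d - 1 \<in> totient_values"
   using totient_prime[OF p(1)] prime_gt_0_nat[OF p(1)] unfolding totient_values_def by (intro CollectI exI[of _ "a + j * d"] conjI) auto
  hence "c * (a + j * d) \<in> f ` totient_values" using p(2) by (metis imageI)
  thus ?thesis by (simp add: algebra_simps)
 qed
 moreover have "c * d > 0" using c ad(1) by auto
 ultimately show "EX a d. d > 0 & (\<forall>i<k. a + i * d \<in> f ` totient_values)" by blast
qed

end
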